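(* Let $X\in\mathbb R^{n\times p}$, $\beta_0\in\mathbb R^p$, $\mu_0=X\beta_0$, and let $Y$ be a random vector in $\mathbb R^n$ following a generalized linear model with a distribution in a continuous standard exponential family, i.e. with density (with respect to Lebesgue measure) $$f(y)=\Big(\prod_{i=1}^nB_i(y_i)\Big)\exp\Big(\langle y,\mu_0\rangle-\sum_{i=1}^n\varphi_i((\mu_0)_i)\Big),\qquad \mu_0\in\Theta^n,$$ where $\Theta\subseteq\mathbb R$ is the natural parameter space, and write $\nabla\log B(y)=\big(\tfrac{\partial\log B_i(y_i)}{\partial y_i}\big)_{i}$. Let $J:\mathbb R^p\to\mathbb R\cup\{+\infty\}$ be proper, lower semicontinuous, convex and partly smooth with a finite set $\mathscr M$ of partial smoothness manifolds, let $F(\beta,y)=F_0(X\beta,y)$, and let $\hat\mu(y)=X\hat\beta(y)$, where $\hat\beta(y)$ is any solution of $(P(y)):\ \min_{\beta\in\mathbb R^p}F_0(X\beta,y)+J(\beta)$. Suppose that conditions $(C_{\mathcal O})$, $(C_{\mathrm{sconv}})$, $(C_F)$ and $(C_L)$ of the context hold and that $\mathcal G$ is of zero Lebesgue measure. Then, with $\Delta$ as in the context: (i) $\widehat{\mathrm{df}}=\mathrm{tr}(\Delta(Y))$ is an unbiased estimate of $\mathrm{df}=\mathbb E(\mathrm{div}(\hat\mu)(Y))$; (ii) $$\mathrm{SURE}(\hat\mu)(Y)=\|\nabla\log B(Y)+\hat\mu(Y)\|^2+2\,\widehat{\mathrm{df}}-\big(\|\nabla\log B(Y)\|^2-\|\mu_0\|^2\big)$$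 is an unbiased estimator of the risk $\mathbb E\big(\|\hat\mu(Y)-\mu_0\|^2\big)$.
   Context: Notation. $\nabla F,\nabla F_0,\nabla^2F,\nabla^2F_0$ are derivatives in the first variable; $\mathrm D(\nabla F_0)(\mu,y)$ is the Jacobian of $\nabla F_0(\mu,\cdot)$ in the second variable at $y$. $\mathrm P_E$ is the orthogonal projector on $E$; $X_T=X\mathrm P_T$, $X_S=X\mathrm P_S$; $A^+$ is the Moore–Penrose pseudo-inverse; $\mathrm{rbd}$, $\mathrm{bd}$ denote relative boundary and boundary; $\mathrm{Lin}(C)=\mathbb R(C-C)$. For $\beta$ with $\partial J(\beta)\neq\emptyset$, $S_\beta=\mathrm{Lin}(\partial J(\beta))$, $T_\beta=S_\beta^\perp$. $\mathrm{div}(g)=\mathrm{tr}(\mathrm Dg)$, where derivatives are understood in the weak sense (identities hold Lebesgue-a.e.). Partial smoothness. $J$ is partly smooth at $\beta$ (with $\partial J(\beta)\ne\emptyset$) relative to $\mathcal M\ni\beta$ if: (1) $\mathcal M$ is a $C^2$ embedded submanifold of $\mathbb R^p$ around $\beta$ and $J|_{\mathcal M}$ is $C^2$ around $\beta$; (2) the tangent space of $\mathcal M$ at $\beta$ is $T_\beta$; (3) the set-valued map $\partial J$ is continuous at $\beta$ relative to $\mathcal M$. $\mathcal M_\beta$ denotes the partial smoothness manifold associated to $J$ at $\beta$ (one for each $\beta$, fixed once and for all). $\mathscr M=\{\mathcal M_\beta\}_{\beta\in\mathbb R^p}$ (assumed finite), and $\widetilde{\mathcal M}=\{\beta'\in\mathbb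 R^p:\mathcal M_{\beta'}=\mathcal M\}$ for $\mathcal M\in\mathscr M$. Riemannian Hessians. The Weingarten map of $\mathcal M$ at $\beta$ is $\mathfrak A_\beta(\xi,v)=-\mathrm P_{T_\beta}\mathrm DV[\xi]$ for $\xi\in T_\beta$, $v\in T_\beta^\perp$, with $V$ any local extension of $v$ to a normal vector field on $\mathcal M$. For $f$ that is $C^2$ on $\mathcal M$ near $\beta$ and $\tilde f$ any smooth ($C^2$) function on $\mathbb R^p$ agreeing with $f$ on $\mathcal M$ near $\beta$, $\nabla^2_{\mathcal M}f(\beta)\xi=\mathrm P_{T_\beta}\nabla^2\tilde f(\beta)\mathrm P_{T_\beta}\xi+\mathfrak A_\beta(\xi,\mathrm P_{T_\beta^\perp}\nabla\tilde f(\beta))$ for $\xi\in T_\beta$. $\nabla^2_{\mathcal M}F(\beta,y)$ is the Riemannian Hessian of $F(\cdot,y)$. Operators on $T_\beta$ are extended by $0$ on $T_\beta^\perp$. Condition $(\mathcal C_{\beta,y})$: $\langle(\nabla^2_{\mathcal M_\beta}F(\beta,y)+\nabla^2_{\mathcal M_\beta}J(\beta))\xi,\xi\rangle>0$ for all $0\neq\xi\in T_\beta$. Transition space: $\mathcal H=\bigcup_{\mathcal M\in\mathscr M}\mathrm{bd}(\Pi(\mathcal A_{\mathcal M}))$, $\Pi(y,\beta)=y$, $\mathcal A_{\mathcal M}=\{(y,\beta)\in\mathbb R^n\times\widetilde{\mathcal M}:-\nabla F(\beta,y)\in\mathrm{rbd}\,\partial J(\beta)\}$. Non-injectivity set: $\mathcal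 G=\{y\notin\mathcal H:(\mathcal C_{\hat\beta(y),y})$ does not hold for any minimizer $\hat\beta(y)$ of $(P(y))\}$. Matrix $\Delta$. For $y\notin\mathcal H\cup\mathcal G$, with $\hat\beta(y)$ any solution of $(P(y))$ satisfying $(\mathcal C_{\hat\beta(y),y})$, $\mathcal M=\mathcal M_{\hat\beta(y)}$, $T=S^\perp=T_{\hat\beta(y)}$: $\Delta(y)=-X_T\big(X_T^\top\nabla^2F_0(\hat\mu(y),y)X_T+\mathfrak A_{\hat\beta(y)}(\cdot,X_S^\top\nabla F_0(\hat\mu(y),y))+\nabla^2_{\mathcal M}J(\hat\beta(y))\big)^{+}X_T^\top\,\mathrm D(\nabla F_0)(\hat\mu(y),y)$. Conditions. $(C_{\mathcal O})$: there is an o-minimal structure $\mathcal O$ expanding $\mathbb R$ (containing all semi-algebraic sets) in which $F$, $J$ and every $\mathcal M\in\mathscr M$ are definable. $(C_{\mathrm{sconv}})$: for all $y\in\mathbb R^n$, $F_0(\cdot,y)$ is strongly convex with modulus $\tau$ (with $\tau>0$ independent of $y$). $(C_L)$: there is $L>0$ with $\sup_{(\mu,y)\in\mathbb R^n\times\mathbb R^n}\|\mathrm D(\nabla F_0)(\mu,y)\|\le L$. $(C_F)$: for all $y\in\mathbb R^n$, $F(\cdot,y)\in C^2(\mathbb R^p)$, and for all $\beta\in\mathbb R^p$, $F(\beta,\cdot)\in C^2(\mathbb R^n)$. Under $(C_{\mathrm{sconv}})$, all solutions of $(P(y))$ have the same image under $X$, so $\hat\mu$ is single-valued.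
   Formalization: Added: the sets M-tilde are definable, and F_0 is twice differentiable in its first variable; in (ii), each B_i is continuous and weakly differentiable on the line, and the loss and the inner product of grad log B(Y) with mu-hat(Y) are integrable. *)

theory Defs
  imports "HOL-Probability.Probability"
begin

section \<open>Differential calculus\<close>

text \<open>Meant for open \<open>S\<close>, where it is the usual \<open>C\<^sup>k\<close> regularity: all partial derivatives of
  order at most \<open>k\<close> exist and are differentiable up to order \<open>k - 1\<close>, resp. continuous.\<close>

primrec Ck_on :: "nat \<Rightarrow> ('a::euclidean_space \<Rightarrow> 'b::real_normed_vector) \<Rightarrow> 'a set \<Rightarrow> bool" where
  "Ck_on 0 f S \<longleftrightarrow> continuous_on S f"
| "Ck_on (Suc k) f S \<longleftrightarrow>
     (\<forall>x\<in>S. f differentiable (at x)) \<and>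
     (\<forall>b\<in>Basis. Ck_on k (\<lambda>x. frechet_derivative f (at x) b) S)"

definition grad :: "(real^'n \<Rightarrow> real) \<Rightarrow> real^'n \<Rightarrow> real^'n" where
  "grad f x = (THE D. GDERIV f x :> D)"

definition hess :: "(real^'n \<Rightarrow> real) \<Rightarrow> real^'n \<Rightarrow> real^'n^'n" where
  "hess f x = jacobian (grad f) (at x)"

subsection \<open>Weak derivatives\<close>

definition test_function :: "('a::euclidean_space \<Rightarrow> real) \<Rightarrow> bool" where
  "test_function \<phi> \<longleftrightarrow> (\<forall>k. Ck_on k \<phi> UNIV) \<and> compact (closure {x. \<phi> x \<noteq> 0})"

definition locally_integrable :: "('a::euclidean_space \<Rightarrow> real) \<Rightarrow> bool" where
  "locally_integrable f \<longleftrightarrow> (\<forall>K. compact K \<longrightarrow> set_integrable lebesgue K f)"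

text \<open>\<open>h\<close> is (a version of) the weak derivative of \<open>f\<close> in direction \<open>b\<close>.\<close>

definition weak_partial :: "('a::euclidean_space \<Rightarrow> real) \<Rightarrow> 'a \<Rightarrow> ('a \<Rightarrow> real) \<Rightarrow> bool" where
  "weak_partial f b h \<longleftrightarrow>
     locally_integrable f \<and> locally_integrable h \<and>
     (\<forall>\<phi>. test_function \<phi> \<longrightarrow>
        (LINT x|lebesgue. f x * frechet_derivative \<phi> (at x) b) = - (LINT x|lebesgue. h x * \<phi> x))"

definition weak_jacobian :: "(real^'n \<Rightarrow> real^'m) \<Rightarrow> (real^'n \<Rightarrow> real^'n^'m) \<Rightarrow> bool" where
  "weak_jacobian g G \<longleftrightarrow> (\<forall>i j. weak_partial (\<lambda>x. g x $ i) (axis j 1) (\<lambda>x. G x $ i $ j))"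


section \<open>Linear algebra\<close>

definition proj :: "(real^'p) set \<Rightarrow> real^'p^'p" where
  "proj E = matrix (closest_point E)"

text \<open>Moore--Penrose pseudo-inverse, by the Penrose equations.\<close>

definition pinv :: "real^'n^'m \<Rightarrow> real^'m^'n" where
  "pinv A = (THE B. A ** B ** A = A \<and> B ** A ** B = B \<and>
                    transpose (A ** B) = A ** B \<and> transpose (B ** A) = B ** A)"


section \<open>Extended-real-valued convex functions\<close>

definition proper_fun :: "('a \<Rightarrow> ereal) \<Rightarrow> bool" where
  "proper_fun J \<longleftrightarrow> (\<forall>x. J x \<noteq> -\<infinity>) \<and> (\<exists>x. J x \<noteq> \<infinity>)"

definition lsc_fun :: "('a::topological_space \<Rightarrow> ereal) \<Rightarrow> bool" where
  "lsc_fun J \<longleftrightarrow> (\<forall>x. J x \<le> Liminf (at x) J)"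

definition convex_fun :: "('a::real_vector \<Rightarrow> ereal) \<Rightarrow> bool" where
  "convex_fun J \<longleftrightarrow> (\<forall>x y u v. 0 \<le> u \<and> 0 \<le> v \<and> u + v = 1 \<longrightarrow>
     J (u *\<^sub>R x + v *\<^sub>R y) \<le> ereal u * J x + ereal v * J y)"

text \<open>For proper \<open>J\<close> this is empty wherever \<open>J\<close> is infinite.\<close>

definition subdiff :: "('a::real_inner \<Rightarrow> ereal) \<Rightarrow> 'a \<Rightarrow> 'a set" where
  "subdiff J x = {u. \<forall>z. J x + ereal (u \<bullet> (z - x)) \<le> J z}"

definition Lin :: "'a::real_vector set \<Rightarrow> 'a set" where
  "Lin C = {t *\<^sub>R (a - b) | t a b. a \<in> C \<and> b \<in> C}"

definition S_space :: "('a::euclidean_space \<Rightarrow> ereal) \<Rightarrow> 'a \<Rightarrow> 'a set" where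
  "S_space J \<beta> = Lin (subdiff J \<beta>)"

definition T_space :: "('a::euclidean_space \<Rightarrow> ereal) \<Rightarrow> 'a \<Rightarrow> 'a set" where
  "T_space J \<beta> = orthogonal_comp (S_space J \<beta>)"

definition strongly_convex :: "real \<Rightarrow> ('a::real_inner \<Rightarrow> real) \<Rightarrow> bool" where
  "strongly_convex \<tau> f \<longleftrightarrow> (\<forall>x y t. 0 \<le> t \<and> t \<le> 1 \<longrightarrow>
     f (t *\<^sub>R x + (1 - t) *\<^sub>R y) \<le> t * f x + (1 - t) * f y - \<tau> / 2 * t * (1 - t) * (norm (x - y))\<^sup>2)"


section \<open>Submanifolds and partial smoothness\<close>

text \<open>Local straightening by a \<open>C\<^sup>2\<close> diffeomorphism of the ambient space; the dimension is that
  of the subspace \<open>E\<close>.\<close>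

definition C2_submanifold_around :: "'a::euclidean_space set \<Rightarrow> 'a \<Rightarrow> bool" where
  "C2_submanifold_around M \<beta> \<longleftrightarrow> \<beta> \<in> M \<and>
     (\<exists>U V (\<Psi> :: 'a \<Rightarrow> 'a) \<Phi> E. open U \<and> \<beta> \<in> U \<and> open V \<and> subspace E \<and>
        homeomorphism U V \<Psi> \<Phi> \<and> Ck_on 2 \<Psi> U \<and> Ck_on 2 \<Phi> V \<and> \<Psi> ` (U \<inter> M) = V \<inter> E)"

text \<open>Velocities of curves lying in \<open>M\<close>.\<close>

definition tangent_space :: "'a::euclidean_space set \<Rightarrow> 'a \<Rightarrow> 'a set" where
  "tangent_space M \<beta> = {v. \<exists>\<gamma> :: real \<Rightarrow> 'a. \<gamma> 0 = \<beta> \<and> (\<forall>\<^sub>F t in nhds 0. \<gamma> t \<in> M) \<and>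
     (\<gamma> has_vector_derivative v) (at 0)}"

definition C2_extension :: "'a::euclidean_space set \<Rightarrow> 'a \<Rightarrow> ('a \<Rightarrow> real) \<Rightarrow> ('a \<Rightarrow> real) \<Rightarrow> bool" where
  "C2_extension M \<beta> f g \<longleftrightarrow> Ck_on 2 g UNIV \<and> (\<forall>\<^sub>F x in nhds \<beta>. x \<in> M \<longrightarrow> f x = g x)"

text \<open>Painleve--Kuratowski continuity at \<open>\<beta>\<close> relative to \<open>M\<close>: outer and inner semicontinuity.\<close>

definition setvalued_continuous_at ::
    "('a::euclidean_space \<Rightarrow> 'a set) \<Rightarrow> 'a \<Rightarrow> 'a set \<Rightarrow> bool" where
  "setvalued_continuous_at G \<beta> M \<longleftrightarrow>
     (\<forall>x. (\<forall>k::nat. x k \<in> M) \<and> x \<longlonglongrightarrow> \<beta> \<longrightarrow>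
        (\<forall>u v. (\<forall>k. u k \<in> G (x k)) \<and> u \<longlonglongrightarrow> v \<longrightarrow> v \<in> G \<beta>) \<and>
        (\<forall>v\<in>G \<beta>. \<exists>u. (\<forall>\<^sub>F k in sequentially. u k \<in> G (x k)) \<and> u \<longlonglongrightarrow> v))"

definition partly_smooth_at :: "('a::euclidean_space \<Rightarrow> ereal) \<Rightarrow> 'a \<Rightarrow> 'a set \<Rightarrow> bool" where
  "partly_smooth_at J \<beta> M \<longleftrightarrow>
     subdiff J \<beta> \<noteq> {} \<and>
     C2_submanifold_around M \<beta> \<and>
     (\<exists>g. Ck_on 2 g UNIV \<and> (\<forall>\<^sub>F x in nhds \<beta>. x \<in> M \<longrightarrow> J x = ereal (g x))) \<and>
     tangent_space M \<beta> = T_space J \<beta> \<and>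
     setvalued_continuous_at (subdiff J) \<beta> M"

text \<open>The choice of manifolds is a function \<open>\<beta> \<mapsto> \<M> \<beta>\<close>. Partial smoothness only makes sense at points
  with nonempty subdifferential, so its values elsewhere play no role.\<close>

definition partial_smoothness_manifolds ::
    "('a::euclidean_space \<Rightarrow> ereal) \<Rightarrow> ('a \<Rightarrow> 'a set) \<Rightarrow> bool" where
  "partial_smoothness_manifolds J \<M> \<longleftrightarrow> (\<forall>\<beta>. subdiff J \<beta> \<noteq> {} \<longrightarrow> partly_smooth_at J \<beta> (\<M> \<beta>))"

definition manifold_family :: "('a::euclidean_space \<Rightarrow> ereal) \<Rightarrow> ('a \<Rightarrow> 'a set) \<Rightarrow> 'a set set" where
  "manifold_family J \<M> = \<M> ` {\<beta>. subdiff J \<beta> \<noteq> {}}"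

definition stratum :: "('a::euclidean_space \<Rightarrow> ereal) \<Rightarrow> ('a \<Rightarrow> 'a set) \<Rightarrow> 'a set \<Rightarrow> 'a set" where
  "stratum J \<M> M = {\<beta>. subdiff J \<beta> \<noteq> {} \<and> \<M> \<beta> = M}"


section \<open>Riemannian Hessians\<close>

definition normal_extension ::
    "(real^'p) set \<Rightarrow> real^'p \<Rightarrow> real^'p \<Rightarrow> (real^'p \<Rightarrow> real^'p) \<Rightarrow> bool" where
  "normal_extension M \<beta> v V \<longleftrightarrow> V \<beta> = v \<and>
     (\<exists>U. open U \<and> \<beta> \<in> U \<and> Ck_on 1 V U \<and> (\<forall>x\<in>M \<inter> U. V x \<in> orthogonal_comp (tangent_space M x)))"

definition weingarten :: "(real^'p) set \<Rightarrow> real^'p \<Rightarrow> real^'p \<Rightarrow> real^'p \<Rightarrow> real^'p" where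
  "weingarten M \<beta> \<xi> v =
     (THE w. \<exists>V. normal_extension M \<beta> v V \<and>
        w = - (proj (tangent_space M \<beta>) *v frechet_derivative V (at \<beta>) \<xi>))"

text \<open>The argument is first projected on the tangent space, which extends the operator by 0 on the
  normal space.\<close>

definition riem_hess ::
    "(real^'p) set \<Rightarrow> (real^'p \<Rightarrow> real) \<Rightarrow> real^'p \<Rightarrow> real^'p \<Rightarrow> real^'p" where
  "riem_hess M f \<beta> \<xi> =
     (THE w. \<exists>g. C2_extension M \<beta> f g \<and>
        (let P = proj (tangent_space M \<beta>); Q = proj (orthogonal_comp (tangent_space M \<beta>)) in
         w = P *v (hess g \<beta> *v (P *v \<xi>)) + weingarten M \<beta> (P *v \<xi>) (Q *v grad g \<beta>)))"


section \<open>O-minimal structures\<close>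

text \<open>Points of \<open>\<real>\<^sup>k\<close> are lists of length \<open>k\<close>, as all dimensions occur at once.\<close>

definition space_of :: "nat \<Rightarrow> real list set" where
  "space_of k = {xs. length xs = k}"

inductive poly_function :: "nat \<Rightarrow> (real list \<Rightarrow> real) \<Rightarrow> bool" for k where
  const: "poly_function k (\<lambda>xs. c)"
| var: "i < k \<Longrightarrow> poly_function k (\<lambda>xs. xs ! i)"
| add: "poly_function k P \<Longrightarrow> poly_function k Q \<Longrightarrow> poly_function k (\<lambda>xs. P xs + Q xs)"
| mult: "poly_function k P \<Longrightarrow> poly_function k Q \<Longrightarrow> poly_function k (\<lambda>xs. P xs * Q xs)"

inductive semialgebraic :: "nat \<Rightarrow> real list set \<Rightarrow> bool" for k where
  zero: "poly_function k P \<Longrightarrow> semialgebraic k {xs \<in> space_of k. P xs = 0}"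
| pos: "poly_function k P \<Longrightarrow> semialgebraic k {xs \<in> space_of k. P xs > 0}"
| union: "semialgebraic k A \<Longrightarrow> semialgebraic k B \<Longrightarrow> semialgebraic k (A \<union> B)"
| compl: "semialgebraic k A \<Longrightarrow> semialgebraic k (space_of k - A)"

definition o_minimal_structure :: "(nat \<Rightarrow> real list set set) \<Rightarrow> bool" where
  "o_minimal_structure \<O> \<longleftrightarrow>
     (\<forall>k. \<forall>A\<in>\<O> k. A \<subseteq> space_of k) \<and>
     (\<forall>k. \<forall>A\<in>\<O> k. \<forall>B\<in>\<O> k. A \<union> B \<in> \<O> k) \<and>
     (\<forall>k. \<forall>A\<in>\<O> k. space_of k - A \<in> \<O> k) \<and>
     (\<forall>k A. semialgebraic k A \<longrightarrow> A \<in> \<O> k) \<and>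
     (\<forall>k. \<forall>A\<in>\<O> k. {xs @ [t] | xs t. xs \<in> A} \<in> \<O> (Suc k) \<and> {t # xs | xs t. xs \<in> A} \<in> \<O> (Suc k)) \<and>
     (\<forall>k. \<forall>A\<in>\<O> (Suc k). butlast ` A \<in> \<O> k) \<and>
     (\<forall>A\<in>\<O> 1. \<exists>I. finite I \<and> (\<forall>S\<in>I. is_interval S) \<and> {t. [t] \<in> A} = \<Union>I)"

text \<open>Coordinates in an arbitrary fixed order; definability does not depend on the order.\<close>

definition vlist :: "real^'n \<Rightarrow> real list" where
  "vlist x = map (\<lambda>i. x $ from_nat_into UNIV i) [0..<CARD('n)]"

definition definable_set :: "(nat \<Rightarrow> real list set set) \<Rightarrow> (real^'p) set \<Rightarrow> bool" where
  "definable_set \<O> A \<longleftrightarrow> vlist ` A \<in> \<O> CARD('p)"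

definition definable_ereal_fun :: "(nat \<Rightarrow> real list set set) \<Rightarrow> (real^'p \<Rightarrow> ereal) \<Rightarrow> bool" where
  "definable_ereal_fun \<O> J \<longleftrightarrow> {vlist x @ [r] | x r. J x = ereal r} \<in> \<O> (CARD('p) + 1)"

definition definable_fun2 :: "(nat \<Rightarrow> real list set set) \<Rightarrow> (real^'p \<Rightarrow> real^'n \<Rightarrow> real) \<Rightarrow> bool" where
  "definable_fun2 \<O> F \<longleftrightarrow>
     {vlist x @ vlist y @ [F x y] | x y. True} \<in> \<O> (CARD('p) + CARD('n) + 1)"


section \<open>The variational problem\<close>

definition is_solution ::
    "('p \<Rightarrow> 'n \<Rightarrow> real) \<Rightarrow> ('p \<Rightarrow> ereal) \<Rightarrow> 'n \<Rightarrow> 'p \<Rightarrow> bool" where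
  "is_solution F J y \<beta> \<longleftrightarrow> (\<forall>\<beta>'. ereal (F \<beta> y) + J \<beta> \<le> ereal (F \<beta>' y) + J \<beta>')"

definition restricted_positive_definite ::
    "(real^'p \<Rightarrow> real^'n \<Rightarrow> real) \<Rightarrow> (real^'p \<Rightarrow> ereal) \<Rightarrow> (real^'p \<Rightarrow> (real^'p) set) \<Rightarrow>
     real^'p \<Rightarrow> real^'n \<Rightarrow> bool" where
  "restricted_positive_definite F J \<M> \<beta> y \<longleftrightarrow>
     (\<forall>\<xi>\<in>T_space J \<beta>. \<xi> \<noteq> 0 \<longrightarrow>
        (riem_hess (\<M> \<beta>) (\<lambda>b. F b y) \<beta> \<xi> + riem_hess (\<M> \<beta>) (\<lambda>b. real_of_ereal (J b)) \<beta> \<xi>) \<bullet> \<xi> > 0)"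

definition degenerate_pairs ::
    "(real^'p \<Rightarrow> real^'n \<Rightarrow> real) \<Rightarrow> (real^'p \<Rightarrow> ereal) \<Rightarrow> (real^'p \<Rightarrow> (real^'p) set) \<Rightarrow>
     (real^'p) set \<Rightarrow> ((real^'n) \<times> (real^'p)) set" where
  "degenerate_pairs F J \<M> M =
     {(y, \<beta>). \<beta> \<in> stratum J \<M> M \<and> - grad (\<lambda>b. F b y) \<beta> \<in> rel_frontier (subdiff J \<beta>)}"

definition transition_space ::
    "(real^'p \<Rightarrow> real^'n \<Rightarrow> real) \<Rightarrow> (real^'p \<Rightarrow> ereal) \<Rightarrow> (real^'p \<Rightarrow> (real^'p) set) \<Rightarrow>
     (real^'n) set" where
  "transition_space F J \<M> = (\<Union>M\<in>manifold_family J \<M>. frontier (fst ` degenerate_pairs F J \<M> M))"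

definition non_injectivity_set ::
    "(real^'p \<Rightarrow> real^'n \<Rightarrow> real) \<Rightarrow> (real^'p \<Rightarrow> ereal) \<Rightarrow> (real^'p \<Rightarrow> (real^'p) set) \<Rightarrow>
     (real^'n) set" where
  "non_injectivity_set F J \<M> =
     {y. y \<notin> transition_space F J \<M> \<and>
         (\<forall>\<beta>. is_solution F J y \<beta> \<longrightarrow> \<not> restricted_positive_definite F J \<M> \<beta> y)}"

text \<open>The matrix \<open>\<Delta>(y)\<close> computed from a given solution \<open>\<beta>\<close>.\<close>

definition Delta_at ::
    "real^'p^'n \<Rightarrow> (real^'n \<Rightarrow> real^'n \<Rightarrow> real) \<Rightarrow> (real^'p \<Rightarrow> ereal) \<Rightarrow>
     (real^'p \<Rightarrow> (real^'p) set) \<Rightarrow> real^'p \<Rightarrow> real^'n \<Rightarrow> real^'n^'n" where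
  "Delta_at X F0 J \<M> \<beta> y =
     (let M = \<M> \<beta>; \<mu> = X *v \<beta>;
          P = proj (T_space J \<beta>);
          XT = X ** P; XS = X ** proj (S_space J \<beta>);
          A = transpose XT ** hess (\<lambda>m. F0 m y) \<mu> ** XT
              + matrix (\<lambda>\<xi>. weingarten M \<beta> (P *v \<xi>) (transpose XS *v grad (\<lambda>m. F0 m y) \<mu>))
              + matrix (riem_hess M (\<lambda>b. real_of_ereal (J b)) \<beta>)
      in - (XT ** pinv A ** transpose XT ** jacobian (\<lambda>z. grad (\<lambda>m. F0 m z) \<mu>) (at y)))"

definition is_Delta ::
    "real^'p^'n \<Rightarrow> (real^'n \<Rightarrow> real^'n \<Rightarrow> real) \<Rightarrow> (real^'p \<Rightarrow> real^'n \<Rightarrow> real) \<Rightarrow>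
     (real^'p \<Rightarrow> ereal) \<Rightarrow> (real^'p \<Rightarrow> (real^'p) set) \<Rightarrow> (real^'n \<Rightarrow> real^'n^'n) \<Rightarrow> bool" where
  "is_Delta X F0 F J \<M> \<Delta> \<longleftrightarrow>
     (\<forall>y. y \<notin> transition_space F J \<M> \<union> non_injectivity_set F J \<M> \<longrightarrow>
        (\<exists>\<beta>. is_solution F J y \<beta> \<and> restricted_positive_definite F J \<M> \<beta> y \<and>
             \<Delta> y = Delta_at X F0 J \<M> \<beta> y))"


section \<open>Conditions\<close>

text \<open>The sets \<open>stratum J \<M> M\<close> depend on the choice of \<open>\<M>\<close>, so their definability does not follow
  from that of \<open>J\<close> and of the manifolds. It has to be required: for a choice that alternates between two
  manifolds with the same germ, the transition space can be the whole space.\<close>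

definition cond_O ::
    "(real^'p \<Rightarrow> real^'n \<Rightarrow> real) \<Rightarrow> (real^'p \<Rightarrow> ereal) \<Rightarrow> (real^'p \<Rightarrow> (real^'p) set) \<Rightarrow> bool" where
  "cond_O F J \<M> \<longleftrightarrow>
     (\<exists>\<O>. o_minimal_structure \<O> \<and> definable_fun2 \<O> F \<and> definable_ereal_fun \<O> J \<and>
        (\<forall>M\<in>manifold_family J \<M>. definable_set \<O> M \<and> definable_set \<O> (stratum J \<M> M)))"

definition cond_sconv :: "(real^'n \<Rightarrow> real^'n \<Rightarrow> real) \<Rightarrow> bool" where
  "cond_sconv F0 \<longleftrightarrow> (\<exists>\<tau>>0. \<forall>y. strongly_convex \<tau> (\<lambda>m. F0 m y))"

definition cond_F :: "(real^'p \<Rightarrow> real^'n \<Rightarrow> real) \<Rightarrow> bool" where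
  "cond_F F \<longleftrightarrow> (\<forall>y. Ck_on 2 (\<lambda>b. F b y) UNIV) \<and> (\<forall>\<beta>. Ck_on 2 (F \<beta>) UNIV)"

text \<open>Existence of the derivatives of \<open>F0\<close> in its first variable. When the design matrix is not
  surjective it does not follow from \<^const>\<open>cond_F\<close>.\<close>

definition twice_differentiable_fst :: "(real^'n \<Rightarrow> real^'n \<Rightarrow> real) \<Rightarrow> bool" where
  "twice_differentiable_fst F0 \<longleftrightarrow>
     (\<forall>m y. (\<lambda>a. F0 a y) differentiable (at m) \<and> grad (\<lambda>a. F0 a y) differentiable (at m))"

definition cond_L :: "(real^'n \<Rightarrow> real^'n \<Rightarrow> real) \<Rightarrow> bool" where
  "cond_L F0 \<longleftrightarrow>
     (\<exists>L>0. \<forall>m y. (\<lambda>z. grad (\<lambda>a. F0 a z) m) differentiable (at y) \<and>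
        onorm ((*v) (jacobian (\<lambda>z. grad (\<lambda>a. F0 a z) m) (at y))) \<le> L)"


section \<open>Exponential families and unbiased estimation\<close>

definition natural_parameter_space :: "(real \<Rightarrow> real) \<Rightarrow> real set" where
  "natural_parameter_space b = {\<theta>. integrable lborel (\<lambda>t. b t * exp (t * \<theta>))}"

definition exp_family_density ::
    "('n \<Rightarrow> real \<Rightarrow> real) \<Rightarrow> ('n \<Rightarrow> real \<Rightarrow> real) \<Rightarrow> real^'n \<Rightarrow> real^'n \<Rightarrow> real" where
  "exp_family_density B \<phi> \<mu> y =
     (\<Prod>i\<in>UNIV. B i (y $ i)) * exp (y \<bullet> \<mu> - (\<Sum>i\<in>UNIV. \<phi> i (\<mu> $ i)))"

definition grad_log :: "('n \<Rightarrow> real \<Rightarrow> real) \<Rightarrow> real^'n \<Rightarrow> real^'n" where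
  "grad_log B y = (\<chi> i. deriv (\<lambda>t. ln (B i t)) (y $ i))"

text \<open>Continuous with a weak derivative, i.e. locally absolutely continuous. Zeros are allowed
  (e.g. Gamma densities of shape \<open>> 1\<close>); a jump, e.g. a uniform density, is not, as it adds a
  boundary term to Stein's identity.\<close>

definition weakly_differentiable_base :: "(real \<Rightarrow> real) \<Rightarrow> bool" where
  "weakly_differentiable_base b \<longleftrightarrow> continuous_on UNIV b \<and> (\<exists>b'. weak_partial b 1 b')"

text \<open>Expectations are taken in the completed probability space since weak derivatives, and \<open>\<Delta>\<close> on
  the exceptional set, are only determined up to Lebesgue-null sets. For measurable integrands nothing
  changes.\<close>

definition expect :: "'w measure \<Rightarrow> ('w \<Rightarrow> real) \<Rightarrow> real" where
  "expect Pr f = (LINT \<omega>|completion Pr. f \<omega>)"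

definition has_expectation :: "'w measure \<Rightarrow> ('w \<Rightarrow> real) \<Rightarrow> bool" where
  "has_expectation Pr f \<longleftrightarrow> integrable (completion Pr) f"

definition unbiased_estimator :: "'w measure \<Rightarrow> ('w \<Rightarrow> real) \<Rightarrow> real \<Rightarrow> bool" where
  "unbiased_estimator Pr W \<theta> \<longleftrightarrow> has_expectation Pr W \<and> expect Pr W = \<theta>"

definition SURE ::
    "('n \<Rightarrow> real \<Rightarrow> real) \<Rightarrow> real^'n \<Rightarrow> (real^'n \<Rightarrow> real^'n) \<Rightarrow> (real^'n \<Rightarrow> real^'n^'n) \<Rightarrow>
     real^'n \<Rightarrow> real" where
  "SURE B \<mu>0 \<mu>hat \<Delta> y =
     (norm (grad_log B y + \<mu>hat y))\<^sup>2 + 2 * trace (\<Delta> y)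
     - ((norm (grad_log B y))\<^sup>2 - (norm \<mu>0)\<^sup>2)"

end

theory Submission
  imports Defs
begin

text \<open>
  Both parts rest on one fact: off a Lebesgue-null set of data \<open>y\<close>, the prediction \<open>\<mu>hat\<close> is
  Frechet differentiable at \<open>y\<close> with derivative \<open>\<Delta> y\<close> (\<open>prediction_has_derivative\<close>).

  The frontier of a set that is definable in an o-minimal structure is null
  (\<open>definable_frontier_null\<close>): sets definable on the line are finite unions of intervals, and Fubini's
  theorem lifts this to all dimensions by induction. The transition space is a finite union of such
  frontiers, so it is null. The same fact carries properties of solutions from \<open>y\<close> to its neighbours. Let
  \<open>W\<close> be the set of those \<open>y\<close> that have a solution in a given stratum, in a given ball, and with the gradient
  of the loss nearly affine in the data at a given scale. This is a first-order condition, so \<open>W\<close> is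
  definable, and almost every point of \<open>W\<close> is interior to \<open>W\<close>. Countably many choices of the parameters
  approximate every situation, and off one null set every solution for \<open>y\<close> has solutions for all \<open>y'\<close> near
  \<open>y\<close> that lie in the same stratum and close to it (\<open>generic_nearby_solutions\<close>). So the stability of
  the active manifold under perturbation of the data comes from definability.

  A solution on the manifold satisfies first-order optimality along the manifold. In a chart this is
  a system of equations in the coordinates; its linearization at the given solution is the sum of the
  Riemannian Hessians, which is invertible on the tangent space when the restricted positivity condition
  holds. Solving the linearized system gives the expansion of the nearby solutions and with it the matrix
  \<open>\<Delta> y\<close> (\<open>solution_expansion\<close>). Different solutions have the same prediction, so the expansion is one of
  \<open>\<mu>hat\<close>.

  Strong convexity of the loss and monotonicity of subdifferentials make \<open>\<mu>hat\<close> Lipschitz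
  (\<open>prediction_lipschitz\<close>). A Lipschitz map whose derivative is known almost everywhere has that
  derivative as its weak derivative (\<open>lipschitz_weak_partial\<close>), and weak derivatives are unique up to null sets
  (\<open>weak_partial_unique\<close>). As \<open>Y\<close> has a density, this gives the statement on the degrees of freedom.

  For the risk, expanding the squares shows that \<open>SURE\<close> differs from the loss by twice
  \<open>grad_log B \<bullet> \<mu>hat + \<mu>0 \<bullet> \<mu>hat + trace \<Delta>\<close>, whose expectation is zero by Stein's identity
  (\<open>stein_identity\<close>). That identity is integration by parts in every coordinate, for \<open>\<mu>hat\<close> times a cutoff.
  The base densities are only weakly differentiable; on the line, such functions are indefinite integrals of
  their weak derivatives (\<open>weak_derivative_integral\<close>), and Lebesgue's differentiation theorem
  (\<open>lebesgue_differentiation\<close>) identifies the weak with the pointwise derivative.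
\<close>

section \<open>Definable sets\<close>

text \<open>An ordering of the basis, so that points of any Euclidean space, products included, become
  lists. Quantifying over a variable then means passing between a product space and its first
  factor.\<close>

definition basis_list :: "'a::euclidean_space list" where
  "basis_list = (SOME bs. distinct bs \<and> set bs = Basis)"

lemma basis_list: "distinct (basis_list :: 'a::euclidean_space list)" "set (basis_list :: 'a list) = Basis"
proof -
  have "\<exists>bs :: 'a list. distinct bs \<and> set bs = Basis"
    using finite_distinct_list[OF finite_Basis] by blast
  from someI_ex[OF this] show "distinct (basis_list :: 'a list)" "set (basis_list :: 'a list) = Basis"
    by (auto simp: basis_list_def)
qed

lemma length_basis_list [simp]: "length (basis_list :: 'a::euclidean_space list) = DIM('a)"
  by (metis basis_list distinct_card)

definition coords :: "'a::euclidean_space \<Rightarrow> real list" where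
  "coords x = map (\<lambda>b. x \<bullet> b) basis_list"

definition decode :: "real list \<Rightarrow> 'a::euclidean_space" where
  "decode xs = (\<Sum>i<DIM('a). xs ! i *\<^sub>R basis_list ! i)"

lemma length_coords [simp]: "length (coords (x :: 'a::euclidean_space)) = DIM('a)"
  by (simp add: coords_def)

lemma nth_coords: "i < DIM('a) \<Longrightarrow> coords x ! i = (x :: 'a::euclidean_space) \<bullet> (basis_list ! i)"
  by (simp add: coords_def)

lemma basis_list_nth: "i < DIM('a) \<Longrightarrow> (basis_list ! i :: 'a::euclidean_space) \<in> Basis"
  by (metis basis_list(2) length_basis_list nth_mem)

lemma decode_inner: "i < DIM('a) \<Longrightarrow> (decode xs :: 'a::euclidean_space) \<bullet> (basis_list ! i) = xs ! i"
proof -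
  assume i: "i < DIM('a)"
  have "(decode xs :: 'a) \<bullet> (basis_list ! i) = (\<Sum>j<DIM('a). if j = i then xs ! j else 0)"
    unfolding decode_def inner_sum_left
    using i by (intro sum.cong refl) (auto simp: inner_Basis basis_list_nth nth_eq_iff_index_eq basis_list)
  also have "\<dots> = xs ! i" using i by simp
  finally show ?thesis .
qed

lemma coords_decode: "length xs = DIM('a) \<Longrightarrow> coords (decode xs :: 'a::euclidean_space) = xs"
  by (rule nth_equalityI) (auto simp: nth_coords decode_inner)

lemma decode_coords [simp]: "decode (coords x) = (x :: 'a::euclidean_space)"
proof -
  have "decode (coords x) = (\<Sum>b\<leftarrow>basis_list. (x \<bullet> b) *\<^sub>R b)"
    unfolding decode_def by (simp add: nth_coords sum_list_sum_nth atLeast0LessThan)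
  also have "\<dots> = (\<Sum>b\<in>Basis. (x \<bullet> b) *\<^sub>R b)"
    using sum_list_distinct_conv_sum_set[OF basis_list(1)] by (simp add: basis_list(2))
  finally show ?thesis by (simp add: euclidean_representation)
qed

lemma coords_inj: "coords x = coords y \<Longrightarrow> x = y"
  by (metis decode_coords)

lemma poly_function_sum:
  "finite I \<Longrightarrow> (\<And>i. i \<in> I \<Longrightarrow> poly_function k (P i)) \<Longrightarrow> poly_function k (\<lambda>xs. \<Sum>i\<in>I. P i xs)"
  by (induction I rule: finite_induct) (auto intro: poly_function.intros)

lemma poly_function_take:
  assumes "poly_function m P" shows "poly_function (m + k) (\<lambda>xs. P (take m xs))"
  using assms by (induction) (auto intro: poly_function.intros)

text \<open>Polynomials on a Euclidean space are those on lists, so the atomic formulas over a Euclidean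
  space are semialgebraic conditions on coordinates.\<close>

lemma poly_function_of_real_polynomial:
  fixes p :: "'a::euclidean_space \<Rightarrow> real"
  assumes "real_polynomial_function p"
  shows "\<exists>P. poly_function DIM('a) P \<and> (\<forall>x. P (coords x) = p x)"
  using assms
proof induction
  case (linear f)
  interpret bounded_linear f by fact
  let ?P = "\<lambda>xs. \<Sum>i<DIM('a). xs ! i * f (basis_list ! i)"
  have "poly_function DIM('a) ?P"
    by (intro poly_function_sum poly_function.intros) auto
  moreover have "?P (coords x) = f x" for x
  proof -
    have "f x = f (decode (coords x))" by simp
    also have "\<dots> = ?P (coords x)" unfolding decode_def by (simp add: sum scaleR)
    finally show ?thesis by simp
  qed
  ultimately show ?case by blast
next
  case (add f g)
  then obtain P Q where "poly_function DIM('a) P" "\<forall>x. P (coords x) = f x"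
    "poly_function DIM('a) Q" "\<forall>x. Q (coords x) = g x" by blast
  then show ?case
    by (intro exI[of _ "\<lambda>xs. P xs + Q xs"]) (simp add: poly_function.add)
next
  case (mult f g)
  then obtain P Q where "poly_function DIM('a) P" "\<forall>x. P (coords x) = f x"
    "poly_function DIM('a) Q" "\<forall>x. Q (coords x) = g x" by blast
  then show ?case
    by (intro exI[of _ "\<lambda>xs. P xs * Q xs"]) (simp add: poly_function.mult)
next
  case (const c)
  show ?case by (rule exI[of _ "\<lambda>_. c"]) (simp add: poly_function.const)
qed

locale o_minimal =
  fixes \<O> :: "nat \<Rightarrow> real list set set"
  assumes o_min: "o_minimal_structure \<O>"
begin

lemmas o_min_conjs = o_min[unfolded o_minimal_structure_def, THEN conjunct1]
  o_min[unfolded o_minimal_structure_def, THEN conjunct2, THEN conjunct1]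
  o_min[unfolded o_minimal_structure_def, THEN conjunct2, THEN conjunct2, THEN conjunct1]
  o_min[unfolded o_minimal_structure_def, THEN conjunct2, THEN conjunct2, THEN conjunct2, THEN conjunct1]
  o_min[unfolded o_minimal_structure_def, THEN conjunct2, THEN conjunct2, THEN conjunct2, THEN conjunct2, THEN conjunct1]
  o_min[unfolded o_minimal_structure_def, THEN conjunct2, THEN conjunct2, THEN conjunct2, THEN conjunct2, THEN conjunct2, THEN conjunct1]
  o_min[unfolded o_minimal_structure_def, THEN conjunct2, THEN conjunct2, THEN conjunct2, THEN conjunct2, THEN conjunct2, THEN conjunct2]

lemma member_length: "A \<in> \<O> k \<Longrightarrow> xs \<in> A \<Longrightarrow> length xs = k"
  using o_min_conjs(1) by (auto simp: space_of_def)

lemma union_closed: "A \<in> \<O> k \<Longrightarrow> B \<in> \<O> k \<Longrightarrow> A \<union> B \<in> \<O> k"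
  using o_min_conjs(2) by simp

lemma complement_closed: "A \<in> \<O> k \<Longrightarrow> space_of k - A \<in> \<O> k"
  using o_min_conjs(3) by simp

lemma semialgebraic_mem: "semialgebraic k A \<Longrightarrow> A \<in> \<O> k"
  using o_min_conjs(4) by simp

lemma cylinder: "A \<in> \<O> k \<Longrightarrow> {t # xs | xs t. xs \<in> A} \<in> \<O> (Suc k)"
  using o_min_conjs(5) by simp

lemma projection: "A \<in> \<O> (Suc k) \<Longrightarrow> butlast ` A \<in> \<O> k"
  using o_min_conjs(6) by simp

lemma line_intervals: "A \<in> \<O> 1 \<Longrightarrow> \<exists>I. finite I \<and> (\<forall>S\<in>I. is_interval S) \<and> {t. [t] \<in> A} = \<Union>I"
  using o_min_conjs(7) by blast

lemma inter_closed: "A \<in> \<O> k \<Longrightarrow> B \<in> \<O> k \<Longrightarrow> A \<inter> B \<in> \<O> k"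
proof -
  assume A: "A \<in> \<O> k" and B: "B \<in> \<O> k"
  have "A \<inter> B = space_of k - ((space_of k - A) \<union> (space_of k - B))"
    using member_length[OF A] member_length[OF B] by (auto simp: space_of_def)
  then show ?thesis using complement_closed union_closed A B by metis
qed

lemma space_closed: "space_of k \<in> \<O> k"
proof -
  have "{xs \<in> space_of k. (0::real) = 0} \<in> \<O> k"
    by (intro semialgebraic_mem semialgebraic.zero poly_function.intros)
  then show ?thesis by simp
qed

lemma finite_inter_closed: "(\<And>j. j < (n::nat) \<Longrightarrow> C j \<in> \<O> k) \<Longrightarrow> {ws \<in> space_of k. \<forall>j<n. ws \<in> C j} \<in> \<O> k"
proof (induction n)
  case 0 show ?case using space_closed by simp
next
  case (Suc n)
  have "{ws \<in> space_of k. \<forall>j<Suc n. ws \<in> C j} = {ws \<in> space_of k. \<forall>j<n. ws \<in> C j} \<inter> C n"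
    using member_length[OF Suc.prems[of n]] by (auto simp: less_Suc_eq space_of_def)
  then show ?case using Suc inter_closed by simp
qed

lemma projection_take: "A \<in> \<O> (m + k) \<Longrightarrow> take m ` A \<in> \<O> m"
proof (induction k arbitrary: A)
  case 0
  have "take m ` A = A" using member_length[OF 0] by (force simp: image_iff)
  then show ?case using 0 by simp
next
  case (Suc k)
  have "take m ` A = take m ` (butlast ` A)"
    unfolding image_image
    by (rule image_cong[OF refl]) (use member_length[OF Suc.prems] in \<open>auto simp: butlast_conv_take\<close>)
  then show ?case using Suc projection by simp
qed

lemma cylinder_prepend: "A \<in> \<O> k \<Longrightarrow> {xs @ zs | xs zs. length xs = m \<and> zs \<in> A} \<in> \<O> (m + k)"
proof (induction m)
  case (Suc m)
  have "{xs @ zs | xs zs. length xs = Suc m \<and> zs \<in> A}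
      = {t # ws | ws t. ws \<in> {xs @ zs | xs zs. length xs = m \<and> zs \<in> A}}" (is "?L = ?R")
  proof
    show "?L \<subseteq> ?R"
    proof
      fix w assume "w \<in> ?L"
      then obtain xs zs where "w = xs @ zs" "length xs = Suc m" "zs \<in> A" by auto
      then obtain t xs' where "xs = t # xs'" "length xs' = m" by (cases xs) auto
      then show "w \<in> ?R" using \<open>w = _\<close> \<open>zs \<in> A\<close> by auto
    qed
    show "?R \<subseteq> ?L"
    proof
      fix w assume "w \<in> ?R"
      then obtain t xs zs where "w = t # (xs @ zs)" "length xs = m" "zs \<in> A" by auto
      then have "w = (t # xs) @ zs" "length (t # xs) = Suc m" by auto
      then show "w \<in> ?L" using \<open>zs \<in> A\<close> by blast
    qed
  qed
  then show ?case using cylinder[OF Suc.IH[OF Suc.prems]] by simp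
qed auto

text \<open>The graph of a polynomial map is semialgebraic, and the preimage of \<open>A\<close> is a
  projection of the part of the graph above \<open>A\<close>.\<close>

lemma poly_preimage:
  assumes A: "A \<in> \<O> k" and q: "\<And>j. j < k \<Longrightarrow> poly_function m (q j)"
  shows "{xs \<in> space_of m. map (\<lambda>j. q j xs) [0..<k] \<in> A} \<in> \<O> m"
proof -
  let ?C = "\<lambda>j. {ws \<in> space_of (m + k). ws ! (m + j) + (-1) * q j (take m ws) = 0}"
  let ?B = "{xs @ zs | xs zs. length xs = m \<and> zs \<in> A} \<inter> {ws \<in> space_of (m + k). \<forall>j<k. ws \<in> ?C j}"
  have B: "?B \<in> \<O> (m + k)"
  proof (intro inter_closed cylinder_prepend A finite_inter_closed semialgebraic_mem semialgebraic.zero)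
    fix j assume "j < k"
    then show "poly_function (m + k) (\<lambda>ws. ws ! (m + j) + (-1) * q j (take m ws))"
      by (intro poly_function.intros poly_function_take q) auto
  qed
  have eq: "take m ` ?B = {xs \<in> space_of m. map (\<lambda>j. q j xs) [0..<k] \<in> A}" (is "_ = ?R")
  proof
    show "take m ` ?B \<subseteq> ?R"
    proof
      fix x assume "x \<in> take m ` ?B"
      then obtain v where v: "v \<in> ?B" "x = take m v" by (rule imageE)
      from v(1) have "v \<in> {xs @ zs | xs zs. length xs = m \<and> zs \<in> A}" by (rule IntD1)
      then obtain xs zs where v': "v = xs @ zs" "length xs = m" "zs \<in> A" by auto
      have eqs: "\<forall>j<k. v ! (m + j) + (-1) * q j (take m v) = 0"
        using IntD2[OF v(1)] by auto
      have w: "length xs = m" "zs \<in> A" "x = xs"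
        "\<forall>j<k. (xs @ zs) ! (m + j) + (-1) * q j (take m (xs @ zs)) = 0"
        using v(2) v' eqs by auto
      have "map (\<lambda>j. q j xs) [0..<k] = zs"
      proof (rule nth_equalityI)
        show "length (map (\<lambda>j. q j xs) [0..<k]) = length zs" using member_length[OF A w(2)] by simp
      next
        fix i assume "i < length (map (\<lambda>j. q j xs) [0..<k])"
        then have "i < k" by simp
        then show "map (\<lambda>j. q j xs) [0..<k] ! i = zs ! i"
          using w(4) w(1) by (auto simp: nth_append)
      qed
      then show "x \<in> ?R" using w by (simp add: space_of_def)
    qed
    show "?R \<subseteq> take m ` ?B"
    proof
      fix xs assume "xs \<in> ?R"
      then have xs: "length xs = m" "map (\<lambda>j. q j xs) [0..<k] \<in> A" by (auto simp: space_of_def)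
      let ?w = "xs @ map (\<lambda>j. q j xs) [0..<k]"
      have "?w \<in> {xs @ zs | xs zs. length xs = m \<and> zs \<in> A}" using xs by blast
      moreover have "?w \<in> {ws \<in> space_of (m + k). \<forall>j<k. ws \<in> ?C j}"
        using xs by (simp add: space_of_def nth_append)
      ultimately have "?w \<in> ?B" by (rule IntI)
      moreover have "xs = take m ?w" using xs by simp
      ultimately show "xs \<in> take m ` ?B" by (rule rev_image_eqI)
    qed
  qed
  show ?thesis using projection_take[OF B] unfolding eq .
qed

definition definable :: "'a::euclidean_space set \<Rightarrow> bool" where
  "definable A \<longleftrightarrow> coords ` A \<in> \<O> DIM('a)"

lemma coords_img_Collect:
  "coords ` {x :: 'a::euclidean_space. P x} = {xs \<in> space_of DIM('a). P (decode xs)}"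
proof (intro set_eqI iffI)
  fix xs assume "xs \<in> coords ` {x :: 'a. P x}"
  then show "xs \<in> {xs \<in> space_of DIM('a). P (decode xs)}" by (auto simp: space_of_def)
next
  fix xs assume "xs \<in> {xs \<in> space_of DIM('a). P (decode xs)}"
  then have "xs = coords (decode xs :: 'a)" "P (decode xs)"
    by (auto simp: space_of_def coords_decode)
  then show "xs \<in> coords ` {x :: 'a. P x}" by blast
qed

lemma coords_img_eqI:
  assumes "\<And>x. P x \<longleftrightarrow> Q (coords x)"
  shows "coords ` {x :: 'a::euclidean_space. P x} = {xs \<in> space_of DIM('a). Q xs}"
  unfolding coords_img_Collect using assms by (auto simp: space_of_def coords_decode)

text \<open>Graphs of functions are given as sets of lists; this is the rule by which they enter
  formulas.\<close>

lemma definable_list_preimage: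
  fixes q :: "'a::euclidean_space \<Rightarrow> real list"
  assumes B: "B \<in> \<O> k" and q_len: "\<And>x. length (q x) = k"
    and q: "\<And>j. j < k \<Longrightarrow> real_polynomial_function (\<lambda>x. q x ! j)"
  shows "definable {x. q x \<in> B}"
proof -
  have "\<forall>j. \<exists>P. j < k \<longrightarrow> poly_function DIM('a) P \<and> (\<forall>x. P (coords x) = q x ! j)"
    using poly_function_of_real_polynomial[OF q] by blast
  then obtain Q where Q: "\<And>j. j < k \<Longrightarrow> poly_function DIM('a) (Q j)"
    "\<And>j x. j < k \<Longrightarrow> Q j (coords x) = q x ! j" by metis
  have eq: "map (\<lambda>j. Q j (coords x)) [0..<k] = q x" for x
    by (rule nth_equalityI) (auto simp: q_len Q)
  have "coords ` {x. q x \<in> B} = {xs \<in> space_of DIM('a). map (\<lambda>j. Q j xs) [0..<k] \<in> B}"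
    by (rule coords_img_eqI) (simp only: eq)
  then show ?thesis unfolding definable_def using poly_preimage[OF B Q(1)] by simp
qed

lemma definable_compl: "definable {x. P x} \<Longrightarrow> definable {x. \<not> P x}"
proof -
  assume "definable {x. P x}"
  moreover have "coords ` {x. \<not> P x} = space_of DIM('a) - coords ` {x. P x}"
    unfolding coords_img_Collect by auto
  ultimately show ?thesis unfolding definable_def using complement_closed by simp
qed

lemma definable_disj: "definable {x. P x} \<Longrightarrow> definable {x. Q x} \<Longrightarrow> definable {x. P x \<or> Q x}"
proof -
  assume "definable {x. P x}" "definable {x. Q x}"
  moreover have "coords ` {x. P x \<or> Q x} = coords ` {x. P x} \<union> coords ` {x. Q x}" by auto
  ultimately show ?thesis unfolding definable_def using union_closed by simp
qed

lemma definable_conj: "definable {x. P x} \<Longrightarrow> definable {x. Q x} \<Longrightarrow> definable {x. P x \<and> Q x}"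
  using definable_compl[OF definable_disj[OF definable_compl definable_compl, of P Q]] by simp

lemma definable_imp: "definable {x. P x} \<Longrightarrow> definable {x. Q x} \<Longrightarrow> definable {x. P x \<longrightarrow> Q x}"
  unfolding imp_conv_disj by (intro definable_disj definable_compl)

lemma definable_vimage:
  fixes f :: "'a::euclidean_space \<Rightarrow> 'b::euclidean_space"
  assumes B: "definable B" and f: "polynomial_function f"
  shows "definable {x. f x \<in> B}"
proof -
  have "definable {x. coords (f x) \<in> coords ` B}"
  proof (rule definable_list_preimage)
    show "coords ` B \<in> \<O> DIM('b)" using B by (simp add: definable_def)
    show "length (coords (f x)) = DIM('b)" for x by simp
    fix j assume "j < DIM('b)"
    then show "real_polynomial_function (\<lambda>x. coords (f x) ! j)"
      using f[unfolded polynomial_function_def, rule_format, OF bounded_linear_inner_left, of "basis_list ! j"]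
      by (simp add: nth_coords o_def)
  qed
  moreover have "{x. coords (f x) \<in> coords ` B} = {x. f x \<in> B}"
    using coords_inj by blast
  ultimately show ?thesis by simp
qed

text \<open>An existential quantifier is a projection. The coordinates of a pair are linear in those of its
  components, as the bases of the factors and of the product are ordered independently.\<close>

lemma definable_ex_pair:
  assumes S: "definable (S :: ('a::euclidean_space \<times> 'b::euclidean_space) set)"
  shows "definable {x. \<exists>y. (x, y) \<in> S}"
proof -
  let ?m = "DIM('a)" and ?k = "DIM('b)"
  let ?d = "\<lambda>ws. (decode (take ?m ws) :: 'a, decode (drop ?m ws) :: 'b)"
  let ?Q = "\<lambda>j ws. (\<Sum>i<?m. ws ! i * ((basis_list ! i) \<bullet> fst (basis_list ! j :: 'a \<times> 'b)))
     + (\<Sum>i<?k. ws ! (?m + i) * ((basis_list ! i) \<bullet> snd (basis_list ! j :: 'a \<times> 'b)))"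
  have Q: "coords (?d ws) = map (\<lambda>j. ?Q j ws) [0..<?m + ?k]" if "length ws = ?m + ?k" for ws
    by (rule nth_equalityI)
      (use that in \<open>auto simp: nth_coords inner_prod_def decode_def inner_sum_left\<close>)
  let ?C = "{ws \<in> space_of (?m + ?k). map (\<lambda>j. ?Q j ws) [0..<?m + ?k] \<in> coords ` S}"
  have C: "?C \<in> \<O> (?m + ?k)"
    by (intro poly_preimage poly_function_sum poly_function.intros)
      (use S in \<open>auto simp: definable_def\<close>)
  have eqC: "?C = {ws \<in> space_of (?m + ?k). ?d ws \<in> S}"
  proof (rule Collect_cong, rule conj_cong[OF refl])
    fix ws assume "ws \<in> space_of (?m + ?k)"
    then have *: "map (\<lambda>j. ?Q j ws) [0..<?m + ?k] = coords (?d ws)"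
      using Q[of ws] by (simp only: space_of_def mem_Collect_eq)
    show "(map (\<lambda>j. ?Q j ws) [0..<?m + ?k] \<in> coords ` S) = (?d ws \<in> S)"
      unfolding * using coords_inj by blast
  qed
  have eq: "take ?m ` {ws \<in> space_of (?m + ?k). ?d ws \<in> S} = coords ` {x. \<exists>y. (x, y) \<in> S}" (is "?L = ?R")
  proof
    show "?L \<subseteq> ?R"
    proof
      fix xs assume "xs \<in> ?L"
      then obtain ws where ws: "length ws = ?m + ?k" "?d ws \<in> S" "xs = take ?m ws"
        by (auto simp: space_of_def)
      then have "xs = coords (decode (take ?m ws) :: 'a)" by (simp add: coords_decode)
      then show "xs \<in> ?R" using ws by blast
    qed
    show "?R \<subseteq> ?L"
    proof
      fix xs assume "xs \<in> ?R"
      then obtain x y where xy: "(x, y) \<in> S" "xs = coords x" by auto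
      let ?w = "coords x @ coords y"
      have "?w \<in> {ws \<in> space_of (?m + ?k). ?d ws \<in> S}" using xy by (simp add: space_of_def)
      moreover have "xs = take ?m ?w" using xy by simp
      ultimately show "xs \<in> ?L" by (rule rev_image_eqI)
    qed
  qed
  show ?thesis unfolding definable_def using projection_take[OF C] unfolding eqC eq .
qed

lemma definable_ex:
  assumes "definable {z :: 'a::euclidean_space \<times> 'b::euclidean_space. P (fst z) (snd z)}"
  shows "definable {x. \<exists>y. P x y}"
  using definable_ex_pair[OF assms] by simp

lemma definable_all:
  assumes "definable {z :: 'a::euclidean_space \<times> 'b::euclidean_space. P (fst z) (snd z)}"
  shows "definable {x. \<forall>y. P x y}"
proof -
  have "definable {x. \<not> (\<exists>y. \<not> P x y)}"
    by (intro definable_compl definable_ex assms)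
  then show ?thesis by simp
qed

lemma definable_pos:
  assumes "real_polynomial_function (p :: 'a::euclidean_space \<Rightarrow> real)"
  shows "definable {x. p x > 0}"
proof -
  obtain P where P: "poly_function DIM('a) P" "\<And>x. P (coords x) = p x"
    using poly_function_of_real_polynomial[OF assms] by blast
  have "coords ` {x. p x > 0} = {xs \<in> space_of DIM('a). P xs > 0}"
    by (rule coords_img_eqI) (simp only: P(2))
  then show ?thesis unfolding definable_def using semialgebraic_mem[OF semialgebraic.pos[OF P(1)]] by simp
qed

lemma definable_less:
  assumes "real_polynomial_function p" "real_polynomial_function q"
  shows "definable {x :: 'a::euclidean_space. p x < q x}"
  using definable_pos[OF real_polynomial_function_diff[OF assms(2,1)]] by simp

lemma definable_le:
  assumes "real_polynomial_function p" "real_polynomial_function q"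
  shows "definable {x :: 'a::euclidean_space. p x \<le> q x}"
  using definable_compl[OF definable_less[OF assms(2,1)]] by (simp add: not_less)

end

section \<open>Frontiers of definable sets\<close>

text \<open>The interior is generated by open boxes with rational corners. So it is a countable union,
  measurable in every finite product of lines, and it can be tested on base and fiber separately.\<close>

definition rbox :: "rat list \<Rightarrow> rat list \<Rightarrow> real list set" where
  "rbox a c = {xs. length xs = length a \<and> (\<forall>i<length a. of_rat (a ! i) < xs ! i \<and> xs ! i < of_rat (c ! i))}"

definition box_interior :: "nat \<Rightarrow> real list set \<Rightarrow> real list set" where
  "box_interior k A = (\<Union>(a, c) \<in> {(a, c). length a = k \<and> length c = k \<and> rbox a c \<subseteq> A}. rbox a c)"

definition box_frontier :: "nat \<Rightarrow> real list set \<Rightarrow> real list set" where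
  "box_frontier k A = space_of k - box_interior k A - box_interior k (space_of k - A)"

lemma box_interior_subset: "box_interior k A \<subseteq> A"
  unfolding box_interior_def by blast

lemma rbox_append:
  assumes "length a = length xs" "length c = length xs"
  shows "xs @ [t] \<in> rbox (a @ [p]) (c @ [q]) \<longleftrightarrow> xs \<in> rbox a c \<and> of_rat p < t \<and> t < of_rat q"
  using assms unfolding rbox_def by (auto simp: nth_append less_Suc_eq)

lemma rbox_append_cases:
  assumes "ys \<in> rbox (a @ [p]) (c @ [q])" "length a = length c"
  obtains xs t where "ys = xs @ [t]" "xs \<in> rbox a c" "of_rat p < t" "t < of_rat q"
proof -
  have "length ys = Suc (length a)" using assms(1) by (simp add: rbox_def)
  then obtain xs t where ys: "ys = xs @ [t]" by (cases ys rule: rev_cases) auto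
  then have "length a = length xs" "length c = length xs"
    using assms \<open>length ys = _\<close> by auto
  then show thesis using that[of xs t] ys assms(1) rbox_append[of a xs c t p q] by simp
qed

lemma measurable_rbox:
  assumes "length bs = length a" "set bs \<subseteq> I"
  shows "{f \<in> space (PiM I (\<lambda>_. lborel :: real measure)). map f bs \<in> rbox a c} \<in> sets (PiM I (\<lambda>_. lborel))"
proof -
  have "{f \<in> space (PiM I (\<lambda>_. lborel :: real measure)). map f bs \<in> rbox a c}
     = {f \<in> space (PiM I (\<lambda>_. lborel)). \<forall>i\<in>{..<length a}. of_rat (a ! i) < f (bs ! i) \<and> f (bs ! i) < of_rat (c ! i)}"
    using assms(1) by (auto simp: rbox_def)
  also have "\<dots> \<in> sets (PiM I (\<lambda>_. lborel))"
  proof (rule sets.sets_Collect_finite_All)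
    fix i assume "i \<in> {..<length a}"
    then have "bs ! i \<in> I" using assms by auto
    then have [measurable]: "(\<lambda>f. f (bs ! i)) \<in> borel_measurable (PiM I (\<lambda>_. lborel :: real measure))"
      using measurable_component_singleton[of "bs ! i" I "\<lambda>_. lborel :: real measure"] by simp
    have "{f \<in> space (PiM I (\<lambda>_. lborel)). of_rat (a ! i) < f (bs ! i) \<and> f (bs ! i) < of_rat (c ! i)}
        = (\<lambda>f. f (bs ! i)) -` {of_rat (a ! i)<..<of_rat (c ! i)} \<inter> space (PiM I (\<lambda>_. lborel :: real measure))"
      by auto
    also have "\<dots> \<in> sets (PiM I (\<lambda>_. lborel))"
      by (rule measurable_sets[where A = borel]) auto
    finally show "{f \<in> space (PiM I (\<lambda>_. lborel :: real measure)). of_rat (a ! i) < f (bs ! i) \<and> f (bs ! i) < of_rat (c ! i)} \<in> sets (PiM I (\<lambda>_. lborel))" .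
  qed auto
  finally show ?thesis .
qed

lemma measurable_box_interior:
  assumes "length bs = k" "set bs \<subseteq> I"
  shows "{f \<in> space (PiM I (\<lambda>_. lborel :: real measure)). map f bs \<in> box_interior k A} \<in> sets (PiM I (\<lambda>_. lborel))"
proof -
  let ?S = "{(a, c). length a = k \<and> length c = k \<and> rbox a c \<subseteq> A}"
  have "{f \<in> space (PiM I (\<lambda>_. lborel :: real measure)). map f bs \<in> box_interior k A}
    = (\<Union>s\<in>?S. {f \<in> space (PiM I (\<lambda>_. lborel :: real measure)). map f bs \<in> rbox (fst s) (snd s)})"
    unfolding box_interior_def by force
  also have "\<dots> \<in> sets (PiM I (\<lambda>_. lborel))"
    using assms by (intro sets.countable_UN'' countableI_type measurable_rbox) auto
  finally show ?thesis .
qed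

lemma measurable_box_frontier:
  assumes "length bs = k" "set bs \<subseteq> I"
  shows "{f \<in> space (PiM I (\<lambda>_. lborel :: real measure)). map f bs \<in> box_frontier k A} \<in> sets (PiM I (\<lambda>_. lborel))"
proof -
  have "{f \<in> space (PiM I (\<lambda>_. lborel :: real measure)). map f bs \<in> box_frontier k A}
    = space (PiM I (\<lambda>_. lborel)) - {f \<in> space (PiM I (\<lambda>_. lborel)). map f bs \<in> box_interior k A}
      - {f \<in> space (PiM I (\<lambda>_. lborel)). map f bs \<in> box_interior k (space_of k - A)}"
    unfolding box_frontier_def using assms(1) by (auto simp: space_of_def)
  also have "\<dots> \<in> sets (PiM I (\<lambda>_. lborel))"
    by (intro sets.Diff sets.top measurable_box_interior assms)
  finally show ?thesis .
qed

text \<open>The fiber over a point is the preimage of \<open>A\<close> under a polynomial map from the line,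
  so it is a finite union of intervals, which has a finite frontier.\<close>

lemma (in o_minimal) fiber_frontier_null:
  assumes A: "A \<in> \<O> (Suc k)" and xs: "length xs = k"
  shows "frontier {t. xs @ [t] \<in> A} \<in> null_sets lborel"
proof -
  let ?q = "\<lambda>j. if j < k then (\<lambda>_. xs ! j) else (\<lambda>ys :: real list. ys ! 0)"
  have m: "map (\<lambda>j. ?q j [t]) [0..<Suc k] = xs @ [t]" for t
    by (rule nth_equalityI) (auto simp: xs nth_append less_Suc_eq)
  have "{ys \<in> space_of 1. map (\<lambda>j. ?q j ys) [0..<Suc k] \<in> A} \<in> \<O> 1"
    by (rule poly_preimage[OF A]) (auto intro: poly_function.intros)
  from line_intervals[OF this] obtain I where I: "finite I" "\<forall>S\<in>I. is_interval S"
    "{t. [t] \<in> {ys \<in> space_of 1. map (\<lambda>j. ?q j ys) [0..<Suc k] \<in> A}} = \<Union>I"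
    by blast
  have "{t. xs @ [t] \<in> A} = \<Union>I"
    unfolding I(3)[symmetric] using m by (simp add: space_of_def del: upt_Suc)
  then have "frontier {t. xs @ [t] \<in> A} \<subseteq> (\<Union>S\<in>I. frontier S)"
    using frontier_Union_subset[OF I(1)] by simp
  moreover have "negligible (\<Union>S\<in>I. frontier S)"
    using I by (intro negligible_Union) (auto intro: negligible_convex_frontier simp: is_interval_convex)
  ultimately have "negligible (frontier {t. xs @ [t] \<in> A})" by (rule negligible_subset[rotated])
  then show ?thesis
    by (simp add: negligible_iff_null_sets null_sets_completion_iff borel_closed)
qed

text \<open>Induction on the dimension. By the hypothesis, applied to countably many definable sets of base
  points, almost every base point is, for each of these sets, interior to the set or to its complement. Over
  such base points, the frontier of the set lies in the frontier of the fiber, which is null, and Fubini's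
  theorem applies.\<close>

lemma (in o_minimal) box_frontier_null:
  assumes "distinct bs" "A \<in> \<O> (length bs)"
  shows "{f \<in> space (PiM (set bs) (\<lambda>_. lborel)). map f bs \<in> box_frontier (length bs) A}
    \<in> null_sets (PiM (set bs) (\<lambda>_. lborel))"
  using assms
proof (induction bs arbitrary: A rule: rev_induct)
  case Nil
  have "rbox [] [] = {[]}" by (auto simp: rbox_def)
  moreover have "A \<subseteq> {[]}" using member_length[OF Nil(2)] by auto
  ultimately have "box_frontier 0 A = {}"
    unfolding box_frontier_def box_interior_def space_of_def by auto
  then show ?case by simp
next
  case (snoc b bs)
  let ?k = "length bs" and ?I = "set bs"
  have b: "b \<notin> ?I" "distinct bs" using snoc.prems by auto
  have A: "A \<in> \<O> (Suc ?k)" using snoc.prems by simp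
  \<comment> \<open>the base points whose fiber contains a given rational interval\<close>
  define E where "E p q S = {xs \<in> space_of ?k. \<forall>t. of_rat p < t \<and> t < of_rat q \<longrightarrow> xs @ [t] \<in> S}"
    for p q :: rat and S :: "real list set"
  have E_mem: "E p q S \<in> \<O> ?k" if S: "S \<in> \<O> (Suc ?k)" for p q S
  proof -
    let ?P = "{ys \<in> space_of (Suc ?k). ys ! ?k + (- of_rat p) > (0::real)}"
      and ?Q = "{ys \<in> space_of (Suc ?k). of_rat q + (-1) * ys ! ?k > (0::real)}"
    have "space_of ?k - butlast ` (?P \<inter> ?Q \<inter> (space_of (Suc ?k) - S)) \<in> \<O> ?k"
      by (intro complement_closed projection inter_closed semialgebraic_mem semialgebraic.pos poly_function.intros S) auto
    moreover have "E p q S = space_of ?k - butlast ` (?P \<inter> ?Q \<inter> (space_of (Suc ?k) - S))" (is "_ = ?R")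
    proof (intro set_eqI iffI)
      fix xs assume xs: "xs \<in> E p q S"
      have "xs \<notin> butlast ` (?P \<inter> ?Q \<inter> (space_of (Suc ?k) - S))"
      proof
        assume "xs \<in> butlast ` (?P \<inter> ?Q \<inter> (space_of (Suc ?k) - S))"
        then obtain ys where ys: "ys \<in> ?P" "ys \<in> ?Q" "ys \<notin> S" "xs = butlast ys" by auto
        then have "length ys = Suc ?k" by (simp add: space_of_def)
        then have "ys = xs @ [last ys]" "last ys = ys ! ?k"
          using ys(4) by (metis append_butlast_last_id length_0_conv nat.simps(3))
            (metis \<open>length ys = Suc ?k\<close> diff_Suc_1 last_conv_nth length_0_conv nat.simps(3))
        then show False using xs ys(1-3) unfolding E_def by auto
      qed
      then show "xs \<in> ?R" using xs by (simp add: E_def)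
    next
      fix xs assume xs: "xs \<in> ?R"
      have "xs @ [t] \<in> S" if t: "of_rat p < t" "t < of_rat q" for t
      proof (rule ccontr)
        assume "xs @ [t] \<notin> S"
        then have "xs @ [t] \<in> ?P \<inter> ?Q \<inter> (space_of (Suc ?k) - S)"
          using xs t by (simp add: space_of_def nth_append)
        moreover have "xs = butlast (xs @ [t])" by simp
        ultimately have "xs \<in> butlast ` (?P \<inter> ?Q \<inter> (space_of (Suc ?k) - S))"
          by (rule rev_image_eqI)
        then show False using xs by blast
      qed
      then show "xs \<in> E p q S" using xs by (simp add: E_def)
    qed
    ultimately show ?thesis by simp
  qed
  let ?M = "\<lambda>I. PiM I (\<lambda>_. lborel :: real measure)"
  let ?A' = "space_of (Suc ?k) - A"
  have A': "?A' \<in> \<O> (Suc ?k)" by (rule complement_closed[OF A])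
  define N where "N = (\<Union>(p, q) \<in> UNIV.
    {f \<in> space (?M ?I). map f bs \<in> box_frontier ?k (E p q A)} \<union>
    {f \<in> space (?M ?I). map f bs \<in> box_frontier ?k (E p q ?A')})"
  have N: "N \<in> null_sets (?M ?I)"
    unfolding N_def
    by (intro null_sets_UN' countableI_type)
      (auto intro!: null_sets.Un snoc.IH b E_mem A A')
  \<comment> \<open>Off the null set \<open>N\<close> of base points, a fiber meets the frontier only in the frontier of the fiber.\<close>
  have interior_case: "xs @ [t] \<in> box_interior (Suc ?k) S"
    if xs: "length xs = ?k" and S: "S \<in> \<O> (Suc ?k)" and t: "t \<in> interior {t. xs @ [t] \<in> S}"
      and nf: "\<And>p q. xs \<notin> box_frontier ?k (E p q S)" for xs t S
  proof -
    obtain e where e: "e > 0" "ball t e \<subseteq> {t. xs @ [t] \<in> S}"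
      using t mem_interior by blast
    obtain p q where p: "t - e < of_rat p" "of_rat p < t" and q: "t < of_rat q" "of_rat q < t + e"
      using of_rat_dense[of "t - e" t] of_rat_dense[of t "t + e"] e(1) by auto
    have "xs \<in> E p q S"
      unfolding E_def using xs e(2) p q by (force simp: space_of_def dist_real_def)
    then have "xs \<in> box_interior ?k (E p q S)"
      using nf[of p q] box_interior_subset[of ?k "space_of ?k - E p q S"] xs
      unfolding box_frontier_def space_of_def by blast
    then obtain a c where ac: "length a = ?k" "length c = ?k" "rbox a c \<subseteq> E p q S" "xs \<in> rbox a c"
      unfolding box_interior_def by auto
    have "rbox (a @ [p]) (c @ [q]) \<subseteq> S"
    proof
      fix ys assume "ys \<in> rbox (a @ [p]) (c @ [q])"
      then obtain zs s where "ys = zs @ [s]" "zs \<in> rbox a c" "of_rat p < s" "s < of_rat q"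
        by (rule rbox_append_cases) (use ac in auto)
      then show "ys \<in> S" using ac(3) unfolding E_def by blast
    qed
    moreover have "xs @ [t] \<in> rbox (a @ [p]) (c @ [q])"
      using ac p q xs by (simp add: rbox_append)
    moreover have "length (a @ [p]) = Suc ?k" "length (c @ [q]) = Suc ?k" using ac by auto
    ultimately show ?thesis
      unfolding box_interior_def by blast
  qed
  have fiber: "t \<in> frontier {t. xs @ [t] \<in> A}"
    if xs: "length xs = ?k" and bf: "xs @ [t] \<in> box_frontier (Suc ?k) A"
      and nf: "\<And>p q. xs \<notin> box_frontier ?k (E p q A)" "\<And>p q. xs \<notin> box_frontier ?k (E p q ?A')" for xs t
  proof (rule ccontr)
    assume "t \<notin> frontier {t. xs @ [t] \<in> A}"
    then have "t \<in> interior {t. xs @ [t] \<in> A} \<or> t \<in> interior (- {t. xs @ [t] \<in> A})"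
      by (auto simp: frontier_def interior_complement)
    moreover have "- {t. xs @ [t] \<in> A} = {t. xs @ [t] \<in> ?A'}"
      using xs by (auto simp: space_of_def)
    ultimately have "xs @ [t] \<in> box_interior (Suc ?k) A \<or> xs @ [t] \<in> box_interior (Suc ?k) ?A'"
      using interior_case[OF xs A _ nf(1)] interior_case[OF xs A' _ nf(2)] by auto
    then show False using bf unfolding box_frontier_def by blast
  qed
  interpret product_sigma_finite "\<lambda>_ :: 'a. lborel :: real measure" by standard
  let ?B = "{f \<in> space (?M (set (bs @ [b]))). map f (bs @ [b]) \<in> box_frontier (length (bs @ [b])) A}"
  have B: "?B \<in> sets (?M (insert b ?I))"
    using measurable_box_frontier[of "bs @ [b]" _ "insert b ?I" A] by simp
  have "emeasure (?M (insert b ?I)) ?B = (\<integral>\<^sup>+f. indicator ?B f \<partial>?M (insert b ?I))"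
    using B by simp
  also have "\<dots> = (\<integral>\<^sup>+f. (\<integral>\<^sup>+t. indicator ?B (f(b := t)) \<partial>lborel) \<partial>?M ?I)"
    by (rule product_nn_integral_insert) (use b B in auto)
  also have "\<dots> = (\<integral>\<^sup>+f. 0 \<partial>?M ?I)"
  proof (rule nn_integral_cong_AE)
    have "AE f in ?M ?I. f \<notin> N" by (rule AE_not_in[OF N])
    moreover have "AE f in ?M ?I. f \<in> space (?M ?I)" by (rule AE_space)
    ultimately show "AE f in ?M ?I. (\<integral>\<^sup>+t. indicator ?B (f(b := t)) \<partial>lborel) = 0"
    proof eventually_elim
      case (elim f)
      let ?xs = "map f bs"
      have m: "map (f(b := t)) bs = ?xs" for t using b by (auto intro: map_cong)
      have nf: "\<And>p q. ?xs \<notin> box_frontier ?k (E p q A)" "\<And>p q. ?xs \<notin> box_frontier ?k (E p q ?A')"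
        using elim unfolding N_def by auto
      have "indicator ?B (f(b := t)) \<le> (indicator (frontier {t. ?xs @ [t] \<in> A}) t :: ennreal)" for t
      proof (cases "f(b := t) \<in> ?B")
        case True
        have *: "map (f(b := t)) (bs @ [b]) = ?xs @ [t]"
          unfolding map_append m by simp
        have "?xs @ [t] \<in> box_frontier (Suc ?k) A"
          using True unfolding mem_Collect_eq * by simp
        then have "t \<in> frontier {t. ?xs @ [t] \<in> A}" using fiber[OF _ _ nf, of t] by simp
        then show ?thesis unfolding indicator_simps(1)[OF True] by (simp only: indicator_simps order_refl)
      next
        case False
        show ?thesis unfolding indicator_simps(2)[OF False] by (rule zero_le)
      qed
      then have "(\<integral>\<^sup>+t. indicator ?B (f(b := t)) \<partial>lborel)
          \<le> (\<integral>\<^sup>+t. indicator (frontier {t. ?xs @ [t] \<in> A}) t \<partial>lborel)"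
        by (intro nn_integral_mono)
      also have "\<dots> = emeasure lborel (frontier {t. ?xs @ [t] \<in> A})"
        by (rule nn_integral_indicator) (simp add: borel_closed)
      also have "\<dots> = 0" by (rule null_setsD1[OF fiber_frontier_null[OF A]]) simp
      finally show ?case by (simp only: le_zero_eq)
    qed
  qed
  also have "\<dots> = 0" by simp
  finally have "emeasure (?M (insert b ?I)) ?B = 0" .
  with B have "?B \<in> null_sets (?M (insert b ?I))" by (rule null_setsI[rotated])
  moreover have "insert b ?I = set (bs @ [b])" by simp
  ultimately show ?case by (simp only:)
qed

lemma open_rbox: "length a = DIM('a) \<Longrightarrow> open {x :: 'a::euclidean_space. coords x \<in> rbox a c}"
proof -
  assume a: "length a = DIM('a)"
  have "{x :: 'a. coords x \<in> rbox a c} = (\<Inter>i\<in>{..<DIM('a)}. {x. of_rat (a ! i) < x \<bullet> (basis_list ! i)} \<inter> {x. x \<bullet> (basis_list ! i) < of_rat (c ! i)})"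
    by (auto simp: rbox_def a nth_coords)
  also have "open \<dots>"
    by (intro open_INT open_Int open_Collect_less continuous_intros finite_lessThan ballI)
  finally show ?thesis .
qed

lemma coords_box_interior:
  assumes "coords (x :: 'a::euclidean_space) \<in> box_interior DIM('a) (coords ` A)"
  shows "x \<in> interior A"
proof -
  obtain a c where ac: "length a = DIM('a)" "rbox a c \<subseteq> coords ` A" "coords x \<in> rbox a c"
    using assms unfolding box_interior_def by auto
  have "{x. coords x \<in> rbox a c} \<subseteq> A" using ac(2) coords_inj by blast
  then show ?thesis using open_rbox[OF ac(1), of c] ac(3) by (metis interiorI mem_Collect_eq)
qed

text \<open>Lebesgue measure is the image of the product measure under the coordinates.\<close>

theorem (in o_minimal) definable_frontier_null:
  fixes A :: "'a::euclidean_space set"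
  assumes "definable A"
  shows "frontier A \<in> null_sets lborel"
proof -
  let ?M = "PiM (Basis :: 'a set) (\<lambda>_. lborel :: real measure)" and ?T = "\<lambda>f. \<Sum>b\<in>(Basis :: 'a set). f b *\<^sub>R b"
  have lb: "lborel = distr ?M borel ?T"
    by (subst lborel_def) (simp only: lborel_eq_real)
  have co: "coords (?T f) = map f basis_list" for f
    by (rule nth_equalityI) (auto simp: nth_coords basis_list_nth inner_sum_left inner_Basis if_distrib cong: if_cong)
  have sub: "?T -` frontier A \<inter> space ?M \<subseteq> {f \<in> space ?M. map f basis_list \<in> box_frontier DIM('a) (coords ` A)}"
  proof
    fix f assume f: "f \<in> ?T -` frontier A \<inter> space ?M"
    then have "?T f \<notin> interior A" "?T f \<notin> interior (- A)"
      by (auto simp: frontier_def interior_complement)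
    moreover have "space_of DIM('a) - coords ` A = coords ` (- A)"
      using coords_img_Collect[of "\<lambda>x. x \<in> A"] coords_img_Collect[of "\<lambda>x. x \<notin> A"]
      by (auto simp: Compl_eq)
    ultimately have "coords (?T f) \<in> box_frontier DIM('a) (coords ` A)"
      unfolding box_frontier_def using coords_box_interior[of "?T f"]
      by (auto simp: space_of_def)
    then show "f \<in> {f \<in> space ?M. map f basis_list \<in> box_frontier DIM('a) (coords ` A)}"
      using f co by auto
  qed
  have nul: "{f \<in> space ?M. map f basis_list \<in> box_frontier DIM('a) (coords ` A)} \<in> null_sets ?M"
    using box_frontier_null[of "basis_list :: 'a list", OF basis_list(1), of "coords ` A"] assms by (simp add: basis_list(2) definable_def)
  have meas: "?T \<in> ?M \<rightarrow>\<^sub>M borel" by measurable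
  have "emeasure ?M (?T -` frontier A \<inter> space ?M) = 0"
    by (rule emeasure_eq_0[OF null_setsD2[OF nul] null_setsD1[OF nul] sub])
  then have "emeasure lborel (frontier A) = 0"
    unfolding lb by (subst emeasure_distr[OF meas]) auto
  then show ?thesis by (auto simp: null_sets_def)
qed

section \<open>Gradients\<close>

lemma GDERIV_unique: "GDERIV f x :> a \<Longrightarrow> GDERIV f x :> b \<Longrightarrow> a = b"
  unfolding gderiv_def
  by (metis has_derivative_unique inner_commute vector_eq_rdot)

lemma grad_eqI: "GDERIV f x :> v \<Longrightarrow> grad f x = v"
  unfolding grad_def using GDERIV_unique by blast

lemma differentiable_GDERIV:
  fixes f :: "real^'n \<Rightarrow> real"
  assumes "f differentiable (at x)"
  shows "GDERIV f x :> grad f x"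
proof -
  obtain f' where f': "(f has_derivative f') (at x)" using assms by (auto simp: differentiable_def)
  interpret f': bounded_linear f' by (rule has_derivative_bounded_linear[OF f'])
  have "f' = (\<lambda>h. h \<bullet> (\<Sum>b\<in>Basis. f' b *\<^sub>R b))"
  proof
    fix h
    have "f' h = f' (\<Sum>b\<in>Basis. (h \<bullet> b) *\<^sub>R b)" by (simp add: euclidean_representation)
    also have "\<dots> = (\<Sum>b\<in>Basis. (h \<bullet> b) * f' b)" by (simp add: f'.sum f'.scaleR)
    also have "\<dots> = h \<bullet> (\<Sum>b\<in>Basis. f' b *\<^sub>R b)"
      by (simp add: inner_sum_right mult.commute)
    finally show "f' h = h \<bullet> (\<Sum>b\<in>Basis. f' b *\<^sub>R b)" .
  qed
  then have "GDERIV f x :> (\<Sum>b\<in>Basis. f' b *\<^sub>R b)" using f' unfolding gderiv_def by simp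
  then show ?thesis using grad_eqI by metis
qed

lemma differentiable_has_derivative_grad:
  fixes f :: "real^'n \<Rightarrow> real"
  assumes "f differentiable (at x)"
  shows "(f has_derivative (\<lambda>h. h \<bullet> grad f x)) (at x)"
  using differentiable_GDERIV[OF assms] by (simp add: gderiv_def)

lemma grad_inner:
  fixes f :: "real^'n \<Rightarrow> real"
  assumes "f differentiable (at x)"
  shows "frechet_derivative f (at x) h = h \<bullet> grad f x"
  using frechet_derivative_at[OF differentiable_has_derivative_grad[OF assms]] by metis

lemma Ck2_differentiable:
  assumes "Ck_on 2 f S" "x \<in> S" shows "f differentiable (at x)"
  using assms by (simp add: eval_nat_numeral)

lemma Ck2_partial_differentiable:
  assumes "Ck_on 2 f S" "x \<in> S" "b \<in> Basis"
  shows "(\<lambda>x. frechet_derivative f (at x) b) differentiable (at x)"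
  using assms by (simp add: eval_nat_numeral)

lemma Ck2_grad_differentiable:
  fixes f :: "real^'n \<Rightarrow> real"
  assumes "Ck_on 2 f UNIV" shows "grad f differentiable (at x)"
proof -
  have "grad f = (\<lambda>x. \<Sum>b\<in>Basis. frechet_derivative f (at x) b *\<^sub>R b)"
  proof
    fix x
    have "f differentiable (at x)" by (rule Ck2_differentiable[OF assms]) simp
    then show "grad f x = (\<Sum>b\<in>Basis. frechet_derivative f (at x) b *\<^sub>R b)"
      by (simp add: grad_inner inner_commute[of _ "grad f x"] euclidean_representation)
  qed
  moreover have "(\<lambda>x. \<Sum>b\<in>Basis. frechet_derivative f (at x) b *\<^sub>R b) differentiable (at x)"
    by (intro differentiable_sum ballI finite_Basis differentiable_scaleR
        Ck2_partial_differentiable[OF assms]) auto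
  ultimately show ?thesis by simp
qed

lemma hess_has_derivative:
  assumes "grad f differentiable (at x)"
  shows "(grad f has_derivative (\<lambda>h. hess f x *v h)) (at x)"
  using assms unfolding hess_def jacobian_works .

lemma grad_compose_matrix:
  fixes f :: "real^'n \<Rightarrow> real" and X :: "real^'p^'n"
  assumes "f differentiable (at (X *v b))"
  shows "grad (\<lambda>b. f (X *v b)) b = transpose X *v grad f (X *v b)"
proof (rule grad_eqI, unfold gderiv_def)
  have "((\<lambda>b. f (X *v b)) has_derivative (\<lambda>h. (X *v h) \<bullet> grad f (X *v b))) (at b)"
    using has_derivative_compose[OF bounded_linear_imp_has_derivative[OF matrix_vector_mul_bounded_linear]
        differentiable_has_derivative_grad[OF assms]] by simp
  moreover have "(X *v h) \<bullet> grad f (X *v b) = h \<bullet> (transpose X *v grad f (X *v b))" for h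
    by (metis dot_lmul_matrix inner_commute transpose_matrix_vector)
  ultimately show "((\<lambda>b. f (X *v b)) has_derivative (\<lambda>h. h \<bullet> (transpose X *v grad f (X *v b)))) (at b)"
    by simp
qed

section \<open>Definability in the variational problem\<close>

lemma real_polynomial_function_fst:
  "polynomial_function f \<Longrightarrow> real_polynomial_function (\<lambda>z. fst (f z) :: real)"
  unfolding polynomial_function_def o_def using bounded_linear_fst by blast

lemma real_polynomial_function_snd:
  "polynomial_function f \<Longrightarrow> real_polynomial_function (\<lambda>z. snd (f z) :: real)"
  unfolding polynomial_function_def o_def using bounded_linear_snd by blast

lemma polynomial_function_linear_image:
  assumes h: "bounded_linear h" and f: "polynomial_function f"
  shows "polynomial_function (\<lambda>z. h (f z))"
  unfolding polynomial_function_def o_def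
proof (intro allI impI)
  fix g :: "'b \<Rightarrow> real" assume "bounded_linear g"
  then have "bounded_linear (\<lambda>x. g (h x))" using h by (rule bounded_linear_compose)
  then show "real_polynomial_function (\<lambda>x. g (h (f x)))"
    by (rule f[unfolded polynomial_function_def o_def, rule_format])
qed

lemma polynomial_function_Pair:
  assumes f: "polynomial_function f" and g: "polynomial_function g"
  shows "polynomial_function (\<lambda>z. (f z, g z))"
  unfolding polynomial_function_def o_def
proof (intro allI impI)
  fix h :: "'b \<times> 'c \<Rightarrow> real" assume h: "bounded_linear h"
  have "bounded_linear (\<lambda>x. h (x, 0))" "bounded_linear (\<lambda>x. h (0, x))"
    by (intro bounded_linear_compose[OF h] bounded_linear_Pair bounded_linear_ident bounded_linear_zero)+
  then have "real_polynomial_function (\<lambda>x. h (f x, 0) + h (0, g x))"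
    using f[unfolded polynomial_function_def o_def, rule_format, of "\<lambda>x. h (x, 0)"]
      g[unfolded polynomial_function_def o_def, rule_format, of "\<lambda>x. h (0, x)"]
    by (intro real_polynomial_function.intros(3))
  moreover have "h (f x, 0) + h (0, g x) = h (f x, g x)" for x
    using linear_add[OF bounded_linear.linear[OF h], of "(f x, 0)" "(0, g x)"] by simp
  ultimately show "real_polynomial_function (\<lambda>x. h (f x, g x))" by simp
qed

lemmas polynomial_function_fst = polynomial_function_linear_image[OF bounded_linear_fst]
lemmas polynomial_function_snd = polynomial_function_linear_image[OF bounded_linear_snd]
lemmas polynomial_function_matrix = polynomial_function_linear_image[OF matrix_vector_mul_bounded_linear]

lemma real_polynomial_function_inner:
  fixes f g :: "'a::real_normed_vector \<Rightarrow> 'b::euclidean_space"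
  assumes "polynomial_function f" "polynomial_function g"
  shows "real_polynomial_function (\<lambda>z. f z \<bullet> g z)"
proof -
  have "real_polynomial_function (\<lambda>z. f z \<bullet> b)" if "polynomial_function f" for f :: "'a \<Rightarrow> 'b" and b
    using that[unfolded polynomial_function_def o_def, rule_format, OF bounded_linear_inner_left] .
  then have "real_polynomial_function (\<lambda>z. \<Sum>b\<in>Basis. (f z \<bullet> b) * (g z \<bullet> b))"
    using assms by (intro real_polynomial_function_sum real_polynomial_function.intros(4)) auto
  then show ?thesis by (subst euclidean_inner)
qed

text \<open>The terms in the formulas below are recognized as polynomials by these rules.\<close>

lemmas poly_intros = real_polynomial_function_inner real_polynomial_function.intros(2-4)
  real_polynomial_function_diff real_polynomial_function_minus
  real_polynomial_function_fst real_polynomial_function_snd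
  polynomial_function_fst polynomial_function_snd polynomial_function_matrix
  polynomial_function_const polynomial_function_id
  polynomial_function_add polynomial_function_diff polynomial_function_minus polynomial_function_mult

lemma length_vlist [simp]: "length (vlist (x :: real^'n)) = CARD('n)"
  by (simp add: vlist_def)

lemma nth_vlist: "i < CARD('n) \<Longrightarrow> vlist (x :: real^'n) ! i = x $ from_nat_into UNIV i"
  by (simp add: vlist_def)

lemma vlist_inj: "vlist x = vlist y \<Longrightarrow> x = (y :: real^'n)"
proof -
  assume eq: "vlist x = vlist y"
  have "x $ i = y $ i" for i
  proof -
    have "i \<in> from_nat_into UNIV ` {..<CARD('n)}"
      using bij_betw_from_nat_into_finite[of "UNIV :: 'n set"] by (simp add: bij_betw_def)
    then obtain j where "j < CARD('n)" "i = from_nat_into UNIV j" by auto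
    then show ?thesis using eq nth_vlist by metis
  qed
  then show "x = y" by (simp add: vec_eq_iff)
qed

lemma real_polynomial_function_nth_vlist:
  fixes f :: "'a::real_normed_vector \<Rightarrow> real^'n"
  assumes "polynomial_function f" "j < CARD('n)"
  shows "real_polynomial_function (\<lambda>z. vlist (f z) ! j)"
  using assms(1)[unfolded polynomial_function_def o_def, rule_format, OF bounded_linear_vec_nth] assms(2)
  by (simp add: nth_vlist)

context o_minimal
begin

text \<open>Only equations \<open>F x y = r\<close> are directly definable; inequalities between values of
  \<open>F\<close> need bound variables for the values.\<close>

lemma definable_fun2_eq:
  fixes F :: "real^'p \<Rightarrow> real^'n \<Rightarrow> real"
  assumes F: "definable_fun2 \<O> F"
    and "polynomial_function f" "polynomial_function g" "real_polynomial_function h"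
  shows "definable {z :: 'a::euclidean_space. F (f z) (g z) = h z}"
proof -
  let ?B = "{vlist x @ vlist y @ [F x y] | x y. True}"
  have mem: "vlist x @ vlist y @ [r] \<in> ?B \<longleftrightarrow> F x y = r" for x y r
  proof
    assume "vlist x @ vlist y @ [r] \<in> ?B"
    then obtain x' y' where "vlist x @ vlist y @ [r] = vlist x' @ vlist y' @ [F x' y']" by auto
    then have "vlist x = vlist x'" "vlist y = vlist y'" "r = F x' y'" by auto
    then show "F x y = r" using vlist_inj by metis
  qed auto
  have "definable {z. vlist (f z) @ vlist (g z) @ [h z] \<in> ?B}"
  proof (rule definable_list_preimage)
    show "?B \<in> \<O> (CARD('p) + CARD('n) + 1)" using F unfolding definable_fun2_def .
    fix j assume j: "j < CARD('p) + CARD('n) + 1"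
    consider "j < CARD('p)" | i where "j = CARD('p) + i" "i < CARD('n)" | "j = CARD('p) + CARD('n)"
      using j by (metis add.commute add_less_cancel_left less_SucE linorder_not_less
          nat_le_iff_add plus_1_eq_Suc)
    then show "real_polynomial_function (\<lambda>z. (vlist (f z) @ vlist (g z) @ [h z]) ! j)"
      using assms(2-4) by cases (auto simp: nth_append real_polynomial_function_nth_vlist)
  qed auto
  then show ?thesis unfolding mem .
qed

lemma definable_ereal_fun_eq:
  fixes J :: "real^'p \<Rightarrow> ereal"
  assumes J: "definable_ereal_fun \<O> J"
    and "polynomial_function f" "real_polynomial_function h"
  shows "definable {z :: 'a::euclidean_space. J (f z) = ereal (h z)}"
proof -
  let ?B = "{vlist x @ [r] | x r. J x = ereal r}"
  have mem: "vlist x @ [r] \<in> ?B \<longleftrightarrow> J x = ereal r" for x r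
    using vlist_inj by auto
  have "definable {z. vlist (f z) @ [h z] \<in> ?B}"
  proof (rule definable_list_preimage)
    show "?B \<in> \<O> (CARD('p) + 1)" using J unfolding definable_ereal_fun_def .
    fix j assume j: "j < CARD('p) + 1"
    then consider "j < CARD('p)" | "j = CARD('p)" by linarith
    then show "real_polynomial_function (\<lambda>z. (vlist (f z) @ [h z]) ! j)"
      using assms(2-3) by cases (auto simp: nth_append real_polynomial_function_nth_vlist)
  qed auto
  then show ?thesis unfolding mem .
qed

lemma definable_set_mem:
  fixes A :: "(real^'p) set"
  assumes "definable_set \<O> A" "polynomial_function f"
  shows "definable {z :: 'a::euclidean_space. f z \<in> A}"
proof -
  have "definable {z. vlist (f z) \<in> vlist ` A}"
    by (rule definable_list_preimage)
      (use assms real_polynomial_function_nth_vlist in \<open>auto simp: definable_set_def\<close>)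
  moreover have "{z. vlist (f z) \<in> vlist ` A} = {z. f z \<in> A}" using vlist_inj by blast
  ultimately show ?thesis by simp
qed

end

text \<open>The predicates below are first-order formulas over \<open>F\<close>, \<open>J\<close> and polynomials: norms enter through
  their squares, and values of \<open>F\<close> and \<open>J\<close> through equations.\<close>

definition grad_graph :: "(real^'p \<Rightarrow> real^'n \<Rightarrow> real) \<Rightarrow> real^'p \<Rightarrow> real^'n \<Rightarrow> real^'p \<Rightarrow> bool" where
  "grad_graph F \<beta> y v \<longleftrightarrow> (\<forall>\<epsilon>::real. 0 < \<epsilon> \<longrightarrow> (\<exists>\<delta>::real. 0 < \<delta> \<and> (\<forall>\<beta>'. \<forall>r s::real. F \<beta>' y = r \<longrightarrow> F \<beta> y = s \<longrightarrow>
     (\<beta>' - \<beta>) \<bullet> (\<beta>' - \<beta>) < \<delta> * \<delta> \<longrightarrow>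
     (r - s - v \<bullet> (\<beta>' - \<beta>)) * (r - s - v \<bullet> (\<beta>' - \<beta>)) \<le> \<epsilon> * \<epsilon> * ((\<beta>' - \<beta>) \<bullet> (\<beta>' - \<beta>)))))"

definition subgrad :: "(real^'p \<Rightarrow> ereal) \<Rightarrow> real^'p \<Rightarrow> real^'p \<Rightarrow> bool" where
  "subgrad J \<beta> u \<longleftrightarrow> (\<forall>z. \<forall>s r. J \<beta> = ereal s \<longrightarrow> J z = ereal r \<longrightarrow> s + u \<bullet> (z - \<beta>) \<le> r)"

definition solves :: "(real^'p \<Rightarrow> real^'n \<Rightarrow> real) \<Rightarrow> (real^'p \<Rightarrow> ereal) \<Rightarrow> real^'n \<Rightarrow> real^'p \<Rightarrow> bool" where
  "solves F J y \<beta> \<longleftrightarrow> (\<forall>\<beta>'. \<forall>s r a b. J \<beta> = ereal s \<longrightarrow> J \<beta>' = ereal r \<longrightarrow> F \<beta> y = a \<longrightarrow> F \<beta>' y = b \<longrightarrow>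
     a + s \<le> b + r)"

lemma square_less_iff: "0 < d \<Longrightarrow> (x :: 'a::real_inner) \<bullet> x < d * d \<longleftrightarrow> norm x < d"
  by (metis abs_norm_cancel abs_of_pos dot_square_norm power2_eq_square real_sqrt_abs real_sqrt_less_iff)

lemma square_le_iff: "0 \<le> d \<Longrightarrow> (x :: 'a::real_inner) \<bullet> x \<le> d * d \<longleftrightarrow> norm x \<le> d"
  by (metis abs_norm_cancel abs_of_nonneg dot_square_norm power2_eq_square real_sqrt_abs real_sqrt_le_iff)

lemma grad_graph_iff:
  assumes diff: "(\<lambda>b. F b y) differentiable (at \<beta>)"
  shows "grad_graph F \<beta> y v \<longleftrightarrow> grad (\<lambda>b. F b y) \<beta> = v"
proof -
  have *: "((r - s - v \<bullet> w) * (r - s - v \<bullet> w) \<le> e * e * (w \<bullet> w)) = (norm (r - s - w \<bullet> v) \<le> e * norm w)"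
    if "0 < e" for r s e and v w :: "real^'p"
    using square_le_iff[of "e * norm w" "r - s - v \<bullet> w"] that
    by (simp add: inner_commute power2_norm_eq_inner[symmetric] power2_eq_square mult.assoc mult.left_commute)
  have bl: "bounded_linear (\<lambda>h. h \<bullet> v)" by (rule bounded_linear_inner_left)
  have "grad_graph F \<beta> y v \<longleftrightarrow> GDERIV (\<lambda>b. F b y) \<beta> :> v"
    unfolding grad_graph_def gderiv_def has_derivative_at_alt
    by (simp add: bl * square_less_iff cong: conj_cong)
  also have "\<dots> \<longleftrightarrow> grad (\<lambda>b. F b y) \<beta> = v"
    using differentiable_GDERIV[OF diff] grad_eqI by metis
  finally show ?thesis .
qed

lemma subgrad_iff:
  assumes "proper_fun J" "J \<beta> \<noteq> \<infinity>"
  shows "subgrad J \<beta> u \<longleftrightarrow> u \<in> subdiff J \<beta>"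
proof -
  obtain s where s: "J \<beta> = ereal s" using assms by (cases "J \<beta>") (auto simp: proper_fun_def)
  have "(J \<beta> + ereal (u \<bullet> (z - \<beta>)) \<le> J z) = (\<forall>r. J z = ereal r \<longrightarrow> s + u \<bullet> (z - \<beta>) \<le> r)" for z
    using assms(1) by (cases "J z") (auto simp: proper_fun_def s)
  then show ?thesis unfolding subgrad_def subdiff_def by (auto simp: s)
qed

lemma subdiff_finite:
  assumes "proper_fun J" "subdiff J \<beta> \<noteq> {}" shows "J \<beta> \<noteq> \<infinity>"
proof
  assume "J \<beta> = \<infinity>"
  moreover obtain u where "u \<in> subdiff J \<beta>" using assms(2) by blast
  ultimately have "J z = \<infinity>" for z by (auto simp: subdiff_def split: if_splits)
  then show False using assms(1) by (simp add: proper_fun_def)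
qed

lemma solves_iff:
  assumes "proper_fun J" "J \<beta> \<noteq> \<infinity>"
  shows "solves F J y \<beta> \<longleftrightarrow> is_solution F J y \<beta>"
proof -
  obtain s where s: "J \<beta> = ereal s" using assms by (cases "J \<beta>") (auto simp: proper_fun_def)
  have "(ereal (F \<beta> y) + J \<beta> \<le> ereal (F z y) + J z) = (\<forall>r. J z = ereal r \<longrightarrow> F \<beta> y + s \<le> F z y + r)" for z
    using assms(1) by (cases "J z") (auto simp: proper_fun_def s)
  then show ?thesis unfolding solves_def is_solution_def by (auto simp: s)
qed

context o_minimal
begin

lemma definable_grad_graph:
  fixes F :: "real^'p \<Rightarrow> real^'n \<Rightarrow> real"
  assumes F: "definable_fun2 \<O> F"
    and p: "polynomial_function f" "polynomial_function g" "polynomial_function v"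
  shows "definable {z :: 'a::euclidean_space. grad_graph F (f z) (g z) (v z)}"
proof -
  have "definable {w :: (real^'p) \<times> (real^'n) \<times> (real^'p). grad_graph F (fst w) (fst (snd w)) (snd (snd w))}"
    unfolding grad_graph_def
    by (intro definable_all definable_ex definable_imp definable_conj definable_less definable_le
        definable_fun2_eq[OF F] poly_intros)
  from definable_vimage[OF this, of "\<lambda>z. (f z, g z, v z)"]
  show ?thesis by (simp add: p polynomial_function_Pair)
qed

lemma definable_subgrad:
  fixes J :: "real^'p \<Rightarrow> ereal"
  assumes J: "definable_ereal_fun \<O> J"
    and p: "polynomial_function f" "polynomial_function g"
  shows "definable {z :: 'a::euclidean_space. subgrad J (f z) (g z)}"
proof -
  have "definable {w :: (real^'p) \<times> (real^'p). subgrad J (fst w) (snd w)}"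
    unfolding subgrad_def
    by (intro definable_all definable_imp definable_le definable_ereal_fun_eq[OF J] poly_intros)
  from definable_vimage[OF this, of "\<lambda>z. (f z, g z)"]
  show ?thesis by (simp add: p polynomial_function_Pair)
qed

lemma definable_solves:
  fixes F :: "real^'p \<Rightarrow> real^'n \<Rightarrow> real"
  assumes F: "definable_fun2 \<O> F" and J: "definable_ereal_fun \<O> J"
    and p: "polynomial_function f" "polynomial_function g"
  shows "definable {z :: 'a::euclidean_space. solves F J (f z) (g z)}"
proof -
  have "definable {w :: (real^'n) \<times> (real^'p). solves F J (fst w) (snd w)}"
    unfolding solves_def
    by (intro definable_all definable_imp definable_le definable_ereal_fun_eq[OF J]
        definable_fun2_eq[OF F] poly_intros)
  from definable_vimage[OF this, of "\<lambda>z. (f z, g z)"]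
  show ?thesis by (simp add: p polynomial_function_Pair)
qed

text \<open>The set to which the generic principle is applied: data that have a solution in
  \<open>S\<close>, close to \<open>q\<close>, at which the gradient depends on the data by the linear map
  \<open>A\<close>, up to \<open>\<epsilon>\<close> and on the scale \<open>\<delta>\<close>.\<close>

lemma definable_closeness:
  fixes F :: "real^'p \<Rightarrow> real^'n \<Rightarrow> real" and J :: "real^'p \<Rightarrow> ereal" and A :: "real^'n^'p"
  assumes F: "definable_fun2 \<O> F" and J: "definable_ereal_fun \<O> J" and S: "definable_set \<O> S"
  shows "definable {y. \<exists>\<beta>. \<beta> \<in> S \<and> (\<beta> - q) \<bullet> (\<beta> - q) < \<rho> * \<rho> \<and> solves F J y \<beta> \<and>
    (\<forall>y'. (y' - y) \<bullet> (y' - y) < \<delta> * \<delta> \<longrightarrow> (\<forall>v v'. grad_graph F \<beta> y v \<longrightarrow> grad_graph F \<beta> y' v' \<longrightarrow>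
      (v' - v - A *v (y' - y)) \<bullet> (v' - v - A *v (y' - y)) \<le> \<epsilon> * \<epsilon> * ((y' - y) \<bullet> (y' - y))))}"
  by (intro definable_ex definable_conj definable_all definable_imp definable_less definable_le
      definable_set_mem[OF S] definable_solves[OF F J] definable_grad_graph[OF F] poly_intros)

text \<open>Since subdifferentials are closed and convex, a point of one of them lies in the relative interior
  exactly if every segment ending there can be prolonged.\<close>

lemma definable_rel_frontier_pairs:
  fixes F :: "real^'p \<Rightarrow> real^'n \<Rightarrow> real" and J :: "real^'p \<Rightarrow> ereal"
  assumes F: "definable_fun2 \<O> F" and J: "definable_ereal_fun \<O> J" and S: "definable_set \<O> S"
  shows "definable {y. \<exists>\<beta>. \<beta> \<in> S \<and> (\<exists>v. grad_graph F \<beta> y v \<and> subgrad J \<beta> (- v) \<and>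
    \<not> (\<forall>x. subgrad J \<beta> x \<longrightarrow> (\<exists>e::real. 1 < e \<and> subgrad J \<beta> ((1 - e) *\<^sub>R x + e *\<^sub>R (- v)))))}"
  by (intro definable_ex definable_conj definable_all definable_imp definable_compl definable_less
      definable_set_mem[OF S] definable_subgrad[OF J] definable_grad_graph[OF F] poly_intros
      real_polynomial_function_eq[THEN iffD1])

end

section \<open>The transition space and generic solutions\<close>

lemma subdiff_eq_Inter:
  "subdiff J x = (\<Inter>z. {u. J x + ereal (u \<bullet> (z - x)) \<le> J z})"
  by (auto simp: subdiff_def)

lemma closed_convex_subdiff:
  assumes "proper_fun J"
  shows "closed (subdiff J (x :: 'a::euclidean_space))" "convex (subdiff J x)"
proof -
  have halfspace: "closed {u. J x + ereal (u \<bullet> (z - x)) \<le> J z} \<and> convex {u. J x + ereal (u \<bullet> (z - x)) \<le> J z}"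
    if x: "J x \<noteq> \<infinity>" for z
  proof -
    obtain s where s: "J x = ereal s" using assms x by (cases "J x") (auto simp: proper_fun_def)
    show ?thesis
    proof (cases "J z")
      case (real r)
      then have "{u. J x + ereal (u \<bullet> (z - x)) \<le> J z} = {u. (z - x) \<bullet> u \<le> r - s}"
        by (auto simp: s inner_commute)
      then show ?thesis by (simp add: closed_halfspace_le convex_halfspace_le)
    qed (use assms in \<open>auto simp: proper_fun_def\<close>)
  qed
  have empty: "subdiff J x = {}" if "J x = \<infinity>"
    using subdiff_finite[OF assms, of x] that by blast
  show "closed (subdiff J x)" "convex (subdiff J x)"
  proof -
    have "closed (subdiff J x) \<and> convex (subdiff J x)"
    proof (cases "J x = \<infinity>")
      case False
      then have "\<forall>z\<in>UNIV. closed {u. J x + ereal (u \<bullet> (z - x)) \<le> J z}"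
        "\<And>z. z \<in> UNIV \<Longrightarrow> convex {u. J x + ereal (u \<bullet> (z - x)) \<le> J z}"
        using halfspace by blast+
      then show ?thesis unfolding subdiff_eq_Inter by (intro conjI closed_INT convex_INT)
    qed (simp add: empty)
    then show "closed (subdiff J x)" "convex (subdiff J x)" by auto
  qed
qed

lemma rel_frontier_subdiff_iff:
  assumes J: "proper_fun J" and ne: "subdiff J \<beta> \<noteq> {}"
  shows "u \<in> rel_frontier (subdiff J \<beta>) \<longleftrightarrow> subgrad J \<beta> u \<and>
    \<not> (\<forall>x. subgrad J \<beta> x \<longrightarrow> (\<exists>e::real. 1 < e \<and> subgrad J \<beta> ((1 - e) *\<^sub>R x + e *\<^sub>R u)))"
  using closed_convex_subdiff[OF J] ne subgrad_iff[OF J subdiff_finite[OF J ne]]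
  unfolding rel_frontier_def by (auto simp: convex_rel_interior_iff)

text \<open>Each of the finitely many sets in the union is the frontier of a definable set, because the relative
  frontier of a subdifferential is described by a formula.\<close>

theorem transition_space_null:
  fixes F :: "real^'p \<Rightarrow> real^'n \<Rightarrow> real" and J :: "real^'p \<Rightarrow> ereal"
  assumes J: "proper_fun J" and fin: "finite (manifold_family J \<M>)"
    and O: "cond_O F J \<M>" and C: "cond_F F"
  shows "transition_space F J \<M> \<in> null_sets lborel"
proof -
  obtain \<O> where o: "o_minimal_structure \<O>" and F: "definable_fun2 \<O> F" and JD: "definable_ereal_fun \<O> J"
    and S: "\<And>M. M \<in> manifold_family J \<M> \<Longrightarrow> definable_set \<O> (stratum J \<M> M)"
    using O unfolding cond_O_def by blast
  interpret o_minimal \<O> by standard fact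
  have diff: "(\<lambda>b. F b y) differentiable (at \<beta>)" for y \<beta>
    using C Ck2_differentiable unfolding cond_F_def by blast
  have "frontier (fst ` degenerate_pairs F J \<M> M) \<in> null_sets lborel" if M: "M \<in> manifold_family J \<M>" for M
  proof (rule definable_frontier_null)
    have "fst ` degenerate_pairs F J \<M> M = {y. \<exists>\<beta>. \<beta> \<in> stratum J \<M> M \<and> (\<exists>v. grad_graph F \<beta> y v \<and> subgrad J \<beta> (- v) \<and>
      \<not> (\<forall>x. subgrad J \<beta> x \<longrightarrow> (\<exists>e::real. 1 < e \<and> subgrad J \<beta> ((1 - e) *\<^sub>R x + e *\<^sub>R (- v)))))}" (is "?L = ?R")
    proof -
      have "?L = {y. \<exists>\<beta>. \<beta> \<in> stratum J \<M> M \<and> - grad (\<lambda>b. F b y) \<beta> \<in> rel_frontier (subdiff J \<beta>)}"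
        unfolding degenerate_pairs_def by force
      also have "\<dots> = {y. \<exists>\<beta>. \<beta> \<in> stratum J \<M> M \<and> (\<exists>v. grad (\<lambda>b. F b y) \<beta> = v \<and> - v \<in> rel_frontier (subdiff J \<beta>))}"
        by blast
      also have "\<dots> = ?R"
        unfolding grad_graph_iff[OF diff]
        by (intro Collect_cong ex_cong1 conj_cong refl rel_frontier_subdiff_iff[OF J])
          (simp add: stratum_def)
      finally show ?thesis .
    qed
    then show "definable (fst ` degenerate_pairs F J \<M> M)"
      using definable_rel_frontier_pairs[OF F JD S[OF M]] by (simp only:)
  qed
  then show ?thesis unfolding transition_space_def
    by (intro null_sets.finite_UN fin)
qed

text \<open>A definable set of data is, up to a null set, open. Applied to countably many
  definable properties of a solution, this shows that for almost every \<open>y\<close> such a property passes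
  from \<open>y\<close> to its neighbours, with solutions on the same stratum and close to the given one.\<close>

theorem generic_nearby_solutions:
  fixes F :: "real^'p \<Rightarrow> real^'n \<Rightarrow> real" and J :: "real^'p \<Rightarrow> ereal"
  assumes J: "proper_fun J" and fin: "finite (manifold_family J \<M>)"
    and O: "cond_O F J \<M>" and C: "cond_F F"
  obtains N where "N \<in> null_sets lborel"
    "\<And>y \<beta> K \<epsilon> r. \<lbrakk>y \<notin> N; is_solution F J y \<beta>; subdiff J \<beta> \<noteq> {};
      ((\<lambda>y. grad (\<lambda>b. F b y) \<beta>) has_derivative (\<lambda>h. K *v h)) (at y); 0 < \<epsilon>; 0 < r\<rbrakk> \<Longrightarrow>
      \<forall>\<^sub>F y' in nhds y. \<exists>\<beta>'. \<beta>' \<in> stratum J \<M> (\<M> \<beta>) \<and> dist \<beta>' \<beta> < r \<and> is_solution F J y' \<beta>' \<and>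
        norm (grad (\<lambda>b. F b y) \<beta>' - grad (\<lambda>b. F b y') \<beta>' - K *v (y - y')) \<le> \<epsilon> * norm (y - y')"
proof -
  obtain \<O> where o: "o_minimal_structure \<O>" and F: "definable_fun2 \<O> F" and JD: "definable_ereal_fun \<O> J"
    and S: "\<And>M. M \<in> manifold_family J \<M> \<Longrightarrow> definable_set \<O> (stratum J \<M> M)"
    using O unfolding cond_O_def by blast
  interpret o_minimal \<O> by standard fact
  have diff: "(\<lambda>b. F b y) differentiable (at \<beta>)" for y \<beta>
    using C Ck2_differentiable unfolding cond_F_def by blast
  define G where "G \<beta> y = grad (\<lambda>b. F b y) \<beta>" for \<beta> y
  define W where "W M q \<rho> \<delta> \<epsilon> A = {y. \<exists>\<beta>. \<beta> \<in> stratum J \<M> M \<and> (\<beta> - q) \<bullet> (\<beta> - q) < \<rho> * \<rho> \<and> solves F J y \<beta> \<and>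
    (\<forall>y'. (y' - y) \<bullet> (y' - y) < \<delta> * \<delta> \<longrightarrow> (\<forall>v v'. grad_graph F \<beta> y v \<longrightarrow> grad_graph F \<beta> y' v' \<longrightarrow>
      (v' - v - A *v (y' - y)) \<bullet> (v' - v - A *v (y' - y)) \<le> \<epsilon> * \<epsilon> * ((y' - y) \<bullet> (y' - y))))}"
    for M q \<rho> \<delta> \<epsilon> and A :: "real^'n^'p"
  have W_iff: "y \<in> W M q \<rho> \<delta> \<epsilon> A \<longleftrightarrow> (\<exists>\<beta>. \<beta> \<in> stratum J \<M> M \<and> dist \<beta> q < \<rho> \<and> is_solution F J y \<beta> \<and>
    (\<forall>y'. dist y' y < \<delta> \<longrightarrow> norm (G \<beta> y' - G \<beta> y - A *v (y' - y)) \<le> \<epsilon> * norm (y' - y)))"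
    if "0 < \<rho>" "0 < \<delta>" "0 < \<epsilon>" for M q \<rho> \<delta> \<epsilon> A y
  proof -
    have e: "\<epsilon> * \<epsilon> * (h \<bullet> h) = (\<epsilon> * norm h) * (\<epsilon> * norm h)" for h :: "real^'n"
      by (simp add: power2_norm_eq_inner[symmetric] power2_eq_square)
    have "solves F J y \<beta> = is_solution F J y \<beta>" if "\<beta> \<in> stratum J \<M> M" for \<beta>
      using solves_iff[OF J subdiff_finite[OF J]] that by (auto simp: stratum_def)
    then show ?thesis
      unfolding W_def using that
      by (simp add: square_less_iff e square_le_iff grad_graph_iff[OF diff] G_def[symmetric] dist_norm
          cong: conj_cong)
  qed
  have W_definable: "definable (W M q \<rho> \<delta> \<epsilon> A)" if "M \<in> manifold_family J \<M>" for M q \<rho> \<delta> \<epsilon> A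
    unfolding W_def by (rule definable_closeness[OF F JD S[OF that]])
  \<comment> \<open>countable dense sets of centres and of linear maps, to approximate any solution and any
    derivative\<close>
  obtain D :: "(real^'p) set" where D: "countable D" "\<And>X. open X \<Longrightarrow> X \<noteq> {} \<Longrightarrow> \<exists>d\<in>D. d \<in> X"
    by (rule countable_dense_setE) auto
  obtain E :: "(real^'n^'p) set" where E: "countable E" "\<And>X. open X \<Longrightarrow> X \<noteq> {} \<Longrightarrow> \<exists>d\<in>E. d \<in> X"
    by (rule countable_dense_setE) auto
  define r where "r k = 1 / real (Suc k)" for k
  have r: "r k > 0" for k by (simp add: r_def)
  have r_small: "\<exists>k. r k < e" if "e > 0" for e
    using that nat_approx_posE unfolding r_def by metis
  define N where "N = (\<Union>M\<in>manifold_family J \<M>. \<Union>q\<in>D. \<Union>A\<in>E. \<Union>i. \<Union>j. \<Union>k. frontier (W M q (r i) (r j) (r k) A))"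
  have N: "N \<in> null_sets lborel"
    unfolding N_def
    by (intro null_sets_UN' countable_finite[OF fin] D(1) E(1) null_sets_UN definable_frontier_null)
      (use W_definable in auto)
  show thesis
  proof (rule that[OF N])
    fix y \<beta> K and \<epsilon> \<rho> :: real
    assume y: "y \<notin> N" and sol: "is_solution F J y \<beta>" and ne: "subdiff J \<beta> \<noteq> {}"
      and K: "((\<lambda>y. grad (\<lambda>b. F b y) \<beta>) has_derivative (\<lambda>h. K *v h)) (at y)"
      and e: "0 < \<epsilon>" and \<rho>: "0 < \<rho>"
    have M: "\<M> \<beta> \<in> manifold_family J \<M>" "\<beta> \<in> stratum J \<M> (\<M> \<beta>)"
      using ne by (auto simp: manifold_family_def stratum_def)
    obtain i where i: "r i < \<rho> / 2" using r_small[of "\<rho> / 2"] \<rho> by auto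
    obtain q where q: "q \<in> D" "q \<in> ball \<beta> (r i)" using D(2)[of "ball \<beta> (r i)"] r[of i] by auto
    obtain k where k: "r k < \<epsilon> / 2" using r_small[of "\<epsilon> / 2"] e by auto
    \<comment> \<open>a linear map from the dense set that is close to the derivative\<close>
    have close: "\<exists>A\<in>E. \<forall>h. norm (A *v h - K *v h) \<le> r k / 2 * norm h"
    proof -
      define c where "c = r k / 2 / (real CARD('p) * real CARD('n))"
      have c: "c > 0" using r[of k] by (simp add: c_def)
      obtain A where A: "A \<in> E" "A \<in> ball K c" using E(2)[of "ball K c"] c by auto
      have "\<bar>(A - K) $ i $ j\<bar> \<le> c" for i j
      proof -
        have "\<bar>(A - K) $ i $ j\<bar> \<le> norm ((A - K) $ i)" by (rule component_le_norm_cart)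
        also have "\<dots> \<le> norm (A - K)" by (rule Finite_Cartesian_Product.norm_nth_le)
        finally show ?thesis using A(2) by (simp add: dist_norm norm_minus_commute)
      qed
      then have "onorm ((*v) (A - K)) \<le> real CARD('p) * real CARD('n) * c"
        using onorm_le_matrix_component[of "A - K" c] by (simp add: mult_ac)
      then have "onorm ((*v) (A - K)) \<le> r k / 2" by (simp add: c_def)
      then have "norm ((A - K) *v h) \<le> r k / 2 * norm h" for h
        using onorm[OF matrix_vector_mul_bounded_linear, of "A - K" h]
        by (meson mult_right_mono norm_ge_zero order_trans)
      then show ?thesis using A(1) by (auto simp: matrix_vector_mult_diff_rdistrib)
    qed
    then obtain A where A: "A \<in> E" "\<And>h. norm (A *v h - K *v h) \<le> r k / 2 * norm h" by blast
    have "\<exists>d>0. \<forall>y'. norm (y' - y) < d \<longrightarrow> norm (G \<beta> y' - G \<beta> y - K *v (y' - y)) \<le> r k / 2 * norm (y' - y)"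
      using K[unfolded has_derivative_at_alt] half_gt_zero[OF r[of k]] unfolding G_def by blast
    then obtain d where d: "d > 0" "\<And>y'. norm (y' - y) < d \<Longrightarrow> norm (G \<beta> y' - G \<beta> y - K *v (y' - y)) \<le> r k / 2 * norm (y' - y)"
      by blast
    obtain j where j: "r j < d" using r_small[OF d(1)] by auto
    have "norm (G \<beta> y' - G \<beta> y - A *v (y' - y)) \<le> r k * norm (y' - y)" if "dist y' y < r j" for y'
    proof -
      have eq: "(G \<beta> y' - G \<beta> y - K *v (y' - y)) - (A *v (y' - y) - K *v (y' - y)) = G \<beta> y' - G \<beta> y - A *v (y' - y)"
        by simp
      have "norm (G \<beta> y' - G \<beta> y - A *v (y' - y))
          \<le> norm (G \<beta> y' - G \<beta> y - K *v (y' - y)) + norm (A *v (y' - y) - K *v (y' - y))"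
        by (subst eq[symmetric]) (rule norm_triangle_ineq4)
      also have "\<dots> \<le> r k / 2 * norm (y' - y) + r k / 2 * norm (y' - y)"
        using that j by (intro add_mono d(2) A(2)) (simp add: dist_norm)
      finally show ?thesis by (simp add: field_simps)
    qed
    moreover have "dist \<beta> q < r i" using q(2) by simp
    ultimately have "y \<in> W (\<M> \<beta>) q (r i) (r j) (r k) A"
      unfolding W_iff[OF r r r] using sol M(2) by blast
    moreover have "y \<notin> frontier (W (\<M> \<beta>) q (r i) (r j) (r k) A)"
    proof
      assume "y \<in> frontier (W (\<M> \<beta>) q (r i) (r j) (r k) A)"
      then have "y \<in> N" unfolding N_def
        by (intro UN_I[OF M(1)] UN_I[OF q(1)] UN_I[OF A(1)] UN_I[OF UNIV_I])
      with y show False by contradiction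
    qed
    ultimately have "y \<in> interior (W (\<M> \<beta>) q (r i) (r j) (r k) A)"
      using closure_subset[of "W (\<M> \<beta>) q (r i) (r j) (r k) A"] unfolding frontier_def by blast
    then have "\<forall>\<^sub>F y' in nhds y. y' \<in> interior (W (\<M> \<beta>) q (r i) (r j) (r k) A)"
      by (intro eventually_nhds_in_open open_interior)
    then have "\<forall>\<^sub>F y' in nhds y. y' \<in> W (\<M> \<beta>) q (r i) (r j) (r k) A"
      by (rule eventually_mono) (use interior_subset in blast)
    moreover have "\<forall>\<^sub>F y' in nhds y. dist y' y < r j"
      using r[of j] eventually_nhds_metric by blast
    ultimately show "\<forall>\<^sub>F y' in nhds y. \<exists>\<beta>'. \<beta>' \<in> stratum J \<M> (\<M> \<beta>) \<and> dist \<beta>' \<beta> < \<rho> \<and> is_solution F J y' \<beta>' \<and>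
        norm (grad (\<lambda>b. F b y) \<beta>' - grad (\<lambda>b. F b y') \<beta>' - K *v (y - y')) \<le> \<epsilon> * norm (y - y')"
    proof eventually_elim
      case (elim y')
      then obtain b where b: "b \<in> stratum J \<M> (\<M> \<beta>)" "dist b q < r i" "is_solution F J y' b"
        "\<And>z. dist z y' < r j \<Longrightarrow> norm (G b z - G b y' - A *v (z - y')) \<le> r k * norm (z - y')"
        unfolding W_iff[OF r r r] by blast
      have eq: "(G b y - G b y' - A *v (y - y')) + (A *v (y - y') - K *v (y - y')) = G b y - G b y' - K *v (y - y')"
        by simp
      have "norm (G b y - G b y' - K *v (y - y'))
          \<le> norm (G b y - G b y' - A *v (y - y')) + norm (A *v (y - y') - K *v (y - y'))"
        by (subst eq[symmetric]) (rule norm_triangle_ineq)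
      also have "\<dots> \<le> r k * norm (y - y') + r k / 2 * norm (y - y')"
        using elim(2) by (intro add_mono b(4) A(2)) (simp add: dist_commute)
      also have "\<dots> = (r k + r k / 2) * norm (y - y')" by (simp add: algebra_simps)
      also have "\<dots> \<le> \<epsilon> * norm (y - y')"
        using k r[of k] e by (intro mult_right_mono) auto
      finally have "norm (G b y - G b y' - K *v (y - y')) \<le> \<epsilon> * norm (y - y')" .
      moreover have "dist b \<beta> < \<rho>"
        using b(2) q(2) i dist_triangle[of b \<beta> q] by (simp add: dist_commute)
      ultimately show ?case using b(1,3) unfolding G_def by blast
    qed
  qed
qed

section \<open>Optimality conditions and Lipschitz continuity\<close>

text \<open>Divide by \<open>t\<close> and let \<open>t\<close> tend to 0 from the right. The term with
  \<open>e\<close> leaves room for the modulus of strong convexity.\<close>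

lemma directional_derivative_le:
  fixes f :: "'a::real_normed_vector \<Rightarrow> real"
  assumes f: "(f has_derivative f') (at x)"
    and le: "\<And>t. 0 < t \<Longrightarrow> t < 1 \<Longrightarrow> f (x + t *\<^sub>R d) - f x \<le> t * (c + t * e)"
  shows "f' d \<le> c"
proof -
  interpret f': bounded_linear f' by (rule has_derivative_bounded_linear[OF f])
  have "((\<lambda>t. x + t *\<^sub>R d) has_derivative (\<lambda>t. t *\<^sub>R d)) (at 0)"
    by (auto intro!: derivative_eq_intros)
  then have "((\<lambda>t. f (x + t *\<^sub>R d)) has_derivative (\<lambda>t. f' (t *\<^sub>R d))) (at 0)"
    by (rule has_derivative_compose) (use f in simp)
  then have "((\<lambda>t. f (x + t *\<^sub>R d)) has_real_derivative f' d) (at 0)"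
    by (simp add: has_field_derivative_def f'.scaleR mult_commute_abs)
  then have "((\<lambda>t. (f (x + t *\<^sub>R d) - f x) / t) \<longlongrightarrow> f' d) (at_right 0)"
    unfolding DERIV_def by (simp add: filterlim_at_split)
  moreover have "((\<lambda>t. c + t * e) \<longlongrightarrow> c) (at_right 0)"
    by (auto intro!: tendsto_eq_intros)
  moreover have "\<forall>\<^sub>F t in at_right 0. (f (x + t *\<^sub>R d) - f x) / t \<le> c + t * e"
    using eventually_at_right_real[of 0 "1 :: real"]
    by (rule eventually_mono) (use le in \<open>auto simp: field_simps\<close>)
  ultimately show ?thesis by (intro tendsto_le[OF trivial_limit_at_right_real])
qed

lemma solution_finite:
  assumes "proper_fun J" "is_solution F J y \<beta>" shows "J \<beta> \<noteq> \<infinity>"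
proof
  assume "J \<beta> = \<infinity>"
  then have "J z = \<infinity>" for z
    using assms(2)[unfolded is_solution_def, rule_format, of z] by simp
  then show False using assms(1) by (simp add: proper_fun_def)
qed

text \<open>Fermat's rule: compare the solution with points of a segment that ends in it. On the segment,
  \<open>J\<close> lies below the chord.\<close>

lemma solution_subgradient:
  fixes F :: "real^'p \<Rightarrow> real^'n \<Rightarrow> real"
  assumes J: "proper_fun J" "convex_fun J" and sol: "is_solution F J y \<beta>"
    and diff: "(\<lambda>b. F b y) differentiable (at \<beta>)"
  shows "- grad (\<lambda>b. F b y) \<beta> \<in> subdiff J \<beta>"
proof -
  obtain s where s: "J \<beta> = ereal s"
    using solution_finite[OF J(1) sol] J(1) by (cases "J \<beta>") (auto simp: proper_fun_def)
  have "J \<beta> + ereal (- grad (\<lambda>b. F b y) \<beta> \<bullet> (z - \<beta>)) \<le> J z" for z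
  proof (cases "J z")
    case (real r)
    have "- ((z - \<beta>) \<bullet> grad (\<lambda>b. F b y) \<beta>) \<le> r - s"
    proof (rule directional_derivative_le[where e = 0 and d = "z - \<beta>" and f = "\<lambda>b. - F b y"
          and f' = "\<lambda>h. - (h \<bullet> grad (\<lambda>b. F b y) \<beta>)"])
      show "((\<lambda>b. - F b y) has_derivative (\<lambda>h. - (h \<bullet> grad (\<lambda>b. F b y) \<beta>))) (at \<beta>)"
        by (rule has_derivative_minus[OF differentiable_has_derivative_grad[OF diff]])
      fix t :: real assume t: "0 < t" "t < 1"
      have eq: "(1 - t) *\<^sub>R \<beta> + t *\<^sub>R z = \<beta> + t *\<^sub>R (z - \<beta>)" by (simp add: algebra_simps)
      have "J ((1 - t) *\<^sub>R \<beta> + t *\<^sub>R z) \<le> ereal (1 - t) * J \<beta> + ereal t * J z"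
        using J(2) t unfolding convex_fun_def by simp
      then have "J (\<beta> + t *\<^sub>R (z - \<beta>)) \<le> ereal ((1 - t) * s + t * r)" by (simp only: eq) (simp add: s real)
      moreover have "ereal (F \<beta> y) + J \<beta> \<le> ereal (F (\<beta> + t *\<^sub>R (z - \<beta>)) y) + J (\<beta> + t *\<^sub>R (z - \<beta>))"
        using sol unfolding is_solution_def by blast
      ultimately have "F \<beta> y + s \<le> F (\<beta> + t *\<^sub>R (z - \<beta>)) y + ((1 - t) * s + t * r)"
        using s by (cases "J (\<beta> + t *\<^sub>R (z - \<beta>))") auto
      then show "- F (\<beta> + t *\<^sub>R (z - \<beta>)) y - - F \<beta> y \<le> t * (r - s + t * 0)"
        by (simp add: algebra_simps)
    qed
    then show ?thesis by (simp add: s real inner_commute)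
  qed (use J(1) in \<open>auto simp: proper_fun_def\<close>)
  then show ?thesis unfolding subdiff_def by blast
qed

text \<open>The sum of the two first-order inequalities of a strongly convex function, at \<open>x\<close>
  and at \<open>y\<close>.\<close>

lemma strongly_convex_monotone:
  fixes f :: "real^'n \<Rightarrow> real"
  assumes f: "strongly_convex \<tau> f" and d: "\<And>x. f differentiable (at x)"
  shows "\<tau> * (norm (x - y))\<^sup>2 \<le> (grad f x - grad f y) \<bullet> (x - y)"
proof -
  have *: "(x - y) \<bullet> grad f y \<le> f x - f y - \<tau> / 2 * (norm (x - y))\<^sup>2" for x y
  proof (rule directional_derivative_le[OF differentiable_has_derivative_grad[OF d]])
    fix t :: real assume "0 < t" "t < 1"
    then have "f (t *\<^sub>R x + (1 - t) *\<^sub>R y) \<le> t * f x + (1 - t) * f y - \<tau> / 2 * t * (1 - t) * (norm (x - y))\<^sup>2"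
      using f unfolding strongly_convex_def by simp
    moreover have "t *\<^sub>R x + (1 - t) *\<^sub>R y = y + t *\<^sub>R (x - y)" by (simp add: algebra_simps)
    ultimately show "f (y + t *\<^sub>R (x - y)) - f y
        \<le> t * (f x - f y - \<tau> / 2 * (norm (x - y))\<^sup>2 + t * (\<tau> / 2 * (norm (x - y))\<^sup>2))"
      by (simp add: algebra_simps add_divide_distrib diff_divide_distrib)
  qed
  show ?thesis using *[of x y] *[of y x]
    by (simp add: inner_diff_left inner_diff_right inner_commute norm_minus_commute)
qed

lemma cond_L_lipschitz:
  assumes "\<And>y. (\<lambda>z. grad (\<lambda>a. F0 a z) m) differentiable (at y)"
    and "\<And>y. onorm ((*v) (jacobian (\<lambda>z. grad (\<lambda>a. F0 a z) m) (at y))) \<le> L"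
  shows "norm (grad (\<lambda>a. F0 a y) m - grad (\<lambda>a. F0 a z) m) \<le> L * norm (y - z)"
proof (rule differentiable_bound[of UNIV "\<lambda>z. grad (\<lambda>a. F0 a z) m"
      "\<lambda>y h. jacobian (\<lambda>z. grad (\<lambda>a. F0 a z) m) (at y) *v h"])
  show "((\<lambda>z. grad (\<lambda>a. F0 a z) m) has_derivative (*v) (jacobian (\<lambda>z. grad (\<lambda>a. F0 a z) m) (at x))) (at x within UNIV)"
    for x using assms(1)[of x] by (simp add: jacobian_works)
qed (use assms(2) in auto)

text \<open>Subdifferentials are monotone. So, for solutions \<open>b\<close> and \<open>c\<close> for the
  data \<open>y\<close> and \<open>z\<close>, the difference of the gradients of the loss, each taken at its
  own data, has nonpositive product with \<open>X *v b - X *v c\<close>. Strong convexity bounds that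
  product from below at equal data, and the change of data costs the Lipschitz constant of the gradient. For
  \<open>y = z\<close> this shows that the prediction does not depend on the solution.\<close>

theorem prediction_lipschitz:
  fixes X :: "real^'p^'n"
  assumes J: "proper_fun J" "convex_fun J"
    and F: "\<And>\<beta> y. F \<beta> y = F0 (X *v \<beta>) y"
    and C: "cond_sconv F0" "twice_differentiable_fst F0" "cond_L F0"
  obtains L where "L > 0" "\<And>y z b c. is_solution F J y b \<Longrightarrow> is_solution F J z c \<Longrightarrow>
    norm (X *v b - X *v c) \<le> L * norm (y - z)"
proof -
  obtain \<tau> where \<tau>: "\<tau> > 0" "\<And>y. strongly_convex \<tau> (\<lambda>m. F0 m y)"
    using C(1) unfolding cond_sconv_def by blast
  obtain L where L: "L > 0" "\<And>m y. (\<lambda>z. grad (\<lambda>a. F0 a z) m) differentiable (at y)"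
    "\<And>m y. onorm ((*v) (jacobian (\<lambda>z. grad (\<lambda>a. F0 a z) m) (at y))) \<le> L"
    using C(3) unfolding cond_L_def by blast
  define G where "G m y = grad (\<lambda>a. F0 a y) m" for m y
  have d0: "(\<lambda>a. F0 a y) differentiable (at m)" for m y
    using C(2) unfolding twice_differentiable_fst_def by blast
  have Feq: "(\<lambda>b. F b y) = (\<lambda>b. F0 (X *v b) y)" for y by (simp add: F)
  have dF: "(\<lambda>b. F b y) differentiable (at b)" for b y
    unfolding Feq
    using differentiable_compose[OF d0 linear_imp_differentiable[OF matrix_vector_mul_linear]] .
  have gF: "grad (\<lambda>b. F b y) b = transpose X *v G (X *v b) y" for b y
    unfolding Feq G_def by (rule grad_compose_matrix[OF d0])
  have lip: "norm (X *v b - X *v c) \<le> L / \<tau> * norm (y - z)"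
    if b: "is_solution F J y b" and c: "is_solution F J z c" for y z b c
  proof -
    let ?\<mu> = "X *v b" and ?\<nu> = "X *v c"
    let ?d = "?\<mu> - ?\<nu>"
    have sub: "- (transpose X *v G ?\<mu> y) \<in> subdiff J b" "- (transpose X *v G ?\<nu> z) \<in> subdiff J c"
      using solution_subgradient[OF J b dF] solution_subgradient[OF J c dF] by (simp_all add: gF)
    obtain s where s: "J b = ereal s"
      using solution_finite[OF J(1) b] J(1) by (cases "J b") (auto simp: proper_fun_def)
    obtain r where r: "J c = ereal r"
      using solution_finite[OF J(1) c] J(1) by (cases "J c") (auto simp: proper_fun_def)
    have e: "(transpose X *v u) \<bullet> (v - w) = u \<bullet> (X *v v - X *v w)" for u v w
      by (simp add: dot_lmul_matrix matrix_vector_mult_diff_distrib)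
    have "s - (transpose X *v G ?\<mu> y) \<bullet> (c - b) \<le> r"
      using sub(1) unfolding subdiff_def by (auto simp: s r dest!: spec[of _ c])
    moreover have "r - (transpose X *v G ?\<nu> z) \<bullet> (b - c) \<le> s"
      using sub(2) unfolding subdiff_def by (auto simp: s r dest!: spec[of _ b])
    ultimately have mono: "(G ?\<mu> y - G ?\<nu> z) \<bullet> ?d \<le> 0"
      unfolding e by (simp add: inner_diff_left inner_diff_right)
    have "\<tau> * (norm ?d)\<^sup>2 \<le> (G ?\<mu> y - G ?\<nu> y) \<bullet> ?d"
      using strongly_convex_monotone[OF \<tau>(2) d0] unfolding G_def by blast
    also have "\<dots> = (G ?\<mu> y - G ?\<nu> z) \<bullet> ?d + (G ?\<nu> z - G ?\<nu> y) \<bullet> ?d"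
      by (simp add: inner_diff_left)
    also have "\<dots> \<le> norm (G ?\<nu> z - G ?\<nu> y) * norm ?d"
      using mono norm_cauchy_schwarz[of "G ?\<nu> z - G ?\<nu> y" ?d] by linarith
    also have "\<dots> \<le> (L * norm (y - z)) * norm ?d"
      using cond_L_lipschitz[OF L(2,3), of z ?\<nu> y]
      by (intro mult_right_mono) (simp_all add: G_def norm_minus_commute)
    finally have "\<tau> * norm ?d * norm ?d \<le> L * norm (y - z) * norm ?d"
      by (simp add: power2_eq_square)
    then have "\<tau> * norm ?d \<le> L * norm (y - z)"
      using L(1) by (cases "norm ?d = 0") auto
    then show ?thesis using \<tau>(1) by (simp add: field_simps)
  qed
  show thesis by (rule that[OF _ lip]) (use L(1) \<tau>(1) in simp_all)
qed

section \<open>Projectors and pseudo-inverses\<close>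

lemma closest_point_subspaceI:
  fixes E :: "'a::euclidean_space set"
  assumes E: "subspace E" and a: "a \<in> E" and orth: "\<And>e. e \<in> E \<Longrightarrow> (x - a) \<bullet> e = 0"
  shows "closest_point E x = a"
proof (rule closest_point_unique[symmetric, OF subspace_imp_convex[OF E] closed_subspace[OF E] a], rule ballI)
  fix z assume "z \<in> E"
  then have "(x - a) \<bullet> (a - z) = 0" using orth subspace_diff[OF E a] by blast
  then have "(norm (x - z))\<^sup>2 = (norm (x - a))\<^sup>2 + (norm (a - z))\<^sup>2"
    using norm_add_Pythagorean[of "x - a" "a - z"] by (simp add: orthogonal_def)
  then have "(norm (x - a))\<^sup>2 \<le> (norm (x - z))\<^sup>2" by simp
  then show "dist x a \<le> dist x z" unfolding dist_norm by (rule power2_le_imp_le) simp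
qed

lemma closest_point_subspace:
  fixes E :: "'a::euclidean_space set"
  assumes E: "subspace E"
  shows "closest_point E x \<in> E" "e \<in> E \<Longrightarrow> (x - closest_point E x) \<bullet> e = 0"
proof -
  obtain y z where yz: "y \<in> span E" "\<And>w. w \<in> span E \<Longrightarrow> orthogonal z w" "x = y + z"
    by (rule orthogonal_subspace_decomp_exists[of E x]) blast
  have sp: "span E = E" using E by (simp add: span_eq_iff)
  have "closest_point E x = y"
    by (rule closest_point_subspaceI[OF E]) (use yz sp in \<open>auto simp: orthogonal_def\<close>)
  then show "closest_point E x \<in> E" "e \<in> E \<Longrightarrow> (x - closest_point E x) \<bullet> e = 0"
    using yz sp by (auto simp: orthogonal_def)
qed

lemma proj_mult:
  fixes E :: "(real^'p) set"
  assumes E: "subspace E"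
  shows "proj E *v x = closest_point E x"
proof -
  have "linear (closest_point E)"
  proof (rule linearI)
    fix x y :: "real^'p" and c :: real
    note cp = closest_point_subspace[OF E]
    show "closest_point E (x + y) = closest_point E x + closest_point E y"
      using cp(2)[where x = x] cp(2)[where x = y] cp(1)[of x] cp(1)[of y]
      by (intro closest_point_subspaceI[OF E] subspace_add[OF E])
        (auto simp: inner_diff_left inner_add_left)
    show "closest_point E (c *\<^sub>R x) = c *\<^sub>R closest_point E x"
      using cp(2)[where x = x] cp(1)[of x]
      by (intro closest_point_subspaceI[OF E] subspace_scale[OF E]) (auto simp: inner_diff_left)
  qed
  from fun_cong[OF matrix_vector_mul(2)[OF this]] show ?thesis unfolding proj_def .
qed

lemma proj_in: "subspace E \<Longrightarrow> proj E *v x \<in> E"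
  by (simp add: proj_mult closest_point_subspace)

lemma proj_orth: "subspace E \<Longrightarrow> e \<in> E \<Longrightarrow> (proj E *v x) \<bullet> e = x \<bullet> e"
  using closest_point_subspace(2)[of E e x] by (simp add: proj_mult inner_diff_left)

lemma proj_id: "subspace E \<Longrightarrow> e \<in> E \<Longrightarrow> proj E *v e = e"
  by (simp add: proj_mult closest_point_self)

lemma proj_sym: "subspace E \<Longrightarrow> (proj E *v x) \<bullet> y = x \<bullet> (proj E *v y)"
  by (metis inner_commute proj_in proj_orth)

lemma proj_transpose:
  assumes E: "subspace E" shows "transpose (proj E) = proj E"
  unfolding matrix_eq transpose_matrix_vector
proof
  fix x
  have "(x v* proj E) \<bullet> y = (proj E *v x) \<bullet> y" for y
    by (rule trans[OF dot_lmul_matrix proj_sym[OF E, symmetric]])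
  then show "x v* proj E = proj E *v x" by (rule vector_eq_rdot[THEN iffD1, OF allI])
qed

lemma orthogonal_compI: "(\<And>e. e \<in> E \<Longrightarrow> x \<bullet> e = 0) \<Longrightarrow> x \<in> orthogonal_comp E"
  by (simp add: orthogonal_comp_def orthogonal_def inner_commute)

lemma orthogonal_compD: "x \<in> orthogonal_comp E \<Longrightarrow> e \<in> E \<Longrightarrow> x \<bullet> e = 0"
  by (simp add: orthogonal_comp_def orthogonal_def inner_commute)

lemma proj_comp:
  assumes E: "subspace E"
  shows "proj (orthogonal_comp E) *v x = x - proj E *v x"
proof -
  have "closest_point (orthogonal_comp E) x = x - proj E *v x"
  proof (rule closest_point_subspaceI[OF subspace_orthogonal_comp])
    show "x - proj E *v x \<in> orthogonal_comp E"
      by (rule orthogonal_compI) (simp add: inner_diff_left proj_orth[OF E])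
    fix e assume "e \<in> orthogonal_comp E"
    then show "(x - (x - proj E *v x)) \<bullet> e = 0"
      using orthogonal_compD[OF _ proj_in[OF E]] by (simp add: inner_commute)
  qed
  then show ?thesis by (simp add: proj_mult[OF subspace_orthogonal_comp])
qed

lemma subspace_eqI:
  assumes "subspace E" "a \<in> E" "b \<in> E" "\<And>e. e \<in> E \<Longrightarrow> a \<bullet> e = b \<bullet> e"
  shows "a = b"
proof -
  have "a - b \<in> E" using assms by (simp add: subspace_diff)
  then have "(a - b) \<bullet> (a - b) = 0" using assms(4) by (simp add: inner_diff_left)
  then show ?thesis by simp
qed

text \<open>A sum of two multiples of differences is again one, because a convex combination merges the two
  minuends into one point of \<open>C\<close>, and likewise the subtrahends.\<close>

lemma Lin_subspace:
  assumes C: "convex C" and ne: "C \<noteq> {}"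
  shows "subspace (Lin C)"
proof (rule subspaceI)
  obtain c where "c \<in> C" using ne by blast
  then show "0 \<in> Lin C" unfolding Lin_def by (intro CollectI exI[of _ 0] exI[of _ c]) simp
  have pos: "\<exists>t a b. 0 \<le> t \<and> a \<in> C \<and> b \<in> C \<and> x = t *\<^sub>R (a - b)" if x: "x \<in> Lin C" for x
  proof -
    obtain t a b where tab: "a \<in> C" "b \<in> C" "x = t *\<^sub>R (a - b)" using x unfolding Lin_def by auto
    show ?thesis
    proof (cases "0 \<le> t")
      case False
      then have "0 \<le> - t" "x = (- t) *\<^sub>R (b - a)" using tab by (auto simp: algebra_simps)
      then show ?thesis using tab by blast
    qed (use tab in blast)
  qed
  fix x y assume "x \<in> Lin C" "y \<in> Lin C"
  then obtain t a b s c d where x: "0 \<le> t" "a \<in> C" "b \<in> C" "x = t *\<^sub>R (a - b)"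
    and y: "0 \<le> s" "c \<in> C" "d \<in> C" "y = s *\<^sub>R (c - d)" using pos by metis
  show "x + y \<in> Lin C"
  proof (cases "t + s = 0")
    case True
    then have "t = 0" "s = 0" using x y by auto
    then show ?thesis using x y \<open>0 \<in> Lin C\<close> by simp
  next
    case False
    let ?u = "t / (t + s)" and ?v = "s / (t + s)"
    have uv: "0 \<le> ?u" "0 \<le> ?v" "?u + ?v = 1" using x(1) y(1) False by (simp_all add: add_divide_distrib[symmetric])
    have t: "(t + s) * ?u = t" "(t + s) * ?v = s" using False by auto
    have "x + y = (t + s) *\<^sub>R ((?u *\<^sub>R a + ?v *\<^sub>R c) - (?u *\<^sub>R b + ?v *\<^sub>R d))"
      unfolding x(4) y(4) scaleR_diff_right scaleR_add_right scaleR_scaleR t by simp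
    moreover have "?u *\<^sub>R a + ?v *\<^sub>R c \<in> C" "?u *\<^sub>R b + ?v *\<^sub>R d \<in> C"
      using convexD[OF C] x y uv by auto
    ultimately show ?thesis unfolding Lin_def by blast
  qed
next
  fix c x assume "x \<in> Lin C"
  then obtain t a b where "a \<in> C" "b \<in> C" "x = t *\<^sub>R (a - b)" unfolding Lin_def by auto
  then show "c *\<^sub>R x \<in> Lin C" unfolding Lin_def by (intro CollectI exI[of _ "c * t"]) auto
qed

text \<open>Uniqueness of the Moore--Penrose inverse.\<close>

lemma pinv_eqI:
  fixes A :: "real^'n^'m" and B :: "real^'m^'n"
  assumes "A ** B ** A = A" "B ** A ** B = B" "transpose (A ** B) = A ** B" "transpose (B ** A) = B ** A"
  shows "pinv A = B"
  unfolding pinv_def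
proof (rule the_equality)
  show "A ** B ** A = A \<and> B ** A ** B = B \<and> transpose (A ** B) = A ** B \<and> transpose (B ** A) = B ** A"
    using assms by blast
  fix C :: "real^'m^'n"
  assume C: "A ** C ** A = A \<and> C ** A ** C = C \<and> transpose (A ** C) = A ** C \<and> transpose (C ** A) = C ** A"
  have AB: "A ** B = A ** C"
  proof -
    have "A ** B = transpose (A ** B)" using assms by simp
    also have "\<dots> = transpose ((A ** C) ** (A ** B))"
      using C by (simp add: matrix_mul_assoc)
    also have "\<dots> = (A ** B) ** (A ** C)"
      using C assms by (simp add: matrix_transpose_mul)
    also have "\<dots> = A ** C" using assms by (simp add: matrix_mul_assoc)
    finally show ?thesis .
  qed
  have BA: "B ** A = C ** A"
  proof -
    have "B ** A = transpose (B ** A)" using assms by simp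
    also have "\<dots> = transpose ((B ** A) ** (C ** A))"
      using C by (metis matrix_mul_assoc)
    also have "\<dots> = (C ** A) ** (B ** A)"
      using C assms by (simp add: matrix_transpose_mul)
    also have "\<dots> = C ** A" using assms by (metis matrix_mul_assoc)
    finally show ?thesis .
  qed
  have "C = C ** A ** C" using C by simp
  also have "\<dots> = B ** A ** C" using BA by simp
  also have "\<dots> = B ** A ** B" using AB by (metis matrix_mul_assoc)
  also have "\<dots> = B" using assms by simp
  finally show "C = B" .
qed

text \<open>An operator that lives on a subspace and is definite there is invertible on it, and its
  pseudo-inverse is that inverse, extended by zero.\<close>

lemma pinv_definite:
  fixes A :: "real^'p^'p"
  assumes T: "subspace T" and ran: "\<And>x. A *v x \<in> T" and ext: "\<And>x. A *v (proj T *v x) = A *v x"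
    and pos: "\<And>\<xi>. \<xi> \<in> T \<Longrightarrow> \<xi> \<noteq> 0 \<Longrightarrow> (A *v \<xi>) \<bullet> \<xi> > 0"
  shows "pinv A ** A = proj T" "A ** pinv A = proj T" "pinv A ** proj T = pinv A" "proj T ** pinv A = pinv A"
proof -
  \<comment> \<open>Completed by the identity on the normal space, the operator becomes invertible.\<close>
  define C where "C = A + proj (orthogonal_comp T)"
  note Q = proj_comp[OF T]
  have Cx: "C *v x = A *v x + (x - proj T *v x)" for x
    by (simp add: C_def matrix_vector_mult_add_rdistrib Q)
  have PA: "proj T *v (A *v x) = A *v x" for x by (rule proj_id[OF T ran])
  have PP: "proj T *v (proj T *v x) = proj T *v x" for x by (rule proj_id[OF T proj_in[OF T]])
  have PC: "proj T *v (C *v x) = A *v x" for x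
    by (simp add: Cx matrix_vector_right_distrib matrix_vector_mult_diff_distrib PA PP)
  have "x = 0" if "C *v x = 0" for x
  proof -
    have A0: "A *v x = 0" using PC[of x] that by simp
    then have x: "x = proj T *v x" using Cx[of x] that by simp
    have "(A *v x) \<bullet> x > 0" if "x \<noteq> 0" using pos[of x] that x proj_in[OF T, of x] by simp
    then show "x = 0" using A0 by auto
  qed
  then have "inj ((*v) C)"
    using linear_injective_0[OF matrix_vector_mul_linear, of C] by blast
  then obtain D where D: "D ** C = mat 1" using matrix_left_invertible_injective by blast
  then have D': "C ** D = mat 1" by (rule matrix_left_right_inverse[THEN iffD1])
  have DC: "D *v (C *v x) = x" "C *v (D *v x) = x" for x
    using D D' by (simp_all add: matrix_vector_mul_assoc)
  have CP: "C *v (proj T *v x) = A *v x" for x by (simp add: Cx ext PP)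
  define B where "B = proj T ** D ** proj T"
  have Bx: "B *v x = proj T *v (D *v (proj T *v x))" for x
    by (simp only: B_def matrix_vector_mul_assoc matrix_mul_assoc)
  have BA: "B ** A = proj T"
    unfolding matrix_eq matrix_vector_mul_assoc[symmetric] Bx
  proof
    fix x
    have "D *v (A *v x) = proj T *v x" using DC(1)[of "proj T *v x"] by (simp add: CP)
    then show "proj T *v (D *v (proj T *v (A *v x))) = proj T *v x" by (simp add: PA PP)
  qed
  have AB: "A ** B = proj T"
    unfolding matrix_eq matrix_vector_mul_assoc[symmetric] Bx ext
  proof
    fix x show "A *v (D *v (proj T *v x)) = proj T *v x"
      using PC[of "D *v (proj T *v x)"] by (simp add: DC PP)
  qed
  have PB: "proj T ** B = B" unfolding matrix_eq matrix_vector_mul_assoc[symmetric] Bx by (simp add: PP)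
  have BP: "B ** proj T = B" unfolding matrix_eq matrix_vector_mul_assoc[symmetric] Bx by (simp add: PP)
  have PA': "proj T ** A = A" unfolding matrix_eq matrix_vector_mul_assoc[symmetric] by (simp add: PA)
  have "pinv A = B"
    by (rule pinv_eqI) (simp_all add: AB BA PA' PB proj_transpose[OF T])
  then show "pinv A ** A = proj T" "A ** pinv A = proj T" "pinv A ** proj T = pinv A" "proj T ** pinv A = pinv A"
    using AB BA PB BP by auto
qed

section \<open>Charts of a submanifold\<close>

lemma normal_extension_differentiable:
  assumes "normal_extension M \<beta> v W" shows "W differentiable (at \<beta>)"
  using assms unfolding normal_extension_def by auto

text \<open>A chart \<open>\<Psi>\<close> with inverse \<open>\<Phi>\<close> straightens the submanifold to
  a piece of the subspace \<open>E\<close>. Tangent vectors are the images of \<open>E\<close> under the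
  derivative of \<open>\<Phi>\<close>, and curvature is expressed by its second derivative.\<close>

locale C2_chart =
  fixes M :: "(real^'p) set" and \<beta> :: "real^'p" and U V :: "(real^'p) set"
    and \<Psi> \<Phi> :: "real^'p \<Rightarrow> real^'p" and E :: "(real^'p) set"
  assumes U: "open U" "\<beta> \<in> U" and V: "open V" and E: "subspace E"
    and hom: "homeomorphism U V \<Psi> \<Phi>" and Ck: "Ck_on 2 \<Psi> U" "Ck_on 2 \<Phi> V"
    and image: "\<Psi> ` (U \<inter> M) = V \<inter> E" and \<beta>M: "\<beta> \<in> M"
begin

abbreviation "z\<^sub>0 \<equiv> \<Psi> \<beta>"
abbreviation "D\<Phi> z \<equiv> frechet_derivative \<Phi> (at z)"
abbreviation "D\<Psi> x \<equiv> frechet_derivative \<Psi> (at x)"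
definition "D2\<Phi> e' e = frechet_derivative (\<lambda>z. D\<Phi> z e) (at z\<^sub>0) e'"

lemma inv1: "x \<in> U \<Longrightarrow> \<Phi> (\<Psi> x) = x" and inv2: "z \<in> V \<Longrightarrow> \<Psi> (\<Phi> z) = z"
  and \<Psi>V: "x \<in> U \<Longrightarrow> \<Psi> x \<in> V" and \<Phi>U: "z \<in> V \<Longrightarrow> \<Phi> z \<in> U"
  using hom unfolding homeomorphism_def by blast+

lemma \<Phi>M: "z \<in> V \<Longrightarrow> z \<in> E \<Longrightarrow> \<Phi> z \<in> M"
proof -
  assume z: "z \<in> V" "z \<in> E"
  then have "z \<in> \<Psi> ` (U \<inter> M)" using image by blast
  then obtain x where "x \<in> U" "x \<in> M" "z = \<Psi> x" by blast
  then show ?thesis using inv1 by simp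
qed

lemma \<Psi>E: "x \<in> U \<Longrightarrow> x \<in> M \<Longrightarrow> \<Psi> x \<in> E"
  using image by blast

lemma z\<^sub>0: "z\<^sub>0 \<in> V" "z\<^sub>0 \<in> E" "\<Phi> z\<^sub>0 = \<beta>"
  using U \<beta>M \<Psi>V \<Psi>E inv1 by auto

lemma has_D\<Phi>: "z \<in> V \<Longrightarrow> (\<Phi> has_derivative D\<Phi> z) (at z)"
  using Ck2_differentiable[OF Ck(2)] frechet_derivative_works by blast

lemma has_D\<Psi>: "x \<in> U \<Longrightarrow> (\<Psi> has_derivative D\<Psi> x) (at x)"
  using Ck2_differentiable[OF Ck(1)] frechet_derivative_works by blast

lemma D\<Phi>_bl: "z \<in> V \<Longrightarrow> bounded_linear (D\<Phi> z)"
  using has_D\<Phi> has_derivative_bounded_linear by blast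

lemma D\<Psi>_bl: "x \<in> U \<Longrightarrow> bounded_linear (D\<Psi> x)"
  using has_D\<Psi> has_derivative_bounded_linear by blast

lemma D\<Phi>_differentiable: "z \<in> V \<Longrightarrow> (\<lambda>z. D\<Phi> z e) differentiable (at z)"
proof -
  assume z: "z \<in> V"
  have "(\<lambda>z. \<Sum>b\<in>Basis. (e \<bullet> b) *\<^sub>R D\<Phi> z b) differentiable (at z)"
    using Ck2_partial_differentiable[OF Ck(2) z]
    by (intro differentiable_sum ballI finite_Basis differentiable_scaleR) auto
  then obtain D where D: "((\<lambda>z. \<Sum>b\<in>Basis. (e \<bullet> b) *\<^sub>R D\<Phi> z b) has_derivative D) (at z)"
    unfolding differentiable_def by blast
  have "((\<lambda>z. D\<Phi> z e) has_derivative D) (at z)"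
  proof (rule has_derivative_transform_within_open[OF D V z])
    fix z assume "z \<in> V"
    then interpret bounded_linear "D\<Phi> z" by (rule D\<Phi>_bl)
    have "D\<Phi> z (\<Sum>b\<in>Basis. (e \<bullet> b) *\<^sub>R b) = (\<Sum>b\<in>Basis. (e \<bullet> b) *\<^sub>R D\<Phi> z b)"
      by (simp add: sum scaleR)
    then show "(\<Sum>b\<in>Basis. (e \<bullet> b) *\<^sub>R D\<Phi> z b) = D\<Phi> z e" by (simp add: euclidean_representation)
  qed
  then show ?thesis unfolding differentiable_def by blast
qed

lemma has_D2\<Phi>: "((\<lambda>z. D\<Phi> z e) has_derivative (\<lambda>e'. D2\<Phi> e' e)) (at z\<^sub>0)"
  unfolding D2\<Phi>_def using D\<Phi>_differentiable[OF z\<^sub>0(1)] frechet_derivative_works by blast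

lemma D\<Phi>_D\<Psi>: "z \<in> V \<Longrightarrow> D\<Phi> z (D\<Psi> (\<Phi> z) v) = v"
proof -
  assume z: "z \<in> V"
  have "((\<lambda>x. \<Phi> (\<Psi> x)) has_derivative (\<lambda>v. D\<Phi> z (D\<Psi> (\<Phi> z) v))) (at (\<Phi> z))"
    by (rule has_derivative_compose[OF has_D\<Psi>[OF \<Phi>U[OF z]]]) (use has_D\<Phi>[OF z] in \<open>simp add: inv2[OF z]\<close>)
  then have "((\<lambda>x. x) has_derivative (\<lambda>v. D\<Phi> z (D\<Psi> (\<Phi> z) v))) (at (\<Phi> z))"
    by (rule has_derivative_transform_within_open[OF _ U(1) \<Phi>U[OF z]]) (rule inv1)
  from has_derivative_unique[OF this has_derivative_ident] show ?thesis by metis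
qed

lemma D\<Psi>_D\<Phi>: "z \<in> V \<Longrightarrow> D\<Psi> (\<Phi> z) (D\<Phi> z w) = w"
proof -
  assume z: "z \<in> V"
  have "((\<lambda>x. \<Psi> (\<Phi> x)) has_derivative (\<lambda>v. D\<Psi> (\<Phi> z) (D\<Phi> z v))) (at z)"
    by (rule has_derivative_compose[OF has_D\<Phi>[OF z] has_D\<Psi>[OF \<Phi>U[OF z]]])
  then have "((\<lambda>x. x) has_derivative (\<lambda>v. D\<Psi> (\<Phi> z) (D\<Phi> z v))) (at z)"
    by (rule has_derivative_transform_within_open[OF _ V z]) (rule inv2)
  from has_derivative_unique[OF this has_derivative_ident] show ?thesis by metis
qed

text \<open>Curves in the submanifold are obtained as images of straight segments in the directions of \<open>E\<close>; derivatives
  along the submanifold are computed along them.\<close>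

lemma segment_V: "z \<in> V \<Longrightarrow> \<forall>\<^sub>F t in nhds (0::real). z + t *\<^sub>R e \<in> V"
proof -
  assume "z \<in> V"
  moreover have "((\<lambda>t. z + t *\<^sub>R e) \<longlongrightarrow> z + 0 *\<^sub>R e) (nhds (0::real))"
    by (intro tendsto_intros) (simp add: filterlim_ident)
  ultimately show ?thesis using V topological_tendstoD by fastforce
qed

lemma segment_E: "z \<in> E \<Longrightarrow> e \<in> E \<Longrightarrow> z + t *\<^sub>R e \<in> E"
  by (intro subspace_add[OF E] subspace_scale[OF E])

lemma segment_derivative: "((\<lambda>t. z + t *\<^sub>R e) has_vector_derivative e) (at (0::real))"
  by (auto intro!: derivative_eq_intros)

lemma segment_\<Phi>: "z \<in> V \<Longrightarrow> ((\<lambda>t. \<Phi> (z + t *\<^sub>R e)) has_vector_derivative D\<Phi> z e) (at (0::real))"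
proof -
  assume z: "z \<in> V"
  interpret bounded_linear "D\<Phi> z" by (rule D\<Phi>_bl[OF z])
  have "((\<lambda>t. \<Phi> (z + t *\<^sub>R e)) has_derivative (\<lambda>t. D\<Phi> z (t *\<^sub>R e))) (at 0)"
    by (rule has_derivative_compose[OF segment_derivative[unfolded has_vector_derivative_def]])
      (use has_D\<Phi>[OF z] in simp)
  then show ?thesis by (simp add: has_vector_derivative_def scaleR)
qed

lemma image_tangent: "z \<in> V \<Longrightarrow> z \<in> E \<Longrightarrow> e \<in> E \<Longrightarrow> D\<Phi> z e \<in> tangent_space M (\<Phi> z)"
  unfolding tangent_space_def
proof (intro CollectI exI[of _ "\<lambda>t. \<Phi> (z + t *\<^sub>R e)"] conjI)
  assume z: "z \<in> V" "z \<in> E" "e \<in> E"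
  show "\<forall>\<^sub>F t in nhds 0. \<Phi> (z + t *\<^sub>R e) \<in> M"
    using segment_V[OF z(1)] by (rule eventually_mono) (use \<Phi>M segment_E z in blast)
  show "((\<lambda>t. \<Phi> (z + t *\<^sub>R e)) has_vector_derivative D\<Phi> z e) (at 0)" by (rule segment_\<Phi>[OF z(1)])
qed simp

text \<open>In the chart, difference quotients of a curve in the submanifold stay in \<open>E\<close>, which
  is closed.\<close>

lemma tangent_D\<Psi>: "x \<in> U \<Longrightarrow> v \<in> tangent_space M x \<Longrightarrow> D\<Psi> x v \<in> E"
proof -
  assume x: "x \<in> U" and v: "v \<in> tangent_space M x"
  obtain \<gamma> where \<gamma>: "\<gamma> 0 = x" "\<forall>\<^sub>F t in nhds 0. \<gamma> t \<in> M" "(\<gamma> has_vector_derivative v) (at (0::real))"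
    using v unfolding tangent_space_def by blast
  interpret bounded_linear "D\<Psi> x" by (rule D\<Psi>_bl[OF x])
  have "(\<gamma> \<longlongrightarrow> x) (at 0)"
    using has_vector_derivative_continuous[OF \<gamma>(3)] \<gamma>(1) by (simp add: isCont_def)
  then have "\<forall>\<^sub>F t in at 0. \<gamma> t \<in> U" by (rule topological_tendstoD) (use U x in auto)
  moreover have "\<forall>\<^sub>F t in at 0. \<gamma> t \<in> M" using \<gamma>(2) by (simp add: eventually_nhds_conv_at)
  ultimately have U': "\<forall>\<^sub>F t in at 0. \<Psi> (\<gamma> t) \<in> E" by eventually_elim (rule \<Psi>E)
  have xM: "x \<in> M" using \<gamma>(1,2) eventually_nhds_x_imp_x by blast
  have "((\<lambda>t. \<Psi> (\<gamma> t)) has_derivative (\<lambda>t. D\<Psi> x (t *\<^sub>R v))) (at 0)"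
    by (rule has_derivative_compose[OF \<gamma>(3)[unfolded has_vector_derivative_def]])
      (use has_D\<Psi>[OF x] \<gamma>(1) in simp)
  then have "((\<lambda>t. norm (\<Psi> (\<gamma> t) - \<Psi> x - t *\<^sub>R D\<Psi> x v) / norm t) \<longlongrightarrow> 0) (at 0)"
    unfolding has_derivative_at by (simp add: \<gamma>(1) scaleR)
  moreover have "\<forall>\<^sub>F t in at 0. norm (\<Psi> (\<gamma> t) - \<Psi> x - t *\<^sub>R D\<Psi> x v) / norm t
      = norm ((\<Psi> (\<gamma> t) - \<Psi> x) /\<^sub>R t - D\<Psi> x v)"
    unfolding eventually_at_filter
  proof (intro always_eventually allI impI)
    fix t :: real assume "t \<noteq> 0"
    then have "(\<Psi> (\<gamma> t) - \<Psi> x) /\<^sub>R t - D\<Psi> x v = (\<Psi> (\<gamma> t) - \<Psi> x - t *\<^sub>R D\<Psi> x v) /\<^sub>R t"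
      by (simp add: scaleR_diff_right)
    then show "norm (\<Psi> (\<gamma> t) - \<Psi> x - t *\<^sub>R D\<Psi> x v) / norm t = norm ((\<Psi> (\<gamma> t) - \<Psi> x) /\<^sub>R t - D\<Psi> x v)"
      by (simp add: divide_inverse mult.commute)
  qed
  ultimately have "((\<lambda>t. norm ((\<Psi> (\<gamma> t) - \<Psi> x) /\<^sub>R t - D\<Psi> x v)) \<longlongrightarrow> 0) (at 0)"
    by (rule Lim_transform_eventually)
  then have "((\<lambda>t. (\<Psi> (\<gamma> t) - \<Psi> x) /\<^sub>R t) \<longlongrightarrow> D\<Psi> x v) (at 0)"
    by (simp add: tendsto_norm_zero_iff LIM_zero_iff)
  moreover have "\<forall>\<^sub>F t in at 0. (\<Psi> (\<gamma> t) - \<Psi> x) /\<^sub>R t \<in> E"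
    using U' by (rule eventually_mono)
      (intro subspace_scale[OF E] subspace_diff[OF E] \<Psi>E[OF x xM])
  ultimately show ?thesis
    by (intro Lim_in_closed_set[OF closed_subspace[OF E], where F = "at (0::real)"
          and f = "\<lambda>t. (\<Psi> (\<gamma> t) - \<Psi> x) /\<^sub>R t"]) auto
qed

lemma tangent_eq: "tangent_space M \<beta> = D\<Phi> z\<^sub>0 ` E"
proof
  show "D\<Phi> z\<^sub>0 ` E \<subseteq> tangent_space M \<beta>"
    using image_tangent[OF z\<^sub>0(1,2)] z\<^sub>0(3) by auto
  show "tangent_space M \<beta> \<subseteq> D\<Phi> z\<^sub>0 ` E"
  proof
    fix v assume "v \<in> tangent_space M \<beta>"
    then have "D\<Psi> \<beta> v \<in> E" by (rule tangent_D\<Psi>[OF U(2)])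
    moreover have "v = D\<Phi> z\<^sub>0 (D\<Psi> \<beta> v)" using D\<Phi>_D\<Psi>[OF z\<^sub>0(1)] z\<^sub>0(3) by simp
    ultimately show "v \<in> D\<Phi> z\<^sub>0 ` E" by blast
  qed
qed

abbreviation "T \<equiv> tangent_space M \<beta>"

lemma T: "subspace T"
  unfolding tangent_eq using linear_subspace_image[OF bounded_linear.linear[OF D\<Phi>_bl[OF z\<^sub>0(1)]] E] .

lemma D\<Phi>_T: "e \<in> E \<Longrightarrow> D\<Phi> z\<^sub>0 e \<in> T" by (auto simp: tangent_eq)

lemma T_cases:
  assumes "\<xi> \<in> T" obtains e where "e \<in> E" "\<xi> = D\<Phi> z\<^sub>0 e"
  using assms by (auto simp: tangent_eq)

text \<open>The product rule for the pairing of a vector field with the coordinate field \<open>D\<Phi> z e\<close>.\<close>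

lemma pairing_derivative:
  assumes W: "(W has_derivative W') (at \<beta>)"
  shows "((\<lambda>t. W (\<Phi> (z\<^sub>0 + t *\<^sub>R e')) \<bullet> D\<Phi> (z\<^sub>0 + t *\<^sub>R e') e)
     has_real_derivative (W' (D\<Phi> z\<^sub>0 e') \<bullet> D\<Phi> z\<^sub>0 e + W \<beta> \<bullet> D2\<Phi> e' e)) (at 0)"
proof -
  interpret W': bounded_linear W' by (rule has_derivative_bounded_linear[OF W])
  have "((\<lambda>t. W (\<Phi> (z\<^sub>0 + t *\<^sub>R e'))) has_derivative (\<lambda>t. W' (t *\<^sub>R D\<Phi> z\<^sub>0 e'))) (at 0)"
    by (rule has_derivative_compose[OF segment_\<Phi>[OF z\<^sub>0(1), unfolded has_vector_derivative_def]])
      (use W z\<^sub>0(3) in simp)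
  then have 1: "((\<lambda>t. W (\<Phi> (z\<^sub>0 + t *\<^sub>R e'))) has_derivative (\<lambda>t. t *\<^sub>R W' (D\<Phi> z\<^sub>0 e'))) (at 0)"
    by (simp add: W'.scaleR)
  interpret D2: bounded_linear "\<lambda>e'. D2\<Phi> e' e" by (rule has_derivative_bounded_linear[OF has_D2\<Phi>])
  have "((\<lambda>t. D\<Phi> (z\<^sub>0 + t *\<^sub>R e') e) has_derivative (\<lambda>t. D2\<Phi> (t *\<^sub>R e') e)) (at 0)"
    by (rule has_derivative_compose[OF segment_derivative[unfolded has_vector_derivative_def]])
      (use has_D2\<Phi> in simp)
  then have 2: "((\<lambda>t. D\<Phi> (z\<^sub>0 + t *\<^sub>R e') e) has_derivative (\<lambda>t. t *\<^sub>R D2\<Phi> e' e)) (at 0)"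
    by (simp add: D2.scaleR)
  show ?thesis
    unfolding has_field_derivative_def
    by (rule has_derivative_eq_rhs[OF has_derivative_inner[OF 1 2]])
      (simp add: z\<^sub>0(3) fun_eq_iff algebra_simps)
qed

text \<open>The pairing of a normal field with the tangent field \<open>D\<Phi> z e\<close> vanishes along
  the submanifold; the product rule gives the claim. In particular, the tangential part of the derivative
  depends on the value \<open>v\<close> alone.\<close>

lemma normal_extension_derivative:
  assumes W: "normal_extension M \<beta> v W" and e: "e \<in> E" "e' \<in> E"
  shows "frechet_derivative W (at \<beta>) (D\<Phi> z\<^sub>0 e') \<bullet> D\<Phi> z\<^sub>0 e = - (v \<bullet> D2\<Phi> e' e)"
proof -
  obtain G where G: "W \<beta> = v" "open G" "\<beta> \<in> G" "\<forall>x\<in>M \<inter> G. W x \<in> orthogonal_comp (tangent_space M x)"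
    using W unfolding normal_extension_def by blast
  have W': "(W has_derivative frechet_derivative W (at \<beta>)) (at \<beta>)"
    using normal_extension_differentiable[OF W] frechet_derivative_works by blast
  let ?k = "\<lambda>t. W (\<Phi> (z\<^sub>0 + t *\<^sub>R e')) \<bullet> D\<Phi> (z\<^sub>0 + t *\<^sub>R e') e"
  have "(((\<lambda>t. \<Phi> (z\<^sub>0 + t *\<^sub>R e'))) \<longlongrightarrow> \<beta>) (nhds 0)"
    using has_vector_derivative_continuous[OF segment_\<Phi>[OF z\<^sub>0(1), of e']] z\<^sub>0(3)
      tendsto_at_iff_tendsto_nhds[of "\<lambda>t. \<Phi> (z\<^sub>0 + t *\<^sub>R e')" 0]
    by (simp add: isCont_def)
  then have "\<forall>\<^sub>F t in nhds 0. \<Phi> (z\<^sub>0 + t *\<^sub>R e') \<in> G"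
    using G(2,3) topological_tendstoD by blast
  then have "\<forall>\<^sub>F t in nhds 0. ?k t = 0"
    using segment_V[OF z\<^sub>0(1), of e']
  proof eventually_elim
    case (elim t)
    have "z\<^sub>0 + t *\<^sub>R e' \<in> E" using segment_E z\<^sub>0 e by blast
    then have "\<Phi> (z\<^sub>0 + t *\<^sub>R e') \<in> M" "D\<Phi> (z\<^sub>0 + t *\<^sub>R e') e \<in> tangent_space M (\<Phi> (z\<^sub>0 + t *\<^sub>R e'))"
      using elim e \<Phi>M image_tangent by auto
    then show ?case using G(4) elim(1) orthogonal_compD by blast
  qed
  then have "(?k has_real_derivative 0) (at 0)"
    using DERIV_cong_ev[of 0 0 ?k "\<lambda>_. 0" 0 0] by simp
  from DERIV_unique[OF this pairing_derivative[OF W']] show ?thesis using G(1) by simp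
qed

text \<open>The covector \<open>w \<mapsto> a \<bullet> D\<Psi> x w\<close> equals the product with
  \<open>v\<close> at \<open>\<beta>\<close> and vanishes on tangent vectors, because \<open>a\<close> is
  orthogonal to \<open>E\<close>. The field is \<open>C\<^sup>1\<close> because \<open>\<Psi>\<close> is
  \<open>C\<^sup>2\<close>.\<close>

lemma normal_extension_exists:
  assumes v: "v \<in> orthogonal_comp T"
  obtains W where "normal_extension M \<beta> v W"
proof -
  define a where "a = (\<Sum>b\<in>Basis. (v \<bullet> D\<Phi> z\<^sub>0 b) *\<^sub>R b)"
  have a: "a \<bullet> w = v \<bullet> D\<Phi> z\<^sub>0 w" for w
  proof -
    interpret bounded_linear "D\<Phi> z\<^sub>0" by (rule D\<Phi>_bl[OF z\<^sub>0(1)])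
    have "v \<bullet> D\<Phi> z\<^sub>0 (\<Sum>b\<in>Basis. (w \<bullet> b) *\<^sub>R b) = a \<bullet> w"
      by (simp add: sum scaleR a_def inner_sum_left inner_sum_right inner_commute mult.commute)
    then show ?thesis by (simp add: euclidean_representation)
  qed
  define W where "W x = (\<Sum>b\<in>Basis. (a \<bullet> D\<Psi> x b) *\<^sub>R b)" for x
  have Wx: "W x \<bullet> w = a \<bullet> D\<Psi> x w" if x: "x \<in> U" for x w
  proof -
    interpret bounded_linear "D\<Psi> x" by (rule D\<Psi>_bl[OF x])
    have "a \<bullet> D\<Psi> x (\<Sum>b\<in>Basis. (w \<bullet> b) *\<^sub>R b) = W x \<bullet> w"
      by (simp add: sum scaleR W_def inner_sum_left inner_sum_right inner_commute mult.commute)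
    then show ?thesis by (simp add: euclidean_representation)
  qed
  have "normal_extension M \<beta> v W"
    unfolding normal_extension_def
  proof (intro conjI exI[of _ U] U ballI)
    have "W \<beta> \<bullet> w = v \<bullet> w" for w
      using D\<Phi>_D\<Psi>[OF z\<^sub>0(1), of w] by (simp add: Wx[OF U(2)] a z\<^sub>0(3))
    then show "W \<beta> = v" by (metis vector_eq_rdot inner_commute)
    fix x assume x: "x \<in> M \<inter> U"
    show "W x \<in> orthogonal_comp (tangent_space M x)"
    proof (rule orthogonal_compI)
      fix w assume w: "w \<in> tangent_space M x"
      then have "D\<Psi> x w \<in> E" using tangent_D\<Psi> x by blast
      then have "D\<Phi> z\<^sub>0 (D\<Psi> x w) \<in> T" by (rule D\<Phi>_T)
      then show "W x \<bullet> w = 0" using x Wx a orthogonal_compD[OF v] by simp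
    qed
  next
    have part: "(\<lambda>x. D\<Psi> x b) differentiable (at x)"
      and cont: "continuous_on U (\<lambda>x. frechet_derivative (\<lambda>x. D\<Psi> x b) (at x) c)"
      if "x \<in> U" "b \<in> Basis" "c \<in> Basis" for x b c
      using Ck(1) that by (auto simp: eval_nat_numeral)
    have hd: "(W has_derivative (\<lambda>h. \<Sum>b\<in>Basis. (a \<bullet> frechet_derivative (\<lambda>x. D\<Psi> x b) (at x) h) *\<^sub>R b)) (at x)"
      if x: "x \<in> U" for x
    proof -
      have "((\<lambda>x. D\<Psi> x b) has_derivative frechet_derivative (\<lambda>x. D\<Psi> x b) (at x)) (at x)" if "b \<in> Basis" for b
        using part[OF x that that] frechet_derivative_works by blast
      then have "((\<lambda>x. \<Sum>b\<in>Basis. (a \<bullet> D\<Psi> x b) *\<^sub>R b) has_derivative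
          (\<lambda>h. \<Sum>b\<in>Basis. (a \<bullet> frechet_derivative (\<lambda>x. D\<Psi> x b) (at x) h) *\<^sub>R b)) (at x)"
        by (intro has_derivative_sum has_derivative_scaleR_left has_derivative_inner_right) auto
      then show ?thesis unfolding W_def[abs_def] .
    qed
    have "continuous_on U (\<lambda>x. frechet_derivative W (at x) c)" if c: "c \<in> Basis" for c
    proof -
      have "continuous_on U (\<lambda>x. \<Sum>b\<in>Basis. (a \<bullet> frechet_derivative (\<lambda>x. D\<Psi> x b) (at x) c) *\<^sub>R b)"
        using cont c U(2) by (intro continuous_intros) auto
      then show ?thesis
        by (rule continuous_on_eq) (simp add: frechet_derivative_at[OF hd, symmetric])
    qed
    then show "Ck_on 1 W U"
      using hd by (auto simp: differentiable_def)
  qed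
  then show thesis by (rule that)
qed

lemma weingarten_eq:
  assumes W: "normal_extension M \<beta> v W" and \<xi>: "\<xi> \<in> T"
  shows "weingarten M \<beta> \<xi> v = - (proj T *v frechet_derivative W (at \<beta>) \<xi>)"
  unfolding weingarten_def
proof (rule the_equality)
  show "\<exists>V. normal_extension M \<beta> v V \<and> - (proj T *v frechet_derivative W (at \<beta>) \<xi>) = - (proj T *v frechet_derivative V (at \<beta>) \<xi>)"
    using W by blast
  fix w assume "\<exists>V. normal_extension M \<beta> v V \<and> w = - (proj T *v frechet_derivative V (at \<beta>) \<xi>)"
  then obtain V where V: "normal_extension M \<beta> v V" "w = - (proj T *v frechet_derivative V (at \<beta>) \<xi>)" by blast
  obtain e' where e': "e' \<in> E" "\<xi> = D\<Phi> z\<^sub>0 e'" using T_cases[OF \<xi>] .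
  have "proj T *v frechet_derivative V (at \<beta>) \<xi> = proj T *v frechet_derivative W (at \<beta>) \<xi>"
  proof (rule subspace_eqI[OF T proj_in[OF T] proj_in[OF T]])
    fix \<zeta> assume z: "\<zeta> \<in> T"
    then obtain e where e: "e \<in> E" "\<zeta> = D\<Phi> z\<^sub>0 e" by (rule T_cases)
    show "(proj T *v frechet_derivative V (at \<beta>) \<xi>) \<bullet> \<zeta> = (proj T *v frechet_derivative W (at \<beta>) \<xi>) \<bullet> \<zeta>"
      using normal_extension_derivative[OF W e(1) e'(1)] normal_extension_derivative[OF V(1) e(1) e'(1)]
      by (simp add: proj_orth[OF T z]) (simp add: e e')
  qed
  then show "w = - (proj T *v frechet_derivative W (at \<beta>) \<xi>)" using V(2) by simp
qed

lemma weingarten_in: "\<xi> \<in> T \<Longrightarrow> v \<in> orthogonal_comp T \<Longrightarrow> weingarten M \<beta> \<xi> v \<in> T"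
  using normal_extension_exists weingarten_eq subspace_neg[OF T proj_in[OF T]] by metis

text \<open>The Weingarten map is paired with tangent vectors by the second fundamental form.\<close>

lemma weingarten_inner:
  assumes e: "e \<in> E" "e' \<in> E" and v: "v \<in> orthogonal_comp T"
  shows "weingarten M \<beta> (D\<Phi> z\<^sub>0 e') v \<bullet> D\<Phi> z\<^sub>0 e = v \<bullet> D2\<Phi> e' e"
proof -
  obtain W where W: "normal_extension M \<beta> v W" using normal_extension_exists[OF v] .
  show ?thesis
    using normal_extension_derivative[OF W e]
    by (simp add: weingarten_eq[OF W D\<Phi>_T[OF e(2)]] proj_orth[OF T D\<Phi>_T[OF e(1)]])
qed

lemma weingarten_linear:
  assumes v: "v \<in> orthogonal_comp T"
  shows "linear (\<lambda>\<xi>. weingarten M \<beta> (proj T *v \<xi>) v)"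
proof -
  obtain W where W: "normal_extension M \<beta> v W" using normal_extension_exists[OF v] .
  have bl: "bounded_linear (frechet_derivative W (at \<beta>))"
    using normal_extension_differentiable[OF W] frechet_derivative_works has_derivative_bounded_linear by blast
  have "bounded_linear (\<lambda>\<xi>. - (proj T *v frechet_derivative W (at \<beta>) (proj T *v \<xi>)))"
    by (intro bounded_linear_minus bounded_linear_compose[OF matrix_vector_mul_bounded_linear]
        bounded_linear_compose[OF bl] matrix_vector_mul_bounded_linear)
  then show ?thesis
    unfolding weingarten_eq[OF W proj_in[OF T]] by (rule bounded_linear.linear)
qed

end

section \<open>Riemannian Hessians\<close>

context C2_chart
begin

lemma segment_\<Phi>_tendsto: "z \<in> V \<Longrightarrow> ((\<lambda>t. \<Phi> (z + t *\<^sub>R e)) \<longlongrightarrow> \<Phi> z) (nhds (0::real))"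
  using has_vector_derivative_continuous[OF segment_\<Phi>, of z e]
    tendsto_at_iff_tendsto_nhds[of "\<lambda>t. \<Phi> (z + t *\<^sub>R e)" 0]
  by (simp add: isCont_def)

lemma derivative_along:
  assumes g: "g differentiable (at (\<Phi> z))" and z: "z \<in> V"
  shows "((\<lambda>t. g (\<Phi> (z + t *\<^sub>R e))) has_real_derivative (grad g (\<Phi> z) \<bullet> D\<Phi> z e)) (at 0)"
proof -
  have "((\<lambda>t. g (\<Phi> (z + t *\<^sub>R e))) has_derivative (\<lambda>t. (t *\<^sub>R D\<Phi> z e) \<bullet> grad g (\<Phi> z))) (at 0)"
    by (rule has_derivative_compose[OF segment_\<Phi>[OF z, unfolded has_vector_derivative_def]])
      (use differentiable_has_derivative_grad[OF g] in simp)
  then show ?thesis by (simp add: has_field_derivative_def inner_commute mult_commute_abs)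
qed

lemma second_derivative_along:
  assumes g: "Ck_on 2 g UNIV"
  shows "((\<lambda>t. grad g (\<Phi> (z\<^sub>0 + t *\<^sub>R e')) \<bullet> D\<Phi> (z\<^sub>0 + t *\<^sub>R e') e)
     has_real_derivative ((hess g \<beta> *v D\<Phi> z\<^sub>0 e') \<bullet> D\<Phi> z\<^sub>0 e + grad g \<beta> \<bullet> D2\<Phi> e' e)) (at 0)"
  by (rule pairing_derivative[OF hess_has_derivative[OF Ck2_grad_differentiable[OF g]]])

text \<open>Extensions agree on the submanifold, hence so do their derivatives along it, at all nearby
  points.\<close>

lemma C2_extension_unique:
  assumes "C2_extension M \<beta> f g" "C2_extension M \<beta> f h" and e: "e \<in> E" "e' \<in> E"
  shows "\<forall>\<^sub>F t in nhds 0. grad g (\<Phi> (z\<^sub>0 + t *\<^sub>R e')) \<bullet> D\<Phi> (z\<^sub>0 + t *\<^sub>R e') e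
      = grad h (\<Phi> (z\<^sub>0 + t *\<^sub>R e')) \<bullet> D\<Phi> (z\<^sub>0 + t *\<^sub>R e') e"
proof -
  have "\<forall>\<^sub>F x in nhds \<beta>. x \<in> M \<longrightarrow> g x = h x"
    using assms(1,2) unfolding C2_extension_def by (auto elim: eventually_elim2)
  then obtain G where G: "open G" "\<beta> \<in> G" "\<And>x. x \<in> G \<Longrightarrow> x \<in> M \<Longrightarrow> g x = h x"
    unfolding eventually_nhds by blast
  have d: "g differentiable (at x)" "h differentiable (at x)" for x
    using assms(1,2) Ck2_differentiable unfolding C2_extension_def by blast+
  have "\<forall>\<^sub>F t in nhds 0. \<Phi> (z\<^sub>0 + t *\<^sub>R e') \<in> G"
    using segment_\<Phi>_tendsto[OF z\<^sub>0(1), of e'] G(1,2) z\<^sub>0(3) topological_tendstoD by fastforce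
  then show ?thesis using segment_V[OF z\<^sub>0(1), of e']
  proof eventually_elim
    case (elim t)
    let ?z = "z\<^sub>0 + t *\<^sub>R e'"
    have zE: "?z \<in> E" using segment_E z\<^sub>0 e by blast
    have "\<forall>\<^sub>F s in nhds 0. \<Phi> (?z + s *\<^sub>R e) \<in> G"
      using segment_\<Phi>_tendsto[OF elim(2), of e] G(1) elim(1) topological_tendstoD by fastforce
    then have "\<forall>\<^sub>F s in nhds 0. g (\<Phi> (?z + s *\<^sub>R e)) = h (\<Phi> (?z + s *\<^sub>R e))"
      using segment_V[OF elim(2), of e]
      by eventually_elim (intro G(3) \<Phi>M segment_E zE e)
    then have "((\<lambda>s. g (\<Phi> (?z + s *\<^sub>R e))) has_real_derivative (grad h (\<Phi> ?z) \<bullet> D\<Phi> ?z e)) (at 0)"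
      using derivative_along[OF d(2) elim(2), of e]
        DERIV_cong_ev[of 0 0 "\<lambda>s. g (\<Phi> (?z + s *\<^sub>R e))" "\<lambda>s. h (\<Phi> (?z + s *\<^sub>R e))"] by simp
    then show ?case using DERIV_unique derivative_along[OF d(1) elim(2), of e] by blast
  qed
qed

abbreviation "P \<equiv> proj T"
abbreviation "Q \<equiv> proj (orthogonal_comp T)"

lemma Q_in: "Q *v x \<in> orthogonal_comp T"
  by (rule proj_in[OF subspace_orthogonal_comp])

text \<open>For the gradient part \<open>v\<close> of a function, the right-hand side is the second
  derivative of the function composed with \<open>\<Phi>\<close>.\<close>

lemma hessian_formula_inner:
  assumes e: "e \<in> E" "e' \<in> E" and v: "v \<in> orthogonal_comp T"
  shows "(P *v (A *v (P *v D\<Phi> z\<^sub>0 e')) + weingarten M \<beta> (P *v D\<Phi> z\<^sub>0 e') v) \<bullet> D\<Phi> z\<^sub>0 e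
    = (A *v D\<Phi> z\<^sub>0 e') \<bullet> D\<Phi> z\<^sub>0 e + v \<bullet> D2\<Phi> e' e"
  by (simp add: inner_add_left proj_id[OF T D\<Phi>_T] proj_orth[OF T D\<Phi>_T] weingarten_inner e v)

text \<open>The formula does not depend on the extension: the tangential parts of the gradients agree, and
  in the chart the remaining terms form the derivative of the tangential derivatives, which agree near
  \<open>\<beta>\<close>.\<close>

lemma riem_hess_eq:
  assumes g: "C2_extension M \<beta> f g"
  shows "riem_hess M f \<beta> \<xi> = P *v (hess g \<beta> *v (P *v \<xi>)) + weingarten M \<beta> (P *v \<xi>) (Q *v grad g \<beta>)"
proof -
  let ?w = "\<lambda>g. P *v (hess g \<beta> *v (P *v \<xi>)) + weingarten M \<beta> (P *v \<xi>) (Q *v grad g \<beta>)"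
  have "?w h = ?w g" if h: "C2_extension M \<beta> f h" for h
  proof (rule subspace_eqI[OF T])
    show "?w h \<in> T" "?w g \<in> T"
      by (intro subspace_add[OF T] proj_in[OF T] weingarten_in Q_in)+
    fix \<zeta> assume "\<zeta> \<in> T"
    then obtain e where e: "e \<in> E" "\<zeta> = D\<Phi> z\<^sub>0 e" by (rule T_cases)
    obtain e' where e': "e' \<in> E" "P *v \<xi> = D\<Phi> z\<^sub>0 e'" by (rule T_cases[OF proj_in[OF T]])
    have PP: "P *v \<xi> = P *v D\<Phi> z\<^sub>0 e'" by (simp add: proj_id[OF T D\<Phi>_T[OF e'(1)]] e'(2))
    note k = C2_extension_unique[OF g h]
    have Ck: "Ck_on 2 g UNIV" "Ck_on 2 h UNIV" using g h by (simp_all add: C2_extension_def)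
    have "grad g \<beta> \<bullet> \<eta> = grad h \<beta> \<bullet> \<eta>" if \<eta>: "\<eta> \<in> T" for \<eta>
    proof -
      obtain d where "d \<in> E" "\<eta> = D\<Phi> z\<^sub>0 d" using \<eta> by (rule T_cases)
      then show ?thesis using eventually_nhds_x_imp_x[OF k[OF \<open>d \<in> E\<close> e'(1)]] by (simp add: z\<^sub>0(3))
    qed
    then have "P *v grad g \<beta> = P *v grad h \<beta>"
      by (intro subspace_eqI[OF T proj_in[OF T] proj_in[OF T]]) (simp add: proj_orth[OF T])
    then have Q: "Q *v grad g \<beta> = grad g \<beta> - P *v grad h \<beta>" "Q *v grad h \<beta> = grad h \<beta> - P *v grad h \<beta>"
      by (simp_all add: proj_comp[OF T])
    have "((\<lambda>t. grad g (\<Phi> (z\<^sub>0 + t *\<^sub>R e')) \<bullet> D\<Phi> (z\<^sub>0 + t *\<^sub>R e') e) has_real_derivative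
        ((hess h \<beta> *v D\<Phi> z\<^sub>0 e') \<bullet> D\<Phi> z\<^sub>0 e + grad h \<beta> \<bullet> D2\<Phi> e' e)) (at 0)"
      using DERIV_cong_ev[OF refl k[OF e(1) e'(1)] refl] second_derivative_along[OF Ck(2)] by blast
    from DERIV_unique[OF this second_derivative_along[OF Ck(1)]]
    have "(hess h \<beta> *v D\<Phi> z\<^sub>0 e') \<bullet> D\<Phi> z\<^sub>0 e + grad h \<beta> \<bullet> D2\<Phi> e' e
        = (hess g \<beta> *v D\<Phi> z\<^sub>0 e') \<bullet> D\<Phi> z\<^sub>0 e + grad g \<beta> \<bullet> D2\<Phi> e' e" .
    then show "?w h \<bullet> \<zeta> = ?w g \<bullet> \<zeta>"
      unfolding PP e(2) hessian_formula_inner[OF e(1) e'(1) Q_in] unfolding Q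
      by (simp add: inner_diff_left)
  qed
  then show ?thesis
    unfolding riem_hess_def Let_def by (intro the_equality) (use g in blast)+
qed

lemma riem_hess_in: "C2_extension M \<beta> f g \<Longrightarrow> riem_hess M f \<beta> \<xi> \<in> T"
  unfolding riem_hess_eq by (intro subspace_add[OF T] proj_in[OF T] weingarten_in Q_in)

lemma riem_hess_linear:
  assumes g: "C2_extension M \<beta> f g" shows "linear (riem_hess M f \<beta>)"
proof -
  have "linear (\<lambda>\<xi>. P *v (hess g \<beta> *v (P *v \<xi>)))"
    using matrix_vector_mul_linear[of "P ** hess g \<beta> ** P"]
    by (simp add: matrix_vector_mul_assoc matrix_mul_assoc)
  from linear_compose_add[OF this weingarten_linear[OF Q_in]]
  show ?thesis unfolding riem_hess_eq[OF g, abs_def] .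
qed

lemma riem_hess_proj: "C2_extension M \<beta> f g \<Longrightarrow> riem_hess M f \<beta> (P *v \<xi>) = riem_hess M f \<beta> \<xi>"
  by (simp add: riem_hess_eq proj_id[OF T proj_in[OF T]])

end

section \<open>Differentiability of the prediction\<close>

text \<open>Here \<open>u\<close> is the residual of the linearized optimality condition, \<open>w\<close>
  the displacement in the chart and \<open>h\<close> the displacement of the data. Each of \<open>u\<close>
  and \<open>w\<close> is bounded through the other; as \<open>\<eta>\<close> is small, the part of
  \<open>u\<close> that returns is at most half of it. So \<open>u\<close> is small compared with
  \<open>h\<close>, and \<open>w\<close> is of the order of \<open>h\<close>.\<close>

lemma absorb_constants:
  fixes u w h :: real
  assumes nn: "0 \<le> u" "0 \<le> w" "0 \<le> h" "0 \<le> C1" "0 \<le> C2" "0 \<le> a" "0 \<le> k"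
    and e: "0 < \<eta>" "\<eta> \<le> 1" "C2 * C2 * a * \<eta> \<le> 1 / 2"
    and u: "u \<le> C2 * (\<eta> * C1 * h + (k + \<eta>) * \<eta> * h + \<eta> * w)"
    and w: "w \<le> C2 * a * (u + k * h)"
  shows "u \<le> \<eta> * (2 * (C2 * (C1 + k + 1) + C2 * C2 * a * k)) * h"
    and "w \<le> C2 * a * (2 * (C2 * (C1 + k + 1) + C2 * C2 * a * k) + k) * h"
proof -
  let ?c = "2 * (C2 * (C1 + k + 1) + C2 * C2 * a * k)"
  have "(k + \<eta>) * \<eta> * h \<le> (k + 1) * \<eta> * h" using e nn by (intro mult_right_mono) auto
  then have "u \<le> C2 * (\<eta> * C1 * h + (k + 1) * \<eta> * h + \<eta> * w)"
    using u nn(5) by (smt (verit) mult_left_mono)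
  also have "\<dots> = \<eta> * (C2 * (C1 + k + 1)) * h + C2 * \<eta> * w" by (simp add: algebra_simps)
  also have "C2 * \<eta> * w \<le> C2 * \<eta> * (C2 * a * (u + k * h))"
    using w nn e by (intro mult_left_mono) auto
  also have "\<eta> * (C2 * (C1 + k + 1)) * h + C2 * \<eta> * (C2 * a * (u + k * h))
      = \<eta> * (C2 * (C1 + k + 1) + C2 * C2 * a * k) * h + (C2 * C2 * a * \<eta>) * u"
    by (simp add: algebra_simps)
  also have "(C2 * C2 * a * \<eta>) * u \<le> 1 / 2 * u" using e nn by (intro mult_right_mono) auto
  finally have "u \<le> \<eta> * (C2 * (C1 + k + 1) + C2 * C2 * a * k) * h + 1 / 2 * u" by simp
  then show 1: "u \<le> \<eta> * ?c * h" by (simp add: algebra_simps)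
  have "\<eta> * (?c * h) \<le> 1 * (?c * h)" using e nn by (intro mult_right_mono) auto
  then have "u \<le> ?c * h" using 1 by (simp add: mult.assoc)
  then have "C2 * a * (u + k * h) \<le> C2 * a * (?c * h + k * h)"
    using nn by (intro mult_left_mono) auto
  then show "w \<le> C2 * a * (?c + k) * h" using w by (simp add: algebra_simps)
qed

context C2_chart
begin

lemma D\<Phi>_sum: "z \<in> V \<Longrightarrow> D\<Phi> z e = (\<Sum>b\<in>Basis. (e \<bullet> b) *\<^sub>R D\<Phi> z b)"
proof -
  assume "z \<in> V"
  then interpret bounded_linear "D\<Phi> z" by (rule D\<Phi>_bl)
  have "D\<Phi> z (\<Sum>b\<in>Basis. (e \<bullet> b) *\<^sub>R b) = (\<Sum>b\<in>Basis. (e \<bullet> b) *\<^sub>R D\<Phi> z b)"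
    by (simp add: sum scaleR)
  then show ?thesis by (simp add: euclidean_representation)
qed

lemma D\<Phi>_continuous:
  assumes \<eta>: "\<eta> > 0"
  shows "\<forall>\<^sub>F z in nhds z\<^sub>0. \<forall>e. norm (D\<Phi> z e - D\<Phi> z\<^sub>0 e) \<le> \<eta> * norm e"
proof -
  let ?c = "\<eta> / real (DIM(real^'p))"
  have c: "?c > 0" using \<eta> DIM_positive[where 'a = "real^'p"] by (intro divide_pos_pos) (auto simp del: DIM_cart)
  have "\<forall>\<^sub>F z in nhds z\<^sub>0. norm (D\<Phi> z b - D\<Phi> z\<^sub>0 b) < ?c" for b
  proof -
    have "isCont (\<lambda>z. D\<Phi> z b) z\<^sub>0"
      using D\<Phi>_differentiable[OF z\<^sub>0(1)] differentiable_imp_continuous_within by blast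
    then have "((\<lambda>z. D\<Phi> z b) \<longlongrightarrow> D\<Phi> z\<^sub>0 b) (nhds z\<^sub>0)"
      unfolding isCont_def by (rule tendsto_at_iff_tendsto_nhds[THEN iffD1, of "\<lambda>z. D\<Phi> z b"])
    then show ?thesis using c unfolding tendsto_iff dist_norm by blast
  qed
  then have "\<forall>\<^sub>F z in nhds z\<^sub>0. \<forall>b\<in>Basis. norm (D\<Phi> z b - D\<Phi> z\<^sub>0 b) < ?c"
    by (intro eventually_ball_finite) auto
  moreover have "\<forall>\<^sub>F z in nhds z\<^sub>0. z \<in> V" by (rule eventually_nhds_in_open[OF V z\<^sub>0(1)])
  ultimately show ?thesis
  proof eventually_elim
    case (elim z)
    show ?case
    proof
      fix e
      have "D\<Phi> z e - D\<Phi> z\<^sub>0 e = (\<Sum>b\<in>Basis. (e \<bullet> b) *\<^sub>R (D\<Phi> z b - D\<Phi> z\<^sub>0 b))"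
        unfolding D\<Phi>_sum[OF elim(2), of e] D\<Phi>_sum[OF z\<^sub>0(1), of e]
        by (simp add: sum_subtractf scaleR_diff_right)
      also have "norm \<dots> \<le> (\<Sum>b\<in>(Basis :: (real^'p) set). norm e * ?c)"
      proof (intro sum_norm_le)
        fix b :: "real^'p" assume b: "b \<in> Basis"
        have "norm ((e \<bullet> b) *\<^sub>R (D\<Phi> z b - D\<Phi> z\<^sub>0 b)) = \<bar>e \<bullet> b\<bar> * norm (D\<Phi> z b - D\<Phi> z\<^sub>0 b)" by simp
        also have "\<dots> \<le> norm e * ?c"
          using bspec[OF elim(1) b, THEN less_imp_le] Basis_le_norm[OF b, of e] by (intro mult_mono) simp_all
        finally show "norm ((e \<bullet> b) *\<^sub>R (D\<Phi> z b - D\<Phi> z\<^sub>0 b)) \<le> norm e * ?c" .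
      qed
      also have "\<dots> = \<eta> * norm e" by simp
      finally show "norm (D\<Phi> z e - D\<Phi> z\<^sub>0 e) \<le> \<eta> * norm e" .
    qed
  qed
qed

lemma \<Phi>_expansion:
  assumes \<eta>: "\<eta> > 0"
  shows "\<forall>\<^sub>F z in nhds z\<^sub>0. norm (\<Phi> z - \<beta> - D\<Phi> z\<^sub>0 (z - z\<^sub>0)) \<le> \<eta> * norm (z - z\<^sub>0)"
proof -
  have "\<exists>d>0. \<forall>z. norm (z - z\<^sub>0) < d \<longrightarrow> norm (\<Phi> z - \<Phi> z\<^sub>0 - D\<Phi> z\<^sub>0 (z - z\<^sub>0)) \<le> \<eta> * norm (z - z\<^sub>0)"
    using has_D\<Phi>[OF z\<^sub>0(1)] \<eta> unfolding has_derivative_at_alt by blast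
  then show ?thesis unfolding eventually_nhds_metric dist_norm z\<^sub>0(3) by blast
qed

text \<open>Linearization of the covector \<open>e \<mapsto> q (\<Phi> z) \<bullet> D\<Phi> z e\<close>,
  uniformly in \<open>e\<close>. The right-hand side is the Hessian of the function with gradient
  \<open>q\<close>, read in the chart.\<close>

lemma pairing_expansion:
  assumes q: "(q has_derivative q') (at \<beta>)" and \<eta>: "\<eta> > 0"
  shows "\<forall>\<^sub>F z in nhds z\<^sub>0. \<forall>e. \<bar>q (\<Phi> z) \<bullet> D\<Phi> z e - q \<beta> \<bullet> D\<Phi> z\<^sub>0 e
      - (q' (D\<Phi> z\<^sub>0 (z - z\<^sub>0)) \<bullet> D\<Phi> z\<^sub>0 e + q \<beta> \<bullet> D2\<Phi> (z - z\<^sub>0) e)\<bar> \<le> \<eta> * norm (z - z\<^sub>0) * norm e"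
proof -
  have pair: "((\<lambda>z. q (\<Phi> z) \<bullet> D\<Phi> z e) has_derivative
      (\<lambda>w. q' (D\<Phi> z\<^sub>0 w) \<bullet> D\<Phi> z\<^sub>0 e + q \<beta> \<bullet> D2\<Phi> w e)) (at z\<^sub>0)" for e
  proof -
    have "((\<lambda>z. q (\<Phi> z)) has_derivative (\<lambda>w. q' (D\<Phi> z\<^sub>0 w))) (at z\<^sub>0)"
      by (rule has_derivative_compose[OF has_D\<Phi>[OF z\<^sub>0(1)]]) (use q z\<^sub>0(3) in simp)
    from has_derivative_inner[OF this has_D2\<Phi>] show ?thesis
      by (rule has_derivative_eq_rhs) (simp add: z\<^sub>0(3) fun_eq_iff)
  qed
  define N where "N z = (\<Sum>b\<in>Basis. (q (\<Phi> z) \<bullet> D\<Phi> z b) *\<^sub>R b)" for z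
  define N' where "N' w = (\<Sum>b\<in>Basis. (q' (D\<Phi> z\<^sub>0 w) \<bullet> D\<Phi> z\<^sub>0 b + q \<beta> \<bullet> D2\<Phi> w b) *\<^sub>R b)" for w
  have N': "(N has_derivative N') (at z\<^sub>0)"
    unfolding N_def[abs_def] N'_def[abs_def]
    by (intro has_derivative_sum has_derivative_scaleR_left pair)
  have Ne: "N z \<bullet> e = q (\<Phi> z) \<bullet> D\<Phi> z e" if z: "z \<in> V" for z e
    unfolding D\<Phi>_sum[OF z, of e]
    by (simp add: N_def inner_sum_left inner_sum_right inner_commute mult.commute)
  have N'e: "N' w \<bullet> e = q' (D\<Phi> z\<^sub>0 w) \<bullet> D\<Phi> z\<^sub>0 e + q \<beta> \<bullet> D2\<Phi> w e" for w e
  proof -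
    have "((\<lambda>z. N z \<bullet> e) has_derivative (\<lambda>w. N' w \<bullet> e)) (at z\<^sub>0)"
      by (rule has_derivative_inner_left[OF N'])
    then have "((\<lambda>z. q (\<Phi> z) \<bullet> D\<Phi> z e) has_derivative (\<lambda>w. N' w \<bullet> e)) (at z\<^sub>0)"
      by (rule has_derivative_transform_within_open[OF _ V z\<^sub>0(1)]) (rule Ne)
    from has_derivative_unique[OF this pair] show ?thesis by metis
  qed
  have "\<exists>d>0. \<forall>z. norm (z - z\<^sub>0) < d \<longrightarrow> norm (N z - N z\<^sub>0 - N' (z - z\<^sub>0)) \<le> \<eta> * norm (z - z\<^sub>0)"
    using N' \<eta> unfolding has_derivative_at_alt by blast
  then have "\<forall>\<^sub>F z in nhds z\<^sub>0. norm (N z - N z\<^sub>0 - N' (z - z\<^sub>0)) \<le> \<eta> * norm (z - z\<^sub>0)"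
    unfolding eventually_nhds_metric dist_norm by blast
  moreover have "\<forall>\<^sub>F z in nhds z\<^sub>0. z \<in> V" by (rule eventually_nhds_in_open[OF V z\<^sub>0(1)])
  ultimately show ?thesis
  proof eventually_elim
    case (elim z)
    show ?case
    proof
      fix e
      have "q (\<Phi> z) \<bullet> D\<Phi> z e - q \<beta> \<bullet> D\<Phi> z\<^sub>0 e
          - (q' (D\<Phi> z\<^sub>0 (z - z\<^sub>0)) \<bullet> D\<Phi> z\<^sub>0 e + q \<beta> \<bullet> D2\<Phi> (z - z\<^sub>0) e)
          = (N z - N z\<^sub>0 - N' (z - z\<^sub>0)) \<bullet> e"
        by (simp only: inner_diff_left Ne[OF elim(2)] Ne[OF z\<^sub>0(1)] N'e z\<^sub>0(3))
      also have "\<bar>\<dots>\<bar> \<le> norm (N z - N z\<^sub>0 - N' (z - z\<^sub>0)) * norm e" by (rule Cauchy_Schwarz_ineq2)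
      also have "\<dots> \<le> \<eta> * norm (z - z\<^sub>0) * norm e" using elim(1) by (intro mult_right_mono) auto
      finally show "\<bar>q (\<Phi> z) \<bullet> D\<Phi> z e - q \<beta> \<bullet> D\<Phi> z\<^sub>0 e
          - (q' (D\<Phi> z\<^sub>0 (z - z\<^sub>0)) \<bullet> D\<Phi> z\<^sub>0 e + q \<beta> \<bullet> D2\<Phi> (z - z\<^sub>0) e)\<bar> \<le> \<eta> * norm (z - z\<^sub>0) * norm e" .
    qed
  qed
qed

text \<open>On the manifold, \<open>J\<close> agrees with the smooth function \<open>g\<close>; so along the image of a segment in \<open>E\<close>,
  the objective is differentiable and has a minimum at the solution.\<close>

lemma critical_along:
  assumes f: "\<And>x. f differentiable (at x)" and g: "\<And>x. g differentiable (at x)"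
    and G: "open G" "\<And>x. x \<in> G \<Longrightarrow> x \<in> M \<Longrightarrow> J x = ereal (g x)"
    and x: "x \<in> M" "x \<in> U" "x \<in> G"
    and min: "\<And>x'. ereal (f x) + J x \<le> ereal (f x') + J x'"
    and e: "e \<in> E"
  shows "(grad f x + grad g x) \<bullet> D\<Phi> (\<Psi> x) e = 0"
proof -
  let ?z = "\<Psi> x"
  have z: "?z \<in> V" "?z \<in> E" "\<Phi> ?z = x" using x \<Psi>V \<Psi>E inv1 by auto
  let ?k = "\<lambda>s. f (\<Phi> (?z + s *\<^sub>R e)) + g (\<Phi> (?z + s *\<^sub>R e))"
  have d: "(?k has_real_derivative (grad f x \<bullet> D\<Phi> ?z e + grad g x \<bullet> D\<Phi> ?z e)) (at 0)"
    using DERIV_add[OF derivative_along[OF f z(1)] derivative_along[OF g z(1)]] by (simp add: z(3))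
  have "\<forall>\<^sub>F s in nhds 0. \<Phi> (?z + s *\<^sub>R e) \<in> G"
    using segment_\<Phi>_tendsto[OF z(1), of e] G(1) x(3) z(3) topological_tendstoD by fastforce
  then have "\<forall>\<^sub>F s in nhds 0. ?k 0 \<le> ?k s"
    using segment_V[OF z(1), of e]
  proof eventually_elim
    case (elim s)
    have "\<Phi> (?z + s *\<^sub>R e) \<in> M" by (rule \<Phi>M[OF elim(2) segment_E[OF z(2) e]])
    then show ?case using min[of "\<Phi> (?z + s *\<^sub>R e)"] G(2) x elim z by simp
  qed
  then obtain d' where "d' > 0" "\<And>s. dist s 0 < d' \<Longrightarrow> ?k 0 \<le> ?k s"
    unfolding eventually_nhds_metric by blast
  then have "grad f x \<bullet> D\<Phi> ?z e + grad g x \<bullet> D\<Phi> ?z e = 0"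
    using DERIV_local_min[OF d, of d'] by (simp add: dist_real_def)
  then show ?thesis by (simp add: inner_add_left)
qed

end

context C2_chart
begin

text \<open>The optimality conditions along the manifold, for \<open>y\<close> at \<open>\<beta>\<close> and
  for \<open>y'\<close> at \<open>\<beta>'\<close>, are subtracted and linearized in the chart. This bounds
  \<open>A *v \<xi> + K *v h\<close>, tested on tangent vectors, by small errors; here \<open>\<xi>\<close>
  is the tangential displacement and \<open>h = y' - y\<close>. Inverting \<open>A\<close> yields the
  expansion. That the displacement of the solution is at most of the order of \<open>h\<close> comes out by
  absorption (\<open>absorb_constants\<close>).\<close>

theorem solution_expansion:
  fixes F :: "real^'p \<Rightarrow> real^'n \<Rightarrow> real" and A :: "real^'p^'p" and K :: "real^'n^'p"
  assumes F2: "\<And>y. Ck_on 2 (\<lambda>b. F b y) UNIV"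
    and g: "Ck_on 2 g UNIV" and G: "open G" "\<beta> \<in> G" "\<And>x. x \<in> G \<Longrightarrow> x \<in> M \<Longrightarrow> J x = ereal (g x)"
    and sol: "is_solution F J y \<beta>"
    and A: "\<And>\<xi>. A *v \<xi> = riem_hess M (\<lambda>b. F b y) \<beta> \<xi> + riem_hess M (\<lambda>b. real_of_ereal (J b)) \<beta> \<xi>"
    and pos: "\<And>\<xi>. \<xi> \<in> T \<Longrightarrow> \<xi> \<noteq> 0 \<Longrightarrow> (A *v \<xi>) \<bullet> \<xi> > 0"
    and near: "\<And>\<epsilon> r. 0 < \<epsilon> \<Longrightarrow> 0 < r \<Longrightarrow> \<forall>\<^sub>F y' in nhds y. \<exists>\<beta>'. \<beta>' \<in> M \<and> dist \<beta>' \<beta> < r \<and> is_solution F J y' \<beta>' \<and>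
        norm (grad (\<lambda>b. F b y) \<beta>' - grad (\<lambda>b. F b y') \<beta>' - K *v (y - y')) \<le> \<epsilon> * norm (y - y')"
    and \<epsilon>: "0 < \<epsilon>"
  shows "\<forall>\<^sub>F y' in nhds y. \<exists>\<beta>'. is_solution F J y' \<beta>' \<and>
    norm (\<beta>' - \<beta> + pinv A *v (K *v (y' - y))) \<le> \<epsilon> * norm (y' - y)"
proof -
  define f where "f = (\<lambda>b. F b y)"
  define q where "q x = grad f x + grad g x" for x
  define q' where "q' h = hess f \<beta> *v h + hess g \<beta> *v h" for h
  have f2: "Ck_on 2 f UNIV" unfolding f_def by (rule F2)
  have fd: "f differentiable (at x)" and gd: "g differentiable (at x)"
    and Fd: "(\<lambda>b. F b y') differentiable (at x)" for x y'
    using Ck2_differentiable f2 g F2 by blast+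
  have q: "(q has_derivative q') (at \<beta>)"
    unfolding q_def[abs_def] q'_def[abs_def]
    by (intro has_derivative_add hess_has_derivative Ck2_grad_differentiable f2 g)
  have sol_min: "ereal (F b y') + J b \<le> ereal (F x' y') + J x'" if "is_solution F J y' b" for y' b x'
    using that unfolding is_solution_def by blast
  have crit0: "q \<beta> \<bullet> D\<Phi> z\<^sub>0 e = 0" if "e \<in> E" for e
    unfolding q_def f_def
    by (rule critical_along[where J = J, OF Fd gd G(1,3) \<beta>M U(2) G(2) sol_min[OF sol] that])
  have q_perp: "q \<beta> \<bullet> \<xi> = 0" if "\<xi> \<in> T" for \<xi>
    using that crit0 by (auto elim: T_cases)
  have Qq: "Q *v grad f \<beta> + Q *v grad g \<beta> = q \<beta>"
  proof -
    have "P *v q \<beta> = 0"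
      by (rule subspace_eqI[OF T proj_in[OF T] subspace_0[OF T]]) (simp add: proj_orth[OF T] q_perp)
    then have "Q *v q \<beta> = q \<beta>" by (simp add: proj_comp[OF T])
    then show ?thesis unfolding q_def by (simp add: matrix_vector_right_distrib)
  qed
  have extF: "C2_extension M \<beta> f f" unfolding C2_extension_def using f2 by simp
  have extJ: "C2_extension M \<beta> (\<lambda>b. real_of_ereal (J b)) g"
    unfolding C2_extension_def
  proof (intro conjI g)
    have "\<forall>\<^sub>F x in nhds \<beta>. x \<in> G" by (rule eventually_nhds_in_open[OF G(1,2)])
    then show "\<forall>\<^sub>F x in nhds \<beta>. x \<in> M \<longrightarrow> real_of_ereal (J x) = g x"
      by (rule eventually_mono) (simp add: G(3))
  qed
  note A' = A[folded f_def]
  \<comment> \<open>\<open>A\<close> is the Hessian of the objective in the chart; the normal part of its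
    gradient enters through the curvature\<close>
  have bil: "(A *v D\<Phi> z\<^sub>0 e') \<bullet> D\<Phi> z\<^sub>0 e = q' (D\<Phi> z\<^sub>0 e') \<bullet> D\<Phi> z\<^sub>0 e + q \<beta> \<bullet> D2\<Phi> e' e"
    if e: "e \<in> E" "e' \<in> E" for e e'
    unfolding A' riem_hess_eq[OF extF] riem_hess_eq[OF extJ] inner_add_left[of "_ + _" "_ + _"]
      hessian_formula_inner[OF e Q_in] q'_def Qq[symmetric]
    by (simp add: inner_add_left)
  have ran: "A *v \<xi> \<in> T" for \<xi>
    unfolding A' by (intro subspace_add[OF T] riem_hess_in[OF extF] riem_hess_in[OF extJ])
  have ext: "A *v (P *v \<xi>) = A *v \<xi>" for \<xi>
    unfolding A' riem_hess_proj[OF extF] riem_hess_proj[OF extJ] ..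
  note pinv = pinv_definite[OF T ran ext pos]
  obtain a where a: "0 \<le> a" "\<And>x. norm (pinv A *v x) \<le> norm x * a"
    using bounded_linear.nonneg_bounded[OF matrix_vector_mul_bounded_linear, of "pinv A"] by blast
  obtain k where k: "0 \<le> k" "\<And>x. norm (K *v x) \<le> norm x * k"
    using bounded_linear.nonneg_bounded[OF matrix_vector_mul_bounded_linear, of K] by blast
  obtain C1 where C1: "0 \<le> C1" "\<And>x. norm (D\<Phi> z\<^sub>0 x) \<le> norm x * C1"
    using bounded_linear.nonneg_bounded[OF D\<Phi>_bl[OF z\<^sub>0(1)]] by blast
  obtain C2 where C2: "0 \<le> C2" "\<And>x. norm (D\<Psi> \<beta> x) \<le> norm x * C2"
    using bounded_linear.nonneg_bounded[OF D\<Psi>_bl[OF U(2)]] by blast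
  define c3 where "c3 = 2 * (C2 * (C1 + k + 1) + C2 * C2 * a * k)"
  define c4 where "c4 = C2 * a * (c3 + k)"
  have c3: "0 \<le> c3" unfolding c3_def using C1 C2 a k by simp
  have c4: "0 \<le> c4" unfolding c4_def using c3 C2 a k by simp
  \<comment> \<open>small enough for the absorption, and for the final error to be at most
    \<open>\<epsilon>\<close>\<close>
  define \<eta> where "\<eta> = min 1 (min (1 / (2 * (C2 * C2 * a + 1))) (\<epsilon> / (a * c3 + c4 + 1)))"
  have D: "0 < C2 * C2 * a + 1" "0 < a * c3 + c4 + 1"
    using C2 a c3 c4 by (simp_all add: add_nonneg_pos)
  have \<eta>: "0 < \<eta>" "\<eta> \<le> 1" unfolding \<eta>_def using D \<epsilon> by auto
  have "C2 * C2 * a * \<eta> \<le> C2 * C2 * a * (1 / (2 * (C2 * C2 * a + 1)))"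
    unfolding \<eta>_def using C2 a by (intro mult_left_mono) auto
  also have "\<dots> \<le> 1 / 2" using D by (simp add: field_simps)
  finally have \<eta>2: "C2 * C2 * a * \<eta> \<le> 1 / 2" .
  have "(a * c3 + c4) * \<eta> \<le> (a * c3 + c4) * (\<epsilon> / (a * c3 + c4 + 1))"
    unfolding \<eta>_def using c3 c4 a by (intro mult_left_mono) auto
  also have "\<dots> \<le> \<epsilon>" using D \<epsilon> by (simp add: field_simps)
  finally have \<eta>3: "\<eta> * (a * c3 + c4) \<le> \<epsilon>" by (simp add: mult.commute)
  have "(\<Psi> \<longlongrightarrow> z\<^sub>0) (at \<beta>)"
    using has_derivative_continuous[OF has_D\<Psi>[OF U(2)]] by (simp add: isCont_def)
  then have "filterlim \<Psi> (nhds z\<^sub>0) (nhds \<beta>)"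
    by (rule tendsto_at_iff_tendsto_nhds[THEN iffD1])
  note pull = this[THEN filterlim_iff[THEN iffD1], rule_format]
  have "\<forall>\<^sub>F x in nhds \<beta>. x \<in> U \<and> x \<in> G \<and>
     norm (\<Phi> (\<Psi> x) - \<beta> - D\<Phi> z\<^sub>0 (\<Psi> x - z\<^sub>0)) \<le> \<eta> * norm (\<Psi> x - z\<^sub>0) \<and>
     (\<forall>e. norm (D\<Phi> (\<Psi> x) e - D\<Phi> z\<^sub>0 e) \<le> \<eta> * norm e) \<and>
     (\<forall>e. \<bar>q (\<Phi> (\<Psi> x)) \<bullet> D\<Phi> (\<Psi> x) e - q \<beta> \<bullet> D\<Phi> z\<^sub>0 e
      - (q' (D\<Phi> z\<^sub>0 (\<Psi> x - z\<^sub>0)) \<bullet> D\<Phi> z\<^sub>0 e + q \<beta> \<bullet> D2\<Phi> (\<Psi> x - z\<^sub>0) e)\<bar> \<le> \<eta> * norm (\<Psi> x - z\<^sub>0) * norm e)"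
    by (intro eventually_conj eventually_nhds_in_open[OF U] eventually_nhds_in_open[OF G(1,2)]
        pull[OF \<Phi>_expansion[OF \<eta>(1)]] pull[OF D\<Phi>_continuous[OF \<eta>(1)]] pull[OF pairing_expansion[OF q \<eta>(1)]])
  then obtain r where r: "r > 0" and local: "\<And>x. dist x \<beta> < r \<Longrightarrow> x \<in> U \<and> x \<in> G \<and>
     norm (\<Phi> (\<Psi> x) - \<beta> - D\<Phi> z\<^sub>0 (\<Psi> x - z\<^sub>0)) \<le> \<eta> * norm (\<Psi> x - z\<^sub>0) \<and>
     (\<forall>e. norm (D\<Phi> (\<Psi> x) e - D\<Phi> z\<^sub>0 e) \<le> \<eta> * norm e) \<and>
     (\<forall>e. \<bar>q (\<Phi> (\<Psi> x)) \<bullet> D\<Phi> (\<Psi> x) e - q \<beta> \<bullet> D\<Phi> z\<^sub>0 e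
      - (q' (D\<Phi> z\<^sub>0 (\<Psi> x - z\<^sub>0)) \<bullet> D\<Phi> z\<^sub>0 e + q \<beta> \<bullet> D2\<Phi> (\<Psi> x - z\<^sub>0) e)\<bar> \<le> \<eta> * norm (\<Psi> x - z\<^sub>0) * norm e)"
    unfolding eventually_nhds_metric by blast
  from near[OF \<eta>(1) r] show ?thesis
  proof (rule eventually_mono)
    fix y'
    assume "\<exists>\<beta>'. \<beta>' \<in> M \<and> dist \<beta>' \<beta> < r \<and> is_solution F J y' \<beta>' \<and>
        norm (grad (\<lambda>b. F b y) \<beta>' - grad (\<lambda>b. F b y') \<beta>' - K *v (y - y')) \<le> \<eta> * norm (y - y')"
    then obtain b where b: "b \<in> M" "dist b \<beta> < r" "is_solution F J y' b"
      "norm (grad f b - grad (\<lambda>b. F b y') b - K *v (y - y')) \<le> \<eta> * norm (y - y')"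
      unfolding f_def by blast
    define h where "h = y' - y"
    define z where "z = \<Psi> b"
    define w where "w = z - z\<^sub>0"
    define \<xi> where "\<xi> = D\<Phi> z\<^sub>0 w"
    define c where "c = grad (\<lambda>b. F b y') b - grad f b"
    have bU: "b \<in> U" "b \<in> G" and loc_b: "norm (b - \<beta> - \<xi>) \<le> \<eta> * norm w"
      and loc_c: "\<And>e. norm (D\<Phi> z e - D\<Phi> z\<^sub>0 e) \<le> \<eta> * norm e"
      and loc_a: "\<And>e. \<bar>q b \<bullet> D\<Phi> z e - q \<beta> \<bullet> D\<Phi> z\<^sub>0 e - (q' \<xi> \<bullet> D\<Phi> z\<^sub>0 e + q \<beta> \<bullet> D2\<Phi> w e)\<bar> \<le> \<eta> * norm w * norm e"
      using local[OF b(2)] inv1[of b] unfolding z_def w_def \<xi>_def by auto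
    have w: "w \<in> E" unfolding w_def z_def by (intro subspace_diff[OF E] \<Psi>E bU b z\<^sub>0)
    have \<xi>T: "\<xi> \<in> T" unfolding \<xi>_def by (rule D\<Phi>_T[OF w])
    have cr: "norm (c - K *v h) \<le> \<eta> * norm h"
    proof -
      have "c - K *v h = - (grad f b - grad (\<lambda>b. F b y') b - K *v (y - y'))"
        unfolding c_def h_def by (simp add: matrix_vector_mult_diff_distrib)
      then show ?thesis using b(4) by (simp only: norm_minus_cancel h_def norm_minus_commute)
    qed
    have cn: "norm c \<le> (k + \<eta>) * norm h"
      using norm_triangle_sub[of c "K *v h"] cr k(2)[of h] by (simp add: algebra_simps)
    \<comment> \<open>the difference of the optimality conditions at \<open>b\<close> for \<open>y'\<close>
      and at \<open>\<beta>\<close> for \<open>y\<close>, linearized\<close>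
    have main: "\<bar>(A *v \<xi> + K *v h) \<bullet> D\<Phi> z\<^sub>0 e\<bar>
        \<le> (\<eta> * C1 * norm h + (k + \<eta>) * \<eta> * norm h + \<eta> * norm w) * norm e" if e: "e \<in> E" for e
    proof -
      have "(grad (\<lambda>b. F b y') b + grad g b) \<bullet> D\<Phi> z e = 0"
        unfolding z_def
        by (rule critical_along[where J = J, OF Fd gd G(1,3) b(1) bU sol_min[OF b(3)] e])
      then have 1: "q b \<bullet> D\<Phi> z e = - (c \<bullet> D\<Phi> z e)"
        unfolding q_def c_def by (simp add: inner_add_left inner_diff_left)
      have "(A *v \<xi> + K *v h) \<bullet> D\<Phi> z\<^sub>0 e = (q' \<xi> \<bullet> D\<Phi> z\<^sub>0 e + q \<beta> \<bullet> D2\<Phi> w e) + (K *v h) \<bullet> D\<Phi> z\<^sub>0 e"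
        unfolding inner_add_left \<xi>_def bil[OF e w] ..
      also have "\<dots> = - (q b \<bullet> D\<Phi> z e - q \<beta> \<bullet> D\<Phi> z\<^sub>0 e - (q' \<xi> \<bullet> D\<Phi> z\<^sub>0 e + q \<beta> \<bullet> D2\<Phi> w e))
          - (c - K *v h) \<bullet> D\<Phi> z\<^sub>0 e - c \<bullet> (D\<Phi> z e - D\<Phi> z\<^sub>0 e)"
        using 1 crit0[OF e] by (simp add: inner_diff_left inner_diff_right)
      also have "\<bar>\<dots>\<bar> \<le> \<eta> * norm w * norm e + (\<eta> * norm h) * (norm e * C1) + ((k + \<eta>) * norm h) * (\<eta> * norm e)"
      proof -
        have "\<bar>(c - K *v h) \<bullet> D\<Phi> z\<^sub>0 e\<bar> \<le> norm (c - K *v h) * norm (D\<Phi> z\<^sub>0 e)" by (rule Cauchy_Schwarz_ineq2)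
        also have "\<dots> \<le> (\<eta> * norm h) * (norm e * C1)"
          using cr C1 \<eta>(1) by (intro mult_mono) auto
        finally have 2: "\<bar>(c - K *v h) \<bullet> D\<Phi> z\<^sub>0 e\<bar> \<le> (\<eta> * norm h) * (norm e * C1)" .
        have "\<bar>c \<bullet> (D\<Phi> z e - D\<Phi> z\<^sub>0 e)\<bar> \<le> norm c * norm (D\<Phi> z e - D\<Phi> z\<^sub>0 e)" by (rule Cauchy_Schwarz_ineq2)
        also have "\<dots> \<le> ((k + \<eta>) * norm h) * (\<eta> * norm e)"
          using cn loc_c k \<eta>(1) by (intro mult_mono) auto
        finally have 3: "\<bar>c \<bullet> (D\<Phi> z e - D\<Phi> z\<^sub>0 e)\<bar> \<le> ((k + \<eta>) * norm h) * (\<eta> * norm e)" .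
        show ?thesis using loc_a[of e] 2 3 by linarith
      qed
      finally show ?thesis by (simp add: algebra_simps)
    qed
    define u where "u = A *v \<xi> + P *v (K *v h)"
    have uT: "u \<in> T" unfolding u_def by (intro subspace_add[OF T] ran proj_in[OF T])
    have "norm u \<le> C2 * (\<eta> * C1 * norm h + (k + \<eta>) * \<eta> * norm h + \<eta> * norm w)"
    proof (cases "u = 0")
      case False
      have e: "D\<Psi> \<beta> u \<in> E" by (rule tangent_D\<Psi>[OF U(2) uT])
      have eu: "D\<Phi> z\<^sub>0 (D\<Psi> \<beta> u) = u" using D\<Phi>_D\<Psi>[OF z\<^sub>0(1), of u] by (simp add: z\<^sub>0(3))
      let ?B = "\<eta> * C1 * norm h + (k + \<eta>) * \<eta> * norm h + \<eta> * norm w"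
      have B: "0 \<le> ?B" using \<eta> C1 k by simp
      have "norm u * norm u = (A *v \<xi> + K *v h) \<bullet> u"
        unfolding power2_eq_square[symmetric] power2_norm_eq_inner
        by (subst u_def) (simp add: inner_add_left proj_orth[OF T uT])
      also have "\<dots> \<le> ?B * norm (D\<Psi> \<beta> u)" using main[OF e] unfolding eu by linarith
      also have "\<dots> \<le> ?B * (norm u * C2)" by (rule mult_left_mono[OF C2(2) B])
      finally have "norm u * norm u \<le> (C2 * ?B) * norm u" by (simp add: mult_ac)
      then show ?thesis using False by simp
    qed (use \<eta> C1 C2 k in simp)
    moreover have \<xi>_eq: "\<xi> = pinv A *v u - pinv A *v (K *v h)"
    proof -
      have "pinv A *v (A *v \<xi>) = \<xi>" by (simp add: matrix_vector_mul_assoc pinv(1) proj_id[OF T \<xi>T])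
      moreover have "pinv A *v (P *v (K *v h)) = pinv A *v (K *v h)"
      proof -
        have "pinv A *v (P *v (K *v h)) = (pinv A ** P) *v (K *v h)" by (rule matrix_vector_mul_assoc)
        also have "pinv A ** P = pinv A" by (rule pinv(3))
        finally show ?thesis .
      qed
      ultimately show ?thesis unfolding u_def by (simp add: matrix_vector_right_distrib)
    qed
    moreover have "norm w \<le> C2 * a * (norm u + k * norm h)"
    proof -
      have "w = D\<Psi> \<beta> \<xi>" unfolding \<xi>_def using D\<Psi>_D\<Phi>[OF z\<^sub>0(1), of w] by (simp add: z\<^sub>0(3))
      then have "norm w \<le> norm \<xi> * C2" using C2(2) by simp
      also have "norm \<xi> \<le> norm (pinv A *v u) + norm (pinv A *v (K *v h))"
        unfolding \<xi>_eq by (rule norm_triangle_ineq4)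
      also have "\<dots> \<le> norm u * a + norm (K *v h) * a" by (intro add_mono a(2))
      also have "\<dots> \<le> norm u * a + norm h * k * a" using k(2)[of h] a(1) by (intro add_left_mono mult_right_mono)
      finally show ?thesis using C2(1) by (simp add: algebra_simps mult_right_mono)
    qed
    ultimately have u_le: "norm u \<le> \<eta> * c3 * norm h" and w_le: "norm w \<le> c4 * norm h"
      using absorb_constants[of "norm u" "norm w" "norm h" C1 C2 a k \<eta>] \<eta> \<eta>2 C1 C2 a k
      unfolding c3_def c4_def by auto
    have "b - \<beta> + pinv A *v (K *v h) = (b - \<beta> - \<xi>) + pinv A *v u"
      using \<xi>_eq by simp
    also have "norm \<dots> \<le> norm (b - \<beta> - \<xi>) + norm (pinv A *v u)" by (rule norm_triangle_ineq)
    also have "\<dots> \<le> \<eta> * norm w + norm u * a" by (rule add_mono[OF loc_b a(2)])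
    also have "\<dots> \<le> \<eta> * (c4 * norm h) + (\<eta> * c3 * norm h) * a"
      using u_le w_le \<eta> a by (intro add_mono mult_left_mono mult_right_mono) auto
    also have "\<dots> = \<eta> * (a * c3 + c4) * norm h" by (simp add: algebra_simps)
    also have "\<dots> \<le> \<epsilon> * norm h" by (rule mult_right_mono[OF \<eta>3]) simp
    finally show "\<exists>\<beta>'. is_solution F J y' \<beta>' \<and> norm (\<beta>' - \<beta> + pinv A *v (K *v (y' - y))) \<le> \<epsilon> * norm (y' - y)"
      using b(3) unfolding h_def by blast
  qed
qed

end

text \<open>Off the three null sets, the assumptions of \<open>solution_expansion\<close> hold at the
  solution that defines \<open>\<Delta> y\<close>. Applying \<open>X\<close> to the expansion of nearby
  solutions gives one for \<open>\<mu>hat\<close>, because the prediction is the same for all solutions. The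
  rest identifies the linearization with the matrices in \<open>\<Delta>\<close>, by the chain rule for
  \<open>F0 (X *v \<beta>) y\<close>.\<close>

theorem prediction_has_derivative:
  fixes X :: "real^'p^'n" and J :: "real^'p \<Rightarrow> ereal"
  assumes J: "proper_fun J" "convex_fun J"
    and ps: "partial_smoothness_manifolds J \<M>" "finite (manifold_family J \<M>)"
    and F: "\<And>\<beta> y. F \<beta> y = F0 (X *v \<beta>) y"
    and sol: "\<And>y. is_solution F J y (\<beta>hat y)"
    and muhat: "\<And>y. \<mu>hat y = X *v \<beta>hat y"
    and C: "cond_O F J \<M>" "cond_sconv F0" "cond_F F" "twice_differentiable_fst F0" "cond_L F0"
    and G_null: "non_injectivity_set F J \<M> \<in> null_sets lebesgue"
    and Delta: "is_Delta X F0 F J \<M> \<Delta>"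
  obtains N where "N \<in> null_sets lebesgue" "\<And>y. y \<notin> N \<Longrightarrow> (\<mu>hat has_derivative (\<lambda>h. \<Delta> y *v h)) (at y)"
proof -
  obtain N where N: "N \<in> null_sets lborel"
    "\<And>y \<beta> K \<epsilon> r. \<lbrakk>y \<notin> N; is_solution F J y \<beta>; subdiff J \<beta> \<noteq> {};
      ((\<lambda>y. grad (\<lambda>b. F b y) \<beta>) has_derivative (\<lambda>h. K *v h)) (at y); 0 < \<epsilon>; 0 < r\<rbrakk> \<Longrightarrow>
      \<forall>\<^sub>F y' in nhds y. \<exists>\<beta>'. \<beta>' \<in> stratum J \<M> (\<M> \<beta>) \<and> dist \<beta>' \<beta> < r \<and> is_solution F J y' \<beta>' \<and>
        norm (grad (\<lambda>b. F b y) \<beta>' - grad (\<lambda>b. F b y') \<beta>' - K *v (y - y')) \<le> \<epsilon> * norm (y - y')"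
    by (rule generic_nearby_solutions[OF J(1) ps(2) C(1) C(3)]) (rule that)
  obtain L where L: "L > 0" "\<And>y z b c. is_solution F J y b \<Longrightarrow> is_solution F J z c \<Longrightarrow>
    norm (X *v b - X *v c) \<le> L * norm (y - z)"
    by (rule prediction_lipschitz[OF J F C(2) C(4) C(5)]) (rule that)
  have unique: "\<mu>hat y = X *v b" if "is_solution F J y b" for y b
    using L(2)[OF sol[of y] that] by (simp add: muhat)
  have F2: "Ck_on 2 (\<lambda>b. F b y) UNIV" for y using C(3) unfolding cond_F_def by blast
  have Fd: "(\<lambda>b. F b y) differentiable (at b)" for y b using Ck2_differentiable[OF F2] by blast
  have F0d: "(\<lambda>m. F0 m y) differentiable (at m)" and F0dd: "grad (\<lambda>m. F0 m y) differentiable (at m)" for m y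
    using C(4) unfolding twice_differentiable_fst_def by blast+
  have Dd: "(\<lambda>z. grad (\<lambda>a. F0 a z) m) differentiable (at y)" for m y
    using C(5) unfolding cond_L_def by blast
  have Feq: "(\<lambda>b. F b y) = (\<lambda>b. F0 (X *v b) y)" for y by (simp add: F)
  have gF: "grad (\<lambda>b. F b y) b = transpose X *v grad (\<lambda>m. F0 m y) (X *v b)" for b y
    unfolding Feq by (rule grad_compose_matrix[OF F0d])
  have hF: "hess (\<lambda>b. F b y) b = transpose X ** hess (\<lambda>m. F0 m y) (X *v b) ** X" for b y
  proof -
    have "((\<lambda>b. grad (\<lambda>m. F0 m y) (X *v b)) has_derivative (\<lambda>h. hess (\<lambda>m. F0 m y) (X *v b) *v (X *v h))) (at b)"
      by (rule has_derivative_compose[OF bounded_linear_imp_has_derivative[OF matrix_vector_mul_bounded_linear]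
            hess_has_derivative[OF F0dd]])
    from bounded_linear.has_derivative[OF matrix_vector_mul_bounded_linear this, of "transpose X"]
    have "(grad (\<lambda>b. F b y) has_derivative
        (\<lambda>h. transpose X *v (hess (\<lambda>m. F0 m y) (X *v b) *v (X *v h)))) (at b)"
      unfolding gF[abs_def] .
    from has_derivative_unique[OF this hess_has_derivative[OF Ck2_grad_differentiable[OF F2]]]
    show ?thesis unfolding matrix_eq by (metis matrix_vector_mul_assoc)
  qed
  let ?H = "transition_space F J \<M>" and ?G = "non_injectivity_set F J \<M>"
  show thesis
  proof (rule that)
    have "?H \<in> null_sets lborel" by (rule transition_space_null[OF J(1) ps(2) C(1) C(3)])
    then show "N \<union> ?H \<union> ?G \<in> null_sets lebesgue"
      by (rule null_sets.Un[OF null_sets.Un[OF null_sets_completionI[OF N(1)] null_sets_completionI] G_null])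
    fix y assume y: "y \<notin> N \<union> ?H \<union> ?G"
    then obtain \<beta> where \<beta>: "is_solution F J y \<beta>" "restricted_positive_definite F J \<M> \<beta> y"
      "\<Delta> y = Delta_at X F0 J \<M> \<beta> y"
      using Delta unfolding is_Delta_def by blast
    let ?M = "\<M> \<beta>" and ?\<mu> = "X *v \<beta>"
    have ne: "subdiff J \<beta> \<noteq> {}" using solution_subgradient[OF J \<beta>(1) Fd] by blast
    have psm: "partly_smooth_at J \<beta> ?M" using ps(1) ne unfolding partial_smoothness_manifolds_def by blast
    then have sub: "C2_submanifold_around ?M \<beta>" and tan: "tangent_space ?M \<beta> = T_space J \<beta>"
      unfolding partly_smooth_at_def by blast+
    obtain g where g: "Ck_on 2 g UNIV" "\<forall>\<^sub>F x in nhds \<beta>. x \<in> ?M \<longrightarrow> J x = ereal (g x)"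
      using psm unfolding partly_smooth_at_def by blast
    obtain G where G: "open G" "\<beta> \<in> G" "\<And>x. x \<in> G \<Longrightarrow> x \<in> ?M \<Longrightarrow> J x = ereal (g x)"
      using g(2) unfolding eventually_nhds by blast
    obtain U V :: "(real^'p) set" and \<Psi> \<Phi> :: "real^'p \<Rightarrow> real^'p" and E where chart: "\<beta> \<in> ?M" "open U" "\<beta> \<in> U" "open V" "subspace E" "homeomorphism U V \<Psi> \<Phi>"
      "Ck_on 2 \<Psi> U" "Ck_on 2 \<Phi> V" "\<Psi> ` (U \<inter> ?M) = V \<inter> E"
      using sub unfolding C2_submanifold_around_def by metis
    interpret C2_chart ?M \<beta> U V \<Psi> \<Phi> E by standard (fact chart)+
    have S: "subspace (S_space J \<beta>)"
      unfolding S_space_def by (rule Lin_subspace[OF closed_convex_subdiff(2)[OF J(1)] ne])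
    have Tc: "orthogonal_comp T = S_space J \<beta>"
      unfolding tan T_space_def by (rule orthogonal_comp_self[OF S])
    define D0 where "D0 = jacobian (\<lambda>z. grad (\<lambda>m. F0 m z) ?\<mu>) (at y)"
    define K where "K = transpose X ** D0"
    define H0 where "H0 = hess (\<lambda>m. F0 m y) ?\<mu>"
    define v where "v = Q *v grad (\<lambda>b. F b y) \<beta>"
    let ?rJ = "riem_hess ?M (\<lambda>b. real_of_ereal (J b)) \<beta>"
    define A where "A = transpose (X ** P) ** H0 ** (X ** P)
        + matrix (\<lambda>\<xi>. weingarten ?M \<beta> (P *v \<xi>) v) + matrix ?rJ"
    \<comment> \<open>the normal space of the manifold is \<open>S_space J \<beta>\<close>, so the normal
      part of the gradient of \<open>F\<close> is the vector in \<open>\<Delta>\<close>\<close>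
    have v_eq: "transpose (X ** proj (S_space J \<beta>)) *v grad (\<lambda>m. F0 m y) ?\<mu> = v"
      unfolding v_def Tc gF matrix_transpose_mul proj_transpose[OF S] by (simp only: matrix_vector_mul_assoc)
    have \<Delta>: "\<Delta> y = - (X ** P ** pinv A ** transpose (X ** P) ** D0)"
      unfolding \<beta>(3) Delta_at_def Let_def A_def D0_def H0_def tan[symmetric] v_eq ..
    have extF: "C2_extension ?M \<beta> (\<lambda>b. F b y) (\<lambda>b. F b y)" unfolding C2_extension_def using F2 by simp
    have extJ: "C2_extension ?M \<beta> (\<lambda>b. real_of_ereal (J b)) g"
      unfolding C2_extension_def using g by (auto elim!: eventually_mono)
    have A: "A *v \<xi> = riem_hess ?M (\<lambda>b. F b y) \<beta> \<xi> + ?rJ \<xi>" for \<xi>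
    proof -
      have "matrix ?rJ *v \<xi> = ?rJ \<xi>"
        using fun_cong[OF matrix_vector_mul(2)[OF riem_hess_linear[OF extJ]]] .
      moreover have "matrix (\<lambda>\<xi>. weingarten ?M \<beta> (P *v \<xi>) v) *v \<xi> = weingarten ?M \<beta> (P *v \<xi>) v"
        using fun_cong[OF matrix_vector_mul(2)[OF weingarten_linear[OF Q_in]]] unfolding v_def .
      moreover have "(transpose (X ** P) ** H0 ** (X ** P)) *v \<xi> = P *v (hess (\<lambda>b. F b y) \<beta> *v (P *v \<xi>))"
        unfolding hF H0_def matrix_transpose_mul proj_transpose[OF T]
        by (simp only: matrix_vector_mul_assoc matrix_mul_assoc)
      ultimately show ?thesis
        unfolding A_def riem_hess_eq[OF extF] v_def[symmetric]
        by (simp only: matrix_vector_mult_add_rdistrib)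
    qed
    have pos: "(A *v \<xi>) \<bullet> \<xi> > 0" if "\<xi> \<in> T" "\<xi> \<noteq> 0" for \<xi>
      using \<beta>(2) that unfolding restricted_positive_definite_def A tan by blast
    have ran: "A *v \<xi> \<in> T" for \<xi>
      unfolding A by (intro subspace_add[OF T] riem_hess_in[OF extF] riem_hess_in[OF extJ])
    have ext: "A *v (P *v \<xi>) = A *v \<xi>" for \<xi>
      unfolding A riem_hess_proj[OF extF] riem_hess_proj[OF extJ] ..
    note pinv = pinv_definite[OF T ran ext pos]
    have \<Delta>h: "\<Delta> y *v h = - (X *v (pinv A *v (K *v h)))" for h
    proof -
      have "X ** P ** pinv A ** transpose (X ** P) ** D0 = X ** (P ** pinv A ** P) ** K"
        unfolding K_def matrix_transpose_mul proj_transpose[OF T] by (simp only: matrix_mul_assoc)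
      also have "P ** pinv A ** P = pinv A" using pinv(3,4) by simp
      finally have "\<Delta> y = - (X ** pinv A ** K)" unfolding \<Delta> by simp
      moreover have "(- B) *v h = - (B *v h)" for B :: "real^'n^'n"
        using matrix_vector_mult_diff_rdistrib[of 0 B h] by simp
      ultimately show ?thesis by (simp only: matrix_vector_mul_assoc matrix_mul_assoc)
    qed
    have K: "((\<lambda>y. grad (\<lambda>b. F b y) \<beta>) has_derivative (\<lambda>h. K *v h)) (at y)"
    proof -
      have "((\<lambda>z. grad (\<lambda>m. F0 m z) ?\<mu>) has_derivative (\<lambda>h. D0 *v h)) (at y)"
        using Dd unfolding D0_def jacobian_works .
      from bounded_linear.has_derivative[OF matrix_vector_mul_bounded_linear this, of "transpose X"]
      show ?thesis unfolding gF K_def by (simp only: matrix_vector_mul_assoc)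
    qed
    have near: "\<forall>\<^sub>F y' in nhds y. \<exists>\<beta>'. \<beta>' \<in> ?M \<and> dist \<beta>' \<beta> < r \<and> is_solution F J y' \<beta>' \<and>
        norm (grad (\<lambda>b. F b y) \<beta>' - grad (\<lambda>b. F b y') \<beta>' - K *v (y - y')) \<le> \<epsilon> * norm (y - y')"
      if "0 < \<epsilon>" "0 < r" for \<epsilon> r :: real
    proof -
      have "\<beta>' \<in> ?M" if "\<beta>' \<in> stratum J \<M> ?M" for \<beta>'
      proof -
        have "partly_smooth_at J \<beta>' (\<M> \<beta>')" "\<M> \<beta>' = ?M"
          using that ps(1) unfolding stratum_def partial_smoothness_manifolds_def by blast+
        then show ?thesis unfolding partly_smooth_at_def C2_submanifold_around_def by simp
      qed
      then show ?thesis
        using N(2)[OF _ \<beta>(1) ne K that] y by (auto elim!: eventually_mono)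
    qed
    show "(\<mu>hat has_derivative (\<lambda>h. \<Delta> y *v h)) (at y)"
      unfolding has_derivative_at_alt
    proof (intro conjI matrix_vector_mul_bounded_linear allI impI)
      fix e :: real assume e: "0 < e"
      obtain k where k: "0 \<le> k" "\<And>x. norm (X *v x) \<le> norm x * k"
        using bounded_linear.nonneg_bounded[OF matrix_vector_mul_bounded_linear, of X] by blast
      have "0 < e / (k + 1)" using e k by simp
      from solution_expansion[OF F2 g(1) G \<beta>(1) A pos near this]
      have "\<forall>\<^sub>F y' in nhds y. norm (\<mu>hat y' - \<mu>hat y - \<Delta> y *v (y' - y)) \<le> e * norm (y' - y)"
      proof (rule eventually_mono)
        fix y' assume "\<exists>\<beta>'. is_solution F J y' \<beta>' \<and> norm (\<beta>' - \<beta> + pinv A *v (K *v (y' - y))) \<le> e / (k + 1) * norm (y' - y)"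
        then obtain b where b: "is_solution F J y' b" "norm (b - \<beta> + pinv A *v (K *v (y' - y))) \<le> e / (k + 1) * norm (y' - y)"
          by blast
        have "\<mu>hat y' - \<mu>hat y - \<Delta> y *v (y' - y) = X *v (b - \<beta> + pinv A *v (K *v (y' - y)))"
          unfolding unique[OF b(1)] unique[OF \<beta>(1)] \<Delta>h
          by (simp add: matrix_vector_right_distrib matrix_vector_mult_diff_distrib)
        also have "norm \<dots> \<le> norm (b - \<beta> + pinv A *v (K *v (y' - y))) * k" by (rule k(2))
        also have "\<dots> \<le> (e / (k + 1) * norm (y' - y)) * k" by (rule mult_right_mono[OF b(2) k(1)])
        also have "\<dots> \<le> e * norm (y' - y)"
          using e k(1) by (simp add: field_simps mult_left_mono)
        finally show "norm (\<mu>hat y' - \<mu>hat y - \<Delta> y *v (y' - y)) \<le> e * norm (y' - y)" .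
      qed
      then show "\<exists>d>0. \<forall>y'. norm (y' - y) < d \<longrightarrow> norm (\<mu>hat y' - \<mu>hat y - \<Delta> y *v (y' - y)) \<le> e * norm (y' - y)"
        unfolding eventually_nhds_metric dist_norm .
    qed
  qed
qed

section \<open>Integration by parts for Lipschitz functions\<close>

lemma lborel_integral_translate:
  fixes f :: "'a::euclidean_space \<Rightarrow> real"
  shows "f \<in> borel_measurable borel \<Longrightarrow> (LINT x|lborel. f (x + c)) = (LINT x|lborel. f x)"
  by (subst (2) lborel_distr_plus[of c, symmetric], subst integral_distr) (auto simp: add.commute)

lemma integrable_indicator_cball:
  "integrable lborel (\<lambda>x :: 'a::euclidean_space. C * indicat_real (cball 0 R) x)"
  "integrable lebesgue (\<lambda>x :: 'a::euclidean_space. C * indicat_real (cball 0 R) x)"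
  using emeasure_lborel_cball_finite[of 0 R]
  by (intro integrable_mult_right integrable_real_indicator; auto)+

definition difference_quotient :: "('a::real_normed_vector \<Rightarrow> real) \<Rightarrow> 'a \<Rightarrow> nat \<Rightarrow> 'a \<Rightarrow> real" where
  "difference_quotient w b n x = (w (x + (1 / real (Suc n)) *\<^sub>R b) - w x) * real (Suc n)"

lemma difference_quotient_tendsto:
  assumes "((\<lambda>t. w (x + t *\<^sub>R b)) has_real_derivative w') (at 0)"
  shows "(\<lambda>n. difference_quotient w b n x) \<longlonglongrightarrow> w'"
proof -
  have "((\<lambda>t. (w (x + t *\<^sub>R b) - w x) / t) \<longlongrightarrow> w') (at 0)"
    using assms unfolding DERIV_def by simp
  moreover have "filterlim (\<lambda>n. 1 / real (Suc n)) (at 0) sequentially"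
    unfolding filterlim_at using LIMSEQ_inverse_real_of_nat by (auto simp: inverse_eq_divide)
  ultimately have "(\<lambda>n. (w (x + (1 / real (Suc n)) *\<^sub>R b) - w x) / (1 / real (Suc n))) \<longlonglongrightarrow> w'"
    by (rule filterlim_compose)
  then show ?thesis unfolding difference_quotient_def by (simp add: mult.commute)
qed

lemma difference_quotient_bound:
  assumes "\<And>x t. \<bar>w (x + t *\<^sub>R b) - w x\<bar> \<le> L * \<bar>t\<bar>"
  shows "\<bar>difference_quotient w b n x\<bar> \<le> L"
proof -
  have "\<bar>difference_quotient w b n x\<bar> = \<bar>w (x + (1 / real (Suc n)) *\<^sub>R b) - w x\<bar> * real (Suc n)"
    unfolding difference_quotient_def by (simp add: abs_mult)
  also have "\<dots> \<le> (L * \<bar>1 / real (Suc n)\<bar>) * real (Suc n)"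
    by (intro mult_right_mono assms) simp
  finally show ?thesis by simp
qed

lemma difference_quotient_measurable:
  fixes w :: "'a::euclidean_space \<Rightarrow> real"
  assumes "continuous_on UNIV w"
  shows "difference_quotient w b n \<in> borel_measurable borel"
    "difference_quotient w b n \<in> borel_measurable lebesgue"
proof -
  have "continuous_on UNIV (difference_quotient w b n)"
    unfolding difference_quotient_def[abs_def]
    by (intro continuous_intros continuous_on_compose2[OF assms] assms) auto
  then show 1: "difference_quotient w b n \<in> borel_measurable borel"
    by (rule borel_measurable_continuous_onI)
  then show "difference_quotient w b n \<in> borel_measurable lebesgue"
    by (intro measurable_completion) simp
qed

lemma directional_derivative_measurable:
  fixes w w' :: "'a::euclidean_space \<Rightarrow> real"
  assumes cont: "continuous_on UNIV w"
    and deriv: "AE x in lebesgue. ((\<lambda>t. w (x + t *\<^sub>R b)) has_real_derivative w' x) (at 0)"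
  shows "w' \<in> borel_measurable lebesgue"
proof (rule borel_measurable_AE)
  show "(\<lambda>x. lim (\<lambda>n. difference_quotient w b n x)) \<in> borel_measurable lebesgue"
    by (rule borel_measurable_lim_metric) (rule difference_quotient_measurable[OF cont])
  show "AE x in lebesgue. lim (\<lambda>n. difference_quotient w b n x) = w' x"
    using deriv by eventually_elim (rule limI[OF difference_quotient_tendsto])
qed

text \<open>Difference quotients have integral zero by translation invariance; they converge to the derivative
  boundedly, and all of them vanish off one ball.\<close>

lemma integral_directional_derivative_zero:
  fixes w w' :: "'a::euclidean_space \<Rightarrow> real"
  assumes cont: "continuous_on UNIV w"
    and lip: "\<And>x t. \<bar>w (x + t *\<^sub>R b) - w x\<bar> \<le> L * \<bar>t\<bar>"
    and supp: "\<And>x. R < norm x \<Longrightarrow> w x = 0"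
    and deriv: "AE x in lebesgue. ((\<lambda>t. w (x + t *\<^sub>R b)) has_real_derivative w' x) (at 0)"
  shows "integrable lebesgue w'" "(LINT x|lebesgue. w' x) = 0"
proof -
  let ?d = "difference_quotient w b"
  note dm = difference_quotient_measurable[OF cont, of b]
  have lim: "AE x in lebesgue. (\<lambda>n. ?d n x) \<longlonglongrightarrow> w' x"
    using deriv by eventually_elim (rule difference_quotient_tendsto)
  have bound: "norm (?d n x) \<le> L * indicat_real (cball 0 (R + norm b)) x" for n x
  proof (cases "norm x \<le> R + norm b")
    case True
    then show ?thesis using difference_quotient_bound[OF lip, of n x] by simp
  next
    case False
    have "norm ((1 / real (Suc n)) *\<^sub>R b) \<le> norm b" by (simp add: divide_le_eq mult_le_cancel_left1)
    then have "R < norm (x + (1 / real (Suc n)) *\<^sub>R b)" "R < norm x"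
      using False norm_diff_ineq[of x "(1 / real (Suc n)) *\<^sub>R b"] norm_ge_zero[of b] by linarith+
    then show ?thesis using False unfolding difference_quotient_def by (simp add: supp)
  qed
  have m: "w' \<in> borel_measurable lebesgue" by (rule directional_derivative_measurable[OF cont deriv])
  note dom = integrable_dominated_convergence[OF m dm(2) integrable_indicator_cball(2) lim AE_I2[OF bound]]
    integral_dominated_convergence[OF m dm(2) integrable_indicator_cball(2) lim AE_I2[OF bound]]
  show "integrable lebesgue w'" by (rule dom(1))
  have wm: "w \<in> borel_measurable borel" using cont by (rule borel_measurable_continuous_onI)
  have wi: "integrable lborel w"
  proof -
    have "bounded (w ` cball 0 R)"
      by (rule compact_imp_bounded[OF compact_continuous_image[OF continuous_on_subset[OF cont subset_UNIV] compact_cball]])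
    then obtain C where C: "\<forall>y\<in>w ` cball 0 R. norm y \<le> C" unfolding bounded_iff by blast
    have "norm (w x) \<le> norm (C * indicat_real (cball 0 R) x)" for x
    proof (cases "norm x \<le> R")
      case True
      then have "norm (w x) \<le> C" using C by auto
      then show ?thesis using True by simp
    qed (simp add: supp)
    then show ?thesis
      using wm by (intro Bochner_Integration.integrable_bound[OF integrable_indicator_cball(1)[of C R]] AE_I2) simp_all
  qed
  have zero: "(LINT x|lebesgue. ?d n x) = 0" for n
  proof -
    have i': "integrable lborel (\<lambda>x. w (x + (1 / real (Suc n)) *\<^sub>R b))"
    proof -
      have "integrable (distr lborel borel ((+) ((1 / real (Suc n)) *\<^sub>R b))) w"
        unfolding lborel_distr_plus by (rule wi)
      then show ?thesis
        by (subst (asm) integrable_distr_eq) (use wm in \<open>auto simp: add.commute\<close>)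
    qed
    have "(LINT x|lebesgue. ?d n x) = (LINT x|lborel. ?d n x)"
      by (rule integral_completion) (use dm in simp)
    also have "\<dots> = 0"
      unfolding difference_quotient_def using wi i' lborel_integral_translate[OF wm]
      by (simp add: Bochner_Integration.integral_diff)
    finally show ?thesis .
  qed
  show "(LINT x|lebesgue. w' x) = 0"
    using dom(2) unfolding zero by (rule LIMSEQ_unique) simp
qed

section \<open>Weak derivatives of Lipschitz functions\<close>

lemma test_function_support:
  assumes "test_function \<phi>"
  obtains R where "\<And>x. R < norm x \<Longrightarrow> \<phi> x = 0"
proof -
  have "bounded {x. \<phi> x \<noteq> 0}"
    using assms bounded_subset[OF compact_imp_bounded closure_subset] unfolding test_function_def by blast
  then obtain R where "\<forall>x\<in>{x. \<phi> x \<noteq> 0}. norm x \<le> R" unfolding bounded_iff by blast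
  then show thesis by (intro that[of R]) force
qed

lemma test_function_derivative:
  assumes "test_function \<phi>"
  shows "\<phi> differentiable (at x)" "continuous_on UNIV \<phi>"
    "b \<in> Basis \<Longrightarrow> continuous_on UNIV (\<lambda>x. frechet_derivative \<phi> (at x) b)"
proof -
  have 0: "Ck_on 0 \<phi> UNIV" and 1: "Ck_on (Suc 0) \<phi> UNIV" using assms unfolding test_function_def by blast+
  show "\<phi> differentiable (at x)" "continuous_on UNIV \<phi>"
    "b \<in> Basis \<Longrightarrow> continuous_on UNIV (\<lambda>x. frechet_derivative \<phi> (at x) b)"
    using 0 1 by simp_all
qed

lemma line_derivative:
  fixes f :: "'a::real_normed_vector \<Rightarrow> real"
  assumes "f differentiable (at (x + s *\<^sub>R b))"
  shows "((\<lambda>t. f (x + t *\<^sub>R b)) has_real_derivative frechet_derivative f (at (x + s *\<^sub>R b)) b) (at s)"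
proof -
  have f: "(f has_derivative frechet_derivative f (at (x + s *\<^sub>R b))) (at (x + s *\<^sub>R b))"
    using assms frechet_derivative_works by blast
  interpret bounded_linear "frechet_derivative f (at (x + s *\<^sub>R b))"
    by (rule has_derivative_bounded_linear[OF f])
  have "((\<lambda>t. x + t *\<^sub>R b) has_derivative (\<lambda>t. t *\<^sub>R b)) (at s)"
    by (auto intro!: derivative_eq_intros)
  from has_derivative_compose[OF this f] show ?thesis
    by (simp add: has_field_derivative_def scaleR mult_commute_abs)
qed

lemma line_lipschitz:
  fixes f :: "'a::real_normed_vector \<Rightarrow> real"
  assumes d: "\<And>x. f differentiable (at x)" and C: "\<And>x. \<bar>frechet_derivative f (at x) b\<bar> \<le> C"
  shows "\<bar>f (x + t *\<^sub>R b) - f x\<bar> \<le> C * \<bar>t\<bar>"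
  using field_differentiable_bound[of UNIV "\<lambda>t. f (x + t *\<^sub>R b)" _ C t 0, OF convex_UNIV line_derivative[OF d] ] C
  by simp

lemma test_function_line_lipschitz:
  fixes \<phi> :: "'a::euclidean_space \<Rightarrow> real"
  assumes \<phi>: "test_function \<phi>" and b: "b \<in> Basis"
  obtains C where "\<And>x t. \<bar>\<phi> (x + t *\<^sub>R b) - \<phi> x\<bar> \<le> C * \<bar>t\<bar>"
    "\<And>x. \<bar>frechet_derivative \<phi> (at x) b\<bar> \<le> C"
proof -
  obtain R where R: "\<And>x. R < norm x \<Longrightarrow> \<phi> x = 0" by (rule test_function_support[OF \<phi>]) blast
  note d = test_function_derivative[OF \<phi>]
  let ?D = "\<lambda>x. frechet_derivative \<phi> (at x) b"
  have "bounded (?D ` cball 0 R)"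
    by (rule compact_imp_bounded[OF compact_continuous_image[OF continuous_on_subset[OF d(3)[OF b] subset_UNIV] compact_cball]])
  then obtain C where C: "\<forall>y\<in>?D ` cball 0 R. norm y \<le> C" unfolding bounded_iff by blast
  have bd: "\<bar>?D x\<bar> \<le> max C 0" for x
  proof (cases "norm x \<le> R")
    case True
    then have "norm (?D x) \<le> C" using C by auto
    then show ?thesis by simp
  next
    case False
    have "(\<phi> has_derivative (\<lambda>_. 0)) (at x)"
      by (rule has_derivative_transform_within_open[of "\<lambda>_. 0" _ _ _ "- cball 0 R"])
        (use False R in \<open>auto simp: open_Compl\<close>)
    then have "frechet_derivative \<phi> (at x) = (\<lambda>_. 0)" by (metis frechet_derivative_at)
    then show ?thesis by simp
  qed
  show thesis by (rule that[OF line_lipschitz[OF d(1) bd] bd])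
qed

lemma continuous_locally_integrable:
  fixes f :: "'a::euclidean_space \<Rightarrow> real"
  assumes "continuous_on UNIV f" shows "locally_integrable f"
  unfolding locally_integrable_def
proof (intro allI impI)
  fix K :: "'a set" assume K: "compact K"
  have m: "(\<lambda>x. indicator K x *\<^sub>R f x) \<in> borel_measurable lborel"
    using borel_measurable_continuous_onI[OF assms] borel_compact[OF K]
    by (intro borel_measurable_scaleR borel_measurable_indicator) simp_all
  have "integrable lborel (\<lambda>x. indicator K x *\<^sub>R f x)"
    by (rule borel_integrable_compact[OF K continuous_on_subset[OF assms subset_UNIV]])
  then show "set_integrable lebesgue K f"
    unfolding set_integrable_def by (subst integrable_completion[OF m])
qed

lemma bounded_locally_integrable:
  fixes f :: "'a::euclidean_space \<Rightarrow> real"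
  assumes f: "f \<in> borel_measurable lebesgue" and C: "AE x in lebesgue. \<bar>f x\<bar> \<le> C"
  shows "locally_integrable f"
  unfolding locally_integrable_def set_integrable_def
proof (intro allI impI)
  fix K :: "'a set" assume K: "compact K"
  obtain R where "\<forall>x\<in>K. norm x \<le> R" using compact_imp_bounded[OF K] unfolding bounded_iff by blast
  then have R: "K \<subseteq> cball 0 R" by auto
  show "integrable lebesgue (\<lambda>x. indicator K x *\<^sub>R f x)"
  proof (rule Bochner_Integration.integrable_bound[OF integrable_indicator_cball(2)[of C R]])
    show "(\<lambda>x. indicator K x *\<^sub>R f x) \<in> borel_measurable lebesgue"
      using f borel_compact[OF K] by (intro borel_measurable_scaleR borel_measurable_indicator) auto
    show "AE x in lebesgue. norm (indicator K x *\<^sub>R f x) \<le> norm (C * indicat_real (cball 0 R) x)"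
      using C
    proof eventually_elim
      case (elim x)
      show ?case
      proof (cases "x \<in> K")
        case True
        with R have "x \<in> cball 0 R" by blast
        then show ?thesis using True elim by simp
      qed simp
    qed
  qed
qed

lemma integrable_times_test_function:
  fixes f \<phi> :: "'a::euclidean_space \<Rightarrow> real"
  assumes f: "locally_integrable f" and \<phi>: "\<phi> \<in> borel_measurable lebesgue"
    and C: "\<And>x. \<bar>\<phi> x\<bar> \<le> C" and R: "\<And>x. R < norm x \<Longrightarrow> \<phi> x = 0"
  shows "integrable lebesgue (\<lambda>x. f x * \<phi> x)"
proof -
  have i: "integrable lebesgue (\<lambda>x. indicat_real (cball 0 R) x *\<^sub>R f x)"
    using f compact_cball[of 0 R] unfolding locally_integrable_def set_integrable_def by blast
  have "integrable lebesgue (\<lambda>x. (indicat_real (cball 0 R) x *\<^sub>R f x) * \<phi> x)"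
  proof (rule Bochner_Integration.integrable_bound[OF integrable_mult_right[OF i, of C]])
    show "(\<lambda>x. (indicat_real (cball 0 R) x *\<^sub>R f x) * \<phi> x) \<in> borel_measurable lebesgue"
      by (intro borel_measurable_times borel_measurable_integrable[OF i] \<phi>)
    show "AE x in lebesgue. norm ((indicat_real (cball 0 R) x *\<^sub>R f x) * \<phi> x) \<le> norm (C * (indicat_real (cball 0 R) x *\<^sub>R f x))"
    proof (rule AE_I2)
      fix x
      have "\<bar>\<phi> x\<bar> \<le> \<bar>C\<bar>" using C[of x] by linarith
      then have "\<bar>\<phi> x\<bar> * \<bar>indicat_real (cball 0 R) x *\<^sub>R f x\<bar> \<le> \<bar>C\<bar> * \<bar>indicat_real (cball 0 R) x *\<^sub>R f x\<bar>"
        by (rule mult_right_mono) simp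
      then show "norm ((indicat_real (cball 0 R) x *\<^sub>R f x) * \<phi> x) \<le> norm (C * (indicat_real (cball 0 R) x *\<^sub>R f x))"
        by (simp only: real_norm_def abs_mult[symmetric] mult.commute)
    qed
  qed
  moreover have "(\<lambda>x. (indicat_real (cball 0 R) x *\<^sub>R f x) * \<phi> x) = (\<lambda>x. f x * \<phi> x)"
  proof
    show "(indicat_real (cball 0 R) x *\<^sub>R f x) * \<phi> x = f x * \<phi> x" for x
      using R[of x] by (cases "norm x \<le> R") auto
  qed
  ultimately show ?thesis by (simp only:)
qed

text \<open>The product with a test function is Lipschitz along the direction and has bounded support, so
  the integral of its derivative is zero; that is the defining identity of the weak derivative.\<close>

theorem lipschitz_weak_partial:
  fixes f f' :: "'a::euclidean_space \<Rightarrow> real"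
  assumes lip: "\<And>x y. \<bar>f x - f y\<bar> \<le> L * norm (x - y)" and b: "b \<in> Basis"
    and deriv: "AE x in lebesgue. ((\<lambda>t. f (x + t *\<^sub>R b)) has_real_derivative f' x) (at 0)"
  shows "weak_partial f b f'"
  unfolding weak_partial_def
proof (intro conjI allI impI)
  have L: "0 \<le> L" using order_trans[OF abs_ge_zero lip[of b 0]] b by (simp add: zero_le_mult_iff)
  have cont: "continuous_on UNIV f"
    by (rule lipschitz_on_continuous_on[of L]) (use lip L in \<open>auto simp: lipschitz_on_def dist_norm\<close>)
  show fi: "locally_integrable f" by (rule continuous_locally_integrable[OF cont])
  have lip': "\<bar>f (x + t *\<^sub>R b) - f x\<bar> \<le> L * \<bar>t\<bar>" for x t
    using lip[of "x + t *\<^sub>R b" x] b by simp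
  show f'i: "locally_integrable f'"
  proof (rule bounded_locally_integrable[OF directional_derivative_measurable[OF cont deriv]])
    show "AE x in lebesgue. \<bar>f' x\<bar> \<le> L"
      using deriv
    proof eventually_elim
      case (elim x)
      show ?case
        by (rule LIMSEQ_le_const2[OF tendsto_rabs[OF difference_quotient_tendsto[OF elim]]])
          (use difference_quotient_bound[OF lip'] in blast)
    qed
  qed
  fix \<phi> :: "'a \<Rightarrow> real" assume \<phi>: "test_function \<phi>"
  note d = test_function_derivative[OF \<phi>]
  obtain R where R: "\<And>x. R < norm x \<Longrightarrow> \<phi> x = 0" by (rule test_function_support[OF \<phi>]) blast
  obtain C where C: "\<And>x t. \<bar>\<phi> (x + t *\<^sub>R b) - \<phi> x\<bar> \<le> C * \<bar>t\<bar>"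
    "\<And>x. \<bar>frechet_derivative \<phi> (at x) b\<bar> \<le> C" by (rule test_function_line_lipschitz[OF \<phi> b]) blast
  let ?D = "\<lambda>x. frechet_derivative \<phi> (at x) b"
  have bounded_on_ball: "\<exists>M. \<forall>x. norm x \<le> R \<longrightarrow> \<bar>g x\<bar> \<le> M" if "continuous_on UNIV g" for g :: "'a \<Rightarrow> real"
  proof -
    have "bounded (g ` cball 0 R)"
      by (rule compact_imp_bounded[OF compact_continuous_image[OF continuous_on_subset[OF that subset_UNIV] compact_cball]])
    then obtain M where "\<forall>y\<in>g ` cball 0 R. norm y \<le> M" unfolding bounded_iff by blast
    then show ?thesis by (intro exI[of _ M]) auto
  qed
  obtain Mf where Mf: "\<And>x. norm x \<le> R \<Longrightarrow> \<bar>f x\<bar> \<le> Mf" using bounded_on_ball[OF cont] by blast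
  obtain M\<phi> where M\<phi>: "\<And>x. norm x \<le> R \<Longrightarrow> \<bar>\<phi> x\<bar> \<le> M\<phi>" using bounded_on_ball[OF d(2)] by blast
  have M\<phi>': "\<bar>\<phi> x\<bar> \<le> \<bar>M\<phi>\<bar>" for x using M\<phi>[of x] R[of x] by (cases "norm x \<le> R") auto
  have D0: "?D x = 0" if "R < norm x" for x
  proof -
    have "(\<phi> has_derivative (\<lambda>_. 0)) (at x)"
      by (rule has_derivative_transform_within_open[of "\<lambda>_. 0" _ _ _ "- cball 0 R"])
        (use that R in \<open>auto simp: open_Compl\<close>)
    then have "frechet_derivative \<phi> (at x) = (\<lambda>_. 0)" by (metis frechet_derivative_at)
    then show ?thesis by simp
  qed
  let ?w = "\<lambda>x. f x * \<phi> x" and ?w' = "\<lambda>x. f' x * \<phi> x + f x * ?D x"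
  have wlip: "\<bar>?w (x + t *\<^sub>R b) - ?w x\<bar> \<le> (\<bar>Mf\<bar> * C + \<bar>M\<phi>\<bar> * L) * \<bar>t\<bar>" for x t
  proof -
    let ?y = "x + t *\<^sub>R b"
    have C0: "0 \<le> C" using C(2)[of x] by linarith
    consider "norm x \<le> R" | "norm ?y \<le> R" | "R < norm x" "R < norm ?y" by linarith
    then show ?thesis
    proof cases
      case 1
      have "?w ?y - ?w x = f x * (\<phi> ?y - \<phi> x) + \<phi> ?y * (f ?y - f x)" by (simp add: algebra_simps)
      also have "\<bar>\<dots>\<bar> \<le> \<bar>f x\<bar> * \<bar>\<phi> ?y - \<phi> x\<bar> + \<bar>\<phi> ?y\<bar> * \<bar>f ?y - f x\<bar>"
        by (rule order_trans[OF abs_triangle_ineq]) (simp add: abs_mult)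
      also have "\<dots> \<le> \<bar>Mf\<bar> * (C * \<bar>t\<bar>) + \<bar>M\<phi>\<bar> * (L * \<bar>t\<bar>)"
        using Mf[OF 1] M\<phi>'[of ?y] C(1)[of x t] lip'[of x t] by (intro add_mono mult_mono) auto
      finally show ?thesis by (simp add: algebra_simps)
    next
      case 2
      have "?w ?y - ?w x = f ?y * (\<phi> ?y - \<phi> x) + \<phi> x * (f ?y - f x)" by (simp add: algebra_simps)
      also have "\<bar>\<dots>\<bar> \<le> \<bar>f ?y\<bar> * \<bar>\<phi> ?y - \<phi> x\<bar> + \<bar>\<phi> x\<bar> * \<bar>f ?y - f x\<bar>"
        by (rule order_trans[OF abs_triangle_ineq]) (simp add: abs_mult)
      also have "\<dots> \<le> \<bar>Mf\<bar> * (C * \<bar>t\<bar>) + \<bar>M\<phi>\<bar> * (L * \<bar>t\<bar>)"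
        using Mf[OF 2] M\<phi>'[of x] C(1)[of x t] lip'[of x t] by (intro add_mono mult_mono) auto
      finally show ?thesis by (simp add: algebra_simps)
    next
      case 3
      have "0 \<le> \<bar>Mf\<bar> * (C * \<bar>t\<bar>) + \<bar>M\<phi>\<bar> * (L * \<bar>t\<bar>)" using C0 L by (intro add_nonneg_nonneg mult_nonneg_nonneg) auto
      then show ?thesis using 3 by (simp add: R algebra_simps)
    qed
  qed
  have wd: "AE x in lebesgue. ((\<lambda>t. ?w (x + t *\<^sub>R b)) has_real_derivative ?w' x) (at 0)"
    using deriv
  proof eventually_elim
    case (elim x)
    have "((\<lambda>t. \<phi> (x + t *\<^sub>R b)) has_real_derivative ?D x) (at 0)"
      using line_derivative[OF d(1), where x = x and s = 0 and b = b] by simp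
    from DERIV_mult[OF elim this] show ?case by (simp add: mult.commute add.commute)
  qed
  have "(LINT x|lebesgue. ?w' x) = 0"
    by (rule integral_directional_derivative_zero(2)[OF _ wlip _ wd, of R])
      (use cont d(2) R in \<open>auto intro!: continuous_intros\<close>)
  moreover have mb: "g \<in> borel_measurable lebesgue" if "continuous_on UNIV g" for g :: "'a \<Rightarrow> real"
    using borel_measurable_continuous_onI[OF that] by (intro measurable_completion) simp
  have "integrable lebesgue (\<lambda>x. f' x * \<phi> x)"
    by (rule integrable_times_test_function[OF f'i mb[OF d(2)] M\<phi>' R])
  moreover have "integrable lebesgue (\<lambda>x. f x * ?D x)"
    by (rule integrable_times_test_function[OF fi mb[OF d(3)[OF b]] C(2) D0])
  ultimately show "(LINT x|lebesgue. f x * ?D x) = - (LINT x|lebesgue. f' x * \<phi> x)"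
    by (simp add: Bochner_Integration.integral_add)
qed

section \<open>Smooth bump functions and uniqueness of weak derivatives\<close>

text \<open>The derivatives of \<open>exp (- 1 / t)\<close>, extended by zero, are combinations of these
  functions.\<close>

definition flat :: "nat \<Rightarrow> real \<Rightarrow> real" where
  "flat n t = (if 0 < t then (1 / t) ^ n * exp (- (1 / t)) else 0)"

lemma flat_limit: "(flat n \<longlongrightarrow> 0) (at 0)"
proof -
  have "((\<lambda>t::real. (1 / t) ^ n * exp (- (1 / t))) \<longlongrightarrow> 0) (at_right 0)"
  proof -
    have "((\<lambda>s::real. s ^ n / exp s) \<longlongrightarrow> 0) at_top" by (rule tendsto_power_div_exp_0)
    from filterlim_compose[OF this filterlim_inverse_at_top_right]
    show ?thesis by (simp add: exp_minus divide_inverse)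
  qed
  then have "(flat n \<longlongrightarrow> 0) (at_right 0)"
    by (rule Lim_transform_eventually) (auto simp: flat_def eventually_at_right_field intro!: exI[of _ 1])
  moreover have "(flat n \<longlongrightarrow> 0) (at_left 0)"
    by (rule Lim_transform_eventually[OF tendsto_const])
      (auto simp: flat_def eventually_at_left_field intro!: exI[of _ "-1"])
  ultimately show ?thesis by (simp add: filterlim_at_split)
qed

lemma flat_derivative: "(flat n has_real_derivative (flat (n + 2) t - real n * flat (n + 1) t)) (at t)"
proof -
  consider "t < 0" | "t = 0" | "0 < t" by linarith
  then show ?thesis
  proof cases
    case 1
    have "((\<lambda>_. 0) has_real_derivative (flat (n + 2) t - real n * flat (n + 1) t)) (at t)"
      using 1 by (simp add: flat_def)
    then show ?thesis
      by (rule has_field_derivative_transform_within[where d = "- t"]) (use 1 in \<open>auto simp: flat_def dist_real_def\<close>)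
  next
    case 2
    have "((\<lambda>h. (flat n (0 + h) - flat n 0) / h) \<longlongrightarrow> 0) (at 0)"
      by (rule Lim_transform_eventually[OF flat_limit[of "Suc n"]])
        (auto simp: flat_def eventually_at_filter field_simps)
    then show ?thesis using 2 by (simp add: DERIV_def flat_def)
  next
    case 3
    have "((\<lambda>t. (1 / t) ^ n * exp (- (1 / t))) has_real_derivative
        (real n * (1 / t) ^ (n - 1) * (- (1 / t\<^sup>2))) * exp (- (1 / t)) + (exp (- (1 / t)) * (1 / t\<^sup>2)) * (1 / t) ^ n) (at t)"
      using 3 by (auto intro!: derivative_eq_intros simp: power2_eq_square divide_inverse)
    moreover have "real n * (1 / t) ^ (n - 1) * (- (1 / t\<^sup>2)) * exp (- (1 / t)) + (exp (- (1 / t)) * (1 / t\<^sup>2)) * (1 / t) ^ n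
       = flat (n + 2) t - real n * flat (n + 1) t"
      using 3 by (cases n) (auto simp: flat_def power2_eq_square algebra_simps add_divide_distrib)
    ultimately have "((\<lambda>t. (1 / t) ^ n * exp (- (1 / t))) has_real_derivative
       (flat (n + 2) t - real n * flat (n + 1) t)) (at t)" by simp
    then show ?thesis
      by (rule has_field_derivative_transform_within[where d = t]) (use 3 in \<open>auto simp: flat_def dist_real_def\<close>)
  qed
qed

text \<open>A class of functions that is closed under partial derivatives consists of smooth functions.\<close>

inductive flat_poly :: "('a::euclidean_space \<Rightarrow> real) \<Rightarrow> bool" where
  flat: "flat_poly (\<lambda>x. flat n (x \<bullet> c + d))"
| const: "flat_poly (\<lambda>x. r)"
| add: "flat_poly f \<Longrightarrow> flat_poly g \<Longrightarrow> flat_poly (\<lambda>x. f x + g x)"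
| mult: "flat_poly f \<Longrightarrow> flat_poly g \<Longrightarrow> flat_poly (\<lambda>x. f x * g x)"

lemma flat_poly_derivative:
  assumes "flat_poly f"
  shows "\<exists>f'. (\<forall>x. (f has_derivative f' x) (at x)) \<and> (\<forall>b. flat_poly (\<lambda>x. f' x b))"
  using assms
proof induction
  case (flat n c d)
  let ?f' = "\<lambda>x h. (flat (n + 2) (x \<bullet> c + d) - real n * flat (n + 1) (x \<bullet> c + d)) * (h \<bullet> c)"
  have "((\<lambda>x. flat n (x \<bullet> c + d)) has_derivative ?f' x) (at x)" for x
  proof -
    have "((\<lambda>x. x \<bullet> c + d) has_derivative (\<lambda>h. h \<bullet> c)) (at x)"
      by (auto intro!: derivative_eq_intros)
    from has_derivative_compose[OF this flat_derivative[of n "x \<bullet> c + d", unfolded has_field_derivative_def]]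
    show ?thesis by (simp add: mult.commute)
  qed
  moreover have "flat_poly (\<lambda>x. ?f' x b)" for b
  proof -
    have "flat_poly (\<lambda>x. (flat (n + 2) (x \<bullet> c + d) + (- real n) * flat (n + 1) (x \<bullet> c + d)) * (b \<bullet> c))"
      by (intro flat_poly.intros)
    then show ?thesis by simp
  qed
  ultimately show ?case by (intro exI[of _ ?f']) blast
next
  case (const r)
  show ?case by (rule exI[of _ "\<lambda>_ _. 0"]) (auto intro: flat_poly.intros)
next
  case (add f g)
  then obtain f' g' where "\<forall>x. (f has_derivative f' x) (at x)" "\<forall>b. flat_poly (\<lambda>x. f' x b)"
    "\<forall>x. (g has_derivative g' x) (at x)" "\<forall>b. flat_poly (\<lambda>x. g' x b)" by blast
  then show ?case
    by (intro exI[of _ "\<lambda>x h. f' x h + g' x h"]) (auto intro: flat_poly.intros has_derivative_add)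
next
  case (mult f g)
  then obtain f' g' where *: "\<forall>x. (f has_derivative f' x) (at x)" "\<forall>b. flat_poly (\<lambda>x. f' x b)"
    "\<forall>x. (g has_derivative g' x) (at x)" "\<forall>b. flat_poly (\<lambda>x. g' x b)" by blast
  have "flat_poly (\<lambda>x. f x * g' x b + f' x b * g x)" for b
    using * by (intro flat_poly.add flat_poly.mult mult.hyps) blast+
  moreover have "((\<lambda>x. f x * g x) has_derivative (\<lambda>h. f x * g' x h + f' x h * g x)) (at x)" for x
    using * by (intro has_derivative_mult) blast+
  ultimately show ?case
    by (intro exI[of _ "\<lambda>x h. f x * g' x h + f' x h * g x"]) blast
qed

lemma flat_poly_differentiable:
  assumes "flat_poly f"
  shows "f differentiable (at x)" "flat_poly (\<lambda>x. frechet_derivative f (at x) b)"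
proof -
  obtain f' where f': "\<And>x. (f has_derivative f' x) (at x)" "\<And>b. flat_poly (\<lambda>x. f' x b)"
    using flat_poly_derivative[OF assms] by blast
  show "f differentiable (at x)" using f'(1) by (auto simp: differentiable_def)
  have "(\<lambda>x. frechet_derivative f (at x) b) = (\<lambda>x. f' x b)"
    using frechet_derivative_at[OF f'(1)] by metis
  then show "flat_poly (\<lambda>x. frechet_derivative f (at x) b)" using f'(2) by simp
qed

lemma flat_poly_smooth: "flat_poly f \<Longrightarrow> Ck_on k f UNIV"
proof (induction k arbitrary: f)
  case 0
  then show ?case
    using flat_poly_differentiable(1) differentiable_imp_continuous_within
    by (simp add: continuous_on_eq_continuous_within) blast
next
  case (Suc k)
  then show ?case
    unfolding Ck_on.simps by (intro conjI ballI Suc.IH flat_poly_differentiable)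
qed

lemma flat_poly_prod:
  "finite I \<Longrightarrow> (\<And>i. i \<in> I \<Longrightarrow> flat_poly (f i)) \<Longrightarrow> flat_poly (\<lambda>x. \<Prod>i\<in>I. f i x)"
  by (induction I rule: finite_induct) (auto intro: flat_poly.intros)

text \<open>Smooth functions that increase to the indicator of a box.\<close>

definition bump :: "'a::euclidean_space \<Rightarrow> 'a \<Rightarrow> nat \<Rightarrow> 'a \<Rightarrow> real" where
  "bump l u m x = (\<Prod>b\<in>Basis. flat 0 (real (Suc m) * (x \<bullet> b - l \<bullet> b)) * flat 0 (real (Suc m) * (u \<bullet> b - x \<bullet> b)))"

lemma bump_zero: "x \<notin> cbox l u \<Longrightarrow> bump l u m x = 0"
proof (rule ccontr)
  assume "x \<notin> cbox l u" "bump l u m x \<noteq> 0"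
  then have "\<forall>b\<in>Basis. flat 0 (real (Suc m) * (x \<bullet> b - l \<bullet> b)) \<noteq> 0 \<and> flat 0 (real (Suc m) * (u \<bullet> b - x \<bullet> b)) \<noteq> 0"
    unfolding bump_def by (auto simp: prod_zero_iff)
  then have "x \<in> cbox l u"
    unfolding mem_box by (auto simp: flat_def zero_less_mult_iff split: if_splits intro: less_imp_le)
  with \<open>x \<notin> cbox l u\<close> show False by contradiction
qed

lemma bump_test_function: "test_function (bump l u m)"
  unfolding test_function_def
proof (intro conjI allI)
  have "flat_poly (\<lambda>x. flat 0 (real (Suc m) * (x \<bullet> b - l \<bullet> b)))" for b
    using flat_poly.flat[of 0 "real (Suc m) *\<^sub>R b" "- real (Suc m) * (l \<bullet> b)"] by (simp add: algebra_simps)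
  moreover have "flat_poly (\<lambda>x. flat 0 (real (Suc m) * (u \<bullet> b - x \<bullet> b)))" for b
    using flat_poly.flat[of 0 "- real (Suc m) *\<^sub>R b" "real (Suc m) * (u \<bullet> b)"] by (simp add: algebra_simps)
  ultimately show "Ck_on k (bump l u m) UNIV" for k
    unfolding bump_def[abs_def] by (intro flat_poly_smooth flat_poly_prod flat_poly.mult) auto
  have "{x. bump l u m x \<noteq> 0} \<subseteq> cbox l u" using bump_zero by blast
  then show "compact (closure {x. bump l u m x \<noteq> 0})"
    by (metis bounded_cbox bounded_subset compact_closure)
qed

lemma bump_bounds: "0 \<le> bump l u m x" "bump l u m x \<le> 1"
proof -
  have f: "0 \<le> flat 0 t" "flat 0 t \<le> 1" for t by (auto simp: flat_def)
  show "0 \<le> bump l u m x" unfolding bump_def by (intro prod_nonneg mult_nonneg_nonneg ballI f)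
  show "bump l u m x \<le> 1" unfolding bump_def
    by (intro prod_le_1 conjI mult_nonneg_nonneg mult_le_one f)
qed

lemma bump_limit: "(\<lambda>m. bump l u m x) \<longlonglongrightarrow> indicat_real (box l u) x"
proof -
  have f: "(\<lambda>m. flat 0 (real (Suc m) * t)) \<longlonglongrightarrow> (if 0 < t then 1 else 0)" for t
  proof (cases "0 < t")
    case True
    have "(\<lambda>m. exp (- (1 / (real (Suc m) * t)))) \<longlonglongrightarrow> exp (- 0)"
    proof (intro tendsto_exp tendsto_minus)
      have "(\<lambda>m. (1 / t) * inverse (real (Suc m))) \<longlonglongrightarrow> (1 / t) * 0"
        by (intro tendsto_mult tendsto_const LIMSEQ_inverse_real_of_nat)
      then show "(\<lambda>m. 1 / (real (Suc m) * t)) \<longlonglongrightarrow> 0" by (simp add: divide_inverse mult.commute)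
    qed
    then show ?thesis using True by (simp add: flat_def)
  next
    case False
    then have "flat 0 (real (Suc m) * t) = 0" for m
      by (auto simp: flat_def zero_less_mult_iff)
    then show ?thesis using False by simp
  qed
  have "(\<lambda>m. bump l u m x) \<longlonglongrightarrow> (\<Prod>b\<in>Basis. (if 0 < x \<bullet> b - l \<bullet> b then 1 else 0) * (if 0 < u \<bullet> b - x \<bullet> b then 1 else 0))"
    unfolding bump_def by (intro tendsto_prod tendsto_mult f)
  moreover have "(\<Prod>b\<in>Basis. (if 0 < x \<bullet> b - l \<bullet> b then 1 else 0) * (if 0 < u \<bullet> b - x \<bullet> b then 1 else 0)) = indicat_real (box l u) x"
  proof (cases "x \<in> box l u")
    case True
    then show ?thesis by (simp add: mem_box)
  next
    case False
    then obtain b where "b \<in> Basis" "\<not> (l \<bullet> b < x \<bullet> b \<and> x \<bullet> b < u \<bullet> b)" by (auto simp: mem_box)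
    then show ?thesis using False by (auto simp: prod_zero_iff intro!: bexI[of _ b])
  qed
  ultimately show ?thesis by simp
qed

text \<open>The boxes generate the Borel sets and are stable under intersection, so all integrals over Borel
  sets vanish.\<close>

lemma integral_zero_on_boxes:
  fixes h :: "'a::euclidean_space \<Rightarrow> real"
  assumes h: "integrable lborel h" and zero: "\<And>l u. (LINT x:box l u|lborel. h x) = 0"
  shows "AE x in lborel. h x = 0"
proof -
  have iA: "integrable lborel (\<lambda>x. indicator A x *\<^sub>R h x)" if "A \<in> sets lborel" for A
    using integrable_mult_indicator[OF that h] .
  have "(LINT x:A|lborel. h x) = 0" if A: "A \<in> sets lborel" for A
  proof -
    have "Int_stable (range (\<lambda>(a, b). box a b :: 'a set))"
      by (auto simp: Int_stable_def box_Int_box)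
    moreover have "range (\<lambda>(a, b). box a b :: 'a set) \<subseteq> Pow UNIV" by auto
    moreover have "A \<in> sigma_sets UNIV (range (\<lambda>(a, b). box a b))" using A unfolding sets_lborel borel_eq_box by simp
    ultimately show ?thesis
    proof (induction rule: sigma_sets_induct_disjoint)
      case (basic A) then show ?case using zero by auto
    next
      case empty then show ?case by (simp add: set_lebesgue_integral_def)
    next
      case (compl A)
      then have A: "A \<in> sets lborel" by (simp add: borel_eq_box)
      have whole: "(LINT x|lborel. h x) = 0"
      proof -
        have "(\<lambda>n. LINT x:box (- (real n *\<^sub>R One)) (real n *\<^sub>R One)|lborel. h x) \<longlonglongrightarrow> (LINT x:(\<Union>n. box (- (real n *\<^sub>R One)) (real n *\<^sub>R One))|lborel. h x)"
          by (rule set_integral_cont_up)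
            (auto simp: incseq_def subset_box set_integrable_def UN_box_eq_UNIV intro!: iA h)
        from LIMSEQ_unique[OF this[unfolded zero UN_box_eq_UNIV] tendsto_const]
        show ?thesis by (simp add: set_lebesgue_integral_def)
      qed
      have "(LINT x:UNIV - A|lborel. h x) = (LINT x|lborel. h x - indicator A x *\<^sub>R h x)"
        unfolding set_lebesgue_integral_def by (rule Bochner_Integration.integral_cong) (auto simp: indicator_def)
      also have "\<dots> = 0"
        using whole compl.IH iA[OF A] h by (simp add: set_lebesgue_integral_def Bochner_Integration.integral_diff)
      finally show ?case .
    next
      case (union A)
      then have A: "A i \<in> sets lborel" for i by (auto simp: borel_eq_box)
      have "(\<Sum>i. LINT x:A i|lborel. h x) = (LINT x:(\<Union>i. A i)|lborel. h x)"
        by (rule lebesgue_integral_countable_add[symmetric])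
          (use A union.hyps iA in \<open>auto simp: disjoint_family_on_def set_integrable_def\<close>)
      then show ?case using union.IH by simp
    qed
  qed
  then show ?thesis
    using density_unique_real[OF h integrable_zero] by (simp add: set_lebesgue_integral_def)
qed

text \<open>The difference of two candidates is only locally integrable, so its integrals are taken over
  boxes; they are limits of integrals against bumps, which vanish.\<close>

theorem weak_partial_unique:
  fixes f h k :: "'a::euclidean_space \<Rightarrow> real"
  assumes h: "weak_partial f b h" and k: "weak_partial f b k"
  shows "AE x in lebesgue. h x = k x"
proof -
  define g where "g x = h x - k x" for x
  have li: "set_integrable lebesgue (cbox l u) h" "set_integrable lebesgue (cbox l u) k" for l u
    using h k unfolding weak_partial_def locally_integrable_def by auto
  have gi: "integrable lebesgue (\<lambda>x. indicator (cbox l u) x *\<^sub>R g x)" for l u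
    using set_integral_diff(1)[OF li] unfolding set_integrable_def g_def .
  have \<phi>m: "bump l u m \<in> borel_measurable lebesgue" for l u :: 'a and m
    using borel_measurable_continuous_onI[of "bump l u m"] bump_test_function[of l u m]
    unfolding test_function_def by (intro measurable_completion) (auto dest!: spec[of _ 0])
  \<comment> \<open>Tested against bumps, both candidates give the same value; in the limit, their integrals over boxes agree.\<close>
  have dom: "integrable lebesgue (\<lambda>x. (indicator (cbox l u) x *\<^sub>R v x) * bump l u m x)"
    if v: "integrable lebesgue (\<lambda>x. indicator (cbox l u) x *\<^sub>R v x)" for v :: "'a \<Rightarrow> real" and l u m
  proof (rule Bochner_Integration.integrable_bound[OF v])
    show "(\<lambda>x. (indicator (cbox l u) x *\<^sub>R v x) * bump l u m x) \<in> borel_measurable lebesgue"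
      by (intro borel_measurable_times borel_measurable_integrable[OF v] \<phi>m)
    show "AE x in lebesgue. norm ((indicator (cbox l u) x *\<^sub>R v x) * bump l u m x) \<le> norm (indicator (cbox l u) x *\<^sub>R v x)"
      using bump_bounds[of l u m] by (intro AE_I2) (simp add: abs_mult mult_left_le)
  qed
  have cut: "(indicator (cbox l u) x *\<^sub>R v x) * bump l u m x = v x * bump l u m x" for v :: "'a \<Rightarrow> real" and l u m x
    using bump_zero[of x l u m] by (cases "x \<in> cbox l u") auto
  have zero: "(LINT x|lebesgue. (indicator (cbox l u) x *\<^sub>R g x) * bump l u m x) = 0" for l u m
  proof -
    have "(LINT x|lebesgue. h x * bump l u m x) = (LINT x|lebesgue. k x * bump l u m x)"
      using h k bump_test_function[of l u m] unfolding weak_partial_def by (metis minus_equation_iff)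
    moreover have "integrable lebesgue (\<lambda>x. h x * bump l u m x)" "integrable lebesgue (\<lambda>x. k x * bump l u m x)"
      using dom[OF li(1)[unfolded set_integrable_def]] dom[OF li(2)[unfolded set_integrable_def]] unfolding cut .
    ultimately show ?thesis
      unfolding cut unfolding g_def by (simp add: left_diff_distrib Bochner_Integration.integral_diff)
  qed
  have box_zero: "(LINT x|lebesgue. indicator (box l u) x *\<^sub>R g x) = 0" for l u
  proof -
    have "(\<lambda>m. LINT x|lebesgue. (indicator (cbox l u) x *\<^sub>R g x) * bump l u m x)
        \<longlonglongrightarrow> (LINT x|lebesgue. (indicator (cbox l u) x *\<^sub>R g x) * indicat_real (box l u) x)"
    proof (rule integral_dominated_convergence[OF _ _ integrable_norm[OF gi[of l u]]])
      show "(\<lambda>x. (indicator (cbox l u) x *\<^sub>R g x) * indicat_real (box l u) x) \<in> borel_measurable lebesgue"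
        by (intro borel_measurable_times borel_measurable_integrable[OF gi] borel_measurable_indicator) auto
      show "(\<lambda>x. (indicator (cbox l u) x *\<^sub>R g x) * bump l u m x) \<in> borel_measurable lebesgue" for m
        by (intro borel_measurable_times borel_measurable_integrable[OF gi] \<phi>m)
      show "AE x in lebesgue. (\<lambda>m. (indicator (cbox l u) x *\<^sub>R g x) * bump l u m x)
          \<longlonglongrightarrow> (indicator (cbox l u) x *\<^sub>R g x) * indicat_real (box l u) x"
        by (intro AE_I2 tendsto_mult tendsto_const bump_limit)
      show "AE x in lebesgue. norm ((indicator (cbox l u) x *\<^sub>R g x) * bump l u m x) \<le> norm (indicator (cbox l u) x *\<^sub>R g x)" for m
        using bump_bounds[of l u m] by (intro AE_I2) (simp add: abs_mult mult_left_le)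
    qed
    from LIMSEQ_unique[OF this[unfolded zero] tendsto_const]
    have "(LINT x|lebesgue. (indicator (cbox l u) x *\<^sub>R g x) * indicat_real (box l u) x) = 0" .
    moreover have "(indicator (cbox l u) x *\<^sub>R g x) * indicat_real (box l u) x = indicator (box l u) x *\<^sub>R g x" for x
      using box_subset_cbox[of l u] by (auto simp: indicator_def)
    ultimately show ?thesis by (simp only:)
  qed
  have ae: "AE x in lebesgue. x \<in> box l u \<longrightarrow> g x = 0" for l u
  proof -
    let ?v = "\<lambda>x. indicator (box l u) x *\<^sub>R g x"
    have vi: "integrable lebesgue ?v"
    proof -
      have "integrable lebesgue (\<lambda>x. indicator (box l u) x *\<^sub>R (indicator (cbox l u) x *\<^sub>R g x))"
        by (rule integrable_mult_indicator[OF _ gi]) auto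
      moreover have "indicator (box l u) x *\<^sub>R (indicator (cbox l u) x *\<^sub>R g x) = ?v x" for x
        using box_subset_cbox[of l u] by (auto simp: indicator_def)
      ultimately show ?thesis by (simp only:)
    qed
    obtain v' where v': "v' \<in> borel_measurable lborel" "AE x in lborel. ?v x = v' x"
      using completion_ex_borel_measurable_real[OF borel_measurable_integrable[OF vi]] by blast
    have vv: "AE x in lebesgue. ?v x = v' x" by (rule AE_completion[OF v'(2)])
    have v'L: "v' \<in> borel_measurable lebesgue" by (rule measurable_completion[OF v'(1)])
    have v'i: "integrable lborel v'"
      using integrable_cong_AE[OF borel_measurable_integrable[OF vi] v'L vv] vi integrable_completion[OF v'(1)] by blast
    have "AE x in lborel. v' x = 0"
    proof (rule integral_zero_on_boxes[OF v'i])
      fix a c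
      obtain p q where pq: "box a c \<inter> box l u = box p q" using box_Int_box by blast
      have "(LINT x:box a c|lborel. v' x) = (LINT x|lebesgue. indicator (box a c) x *\<^sub>R v' x)"
        unfolding set_lebesgue_integral_def
        using v'(1) by (intro integral_completion[symmetric] borel_measurable_scaleR borel_measurable_indicator) auto
      also have "\<dots> = (LINT x|lebesgue. indicator (box a c) x *\<^sub>R ?v x)"
      proof (rule integral_cong_AE)
        show "(\<lambda>x. indicator (box a c) x *\<^sub>R v' x) \<in> borel_measurable lebesgue"
          using v'L by (intro borel_measurable_scaleR borel_measurable_indicator) auto
        show "(\<lambda>x. indicator (box a c) x *\<^sub>R ?v x) \<in> borel_measurable lebesgue"
          by (rule borel_measurable_scaleR[OF borel_measurable_indicator borel_measurable_integrable[OF vi]]) auto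
        show "AE x in lebesgue. indicator (box a c) x *\<^sub>R v' x = indicator (box a c) x *\<^sub>R ?v x"
          using vv by eventually_elim simp
      qed
      also have "\<dots> = (LINT x|lebesgue. indicator (box p q) x *\<^sub>R g x)"
        unfolding pq[symmetric] by (rule Bochner_Integration.integral_cong) (auto simp: indicator_def)
      also have "\<dots> = 0" by (rule box_zero)
      finally show "(LINT x:box a c|lborel. v' x) = 0" .
    qed
    then have "AE x in lebesgue. v' x = 0" by (rule AE_completion)
    with vv show ?thesis by eventually_elim (auto simp: indicator_def split: if_splits)
  qed
  have "AE x in lebesgue. \<forall>n. x \<in> box (- (real n *\<^sub>R One)) (real n *\<^sub>R One) \<longrightarrow> g x = 0"
    unfolding AE_all_countable using ae by blast
  then show ?thesis
  proof eventually_elim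
    case (elim x)
    have "x \<in> (\<Union>n. box (- (real n *\<^sub>R One)) (real n *\<^sub>R One))"
      unfolding UN_box_eq_UNIV by (rule UNIV_I)
    then show ?case using elim by (auto simp: g_def)
  qed
qed

section \<open>Lebesgue differentiation on the line\<close>

text \<open>Where \<open>\<bar>f\<bar>\<close> exceeds a large bound, its integral is small; the part below
  the bound is controlled by the measure of the set.\<close>

lemma integral_absolutely_continuous:
  fixes f :: "'a::euclidean_space \<Rightarrow> real"
  assumes f: "integrable lebesgue f" and e: "e > 0"
  obtains \<delta> where "\<delta> > 0"
    "\<And>A. A \<in> lmeasurable \<Longrightarrow> measure lebesgue A < \<delta> \<Longrightarrow> (LINT t|lebesgue. indicator A t * \<bar>f t\<bar>) < e"
proof -
  have fm: "f \<in> borel_measurable lebesgue" by (rule borel_measurable_integrable[OF f])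
  have am: "(\<lambda>t. \<bar>f t\<bar>) \<in> borel_measurable lebesgue" using fm by (rule borel_measurable_abs)
  have ai: "integrable lebesgue (\<lambda>t. \<bar>f t\<bar>)" using f by (rule integrable_abs)
  let ?h = "\<lambda>n t. max 0 (\<bar>f t\<bar> - real n)"
  have hm: "?h n \<in> borel_measurable lebesgue" for n
    by (intro borel_measurable_max borel_measurable_diff am) auto
  have hb: "norm (?h n t) \<le> \<bar>f t\<bar>" for n t by simp
  have lim: "(\<lambda>n. ?h n t) \<longlonglongrightarrow> 0" for t
  proof (rule tendsto_eventually)
    obtain N where "\<bar>f t\<bar> \<le> real N" using real_arch_simple by blast
    then show "\<forall>\<^sub>F n in sequentially. ?h n t = 0"
      by (intro eventually_sequentiallyI[of N]) auto
  qed
  have "(\<lambda>n. LINT t|lebesgue. ?h n t) \<longlonglongrightarrow> (LINT t|(lebesgue :: 'a measure). (0::real))"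
    by (rule integral_dominated_convergence[where s = ?h and w = "\<lambda>t. \<bar>f t\<bar>" and f = "\<lambda>_. 0"])
      (use hm ai lim hb in \<open>auto intro!: AE_I2\<close>)
  then have "\<forall>\<^sub>F n in sequentially. (LINT t|lebesgue. ?h n t) < e / 2"
    using e by (intro order_tendstoD(2)[of _ 0]) simp_all
  then obtain n where n: "(LINT t|lebesgue. ?h n t) < e / 2" unfolding eventually_sequentially by blast
  have hi: "integrable lebesgue (?h n)"
    by (rule Bochner_Integration.integrable_bound[OF ai hm]) (use hb in \<open>auto intro!: AE_I2\<close>)
  show thesis
  proof (rule that[of "e / (2 * (real n + 1))"])
    show "e / (2 * (real n + 1)) > 0" using e by simp
    fix A :: "'a set" assume A: "A \<in> lmeasurable" "measure lebesgue A < e / (2 * (real n + 1))"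
    have Ai: "integrable lebesgue (\<lambda>t. real n * indicat_real A t)"
      using A(1) by (intro integrable_mult_right integrable_real_indicator) (auto simp: fmeasurable_def)
    have "(LINT t|lebesgue. indicator A t * \<bar>f t\<bar>) \<le> (LINT t|lebesgue. real n * indicat_real A t + ?h n t)"
    proof (rule integral_mono_AE)
      show "integrable lebesgue (\<lambda>t. indicator A t * \<bar>f t\<bar>)"
        using integrable_mult_indicator[OF fmeasurableD[OF A(1)] ai] by simp
      show "integrable lebesgue (\<lambda>t. real n * indicat_real A t + ?h n t)"
        by (intro Bochner_Integration.integrable_add Ai hi)
      show "AE t in lebesgue. indicator A t * \<bar>f t\<bar> \<le> real n * indicat_real A t + ?h n t"
        by (intro AE_I2) (auto simp: indicator_def)
    qed
    also have "\<dots> = real n * measure lebesgue A + (LINT t|lebesgue. ?h n t)"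
      using Ai hi A(1) by (simp add: Bochner_Integration.integral_add fmeasurable_def)
    also have "\<dots> < e"
    proof -
      have "real n * measure lebesgue A \<le> (real n + 1) * (e / (2 * (real n + 1)))"
        using A(2) by (intro mult_mono) auto
      also have "\<dots> = e / 2" by (simp add: field_simps)
      finally show ?thesis using n by linarith
    qed
    finally show "(LINT t|lebesgue. indicator A t * \<bar>f t\<bar>) < e" .
  qed
qed

text \<open>By the Vitali covering theorem almost all of \<open>S\<close> is covered by disjoint intervals of nonnegative
  mass; these can be chosen so that they hardly leave a set where \<open>f \<le> - \<rho>\<close>, so they cannot contain
  much of it.\<close>

lemma averages_exceed_negligible:
  fixes f :: "real \<Rightarrow> real"
  assumes f: "integrable lebesgue f" and \<rho>: "\<rho> > 0"
    and bnd: "\<And>x. x \<in> S \<Longrightarrow> \<bar>x\<bar> \<le> R"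
    and below: "\<And>x. x \<in> S \<Longrightarrow> f x \<le> - \<rho>"
    and avg: "\<And>x d. x \<in> S \<Longrightarrow> 0 < d \<Longrightarrow> \<exists>a h. 0 < h \<and> h < d \<and> x \<in> cball a h \<and>
      0 \<le> (LINT t|lebesgue. indicator (cball a h) t * f t)"
  shows "negligible S"
  unfolding negligible_outer
proof (intro allI impI)
  fix e :: real assume e: "e > 0"
  define P where "P = {x \<in> cball 0 R. f x \<le> - \<rho>}"
  have fm: "f \<in> borel_measurable lebesgue" by (rule borel_measurable_integrable[OF f])
  have P: "P \<in> lmeasurable"
  proof -
    have "f -` {..- \<rho>} \<inter> space lebesgue \<in> sets lebesgue" by (rule measurable_sets[OF fm]) simp
    then have "cball 0 R \<inter> (f -` {..- \<rho>} \<inter> space lebesgue) \<in> lmeasurable"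
      by (intro fmeasurable_Int_fmeasurable) auto
    moreover have "P = cball 0 R \<inter> (f -` {..- \<rho>} \<inter> space lebesgue)" unfolding P_def by auto
    ultimately show ?thesis by simp
  qed
  have SP: "S \<subseteq> P" unfolding P_def using bnd below by auto
  \<comment> \<open>an open superset of \<open>P\<close> on which the excess carries little mass\<close>
  obtain \<delta> where \<delta>: "\<delta> > 0" "\<And>A. A \<in> lmeasurable \<Longrightarrow> measure lebesgue A < \<delta> \<Longrightarrow>
      (LINT t|lebesgue. indicator A t * \<bar>f t\<bar>) < e * \<rho> / 2"
    by (rule integral_absolutely_continuous[OF f, of "e * \<rho> / 2"]) (use e \<rho> in auto)
  obtain G where G: "open G" "P \<subseteq> G" "G - P \<in> lmeasurable" "emeasure lebesgue (G - P) < ennreal \<delta>"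
    by (rule sets_lebesgue_outer_open[OF fmeasurableD[OF P] \<delta>(1)]) blast
  have G': "measure lebesgue (G - P) < \<delta>"
    using G(3,4) \<delta>(1) by (simp add: emeasure_eq_measure2 ennreal_less_iff)
  define K where "K = {(a, h). 0 < h \<and> cball a h \<subseteq> G \<and> 0 \<le> (LINT t|lebesgue. indicator (cball a h) t * f t)}"
  let ?B = "\<lambda>i :: real \<times> real. cball (fst i) (snd i)"
  have K: "0 < snd i" "?B i \<subseteq> G" "0 \<le> (LINT t|lebesgue. indicator (?B i) t * f t)" if "i \<in> K" for i
    using that unfolding K_def by auto
  have vit: "\<exists>i. i \<in> K \<and> x \<in> ?B i \<and> snd i < d" if x: "x \<in> S" and d: "0 < d" for x d
  proof -
    obtain q where q: "q > 0" "cball x q \<subseteq> G" using G(1,2) SP x open_contains_cball by blast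
    obtain a h where ah: "0 < h" "h < min d (q / 2)" "x \<in> cball a h" "0 \<le> (LINT t|lebesgue. indicator (cball a h) t * f t)"
      using avg[OF x, of "min d (q / 2)"] d q(1) by auto
    have "cball a h \<subseteq> cball x q"
    proof
      fix y assume "y \<in> cball a h"
      then have "dist a y \<le> h" "dist a x \<le> h" "h < q / 2" using ah by auto
      then show "y \<in> cball x q" using dist_triangle3[of x y a] by (simp add: dist_commute)
    qed
    then show ?thesis using ah q unfolding K_def by (intro exI[of _ "(a, h)"]) auto
  qed
  obtain C where C: "countable C" "C \<subseteq> K"
    "pairwise (\<lambda>i j. disjnt (?B i) (?B j)) C"
    "negligible (S - (\<Union>i\<in>C. ?B i))"
    by (rule Vitali_covering_theorem_cballs[of K snd S fst]) (use vit K(1) in blast)+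
  let ?U = "\<Union>i\<in>C. ?B i"
  have BP: "?B i \<inter> P \<in> lmeasurable" for i
    by (intro fmeasurable_Int_fmeasurable fmeasurableD[OF P]) auto
  have finite_bound: "measure lebesgue (\<Union>i\<in>I. ?B i \<inter> P) \<le> e / 2" if I: "I \<subseteq> C" "finite I" for I
  proof -
    let ?D = "\<Union>i\<in>I. ?B i"
    have DP: "(\<Union>i\<in>I. ?B i \<inter> P) \<in> lmeasurable" using I BP by (intro fmeasurable.finite_UN) auto
    have disj: "disjoint_family_on ?B I"
      using C(3) I unfolding disjoint_family_on_def pairwise_def disjnt_def by blast
    have fi: "integrable lebesgue (\<lambda>t. indicator (?B i) t * f t)" for i
      using integrable_mult_indicator[OF _ f, of "?B i"] by simp
    have "0 \<le> (\<Sum>i\<in>I. LINT t|lebesgue. indicator (?B i) t * f t)"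
      by (intro sum_nonneg K(3)) (use I C(2) in blast)
    also have "\<dots> = (LINT t|lebesgue. (\<Sum>i\<in>I. indicator (?B i) t * f t))"
      using fi by (simp add: Bochner_Integration.integral_sum)
    also have "\<dots> \<le> (LINT t|lebesgue. (- \<rho>) * indicat_real (\<Union>i\<in>I. ?B i \<inter> P) t + indicator (G - P) t * \<bar>f t\<bar>)"
    proof (rule integral_mono)
      show "integrable lebesgue (\<lambda>t. \<Sum>i\<in>I. indicator (?B i) t * f t)" using fi by auto
      show "integrable lebesgue (\<lambda>t. (- \<rho>) * indicat_real (\<Union>i\<in>I. ?B i \<inter> P) t + indicator (G - P) t * \<bar>f t\<bar>)"
        using DP integrable_mult_indicator[OF fmeasurableD[OF G(3)] integrable_abs[OF f]]
        by (intro Bochner_Integration.integrable_add integrable_mult_right integrable_real_indicator)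
          (auto simp: fmeasurable_def)
      fix t
      have "(\<Sum>i\<in>I. indicator (?B i) t * f t) = indicat_real ?D t * f t"
        unfolding indicator_UN_disjoint[OF I(2) disj] sum_distrib_right ..
      also have "\<dots> \<le> (- \<rho>) * indicat_real (\<Union>i\<in>I. ?B i \<inter> P) t + indicator (G - P) t * \<bar>f t\<bar>"
      proof (cases "t \<in> ?D")
        case True
        then have tG: "t \<in> G" using I C(2) K(2) by blast
        show ?thesis
        proof (cases "t \<in> P")
          case True
          then have "t \<in> (\<Union>i\<in>I. ?B i \<inter> P)" "f t \<le> - \<rho>" using \<open>t \<in> ?D\<close> unfolding P_def by auto
          then show ?thesis using \<open>t \<in> ?D\<close> True by simp
        next
          case False
          then have "t \<notin> (\<Union>i\<in>I. ?B i \<inter> P)" "t \<in> G - P" using tG by auto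
          then show ?thesis using \<open>t \<in> ?D\<close> by simp
        qed
      next
        case False
        then have "t \<notin> (\<Union>i\<in>I. ?B i \<inter> P)" by auto
        then show ?thesis using False by simp
      qed
      finally show "(\<Sum>i\<in>I. indicator (?B i) t * f t) \<le> (- \<rho>) * indicat_real (\<Union>i\<in>I. ?B i \<inter> P) t + indicator (G - P) t * \<bar>f t\<bar>" .
    qed
    also have "\<dots> = (- \<rho>) * measure lebesgue (\<Union>i\<in>I. ?B i \<inter> P) + (LINT t|lebesgue. indicator (G - P) t * \<bar>f t\<bar>)"
    proof (subst Bochner_Integration.integral_add)
      show "integrable lebesgue (\<lambda>t. (- \<rho>) * indicat_real (\<Union>i\<in>I. ?B i \<inter> P) t)"
        using DP by (intro integrable_mult_right integrable_real_indicator) (auto simp: fmeasurable_def)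
      show "integrable lebesgue (\<lambda>t. indicator (G - P) t * \<bar>f t\<bar>)"
        using integrable_mult_indicator[OF fmeasurableD[OF G(3)] integrable_abs[OF f]] by simp
      show "(LINT t|lebesgue. (- \<rho>) * indicat_real (\<Union>i\<in>I. ?B i \<inter> P) t) + (LINT t|lebesgue. indicator (G - P) t * \<bar>f t\<bar>)
        = (- \<rho>) * measure lebesgue (\<Union>i\<in>I. ?B i \<inter> P) + (LINT t|lebesgue. indicator (G - P) t * \<bar>f t\<bar>)"
        by (subst integral_mult_right_zero) simp
    qed
    also have "\<dots> \<le> (- \<rho>) * measure lebesgue (\<Union>i\<in>I. ?B i \<inter> P) + e * \<rho> / 2"
      using \<delta>(2)[OF G(3) G'] by simp
    finally have "\<rho> * measure lebesgue (\<Union>i\<in>I. ?B i \<inter> P) \<le> \<rho> * (e / 2)" by (simp add: mult.commute)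
    then show ?thesis using \<rho> by simp
  qed
  have T1: "(\<Union>i\<in>C. ?B i \<inter> P) \<in> lmeasurable"
    by (rule fmeasurable_UN_bound[OF C(1) BP]) (use finite_bound in blast)
  have T2: "measure lebesgue (\<Union>i\<in>C. ?B i \<inter> P) \<le> e / 2"
    by (rule measure_UN_bound[OF C(1) BP]) (use finite_bound in blast)
  have N: "S - ?U \<in> lmeasurable" "measure lebesgue (S - ?U) = 0"
    using C(4) negligible_iff_measure by blast+
  show "\<exists>T. S \<subseteq> T \<and> T \<in> lmeasurable \<and> measure lebesgue T < e"
  proof (intro exI conjI)
    let ?T = "(S - ?U) \<union> (\<Union>i\<in>C. ?B i \<inter> P)"
    show "S \<subseteq> ?T" using SP by auto
    show "?T \<in> lmeasurable" by (rule fmeasurable.Un[OF N(1) T1])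
    have "measure lebesgue ?T \<le> measure lebesgue (S - ?U) + measure lebesgue (\<Union>i\<in>C. ?B i \<inter> P)"
      by (rule measure_Un_le[OF fmeasurableD[OF N(1)] fmeasurableD[OF T1]])
    then show "measure lebesgue ?T < e" using N(2) T2 e by linarith
  qed
qed

lemma set_integrable_lebesgueD:
  "locally_integrable g \<Longrightarrow> compact K \<Longrightarrow> integrable lebesgue (\<lambda>t. indicator K t * g t)"
  unfolding locally_integrable_def set_integrable_def by simp

text \<open>A point that violates the claim has, for some rational \<open>r\<close> above \<open>g
  x\<close>, arbitrarily short intervals on which the average of \<open>g - r\<close> is nonnegative
  although \<open>g - r\<close> is bounded away from zero below at the point. There are countably many such
  exceptional sets, and each of them is negligible.\<close>

lemma upper_average:
  fixes g :: "real \<Rightarrow> real"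
  assumes g: "locally_integrable g"
  shows "AE x in lebesgue. \<forall>\<eta>>0. \<exists>d>0. \<forall>a h. 0 < h \<and> h < d \<and> x \<in> cball a h \<longrightarrow>
    (LINT t|lebesgue. indicator (cball a h) t * g t) \<le> (g x + \<eta>) * (2 * h)"
proof -
  define S where "S R r k = {x. \<bar>x\<bar> \<le> real R \<and> g x \<le> of_rat r - 1 / real (Suc k) \<and>
    (\<forall>d>0. \<exists>a h. 0 < h \<and> h < d \<and> x \<in> cball a h \<and> of_rat r * (2 * h) \<le> (LINT t|lebesgue. indicator (cball a h) t * g t))}"
    for R k :: nat and r :: rat
  have neg: "negligible (S R r k)" for R r k
  proof -
    let ?B = "cball 0 (real R + 1) :: real set" and ?r = "of_rat r :: real"
    let ?f = "\<lambda>t. indicator ?B t * (g t - ?r)"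
    have f: "integrable lebesgue ?f"
    proof -
      have "integrable lebesgue (\<lambda>t. indicator ?B t * g t)" by (rule set_integrable_lebesgueD[OF g compact_cball])
      moreover have "integrable lebesgue (\<lambda>t. ?r * indicat_real ?B t)"
        using emeasure_lborel_cball_finite[of "0::real" "real R + 1"]
        by (intro integrable_mult_right integrable_real_indicator) auto
      ultimately have "integrable lebesgue (\<lambda>t. indicator ?B t * g t - ?r * indicat_real ?B t)"
        by (rule Bochner_Integration.integrable_diff)
      then show ?thesis by (simp add: algebra_simps)
    qed
    show ?thesis
    proof (rule averages_exceed_negligible[OF f, of "1 / real (Suc k)" _ "real R"])
      fix x assume x: "x \<in> S R r k"
      show "\<bar>x\<bar> \<le> real R" using x by (simp add: S_def)
      then have "x \<in> ?B" by (simp add: dist_real_def)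
      then show "?f x \<le> - (1 / real (Suc k))" using x by (simp add: S_def)
      fix d :: real assume "0 < d"
      then obtain a h where ah: "0 < h" "h < min d (1/2)" "x \<in> cball a h"
        "?r * (2 * h) \<le> (LINT t|lebesgue. indicator (cball a h) t * g t)"
        using x unfolding S_def by (auto dest!: spec[of _ "min d (1/2)"])
      have sub: "cball a h \<subseteq> ?B"
      proof
        fix y assume "y \<in> cball a h"
        then show "y \<in> ?B" using ah \<open>\<bar>x\<bar> \<le> real R\<close> by (auto simp: dist_real_def)
      qed
      have "(LINT t|lebesgue. indicator (cball a h) t * ?f t)
          = (LINT t|lebesgue. indicator (cball a h) t * g t - ?r * indicat_real (cball a h) t)"
        using sub by (intro Bochner_Integration.integral_cong) (auto simp: indicator_def algebra_simps)
      also have "\<dots> = (LINT t|lebesgue. indicator (cball a h) t * g t) - ?r * (2 * h)"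
      proof -
        have m: "measure lebesgue (cball a h) = 2 * h"
          using ah(1) by (simp add: cball_eq_atLeastAtMost)
        have "integrable lebesgue (\<lambda>t. ?r * indicat_real (cball a h) t)"
          using emeasure_lborel_cball_finite[of a h]
          by (intro integrable_mult_right integrable_real_indicator) auto
        then show ?thesis
          using set_integrable_lebesgueD[OF g compact_cball[of a h]] m
          by (simp add: Bochner_Integration.integral_diff)
      qed
      finally show "\<exists>a h. 0 < h \<and> h < d \<and> x \<in> cball a h \<and> 0 \<le> (LINT t|lebesgue. indicator (cball a h) t * ?f t)"
        using ah by (intro exI[of _ a] exI[of _ h]) auto
    qed auto
  qed
  have "AE x in lebesgue. \<forall>R r k. x \<notin> S R r k"
    unfolding AE_all_countable using neg negligible_iff_null_sets AE_not_in by blast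
  then show ?thesis
  proof eventually_elim
    case (elim x)
    show ?case
    proof (intro allI impI)
      fix \<eta> :: real assume \<eta>: "\<eta> > 0"
      obtain r :: rat where r: "g x < of_rat r" "of_rat r < g x + \<eta>" using of_rat_dense[of "g x" "g x + \<eta>"] \<eta> by auto
      obtain k where k: "1 / real (Suc k) < of_rat r - g x" using nat_approx_posE[of "of_rat r - g x"] r(1) by auto
      obtain R where R: "\<bar>x\<bar> \<le> real R" using real_arch_simple by blast
      have "x \<notin> S R r k" using elim by blast
      then have "\<not> (\<forall>d>0. \<exists>a h. 0 < h \<and> h < d \<and> x \<in> cball a h \<and> of_rat r * (2 * h) \<le> (LINT t|lebesgue. indicator (cball a h) t * g t))"
        using R k unfolding S_def by simp
      then obtain d where d: "d > 0" "\<And>a h. 0 < h \<Longrightarrow> h < d \<Longrightarrow> x \<in> cball a h \<Longrightarrow>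
          \<not> of_rat r * (2 * h) \<le> (LINT t|lebesgue. indicator (cball a h) t * g t)"
        by blast
      have "(LINT t|lebesgue. indicator (cball a h) t * g t) \<le> (g x + \<eta>) * (2 * h)"
        if "0 < h" "h < d" "x \<in> cball a h" for a h
      proof -
        have "of_rat r * (2 * h) \<le> (g x + \<eta>) * (2 * h)" using r that by (intro mult_right_mono) auto
        then show ?thesis using d(2)[OF that] by linarith
      qed
      then show "\<exists>d>0. \<forall>a h. 0 < h \<and> h < d \<and> x \<in> cball a h \<longrightarrow>
          (LINT t|lebesgue. indicator (cball a h) t * g t) \<le> (g x + \<eta>) * (2 * h)"
        using d(1) by blast
    qed
  qed
qed

text \<open>The upper bounds for the averages of \<open>g\<close> and of \<open>- g\<close> on intervals
  that contain the point are bounds for the difference quotients.\<close>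

theorem lebesgue_differentiation:
  fixes g b :: "real \<Rightarrow> real"
  assumes g: "locally_integrable g"
    and b: "\<And>s t. s \<le> t \<Longrightarrow> b t - b s = (LINT x|lebesgue. indicator {s..t} x * g x)"
  shows "AE x in lebesgue. (b has_real_derivative g x) (at x)"
proof -
  have g': "locally_integrable (\<lambda>x. - g x)"
    unfolding locally_integrable_def set_integrable_def
  proof (intro allI impI)
    fix K :: "real set" assume "compact K"
    from Bochner_Integration.integrable_minus[OF set_integrable_lebesgueD[OF g this]]
    show "integrable lebesgue (\<lambda>x. indicator K x *\<^sub>R - g x)" by simp
  qed
  show ?thesis
    using upper_average[OF g] upper_average[OF g']
  proof eventually_elim
    case (elim x)
    have "\<exists>d>0. \<forall>y. norm (y - x) < d \<longrightarrow> norm (b y - b x - g x * (y - x)) \<le> \<eta> * norm (y - x)" if \<eta>: "\<eta> > 0" for \<eta>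
    proof -
      from elim(1)[THEN spec, THEN mp, OF \<eta>] obtain d1 where d1: "0 < d1"
        and d1': "\<forall>a h. 0 < h \<and> h < d1 \<and> x \<in> cball a h \<longrightarrow>
          (LINT t|lebesgue. indicator (cball a h) t * g t) \<le> (g x + \<eta>) * (2 * h)" by (elim exE conjE)
      from elim(2)[THEN spec, THEN mp, OF \<eta>] obtain d2 where d2: "0 < d2"
        and d2': "\<forall>a h. 0 < h \<and> h < d2 \<and> x \<in> cball a h \<longrightarrow>
          (LINT t|lebesgue. indicator (cball a h) t * - g t) \<le> (- g x + \<eta>) * (2 * h)" by (elim exE conjE)
      have "norm (b y - b x - g x * (y - x)) \<le> \<eta> * norm (y - x)" if y: "norm (y - x) < min d1 d2" for y
      proof (cases "y = x")
        case False
        define s t where "s = min x y" and "t = max x y"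
        have st: "s < t" "norm (y - x) = t - s" using False by (auto simp: s_def t_def)
        let ?a = "(s + t) / 2" and ?h = "(t - s) / 2"
        have cb: "cball ?a ?h = {s..t}" unfolding cball_eq_atLeastAtMost by (simp add: field_simps)
        have two: "2 * ?h = t - s" by simp
        have h: "0 < ?h" "?h < d1" "?h < d2" "x \<in> cball ?a ?h"
          unfolding cb using st y by (auto simp: s_def t_def)
        have "b t - b s \<le> (g x + \<eta>) * (t - s)"
          using d1'[THEN spec, THEN spec, THEN mp, OF conjI[OF h(1) conjI[OF h(2,4)]]] b[of s t] st
          unfolding cb two by simp
        moreover have "- (b t - b s) \<le> (- g x + \<eta>) * (t - s)"
          using d2'[THEN spec, THEN spec, THEN mp, OF conjI[OF h(1) conjI[OF h(3,4)]]] b[of s t] st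
          unfolding cb two by simp
        ultimately have "\<bar>(b t - b s) - g x * (t - s)\<bar> \<le> \<eta> * (t - s)" by (simp add: algebra_simps abs_le_iff)
        moreover have "\<bar>b y - b x - g x * (y - x)\<bar> = \<bar>(b t - b s) - g x * (t - s)\<bar>"
          by (cases "x \<le> y") (auto simp: s_def t_def algebra_simps)
        ultimately show ?thesis using st by simp
      qed simp
      then show ?thesis using d1 d2 by (intro exI[of _ "min d1 d2"]) auto
    qed
    then show ?case
      unfolding has_field_derivative_def has_derivative_at_alt
      by (simp add: bounded_linear_mult_right)
  qed
qed

text \<open>The function \<open>ramp\<close> is smooth and rises on the unit interval; its derivative is
  \<open>hump\<close>.\<close>

definition hump :: "real \<Rightarrow> real" where "hump x = flat 0 x * flat 0 (1 - x)"
definition ramp :: "real \<Rightarrow> real" where "ramp x = integral {-1..x} hump"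

lemma flat0_bounds: "0 \<le> flat 0 t" "flat 0 t \<le> 1" by (auto simp: flat_def)

lemma hump_bounds: "0 \<le> hump x" "hump x \<le> 1"
  unfolding hump_def by (auto intro!: mult_nonneg_nonneg mult_le_one flat0_bounds)

lemma hump_zero: "x \<le> 0 \<or> 1 \<le> x \<Longrightarrow> hump x = 0"
  by (auto simp: hump_def flat_def)

lemma continuous_hump: "continuous_on S hump"
proof -
  have "isCont (flat 0) t" for t by (rule DERIV_isCont[OF flat_derivative])
  then have c: "continuous_on UNIV (flat 0)" by (simp add: continuous_on_eq_continuous_at)
  have "continuous_on S (\<lambda>x. flat 0 x * flat 0 (1 - x))"
  proof (rule continuous_on_mult)
    show "continuous_on S (flat 0)" by (rule continuous_on_subset[OF c]) simp
    show "continuous_on S (\<lambda>x. flat 0 (1 - x))"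
      by (rule continuous_on_compose2[OF c]) (auto intro!: continuous_intros)
  qed
  then show ?thesis unfolding hump_def[abs_def] .
qed

lemma ramp_zero: "x \<le> 0 \<Longrightarrow> ramp x = 0"
  unfolding ramp_def
  using Henstock_Kurzweil_Integration.integral_cong[of "{-1..x}" hump "\<lambda>_. 0"] by (simp add: hump_zero)

lemma ramp_derivative: "(ramp has_real_derivative hump x) (at x)"
proof (cases "x < 0")
  case True
  have "((\<lambda>_. 0) has_real_derivative hump x) (at x)" using True by (simp add: hump_zero)
  then show ?thesis
    by (rule has_field_derivative_transform_within[where d = "- x"])
      (use True in \<open>auto simp: ramp_zero dist_real_def\<close>)
next
  case False
  have "((\<lambda>x. integral {-1..x} hump) has_real_derivative hump x) (at x within {-1..x + 1})"
    by (rule integral_has_real_derivative[OF continuous_hump]) (use False in auto)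
  moreover have "at x within {-1..x + 1} = at x" using False by (intro at_within_Icc_at) auto
  ultimately show ?thesis unfolding ramp_def[abs_def] by simp
qed

lemma ramp_mono: "x \<le> y \<Longrightarrow> ramp x \<le> ramp y"
  by (rule DERIV_nonneg_imp_nondecreasing[of x y ramp]) (use ramp_derivative hump_bounds in blast)+

lemma ramp_const: "1 \<le> x \<Longrightarrow> ramp x = ramp 1"
proof -
  assume x: "1 \<le> x"
  have "ramp x = integral {-1..1} hump + integral {1..x} hump"
    unfolding ramp_def
    by (rule Henstock_Kurzweil_Integration.integral_combine[symmetric])
      (use x integrable_continuous_interval[OF continuous_hump] in auto)
  also have "integral {1..x} hump = 0"
    using Henstock_Kurzweil_Integration.integral_cong[of "{1..x}" hump "\<lambda>_. 0"] by (simp add: hump_zero)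
  finally show ?thesis by (simp add: ramp_def)
qed

lemma ramp_bounds: "0 \<le> ramp x" "ramp x \<le> ramp 1"
  using ramp_mono[of "min x 0" x] ramp_mono[of x "max x 1"] ramp_zero[of "min x 0"] ramp_const[of "max x 1"]
  by auto

text \<open>Otherwise \<open>ramp\<close> would be constant, but its derivative does not vanish at
  1/2.\<close>

lemma ramp_pos: "0 < ramp 1"
proof (rule ccontr)
  assume "\<not> 0 < ramp 1"
  then have "ramp x = 0" for x using ramp_bounds[of x] by linarith
  then have "ramp = (\<lambda>_. 0)" by (rule ext)
  have "(ramp has_real_derivative 0) (at (1/2))" by (subst \<open>ramp = (\<lambda>_. 0)\<close>) (rule DERIV_const)
  from DERIV_unique[OF this ramp_derivative] show False by (simp add: hump_def flat_def)
qed

lemma hump_integral: "integrable lborel hump" "(LINT x|lborel. hump x) = ramp 1"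
proof -
  have eq: "hump = (\<lambda>x. indicator {-1..1} x *\<^sub>R hump x)"
    by (auto simp: fun_eq_iff indicator_def intro!: hump_zero)
  show i: "integrable lborel hump"
    by (subst eq) (rule borel_integrable_compact[OF compact_Icc continuous_hump])
  have "(LINT x|lborel. hump x) = integral UNIV hump" by (rule integral_lborel[OF i, symmetric])
  also have "\<dots> = integral UNIV (\<lambda>x. if x \<in> {-1..1} then hump x else 0)"
    by (intro arg_cong[of _ _ "integral UNIV"]) (auto simp: fun_eq_iff intro!: hump_zero)
  also have "\<dots> = ramp 1" unfolding ramp_def by (rule integral_restrict_UNIV)
  finally show "(LINT x|lborel. hump x) = ramp 1" .
qed

text \<open>A smooth function that rises at \<open>s\<close> and falls at \<open>t\<close>.\<close>

definition plateau :: "real \<Rightarrow> real \<Rightarrow> nat \<Rightarrow> real \<Rightarrow> real" where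
  "plateau s t m x = ramp ((x - s) * real (Suc m)) - ramp ((x - t) * real (Suc m))"

lemma plateau_derivative:
  "(plateau s t m has_real_derivative
    real (Suc m) * hump ((x - s) * real (Suc m)) - real (Suc m) * hump ((x - t) * real (Suc m))) (at x)"
proof -
  have "((\<lambda>x. ramp ((x - c) * real (Suc m))) has_real_derivative (hump ((x - c) * real (Suc m)) * real (Suc m))) (at x)" for c
    by (rule DERIV_chain2[OF ramp_derivative]) (auto intro!: derivative_eq_intros)
  from DERIV_diff[OF this[of s] this[of t]] show ?thesis
    unfolding plateau_def[abs_def] by (simp add: mult.commute)
qed

lemma plateau_frechet:
  "plateau s t m differentiable (at x)"
  "frechet_derivative (plateau s t m) (at x) 1
    = real (Suc m) * hump ((x - s) * real (Suc m)) - real (Suc m) * hump ((x - t) * real (Suc m))"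
proof -
  note d = plateau_derivative[of s t m x, unfolded has_field_derivative_def]
  show "plateau s t m differentiable (at x)" using d by (auto simp: differentiable_def)
  show "frechet_derivative (plateau s t m) (at x) 1
    = real (Suc m) * hump ((x - s) * real (Suc m)) - real (Suc m) * hump ((x - t) * real (Suc m))"
    unfolding frechet_derivative_at[OF d, symmetric] by simp
qed

lemma plateau_test_function:
  assumes st: "s \<le> t" shows "test_function (plateau s t m)"
  unfolding test_function_def
proof (intro conjI allI)
  fix k
  have fp: "flat_poly (\<lambda>x. hump ((x - c) * real (Suc m)))" for c
  proof -
    have "flat_poly (\<lambda>x. flat 0 (x \<bullet> real (Suc m) + (- c * real (Suc m))) * flat 0 (x \<bullet> (- real (Suc m)) + (1 + c * real (Suc m))))"
      by (intro flat_poly.intros)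
    then show ?thesis unfolding hump_def by (simp add: algebra_simps)
  qed
  show "Ck_on k (plateau s t m) UNIV"
  proof (cases k)
    case 0
    then show ?thesis
      using DERIV_isCont[OF plateau_derivative] by (simp add: continuous_on_eq_continuous_at)
  next
    case (Suc j)
    have "flat_poly (\<lambda>x. real (Suc m) * hump ((x - s) * real (Suc m)) + (- 1) * (real (Suc m) * hump ((x - t) * real (Suc m))))"
      by (intro flat_poly.add flat_poly.mult flat_poly.const fp)
    then have "Ck_on j (\<lambda>x. frechet_derivative (plateau s t m) (at x) 1) UNIV"
      unfolding plateau_frechet by (intro flat_poly_smooth) simp
    then show ?thesis using Suc plateau_frechet(1) by simp
  qed
  have "plateau s t m x = 0" if "x \<notin> {s..t + 1}" for x
  proof (cases "x < s")
    case True
    then have "(x - s) * real (Suc m) \<le> 0" "(x - t) * real (Suc m) \<le> 0"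
      using st by (auto simp: mult_le_0_iff)
    then show ?thesis by (simp add: plateau_def ramp_zero)
  next
    case False
    then have "1 \<le> x - s" "1 \<le> x - t" using that st by auto
    then have "ramp ((x - s) * real (Suc m)) = ramp 1"
      by (intro ramp_const) (use mult_mono[of 1 "x - s" 1 "real (Suc m)"] in simp)
    moreover have "ramp ((x - t) * real (Suc m)) = ramp 1"
      by (intro ramp_const) (use mult_mono[of 1 "x - t" 1 "real (Suc m)"] \<open>1 \<le> x - t\<close> in simp)
    ultimately have "ramp ((x - s) * real (Suc m)) = ramp 1" "ramp ((x - t) * real (Suc m)) = ramp 1" by blast+
    then show ?thesis by (simp add: plateau_def)
  qed
  then have "{x. plateau s t m x \<noteq> 0} \<subseteq> {s..t + 1}" by blast
  then show "compact (closure {x. plateau s t m x \<noteq> 0})"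
    by (metis bounded_closed_interval bounded_subset compact_closure)
qed

text \<open>The steepened humps are an approximate identity, up to the factor \<open>ramp 1\<close>; here
  and in the limit below.\<close>

lemma scaled_hump_integral:
  fixes b :: "real \<Rightarrow> real"
  assumes b: "continuous_on UNIV b"
  shows "integrable lborel (\<lambda>x. b x * (real (Suc m) * hump ((x - s) * real (Suc m))))"
    "(LINT x|lborel. b x * (real (Suc m) * hump ((x - s) * real (Suc m)))) = (LINT y|lborel. b (s + y / real (Suc m)) * hump y)"
proof -
  let ?f = "\<lambda>x. b x * (real (Suc m) * hump ((x - s) * real (Suc m)))"
  have c: "continuous_on UNIV ?f"
    by (intro continuous_intros b continuous_on_compose2[OF continuous_hump[of UNIV]]) auto
  have "?f x = indicator {s..s + 1} x *\<^sub>R ?f x" for x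
  proof (cases "x \<in> {s..s + 1}")
    case False
    have "hump ((x - s) * real (Suc m)) = 0"
    proof (rule hump_zero, cases "x < s")
      case True
      then show "(x - s) * real (Suc m) \<le> 0 \<or> 1 \<le> (x - s) * real (Suc m)" by (auto simp: mult_le_0_iff)
    next
      case nl: False
      then have "1 * 1 \<le> (x - s) * real (Suc m)" using False
        by (intro mult_mono) auto
      then show "(x - s) * real (Suc m) \<le> 0 \<or> 1 \<le> (x - s) * real (Suc m)" by simp
    qed
    then show ?thesis by simp
  qed simp
  then have eq: "?f = (\<lambda>x. indicator {s..s + 1} x *\<^sub>R ?f x)" by (rule ext)
  show "integrable lborel ?f"
    by (subst eq) (rule borel_integrable_compact[OF compact_Icc continuous_on_subset[OF c subset_UNIV]])
  have "(LINT x|lborel. ?f x) = \<bar>1 / real (Suc m)\<bar> *\<^sub>R (LINT y|lborel. ?f (s + (1 / real (Suc m)) * y))"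
    by (rule lborel_integral_real_affine) simp
  also have "\<dots> = (LINT y|lborel. (1 / real (Suc m)) * ?f (s + (1 / real (Suc m)) * y))"
    by (simp only: integral_mult_right_zero) simp
  also have "\<dots> = (LINT y|lborel. b (s + y / real (Suc m)) * hump y)"
    by (rule Bochner_Integration.integral_cong) (auto simp del: of_nat_Suc)
  finally show "(LINT x|lborel. ?f x) = (LINT y|lborel. b (s + y / real (Suc m)) * hump y)" .
qed

lemma scaled_hump_limit:
  fixes b :: "real \<Rightarrow> real"
  assumes b: "continuous_on UNIV b"
  shows "(\<lambda>m. LINT y|lborel. b (s + y / real (Suc m)) * hump y) \<longlonglongrightarrow> b s * ramp 1"
proof -
  have "bounded (b ` {s..s + 1})"
    by (rule compact_imp_bounded[OF compact_continuous_image[OF continuous_on_subset[OF b subset_UNIV] compact_Icc]])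
  then obtain C where C: "\<forall>z\<in>b ` {s..s + 1}. norm z \<le> C" unfolding bounded_iff by blast
  have "(\<lambda>m. LINT y|lborel. b (s + y / real (Suc m)) * hump y) \<longlonglongrightarrow> (LINT y|lborel. b s * hump y)"
  proof (rule integral_dominated_convergence[where w = "\<lambda>y. C * hump y"])
    have hm: "hump \<in> borel_measurable lborel"
      using borel_measurable_continuous_onI[OF continuous_hump] by simp
    show "(\<lambda>y. b s * hump y) \<in> borel_measurable lborel" using hm by (intro borel_measurable_times) auto
    show "(\<lambda>y. b (s + y / real (Suc m)) * hump y) \<in> borel_measurable lborel" for m
      by (simp, intro borel_measurable_continuous_onI continuous_intros continuous_hump continuous_on_compose2[OF b]) auto
    show "integrable lborel (\<lambda>y. C * hump y)" by (intro integrable_mult_right hump_integral)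
    show "AE y in lborel. (\<lambda>m. b (s + y / real (Suc m)) * hump y) \<longlonglongrightarrow> b s * hump y"
    proof (intro AE_I2 tendsto_mult tendsto_const)
      fix y
      have "(\<lambda>m. s + y * inverse (real (Suc m))) \<longlonglongrightarrow> s + y * 0"
        by (intro tendsto_intros LIMSEQ_inverse_real_of_nat)
      then have "(\<lambda>m. s + y / real (Suc m)) \<longlonglongrightarrow> s" by (simp add: divide_inverse)
      then show "(\<lambda>m. b (s + y / real (Suc m))) \<longlonglongrightarrow> b s"
        by (rule continuous_on_tendsto_compose[OF b]) auto
    qed
    show "AE y in lborel. norm (b (s + y / real (Suc m)) * hump y) \<le> C * hump y" for m
    proof (rule AE_I2)
      fix y
      show "norm (b (s + y / real (Suc m)) * hump y) \<le> C * hump y"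
      proof (cases "0 < y \<and> y < 1")
        case True
        then have "y / real (Suc m) \<le> 1" "0 \<le> y / real (Suc m)" by (auto simp: divide_le_eq)
        then have "norm (b (s + y / real (Suc m))) \<le> C" using C by auto
        then show ?thesis using hump_bounds[of y] by (simp add: abs_mult mult_right_mono)
      next
        case False
        then have "hump y = 0" by (intro hump_zero) auto
        then show ?thesis by simp
      qed
    qed
  qed
  then show ?thesis using hump_integral by simp
qed

text \<open>Tested against \<open>plateau s t m\<close>, whose derivative tends to point masses at \<open>s\<close> and \<open>t\<close> while the
  plateau itself tends to a multiple of the indicator of the interval.\<close>

theorem weak_derivative_integral:
  fixes b b' :: "real \<Rightarrow> real"
  assumes b: "continuous_on UNIV b" and w: "weak_partial b 1 b'" and st: "s \<le> t"
  shows "b t - b s = (LINT x|lebesgue. indicator {s..t} x * b' x)"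
proof -
  let ?n = "\<lambda>m. real (Suc m)"
  have li: "locally_integrable b'" using w unfolding weak_partial_def by blast
  have bm: "b \<in> borel_measurable borel" using b by (rule borel_measurable_continuous_onI)
  have lhs: "(LINT x|lebesgue. b x * frechet_derivative (plateau s t m) (at x) 1)
      = (LINT y|lborel. b (s + y / ?n m) * hump y) - (LINT y|lborel. b (t + y / ?n m) * hump y)" for m
  proof -
    have c: "continuous_on UNIV (\<lambda>x. b x * (?n m * hump ((x - s) * ?n m)) - b x * (?n m * hump ((x - t) * ?n m)))"
      by (intro continuous_intros b continuous_on_compose2[OF continuous_hump[of UNIV]]) auto
    have "(LINT x|lebesgue. b x * frechet_derivative (plateau s t m) (at x) 1)
      = (LINT x|lebesgue. b x * (?n m * hump ((x - s) * ?n m)) - b x * (?n m * hump ((x - t) * ?n m)))"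
      unfolding plateau_frechet by (simp only: right_diff_distrib)
    also have "\<dots> = (LINT x|lborel. b x * (?n m * hump ((x - s) * ?n m)) - b x * (?n m * hump ((x - t) * ?n m)))"
      by (rule integral_completion) (use borel_measurable_continuous_onI[OF c] in simp)
    also have "\<dots> = (LINT y|lborel. b (s + y / ?n m) * hump y) - (LINT y|lborel. b (t + y / ?n m) * hump y)"
      by (subst Bochner_Integration.integral_diff[OF scaled_hump_integral(1)[OF b] scaled_hump_integral(1)[OF b]])
        (simp only: scaled_hump_integral(2)[OF b])
    finally show ?thesis .
  qed
  have "(\<lambda>m. (LINT y|lborel. b (s + y / ?n m) * hump y) - (LINT y|lborel. b (t + y / ?n m) * hump y))
      \<longlonglongrightarrow> b s * ramp 1 - b t * ramp 1"
    by (intro tendsto_diff scaled_hump_limit b)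
  then have l1: "(\<lambda>m. - (LINT x|lebesgue. b' x * plateau s t m x)) \<longlonglongrightarrow> b s * ramp 1 - b t * ramp 1"
    unfolding lhs[symmetric] using w plateau_test_function[OF st] unfolding weak_partial_def by simp
  have i1: "integrable lebesgue (\<lambda>x. indicator {s..t + 1} x * b' x)"
    by (rule set_integrable_lebesgueD[OF li compact_Icc])
  have pm: "plateau s t m \<in> borel_measurable lebesgue" for m
  proof -
    have "continuous_on UNIV (plateau s t m)"
      using DERIV_isCont[OF plateau_derivative] by (simp add: continuous_on_eq_continuous_at)
    then show ?thesis by (intro measurable_completion) (simp add: borel_measurable_continuous_onI)
  qed
  have supp: "plateau s t m x = indicator {s..t + 1} x * plateau s t m x" for m x
  proof (cases "x \<in> {s..t + 1}")
    case False
    show ?thesis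
    proof (cases "x < s")
      case True
      then have "(x - s) * ?n m \<le> 0" "(x - t) * ?n m \<le> 0" using st by (auto simp: mult_le_0_iff)
      then show ?thesis using False by (simp add: plateau_def ramp_zero)
    next
      case ge: False
      then have "1 \<le> x - s" "1 \<le> x - t" using False st by auto
      then have "ramp ((x - s) * ?n m) = ramp 1"
        by (intro ramp_const) (use mult_mono[of 1 "x - s" 1 "?n m"] in simp)
      moreover have "ramp ((x - t) * ?n m) = ramp 1"
        by (intro ramp_const) (use mult_mono[of 1 "x - t" 1 "?n m"] \<open>1 \<le> x - t\<close> in simp)
      ultimately have "ramp ((x - s) * ?n m) = ramp 1" "ramp ((x - t) * ?n m) = ramp 1" by blast+
      then show ?thesis using False by (simp add: plateau_def)
    qed
  qed simp
  have lim: "(\<lambda>m. plateau s t m x) \<longlonglongrightarrow> ramp 1 * indicat_real {s<..t} x" for x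
  proof -
    have r: "(\<lambda>m. ramp ((x - c) * ?n m)) \<longlonglongrightarrow> (if c < x then ramp 1 else 0)" for c
    proof (cases "c < x")
      case True
      obtain N where N: "1 / (x - c) < real N" using reals_Archimedean2 by blast
      have "ramp ((x - c) * ?n m) = ramp 1" if "N \<le> m" for m
      proof (rule ramp_const)
        have "1 / (x - c) \<le> ?n m" using N that by simp
        then show "1 \<le> (x - c) * ?n m" using True by (simp add: divide_le_eq mult.commute)
      qed
      then show ?thesis using True by (intro tendsto_eventually eventually_sequentiallyI[of N]) simp
    next
      case False
      then have "(x - c) * ?n m \<le> 0" for m by (auto simp: mult_le_0_iff)
      then show ?thesis using False by (simp add: ramp_zero)
    qed
    have "(if s < x then ramp 1 else 0) - (if t < x then ramp 1 else 0) = ramp 1 * indicat_real {s<..t} x"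
      using st by (auto simp: indicator_def)
    then show ?thesis using tendsto_diff[OF r[of s] r[of t]] unfolding plateau_def by simp
  qed
  have b'm: "(\<lambda>x. indicator {s..t + 1} x * b' x) \<in> borel_measurable lebesgue" by (rule borel_measurable_integrable[OF i1])
  have "(\<lambda>m. LINT x|lebesgue. (indicator {s..t + 1} x * b' x) * plateau s t m x)
      \<longlonglongrightarrow> (LINT x|lebesgue. (indicator {s..t + 1} x * b' x) * (ramp 1 * indicat_real {s<..t} x))"
  proof (rule integral_dominated_convergence[where w = "\<lambda>x. \<bar>indicator {s..t + 1} x * b' x\<bar> * ramp 1"])
    show "integrable lebesgue (\<lambda>x. \<bar>indicator {s..t + 1} x * b' x\<bar> * ramp 1)"
      by (intro integrable_mult_left integrable_abs i1)
    show "(\<lambda>x. (indicator {s..t + 1} x * b' x) * (ramp 1 * indicat_real {s<..t} x)) \<in> borel_measurable lebesgue"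
      by (intro borel_measurable_times[OF b'm] borel_measurable_times[OF borel_measurable_const] borel_measurable_indicator) auto
    show "(\<lambda>x. (indicator {s..t + 1} x * b' x) * plateau s t m x) \<in> borel_measurable lebesgue" for m
      by (rule borel_measurable_times[OF b'm pm])
    show "AE x in lebesgue. (\<lambda>m. (indicator {s..t + 1} x * b' x) * plateau s t m x)
        \<longlonglongrightarrow> (indicator {s..t + 1} x * b' x) * (ramp 1 * indicat_real {s<..t} x)"
      by (intro AE_I2 tendsto_mult tendsto_const lim)
    show "AE x in lebesgue. norm ((indicator {s..t + 1} x * b' x) * plateau s t m x) \<le> \<bar>indicator {s..t + 1} x * b' x\<bar> * ramp 1" for m
    proof (rule AE_I2)
      fix x
      have "\<bar>plateau s t m x\<bar> \<le> ramp 1"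
        using ramp_bounds[of "(x - s) * ?n m"] ramp_bounds[of "(x - t) * ?n m"] unfolding plateau_def by linarith
      then show "norm ((indicator {s..t + 1} x * b' x) * plateau s t m x) \<le> \<bar>indicator {s..t + 1} x * b' x\<bar> * ramp 1"
        by (simp add: abs_mult mult_left_mono)
    qed
  qed
  moreover have "(indicator {s..t + 1} x * b' x) * plateau s t m x = b' x * plateau s t m x" for m x
    using supp[of m x] by (cases "x \<in> {s..t + 1}") auto
  moreover have "(LINT x|lebesgue. (indicator {s..t + 1} x * b' x) * (ramp 1 * indicat_real {s<..t} x))
      = (LINT x|lebesgue. indicator {s..t} x * b' x) * ramp 1"
  proof -
    have m1: "(\<lambda>x. indicator {s..t} x * b' x * ramp 1) \<in> borel_measurable lebesgue"
      using borel_measurable_integrable[OF set_integrable_lebesgueD[OF li compact_Icc[of s t]]]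
      by (rule borel_measurable_times[OF _ borel_measurable_const])
    have "(LINT x|lebesgue. (indicator {s..t + 1} x * b' x) * (ramp 1 * indicat_real {s<..t} x))
        = (LINT x|lebesgue. indicator {s..t} x * b' x * ramp 1)"
    proof (rule integral_cong_AE[OF _ m1])
      show "(\<lambda>x. (indicator {s..t + 1} x * b' x) * (ramp 1 * indicat_real {s<..t} x)) \<in> borel_measurable lebesgue"
        by (intro borel_measurable_times[OF b'm] borel_measurable_times[OF borel_measurable_const] borel_measurable_indicator) auto
      have "AE x in lebesgue. x \<noteq> s" by (rule AE_completion[OF AE_lborel_singleton])
      then show "AE x in lebesgue. (indicator {s..t + 1} x * b' x) * (ramp 1 * indicat_real {s<..t} x)
          = indicator {s..t} x * b' x * ramp 1"
        by eventually_elim (auto simp: indicator_def)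
    qed
    then show ?thesis by (simp only: integral_mult_left_zero)
  qed
  ultimately have "(\<lambda>m. LINT x|lebesgue. b' x * plateau s t m x) \<longlonglongrightarrow> (LINT x|lebesgue. indicator {s..t} x * b' x) * ramp 1"
    by (simp only:)
  from LIMSEQ_unique[OF tendsto_minus[OF this] l1]
  have "(LINT x|lebesgue. indicator {s..t} x * b' x) * ramp 1 = (b t - b s) * ramp 1" by (simp add: algebra_simps)
  then show ?thesis using ramp_pos by simp
qed

section \<open>Functions of one coordinate\<close>

text \<open>The integrand is a product of functions of one coordinate each.\<close>

lemma nn_integral_coordinate:
  fixes h :: "real \<Rightarrow> ennreal" and b :: "'a::euclidean_space"
  assumes b: "b \<in> Basis" and h: "h \<in> borel_measurable borel"
  shows "(\<integral>\<^sup>+y. h (y \<bullet> b) * indicator (cbox (- (R *\<^sub>R One)) (R *\<^sub>R One)) y \<partial>lborel)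
    = (\<integral>\<^sup>+t. h t * indicator {-R..R} t \<partial>lborel) * (\<Prod>c\<in>Basis - {b}. emeasure lborel {-R..R})"
proof -
  let ?f = "\<lambda>c t. if c = b then h t * indicator {-R..R} t else indicator {-R..R} (t :: real) :: ennreal"
  have "h (y \<bullet> b) * indicator (cbox (- (R *\<^sub>R One)) (R *\<^sub>R One)) y = (\<Prod>c\<in>Basis. ?f c (y \<bullet> c))" for y
  proof -
    have "(\<Prod>c\<in>Basis. ?f c (y \<bullet> c)) = ?f b (y \<bullet> b) * (\<Prod>c\<in>Basis - {b}. ?f c (y \<bullet> c))"
      using b by (intro prod.remove) auto
    also have "(\<Prod>c\<in>Basis - {b}. ?f c (y \<bullet> c)) = (\<Prod>c\<in>Basis - {b}. indicator {-R..R} (y \<bullet> c))"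
      by (intro prod.cong) auto
    also have "?f b (y \<bullet> b) * \<dots> = h (y \<bullet> b) * (\<Prod>c\<in>Basis. indicator {-R..R} (y \<bullet> c))"
      using b by (subst prod.remove[of Basis b]) (auto simp: mult.assoc)
    also have "(\<Prod>c\<in>Basis. indicator {-R..R} (y \<bullet> c)) = (indicator (cbox (- (R *\<^sub>R One)) (R *\<^sub>R One)) y :: ennreal)"
      by (auto simp: indicator_def mem_box prod_zero_iff)
    finally show ?thesis by simp
  qed
  then have "(\<integral>\<^sup>+y. h (y \<bullet> b) * indicator (cbox (- (R *\<^sub>R One)) (R *\<^sub>R One)) y \<partial>lborel)
    = (\<integral>\<^sup>+y. (\<Prod>c\<in>Basis. ?f c (y \<bullet> c)) \<partial>lborel)" by simp
  also have "\<dots> = (\<Prod>c\<in>Basis. \<integral>\<^sup>+t. ?f c t \<partial>lborel)"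
    using h by (intro nn_integral_lborel_prod) auto
  also have "\<dots> = (\<integral>\<^sup>+t. ?f b t \<partial>lborel) * (\<Prod>c\<in>Basis - {b}. \<integral>\<^sup>+t. ?f c t \<partial>lborel)"
    using b by (intro prod.remove) auto
  also have "(\<Prod>c\<in>Basis - {b}. \<integral>\<^sup>+t. ?f c t \<partial>lborel) = (\<Prod>c\<in>Basis - {b}. emeasure lborel {-R..R})"
    by (intro prod.cong refl) simp
  finally show ?thesis by simp
qed

text \<open>The preimage of a null set under a coordinate is null; on a bounded box this is Fubini's
  theorem, and countably many boxes cover the space.\<close>

lemma AE_coordinate:
  fixes b :: "'a::euclidean_space"
  assumes b: "b \<in> Basis" and P: "AE t in lebesgue. P t"
  shows "AE y in lebesgue. P (y \<bullet> b)"
proof -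
  have "AE t in lborel. P t" using P by (simp add: AE_completion_iff)
  then obtain N where N: "N \<in> null_sets lborel" "{t. \<not> P t} \<subseteq> N"
    by (auto elim!: AE_E simp: null_sets_def)
  let ?Q = "\<lambda>n. cbox (- (real n *\<^sub>R One)) (real n *\<^sub>R One :: 'a)"
  have ind: "indicator N \<in> borel_measurable (borel :: real measure)" using N(1) by (auto simp: null_sets_def)
  have "AE y in lborel. indicator N (y \<bullet> b) * indicator (?Q n) y = (0::ennreal)" for n
  proof -
    have "(\<integral>\<^sup>+y. indicator N (y \<bullet> b) * indicator (?Q n) y \<partial>lborel) = 0"
    proof -
      have "(\<integral>\<^sup>+t. indicator N t * indicator {-real n..real n} t \<partial>lborel) \<le> (\<integral>\<^sup>+t. indicator N t \<partial>lborel)"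
        by (intro nn_integral_mono) (auto simp: indicator_def)
      also have "\<dots> = 0" using null_setsD1[OF N(1)] null_setsD2[OF N(1)] by simp
      finally show ?thesis unfolding nn_integral_coordinate[OF b ind] by simp
    qed
    moreover have "(\<lambda>y. indicator N (y \<bullet> b) * indicator (?Q n) y :: ennreal) \<in> borel_measurable lborel"
      using measurable_compose[OF _ ind, of "\<lambda>y. y \<bullet> b" borel] by (intro borel_measurable_times_ennreal) auto
    ultimately show ?thesis by (subst (asm) nn_integral_0_iff_AE) auto
  qed
  then have "AE y in lborel. \<forall>n. indicator N (y \<bullet> b) * indicator (?Q n) y = (0::ennreal)"
    unfolding AE_all_countable by blast
  then have "AE y in lborel. P (y \<bullet> b)"
  proof eventually_elim
    case (elim y)
    have "y \<in> (\<Union>n. box (- (real n *\<^sub>R One)) (real n *\<^sub>R One))" unfolding UN_box_eq_UNIV by (rule UNIV_I)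
    then obtain n where "y \<in> ?Q n" using box_subset_cbox by blast
    then have "y \<bullet> b \<notin> N" using elim[rule_format, of n] by (auto simp: indicator_def split: if_splits)
    then show ?case using N(2) by blast
  qed
  then show ?thesis by (rule AE_completion)
qed

lemma locally_integrable_coordinate:
  fixes b :: "'a::euclidean_space" and g :: "real \<Rightarrow> real"
  assumes b: "b \<in> Basis" and g: "locally_integrable g" and gm: "g \<in> borel_measurable lebesgue"
  shows "locally_integrable (\<lambda>y. g (y \<bullet> b))" "(\<lambda>y. g (y \<bullet> b)) \<in> borel_measurable lebesgue"
proof -
  obtain g' where g': "g' \<in> borel_measurable lborel" "AE t in lborel. g t = g' t"
    using completion_ex_borel_measurable_real[OF gm] by blast
  have ae: "AE y in lebesgue. g' (y \<bullet> b) = g (y \<bullet> b)"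
    using AE_coordinate[OF b AE_completion[OF g'(2)]] by eventually_elim simp
  have m': "(\<lambda>y :: 'a. g' (y \<bullet> b)) \<in> borel_measurable lborel"
    using g'(1) by (intro measurable_compose[of "\<lambda>y. y \<bullet> b" lborel borel g']) auto
  show m: "(\<lambda>y. g (y \<bullet> b)) \<in> borel_measurable lebesgue"
    by (rule borel_measurable_AE[OF measurable_completion[OF m'] ae])
  show "locally_integrable (\<lambda>y. g (y \<bullet> b))"
    unfolding locally_integrable_def
  proof (intro allI impI)
    fix K :: "'a set" assume K: "compact K"
    obtain M where M: "\<forall>x\<in>K. norm x \<le> M" using compact_imp_bounded[OF K] unfolding bounded_iff by blast
    define R where "R = max M 0"
    let ?Q = "cbox (- (R *\<^sub>R One)) (R *\<^sub>R One :: 'a)"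
    have KQ: "K \<subseteq> ?Q"
    proof
      fix x assume x: "x \<in> K"
      have "\<bar>x \<bullet> c\<bar> \<le> R" if "c \<in> Basis" for c
        using Basis_le_norm[OF that, of x] M x unfolding R_def by force
      then have "- R \<le> x \<bullet> c \<and> x \<bullet> c \<le> R" if "c \<in> Basis" for c
        using that by (meson abs_le_D1 abs_le_D2 minus_le_iff)
      then show "x \<in> ?Q" by (simp add: mem_box)
    qed
    have fin: "(\<integral>\<^sup>+t. ennreal \<bar>g' t\<bar> * indicator {-R..R} t \<partial>lborel) < \<infinity>"
    proof -
      have "integrable lebesgue (\<lambda>t. indicator {-R..R} t *\<^sub>R g t)"
        using g compact_Icc[of "-R" R] unfolding locally_integrable_def set_integrable_def by blast
      then have "(\<integral>\<^sup>+t. ennreal (norm (indicator {-R..R} t *\<^sub>R g t)) \<partial>lebesgue) < \<infinity>"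
        unfolding integrable_iff_bounded by blast
      also have "(\<integral>\<^sup>+t. ennreal (norm (indicator {-R..R} t *\<^sub>R g t)) \<partial>lebesgue)
          = (\<integral>\<^sup>+t. ennreal \<bar>g' t\<bar> * indicator {-R..R} t \<partial>lebesgue)"
        using AE_completion[OF g'(2)] by (intro nn_integral_cong_AE, eventually_elim) (auto simp: indicator_def)
      finally show ?thesis by (simp add: nn_integral_completion)
    qed
    have gm': "(\<lambda>t. ennreal \<bar>g' t\<bar>) \<in> borel_measurable borel" using g'(1) by simp
    have "(\<integral>\<^sup>+y. ennreal (norm (indicator K y *\<^sub>R g (y \<bullet> b))) \<partial>lebesgue)
        \<le> (\<integral>\<^sup>+y. ennreal \<bar>g' (y \<bullet> b)\<bar> * indicator ?Q y \<partial>lebesgue)"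
      using ae by (intro nn_integral_mono_AE, eventually_elim) (use KQ in \<open>auto simp: indicator_def\<close>)
    also have "\<dots> = (\<integral>\<^sup>+y. ennreal \<bar>g' (y \<bullet> b)\<bar> * indicator ?Q y \<partial>lborel)" by (rule nn_integral_completion)
    also have "\<dots> = (\<integral>\<^sup>+t. ennreal \<bar>g' t\<bar> * indicator {-R..R} t \<partial>lborel) * (\<Prod>c\<in>Basis - {b}. emeasure lborel {-R..R})"
      by (rule nn_integral_coordinate[OF b gm'])
    also have "\<dots> < \<infinity>"
    proof -
      have "(\<Prod>c\<in>Basis - {b}. emeasure lborel {-R..R}) = (\<Prod>c\<in>Basis - {b}. ennreal (2 * R))"
        by (simp add: R_def)
      then show ?thesis using fin by (simp add: ennreal_mult_less_top prod_ennreal R_def power_less_top_ennreal)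
    qed
    finally show "set_integrable lebesgue K (\<lambda>y. g (y \<bullet> b))"
      unfolding set_integrable_def integrable_iff_bounded
      using m borel_compact[OF K] by (auto intro!: borel_measurable_times borel_measurable_indicator)
  qed
qed

section \<open>Products along lines and cutoffs\<close>

text \<open>Where \<open>u\<close> vanishes, \<open>v\<close> may be arbitrary. So the factor
  \<open>v\<close> has to be controlled on the ball only.\<close>

lemma line_lipschitz_product:
  fixes u v :: "'a::real_normed_vector \<Rightarrow> real"
  assumes u: "\<And>x. \<bar>u x\<bar> \<le> Cu" "\<And>x t. \<bar>u (x + t *\<^sub>R b) - u x\<bar> \<le> Lu * \<bar>t\<bar>"
    and supp: "\<And>x. R < norm x \<Longrightarrow> u x = 0"
    and v: "\<And>x. norm x \<le> R \<Longrightarrow> \<bar>v x\<bar> \<le> Cv"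
      "\<And>x t. norm x \<le> R \<Longrightarrow> norm (x + t *\<^sub>R b) \<le> R \<Longrightarrow> \<bar>v (x + t *\<^sub>R b) - v x\<bar> \<le> Lv * \<bar>t\<bar>"
    and nn: "0 \<le> Cv" "0 \<le> Lv" "0 \<le> Lu"
  shows "\<bar>v x * u x\<bar> \<le> Cv * Cu"
    "\<bar>v (x + t *\<^sub>R b) * u (x + t *\<^sub>R b) - v x * u x\<bar> \<le> (Cv * Lu + Cu * Lv) * \<bar>t\<bar>"
proof -
  have Cu: "0 \<le> Cu" using u(1)[of 0] by linarith
  show "\<bar>v x * u x\<bar> \<le> Cv * Cu"
  proof (cases "norm x \<le> R")
    case True
    then show ?thesis using v(1)[of x] u(1)[of x] nn by (simp add: abs_mult mult_mono)
  qed (use supp nn Cu in simp)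
  let ?y = "x + t *\<^sub>R b"
  have n1: "0 \<le> Cv * (Lu * \<bar>t\<bar>)" "0 \<le> Cu * (Lv * \<bar>t\<bar>)" using nn Cu by auto
  consider "norm x \<le> R" "norm ?y \<le> R" | "norm x \<le> R" "R < norm ?y" | "R < norm x" "norm ?y \<le> R" | "R < norm x" "R < norm ?y"
    by linarith
  then have "\<bar>v ?y * u ?y - v x * u x\<bar> \<le> Cv * (Lu * \<bar>t\<bar>) + Cu * (Lv * \<bar>t\<bar>)"
  proof cases
    case 1
    have "v ?y * u ?y - v x * u x = v x * (u ?y - u x) + u ?y * (v ?y - v x)" by (simp add: algebra_simps)
    also have "\<bar>\<dots>\<bar> \<le> \<bar>v x\<bar> * \<bar>u ?y - u x\<bar> + \<bar>u ?y\<bar> * \<bar>v ?y - v x\<bar>"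
      by (rule order_trans[OF abs_triangle_ineq]) (simp add: abs_mult)
    also have "\<dots> \<le> Cv * (Lu * \<bar>t\<bar>) + Cu * (Lv * \<bar>t\<bar>)"
      using v(1)[OF 1(1)] u(1)[of ?y] u(2)[of x t] v(2)[OF 1] nn Cu by (intro add_mono mult_mono) auto
    finally show ?thesis .
  next
    case 2
    have "\<bar>v ?y * u ?y - v x * u x\<bar> = \<bar>v x\<bar> * \<bar>u ?y - u x\<bar>" using supp[OF 2(2)] by (simp add: abs_mult)
    also have "\<dots> \<le> Cv * (Lu * \<bar>t\<bar>)" using v(1)[OF 2(1)] u(2)[of x t] nn by (intro mult_mono) auto
    finally show ?thesis using n1 by linarith
  next
    case 3
    have "\<bar>v ?y * u ?y - v x * u x\<bar> = \<bar>v ?y\<bar> * \<bar>u ?y - u x\<bar>" using supp[OF 3(1)] by (simp add: abs_mult)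
    also have "\<dots> \<le> Cv * (Lu * \<bar>t\<bar>)" using v(1)[OF 3(2)] u(2)[of x t] nn by (intro mult_mono) auto
    finally show ?thesis using n1 by linarith
  next
    case 4
    then show ?thesis using supp n1 by simp
  qed
  then show "\<bar>v ?y * u ?y - v x * u x\<bar> \<le> (Cv * Lu + Cu * Lv) * \<bar>t\<bar>" by (simp add: algebra_simps)
qed

text \<open>Continuously differentiable because of the square. Its derivative is of the order of the inverse
  of \<open>R\<close>, so against functions of linear growth it stays bounded, and it vanishes in the
  limit.\<close>

definition cutoff :: "real \<Rightarrow> 'a::real_inner \<Rightarrow> real" where
  "cutoff R x = (max 0 (1 - (x \<bullet> x) / R\<^sup>2))\<^sup>2"

lemma cutoff_bounds: "0 \<le> cutoff R x" "cutoff R x \<le> 1"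
  unfolding cutoff_def by (auto simp: power_le_one)

lemma cutoff_zero: "0 < R \<Longrightarrow> R < norm x \<Longrightarrow> cutoff R x = 0"
proof -
  assume R: "0 < R" "R < norm x"
  then have "R\<^sup>2 \<le> x \<bullet> x" unfolding power2_norm_eq_inner[symmetric] by (intro power_mono) auto
  then have "1 \<le> (x \<bullet> x) / R\<^sup>2" using R by (simp add: le_divide_eq)
  then show ?thesis by (simp add: cutoff_def max_def)
qed

lemma continuous_cutoff: "0 < R \<Longrightarrow> continuous_on UNIV (cutoff R)"
  unfolding cutoff_def[abs_def] by (intro continuous_intros) auto

lemma positive_square_derivative: "((\<lambda>s. (max 0 s)\<^sup>2) has_real_derivative 2 * max 0 s) (at s)"
proof -
  consider "s < 0" | "s = 0" | "0 < s" by linarith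
  then show ?thesis
  proof cases
    case 1
    have "((\<lambda>_. 0) has_real_derivative 2 * max 0 s) (at s)" using 1 by simp
    then show ?thesis
      by (rule has_field_derivative_transform_within[where d = "- s"]) (use 1 in \<open>auto simp: dist_real_def max_def\<close>)
  next
    case 2
    have "((\<lambda>h. max 0 h) \<longlongrightarrow> max 0 (0::real)) (at 0)" by (intro tendsto_intros)
    then have "((\<lambda>h::real. ((max 0 (0 + h))\<^sup>2 - (max 0 0)\<^sup>2) / h) \<longlongrightarrow> 0) (at 0)"
      by (simp, elim Lim_transform_eventually) (auto simp: eventually_at_filter max_def power2_eq_square)
    then show ?thesis using 2 by (simp add: DERIV_def)
  next
    case 3
    have "((\<lambda>s. s\<^sup>2) has_real_derivative 2 * max 0 s) (at s)" using 3 by (auto intro!: derivative_eq_intros)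
    then show ?thesis
      by (rule has_field_derivative_transform_within[where d = s]) (use 3 in \<open>auto simp: dist_real_def max_def\<close>)
  qed
qed

definition cutoff' :: "real \<Rightarrow> 'a::real_inner \<Rightarrow> 'a \<Rightarrow> real" where
  "cutoff' R b x = - (4 / R\<^sup>2) * max 0 (1 - (x \<bullet> x) / R\<^sup>2) * (x \<bullet> b)"

lemma cutoff_derivative:
  assumes R: "0 < R"
  shows "((\<lambda>t. cutoff R (x + t *\<^sub>R b)) has_real_derivative cutoff' R b (x + s *\<^sub>R b)) (at s)"
proof -
  let ?q = "\<lambda>t. 1 - ((x + t *\<^sub>R b) \<bullet> (x + t *\<^sub>R b)) / R\<^sup>2"
  have "(?q has_real_derivative - (2 * ((x + s *\<^sub>R b) \<bullet> b)) / R\<^sup>2) (at s)"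
  proof -
    define k where "k = inverse (R\<^sup>2)"
    have "?q = (\<lambda>t. 1 - (x \<bullet> x + 2 * t * (x \<bullet> b) + t\<^sup>2 * (b \<bullet> b)) * k)"
      by (simp add: fun_eq_iff inner_add_left inner_add_right inner_commute power2_eq_square algebra_simps
          divide_inverse k_def)
    moreover have "((\<lambda>t. 1 - (x \<bullet> x + 2 * t * (x \<bullet> b) + t\<^sup>2 * (b \<bullet> b)) * k) has_real_derivative
        - (2 * ((x + s *\<^sub>R b) \<bullet> b)) * k) (at s)"
      by (auto intro!: derivative_eq_intros simp: inner_add_left algebra_simps)
    ultimately show ?thesis by (simp add: divide_inverse k_def)
  qed
  from DERIV_chain2[OF positive_square_derivative this]
  show ?thesis unfolding cutoff_def by (rule DERIV_cong) (simp add: cutoff'_def)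
qed

lemma cutoff'_bound:
  assumes R: "0 < R" and b: "norm b = 1"
  shows "\<bar>cutoff' R b x\<bar> * norm x \<le> 4" "\<bar>cutoff' R b x\<bar> \<le> 4 / R" "R < norm x \<Longrightarrow> cutoff' R b x = 0"
proof -
  show z: "cutoff' R b x = 0" if "R < norm x"
  proof -
    have "R\<^sup>2 \<le> x \<bullet> x" using R that unfolding power2_norm_eq_inner[symmetric] by (intro power_mono) auto
    then have "1 \<le> (x \<bullet> x) / R\<^sup>2" using R by (simp add: le_divide_eq)
    then show ?thesis by (simp add: cutoff'_def max_def)
  qed
  have le: "\<bar>cutoff' R b x\<bar> \<le> 4 / R\<^sup>2 * norm x"
  proof -
    have m: "0 \<le> max 0 (1 - (x \<bullet> x) / R\<^sup>2)" "max 0 (1 - (x \<bullet> x) / R\<^sup>2) \<le> 1" by auto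
    have "\<bar>cutoff' R b x\<bar> = 4 / R\<^sup>2 * (max 0 (1 - (x \<bullet> x) / R\<^sup>2) * \<bar>x \<bullet> b\<bar>)"
      unfolding cutoff'_def by (simp add: abs_mult)
    also have "\<dots> \<le> 4 / R\<^sup>2 * (1 * norm x)"
      using m Cauchy_Schwarz_ineq2[of x b] b by (intro mult_left_mono mult_mono) auto
    finally show ?thesis by simp
  qed
  show "\<bar>cutoff' R b x\<bar> * norm x \<le> 4"
  proof (cases "norm x \<le> R")
    case True
    have "\<bar>cutoff' R b x\<bar> * norm x \<le> (4 / R\<^sup>2 * norm x) * norm x" by (rule mult_right_mono[OF le]) simp
    also have "\<dots> \<le> (4 / R\<^sup>2) * (R * R)"
      using True R by (simp only: mult.assoc) (intro mult_left_mono mult_mono; simp)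
    finally show ?thesis using R by (simp add: power2_eq_square)
  qed (use z in simp)
  show "\<bar>cutoff' R b x\<bar> \<le> 4 / R"
  proof (cases "norm x \<le> R")
    case True
    have "4 / R\<^sup>2 * norm x \<le> 4 / R\<^sup>2 * R" using True R by (intro mult_left_mono) auto
    then show ?thesis using le R by (simp add: power2_eq_square)
  qed (use z R in simp)
qed

lemma cutoff_line_lipschitz:
  assumes R: "0 < R" and b: "norm b = 1"
  shows "\<bar>cutoff R (x + t *\<^sub>R b) - cutoff R x\<bar> \<le> 4 / R * \<bar>t\<bar>"
  using field_differentiable_bound[of UNIV "\<lambda>t. cutoff R (x + t *\<^sub>R b)" "\<lambda>t. cutoff' R b (x + t *\<^sub>R b)" "4 / R" t 0,
      OF convex_UNIV cutoff_derivative[OF R]] cutoff'_bound(2)[OF R b]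
  by simp

lemma cutoff_limit: "(\<lambda>n. cutoff (real (Suc n)) x) \<longlonglongrightarrow> 1" "(\<lambda>n. cutoff' (real (Suc n)) b x) \<longlonglongrightarrow> 0"
proof -
  have q: "(\<lambda>n. c / (real (Suc n))\<^sup>2) \<longlonglongrightarrow> 0" for c :: real
  proof -
    have "(\<lambda>n. c * (inverse (real (Suc n)))\<^sup>2) \<longlonglongrightarrow> c * 0\<^sup>2"
      by (intro tendsto_intros LIMSEQ_inverse_real_of_nat)
    then show ?thesis by (simp add: divide_inverse power_inverse)
  qed
  have "(\<lambda>n. (max 0 (1 - (x \<bullet> x) / (real (Suc n))\<^sup>2))\<^sup>2) \<longlonglongrightarrow> (max 0 (1 - 0))\<^sup>2"
    by (intro tendsto_intros q)
  then show "(\<lambda>n. cutoff (real (Suc n)) x) \<longlonglongrightarrow> 1" unfolding cutoff_def by simp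
  have "(\<lambda>n. - (4 / (real (Suc n))\<^sup>2) * max 0 (1 - (x \<bullet> x) / (real (Suc n))\<^sup>2) * (x \<bullet> b)) \<longlonglongrightarrow> - 0 * max 0 (1 - 0) * (x \<bullet> b)"
    by (intro tendsto_intros q)
  then show "(\<lambda>n. cutoff' (real (Suc n)) b x) \<longlonglongrightarrow> 0" unfolding cutoff'_def by simp
qed

section \<open>Indefinite integrals and truncation\<close>

text \<open>The integral from 0 to \<open>t\<close>, with the sign reversed for negative
  \<open>t\<close>.\<close>

definition primitive :: "(real \<Rightarrow> real) \<Rightarrow> real \<Rightarrow> real" where
  "primitive g t = (LINT x|lebesgue. (indicator {0..t} x - indicator {t..0} x) * g x)"

lemma primitive_integrable:
  fixes g :: "real \<Rightarrow> real"
  assumes "locally_integrable g"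
  shows "integrable lebesgue (\<lambda>x. (indicator {0..t} x - indicator {t..0} x) * g x)"
  using Bochner_Integration.integrable_diff[OF set_integrable_lebesgueD[OF assms compact_Icc[of 0 t]]
      set_integrable_lebesgueD[OF assms compact_Icc[of t 0]]]
  by (simp add: left_diff_distrib)

lemma primitive_diff:
  assumes g: "locally_integrable g" and st: "s \<le> t"
  shows "primitive g t - primitive g s = (LINT x|lebesgue. indicator {s..t} x * g x)"
proof -
  have "primitive g t - primitive g s = (LINT x|lebesgue. (indicator {0..t} x - indicator {t..0} x) * g x
      - (indicator {0..s} x - indicator {s..0} x) * g x)"
    unfolding primitive_def by (simp add: Bochner_Integration.integral_diff primitive_integrable[OF g])
  also have "\<dots> = (LINT x|lebesgue. indicator {s..t} x * g x)"
  proof (rule integral_cong_AE)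
    show "(\<lambda>x. (indicator {0..t} x - indicator {t..0} x) * g x - (indicator {0..s} x - indicator {s..0} x) * g x) \<in> borel_measurable lebesgue"
      by (intro borel_measurable_integrable Bochner_Integration.integrable_diff primitive_integrable[OF g])
    show "(\<lambda>x. indicator {s..t} x * g x) \<in> borel_measurable lebesgue"
      by (intro borel_measurable_integrable set_integrable_lebesgueD[OF g compact_Icc])
    have "AE x in lebesgue. x \<noteq> c" for c :: real by (rule AE_completion[OF AE_lborel_singleton])
    from this[of 0] this[of s] this[of t]
    show "AE x in lebesgue. (indicator {0..t} x - indicator {t..0} x) * g x - (indicator {0..s} x - indicator {s..0} x) * g x
        = indicator {s..t} x * g x"
      by eventually_elim (use st in \<open>auto simp: indicator_def\<close>)
  qed
  finally show ?thesis .
qed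

lemma primitive_bound:
  assumes g: "locally_integrable g" and t: "\<bar>t\<bar> \<le> R"
  shows "\<bar>primitive g t\<bar> \<le> (LINT x|lebesgue. indicator {-R..R} x * \<bar>g x\<bar>)"
proof -
  have i: "integrable lebesgue (\<lambda>x. indicator {-R..R} x * \<bar>g x\<bar>)"
    using integrable_abs[OF set_integrable_lebesgueD[OF g compact_Icc[of "-R" R]]] by (simp add: abs_mult)
  have "\<bar>primitive g t\<bar> \<le> (LINT x|lebesgue. \<bar>(indicator {0..t} x - indicator {t..0} x) * g x\<bar>)"
    unfolding primitive_def by (rule integral_abs_bound)
  also have "\<dots> \<le> (LINT x|lebesgue. indicator {-R..R} x * \<bar>g x\<bar>)"
    using t by (intro integral_mono integrable_abs primitive_integrable g i) (auto simp: indicator_def abs_mult abs_le_iff)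
  finally show ?thesis .
qed

definition clamp_at :: "nat \<Rightarrow> real \<Rightarrow> real" where
  "clamp_at m v = max (- real m) (min (real m) v)"

lemma clamp_at_bounds: "\<bar>clamp_at m v\<bar> \<le> real m" "\<bar>clamp_at m v\<bar> \<le> \<bar>v\<bar>"
  by (auto simp: clamp_at_def)

lemma clamp_at_limit: "(\<lambda>m. clamp_at m v) \<longlonglongrightarrow> v"
proof (rule tendsto_eventually)
  obtain N where "\<bar>v\<bar> \<le> real N" using real_arch_simple by blast
  then show "\<forall>\<^sub>F m in sequentially. clamp_at m v = v"
    by (intro eventually_sequentiallyI[of N]) (auto simp: clamp_at_def)
qed

lemma clamp_at_measurable: "g \<in> borel_measurable M \<Longrightarrow> (\<lambda>x. clamp_at m (g x)) \<in> borel_measurable M"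
  unfolding clamp_at_def by (intro borel_measurable_max borel_measurable_min borel_measurable_const)

lemma lebesgue_measurable_of_locally_integrable:
  fixes g :: "'a::euclidean_space \<Rightarrow> real"
  assumes g: "locally_integrable g"
  shows "g \<in> borel_measurable lebesgue"
proof -
  have "(\<lambda>x. indicat_real (cball 0 (real n)) x *\<^sub>R g x) \<in> borel_measurable lebesgue" for n
    using g compact_cball[of 0 "real n"] unfolding locally_integrable_def set_integrable_def
    by (intro borel_measurable_integrable) blast
  moreover have "(\<lambda>n. indicat_real (cball 0 (real n)) x *\<^sub>R g x) \<longlonglongrightarrow> g x" for x
  proof (rule tendsto_eventually)
    obtain N where "norm x \<le> real N" using real_arch_simple by blast
    then show "\<forall>\<^sub>F n in sequentially. indicat_real (cball 0 (real n)) x *\<^sub>R g x = g x"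
      by (intro eventually_sequentiallyI[of N]) auto
  qed
  ultimately show ?thesis by (rule borel_measurable_LIMSEQ_real[rotated])
qed

lemma locally_integrable_bound:
  fixes g h :: "'a::euclidean_space \<Rightarrow> real"
  assumes g: "locally_integrable g" and h: "h \<in> borel_measurable lebesgue" and le: "\<And>x. \<bar>h x\<bar> \<le> \<bar>g x\<bar>"
  shows "locally_integrable h"
  unfolding locally_integrable_def set_integrable_def
proof (intro allI impI)
  fix K :: "'a set" assume K: "compact K"
  have "integrable lebesgue (\<lambda>x. indicat_real K x *\<^sub>R g x)"
    using g K unfolding locally_integrable_def set_integrable_def by blast
  then show "integrable lebesgue (\<lambda>x. indicat_real K x *\<^sub>R h x)"
  proof (rule Bochner_Integration.integrable_bound)
    show "(\<lambda>x. indicat_real K x *\<^sub>R h x) \<in> borel_measurable lebesgue"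
      using borel_compact[OF K] by (intro borel_measurable_scaleR borel_measurable_indicator h) auto
    show "AE x in lebesgue. norm (indicat_real K x *\<^sub>R h x) \<le> norm (indicat_real K x *\<^sub>R g x)"
      using le by (intro AE_I2) (simp add: abs_mult mult_left_mono)
  qed
qed

section \<open>Integration by parts against a base density\<close>

text \<open>Truncating the weak derivative of \<open>\<beta>\<close> makes its primitive Lipschitz; the truncation is then removed by
  dominated convergence.\<close>

theorem integration_by_parts_coordinate:
  fixes \<beta> \<beta>' :: "real \<Rightarrow> real" and k u u' :: "'a::euclidean_space \<Rightarrow> real" and b :: 'a
  assumes b: "b \<in> Basis"
    and \<beta>: "continuous_on UNIV \<beta>" "weak_partial \<beta> 1 \<beta>'"
    and k: "continuous_on UNIV k" "\<And>y t. k (y + t *\<^sub>R b) = k y"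
    and u: "continuous_on UNIV u" "\<And>x. \<bar>u x\<bar> \<le> Cu" "\<And>x t. \<bar>u (x + t *\<^sub>R b) - u x\<bar> \<le> Lu * \<bar>t\<bar>"
    and supp: "\<And>x. R < norm x \<Longrightarrow> u x = 0"
    and u': "AE x in lebesgue. ((\<lambda>t. u (x + t *\<^sub>R b)) has_real_derivative u' x) (at 0)"
  shows "integrable lebesgue (\<lambda>y. \<beta>' (y \<bullet> b) * k y * u y)" (is ?i1)
    and "integrable lebesgue (\<lambda>y. \<beta> (y \<bullet> b) * k y * u' y)" (is ?i2)
    and "(LINT y|lebesgue. \<beta>' (y \<bullet> b) * k y * u y) + (LINT y|lebesgue. \<beta> (y \<bullet> b) * k y * u' y) = 0"
proof -
  have nb: "norm b = 1" using b by simp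
  have Lu: "0 \<le> Lu" using order_trans[OF abs_ge_zero u(3)[of 0 1]] by simp
  have Cu: "0 \<le> Cu" using u(2)[of 0] by linarith
  have li: "locally_integrable \<beta>'" using \<beta>(2) unfolding weak_partial_def by blast
  have \<beta>'m: "\<beta>' \<in> borel_measurable lebesgue" by (rule lebesgue_measurable_of_locally_integrable[OF li])
  have mb: "g \<in> borel_measurable lebesgue" if "continuous_on UNIV g" for g :: "'a \<Rightarrow> real"
    using borel_measurable_continuous_onI[OF that] by (intro measurable_completion) simp
  have bounded_on_ball: "\<exists>M\<ge>0. \<forall>x. norm x \<le> R \<longrightarrow> \<bar>g x\<bar> \<le> M" if "continuous_on UNIV g" for g :: "'a \<Rightarrow> real"
  proof -
    have "bounded (g ` cball 0 R)"
      by (rule compact_imp_bounded[OF compact_continuous_image[OF continuous_on_subset[OF that subset_UNIV] compact_cball]])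
    then obtain M where "\<forall>y\<in>g ` cball 0 R. norm y \<le> M" unfolding bounded_iff by blast
    then show ?thesis by (intro exI[of _ "max M 0"]) force
  qed
  obtain Ck where Ck: "0 \<le> Ck" "\<And>x. norm x \<le> R \<Longrightarrow> \<bar>k x\<bar> \<le> Ck" using bounded_on_ball[OF k(1)] by blast
  define \<beta>m' where "\<beta>m' m t = clamp_at m (\<beta>' t)" for m t
  \<comment> \<open>the primitives of the truncated derivatives are Lipschitz and converge to
    \<open>\<beta>\<close>, boundedly on bounded sets\<close>
  define \<beta>m where "\<beta>m m t = \<beta> 0 + primitive (\<beta>m' m) t" for m t
  have \<beta>m'm: "\<beta>m' m \<in> borel_measurable lebesgue" for m
    unfolding \<beta>m'_def[abs_def] by (rule clamp_at_measurable[OF \<beta>'m])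
  have lim: "locally_integrable (\<beta>m' m)" for m
    by (rule locally_integrable_bound[OF li \<beta>m'm]) (simp add: \<beta>m'_def clamp_at_bounds)
  have \<beta>_prim: "\<beta> t = \<beta> 0 + primitive \<beta>' t" for t
  proof (cases "0 \<le> t")
    case True
    have "primitive \<beta>' 0 = 0"
      using primitive_diff[OF li order_refl, of 0] by (simp add: primitive_def)
    then show ?thesis using weak_derivative_integral[OF \<beta> True] primitive_diff[OF li True] by simp
  next
    case False
    have "primitive \<beta>' 0 = 0" by (simp add: primitive_def)
    then show ?thesis using weak_derivative_integral[OF \<beta>, of t 0] primitive_diff[OF li, of t 0] False by simp
  qed
  have \<beta>m_diff: "s \<le> t \<Longrightarrow> \<beta>m m t - \<beta>m m s = (LINT x|lebesgue. indicator {s..t} x * \<beta>m' m x)" for m s t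
    unfolding \<beta>m_def using primitive_diff[OF lim] by simp
  have \<beta>m_lip': "\<bar>\<beta>m m t - \<beta>m m s\<bar> \<le> real m * (t - s)" if st: "s \<le> t" for m s t
  proof -
    have ii: "integrable lebesgue (\<lambda>x. real m * indicat_real {s..t} x)"
      by (intro integrable_mult_right integrable_real_indicator) (simp_all add: emeasure_lborel_Icc_eq)
    have "\<bar>\<beta>m m t - \<beta>m m s\<bar> \<le> (LINT x|lebesgue. \<bar>indicator {s..t} x * \<beta>m' m x\<bar>)"
      unfolding \<beta>m_diff[OF st] by (rule integral_abs_bound)
    also have "\<dots> \<le> (LINT x|lebesgue. real m * indicat_real {s..t} x)"
      using clamp_at_bounds
      by (intro integral_mono integrable_abs set_integrable_lebesgueD[OF lim compact_Icc] ii)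
        (auto simp: indicator_def \<beta>m'_def)
    also have "\<dots> = real m * (t - s)" using st by simp
    finally show ?thesis .
  qed
  have \<beta>m_lip: "\<bar>\<beta>m m t - \<beta>m m s\<bar> \<le> real m * \<bar>t - s\<bar>" for m s t
    using \<beta>m_lip'[of s t m] \<beta>m_lip'[of t s m] by (cases "s \<le> t") (auto simp: abs_minus_commute)
  have \<beta>m_cont: "continuous_on UNIV (\<beta>m m)" for m
    by (rule lipschitz_on_continuous_on[of "real m"]) (use \<beta>m_lip in \<open>auto simp: lipschitz_on_def dist_real_def\<close>)
  have \<beta>m_deriv: "AE t in lebesgue. (\<beta>m m has_real_derivative \<beta>m' m t) (at t)" for m
    by (rule lebesgue_differentiation[OF lim \<beta>m_diff])
  have coord: "\<bar>x \<bullet> b\<bar> \<le> R" if "norm x \<le> R" for x using Basis_le_norm[OF b, of x] that by linarith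
  define D where "D = \<bar>\<beta> 0\<bar> + (LINT x|lebesgue. indicator {-R..R} x * \<bar>\<beta>' x\<bar>)"
  have abs_i: "integrable lebesgue (\<lambda>x. indicator {-R..R} x * \<bar>\<beta>' x\<bar>)"
    using integrable_abs[OF set_integrable_lebesgueD[OF li compact_Icc[of "-R" R]]] by (simp add: abs_mult)
  have D0: "0 \<le> D" unfolding D_def by (intro add_nonneg_nonneg integral_nonneg_AE) auto
  have \<beta>m_bd: "\<bar>\<beta>m m t\<bar> \<le> D" if t: "\<bar>t\<bar> \<le> R" for m t
  proof -
    have "(LINT x|lebesgue. indicator {-R..R} x * \<bar>\<beta>m' m x\<bar>) \<le> (LINT x|lebesgue. indicator {-R..R} x * \<bar>\<beta>' x\<bar>)"
    proof (rule integral_mono[OF _ abs_i])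
      show "integrable lebesgue (\<lambda>x. indicator {-R..R} x * \<bar>\<beta>m' m x\<bar>)"
        using integrable_abs[OF set_integrable_lebesgueD[OF lim compact_Icc[of "-R" R]]] by (simp add: abs_mult)
    qed (auto simp: indicator_def \<beta>m'_def clamp_at_bounds)
    then show ?thesis using primitive_bound[OF lim t, of m] unfolding \<beta>m_def D_def by linarith
  qed
  have \<beta>m_lim: "(\<lambda>m. \<beta>m m t) \<longlonglongrightarrow> \<beta> t" for t
  proof -
    have "(\<lambda>m. primitive (\<beta>m' m) t) \<longlonglongrightarrow> primitive \<beta>' t"
      unfolding primitive_def
    proof (rule integral_dominated_convergence[where w = "\<lambda>x. \<bar>(indicator {0..t} x - indicator {t..0} x) * \<beta>' x\<bar>"])
      show "AE x in lebesgue. (\<lambda>m. (indicator {0..t} x - indicator {t..0} x) * \<beta>m' m x)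
          \<longlonglongrightarrow> (indicator {0..t} x - indicator {t..0} x) * \<beta>' x"
        unfolding \<beta>m'_def by (intro AE_I2 tendsto_mult tendsto_const clamp_at_limit)
      show "AE x in lebesgue. norm ((indicator {0..t} x - indicator {t..0} x) * \<beta>m' m x)
          \<le> \<bar>(indicator {0..t} x - indicator {t..0} x) * \<beta>' x\<bar>" for m
        unfolding \<beta>m'_def by (intro AE_I2) (simp add: abs_mult mult_left_mono clamp_at_bounds)
      show "(\<lambda>x. (indicator {0..t} x - indicator {t..0} x) * \<beta>' x) \<in> borel_measurable lebesgue"
        by (rule borel_measurable_integrable[OF primitive_integrable[OF li]])
      show "(\<lambda>x. (indicator {0..t} x - indicator {t..0} x) * \<beta>m' m x) \<in> borel_measurable lebesgue" for m
        by (rule borel_measurable_integrable[OF primitive_integrable[OF lim]])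
      show "integrable lebesgue (\<lambda>x. \<bar>(indicator {0..t} x - indicator {t..0} x) * \<beta>' x\<bar>)"
        by (rule integrable_abs[OF primitive_integrable[OF li]])
    qed
    then show ?thesis unfolding \<beta>m_def \<beta>_prim[of t] by (intro tendsto_add tendsto_const)
  qed
  let ?w = "\<lambda>m y. (\<beta>m m (y \<bullet> b) * k y) * u y"
  let ?w' = "\<lambda>m y. \<beta>m' m (y \<bullet> b) * k y * u y + \<beta>m m (y \<bullet> b) * k y * u' y"
  \<comment> \<open>integration by parts for the Lipschitz functions with \<open>\<beta>m m\<close> in place
    of \<open>\<beta>\<close>\<close>
  have w_zero: "integrable lebesgue (?w' m)" "(LINT y|lebesgue. ?w' m y) = 0" for m
  proof -
    have cont: "continuous_on UNIV (?w m)"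
      by (intro continuous_intros k(1) u(1) continuous_on_compose2[OF \<beta>m_cont]) auto
    have lip: "\<bar>?w m (x + t *\<^sub>R b) - ?w m x\<bar> \<le> (D * Ck * Lu + Cu * (real m * Ck)) * \<bar>t\<bar>" for x t
    proof -
      have v1: "\<bar>\<beta>m m (x \<bullet> b) * k x\<bar> \<le> D * Ck" if x: "norm x \<le> R" for x
        unfolding abs_mult using \<beta>m_bd[OF coord[OF x]] Ck(2)[OF x] D0 by (intro mult_mono) auto
      have v2: "\<bar>\<beta>m m ((x + t *\<^sub>R b) \<bullet> b) * k (x + t *\<^sub>R b) - \<beta>m m (x \<bullet> b) * k x\<bar> \<le> (real m * Ck) * \<bar>t\<bar>"
        if x: "norm x \<le> R" for x t
      proof -
      have "\<beta>m m ((x + t *\<^sub>R b) \<bullet> b) * k (x + t *\<^sub>R b) - \<beta>m m (x \<bullet> b) * k x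
          = (\<beta>m m ((x + t *\<^sub>R b) \<bullet> b) - \<beta>m m (x \<bullet> b)) * k x"
        unfolding k(2) by (simp add: left_diff_distrib)
      also have "\<bar>\<dots>\<bar> \<le> (real m * \<bar>t\<bar>) * Ck"
      proof -
        have "\<bar>\<beta>m m ((x + t *\<^sub>R b) \<bullet> b) - \<beta>m m (x \<bullet> b)\<bar> \<le> real m * \<bar>t\<bar>"
          using \<beta>m_lip[of m "(x + t *\<^sub>R b) \<bullet> b" "x \<bullet> b"] b by (simp add: inner_add_left)
        then show ?thesis unfolding abs_mult[of "_ - _"] using Ck(2)[OF x] by (intro mult_mono) auto
      qed
      finally show ?thesis by (simp add: mult_ac)
      qed
      show ?thesis
        using line_lipschitz_product(2)[where v = "\<lambda>y. \<beta>m m (y \<bullet> b) * k y" and u = u and b = b and x = x and t = t,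
            OF u(2,3) supp v1 v2] D0 Ck(1) Lu by simp
    qed
    have deriv: "AE x in lebesgue. ((\<lambda>t. ?w m (x + t *\<^sub>R b)) has_real_derivative ?w' m x) (at 0)"
      using u' AE_coordinate[OF b \<beta>m_deriv[of m]]
    proof eventually_elim
      case (elim x)
      have "((\<lambda>t. \<beta>m m ((x + t *\<^sub>R b) \<bullet> b)) has_real_derivative \<beta>m' m (x \<bullet> b) * 1) (at 0)"
      proof -
        have "(\<beta>m m has_real_derivative \<beta>m' m (x \<bullet> b)) (at ((x + 0 *\<^sub>R b) \<bullet> b))" using elim(2) by simp
        moreover have "((\<lambda>t. (x + t *\<^sub>R b) \<bullet> b) has_real_derivative 1) (at 0)"
          using b by (auto intro!: derivative_eq_intros simp: inner_add_left)
        ultimately show ?thesis by (rule DERIV_chain2)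
      qed
      from DERIV_mult[OF DERIV_cmult_right[OF this, of "k x"] elim(1)]
      show ?case unfolding k(2) by (simp add: algebra_simps)
    qed
    show "integrable lebesgue (?w' m)" "(LINT y|lebesgue. ?w' m y) = 0"
      using integral_directional_derivative_zero[OF cont lip _ deriv, where R = R] supp by simp_all
  qed
  have u'm: "u' \<in> borel_measurable lebesgue" by (rule directional_derivative_measurable[OF u(1) u'])
  have u'bd: "AE x in lebesgue. \<bar>u' x\<bar> \<le> Lu * indicator (cball 0 (R + 1)) x"
    using u'
  proof eventually_elim
    case (elim x)
    show ?case
    proof (cases "norm x \<le> R + 1")
      case True
      have "\<bar>u' x\<bar> \<le> Lu"
        by (rule LIMSEQ_le_const2[OF tendsto_rabs[OF difference_quotient_tendsto[OF elim]]])
          (use difference_quotient_bound[OF u(3)] in blast)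
      then show ?thesis using True by simp
    next
      case False
      have "((\<lambda>t. u (x + t *\<^sub>R b)) has_real_derivative 0) (at 0)"
      proof (rule has_field_derivative_transform_within[where d = 1 and f = "\<lambda>_. 0"])
        fix t :: real assume "dist t 0 < 1"
        then have "R < norm (x + t *\<^sub>R b)" using False norm_diff_ineq[of x "t *\<^sub>R b"] nb by simp
        then show "0 = u (x + t *\<^sub>R b)" using supp by simp
      qed auto
      from DERIV_unique[OF elim this] show ?thesis using Lu by simp
    qed
  qed
  have coord_li: "locally_integrable (\<lambda>y. \<beta>' (y \<bullet> b))" "(\<lambda>y. \<beta>' (y \<bullet> b)) \<in> borel_measurable lebesgue"
    by (rule locally_integrable_coordinate[OF b li \<beta>'m])+
  have ku: "\<bar>k x * u x\<bar> \<le> Ck * Cu" for x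
  proof (cases "norm x \<le> R")
    case True then show ?thesis unfolding abs_mult using Ck u(2)[of x] by (intro mult_mono) auto
  qed (use supp Ck Cu in simp)
  have I1: "integrable lebesgue (\<lambda>y. \<beta>' (y \<bullet> b) * (k y * u y))"
    using supp
    by (intro integrable_times_test_function[where \<phi> = "\<lambda>y. k y * u y" and R = R, OF coord_li(1) _ ku]
        borel_measurable_times[OF mb[OF k(1)] mb[OF u(1)]]) auto
  then show i1: ?i1 by (simp add: mult.assoc)
  have ku': "continuous_on UNIV (\<lambda>y. \<beta> (y \<bullet> b) * k y)"
    by (intro continuous_intros k(1) continuous_on_compose2[OF \<beta>(1)]) auto
  obtain M where M: "0 \<le> M" "\<And>x. norm x \<le> R + 1 \<Longrightarrow> \<bar>k x\<bar> \<le> M"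
  proof -
    have "bounded (k ` cball 0 (R + 1))"
      by (rule compact_imp_bounded[OF compact_continuous_image[OF continuous_on_subset[OF k(1) subset_UNIV] compact_cball]])
    then obtain M where "\<forall>y\<in>k ` cball 0 (R + 1). norm y \<le> M" unfolding bounded_iff by blast
    then show thesis by (intro that[of "max M 0"]) force+
  qed
  define D1 where "D1 = \<bar>\<beta> 0\<bar> + (LINT x|lebesgue. indicator {-(R+1)..R+1} x * \<bar>\<beta>' x\<bar>)"
  have abs_i1: "integrable lebesgue (\<lambda>x. indicator {-(R+1)..R+1} x * \<bar>\<beta>' x\<bar>)"
    using integrable_abs[OF set_integrable_lebesgueD[OF li compact_Icc[of "-(R+1)" "R+1"]]] by (simp add: abs_mult)
  have D10: "0 \<le> D1" unfolding D1_def by (intro add_nonneg_nonneg integral_nonneg_AE) auto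
  have \<beta>m_bd1: "\<bar>\<beta>m m t\<bar> \<le> D1" if t: "\<bar>t\<bar> \<le> R + 1" for m t
  proof -
    have "(LINT x|lebesgue. indicator {-(R+1)..R+1} x * \<bar>\<beta>m' m x\<bar>) \<le> (LINT x|lebesgue. indicator {-(R+1)..R+1} x * \<bar>\<beta>' x\<bar>)"
    proof (rule integral_mono[OF _ abs_i1])
      show "integrable lebesgue (\<lambda>x. indicator {-(R+1)..R+1} x * \<bar>\<beta>m' m x\<bar>)"
        using integrable_abs[OF set_integrable_lebesgueD[OF lim compact_Icc[of "-(R+1)" "R+1"]]] by (simp add: abs_mult)
    qed (auto simp: indicator_def \<beta>m'_def clamp_at_bounds)
    then show ?thesis using primitive_bound[OF lim t, of m] unfolding \<beta>m_def D1_def by linarith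
  qed
  have bd2: "AE y in lebesgue. norm (\<beta>m m (y \<bullet> b) * k y * u' y) \<le> (D1 * M * Lu) * indicat_real (cball 0 (R + 1)) y" for m
    using u'bd
  proof eventually_elim
    case (elim y)
    show ?case
    proof (cases "norm y \<le> R + 1")
      case True
      have "\<bar>y \<bullet> b\<bar> \<le> R + 1" using Basis_le_norm[OF b, of y] True by linarith
      then have "\<bar>\<beta>m m (y \<bullet> b)\<bar> * \<bar>k y\<bar> * \<bar>u' y\<bar> \<le> D1 * M * Lu"
        using \<beta>m_bd1 M(2)[OF True] elim True D10 M(1) by (intro mult_mono mult_nonneg_nonneg) auto
      then show ?thesis using True by (simp add: abs_mult)
    next
      case False
      then have "u' y = 0" using elim by simp
      then show ?thesis using False by simp
    qed
  qed
  have m2: "(\<lambda>y. \<beta> (y \<bullet> b) * k y * u' y) \<in> borel_measurable lebesgue"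
    by (rule borel_measurable_times[OF mb[OF ku'] u'm])
  have m2': "(\<lambda>y. \<beta>m m (y \<bullet> b) * k y * u' y) \<in> borel_measurable lebesgue" for m
    by (intro borel_measurable_times[OF mb u'm] continuous_intros k(1) continuous_on_compose2[OF \<beta>m_cont]) auto
  have lim2: "AE y in lebesgue. (\<lambda>m. \<beta>m m (y \<bullet> b) * k y * u' y) \<longlonglongrightarrow> \<beta> (y \<bullet> b) * k y * u' y"
    by (intro AE_I2 tendsto_mult tendsto_const \<beta>m_lim)
  note dom2 = integrable_dominated_convergence2[OF m2 m2' integrable_indicator_cball(2) lim2 bd2]
    integrable_dominated_convergence[OF m2 m2' integrable_indicator_cball(2) lim2 bd2]
    integral_dominated_convergence[OF m2 m2' integrable_indicator_cball(2) lim2 bd2]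
  show ?i2 by (rule dom2(2))
  have m1: "(\<lambda>y. \<beta>' (y \<bullet> b) * k y * u y) \<in> borel_measurable lebesgue" by (rule borel_measurable_integrable[OF i1])
  have m1': "(\<lambda>y. \<beta>m' m (y \<bullet> b) * k y * u y) \<in> borel_measurable lebesgue" for m
    unfolding \<beta>m'_def
    by (intro borel_measurable_times mb[OF k(1)] mb[OF u(1)] clamp_at_measurable coord_li(2))
  have lim1: "AE y in lebesgue. (\<lambda>m. \<beta>m' m (y \<bullet> b) * k y * u y) \<longlonglongrightarrow> \<beta>' (y \<bullet> b) * k y * u y"
    unfolding \<beta>m'_def by (intro AE_I2 tendsto_mult tendsto_const clamp_at_limit)
  have bd1: "AE y in lebesgue. norm (\<beta>m' m (y \<bullet> b) * k y * u y) \<le> \<bar>\<beta>' (y \<bullet> b) * k y * u y\<bar>" for m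
    unfolding \<beta>m'_def abs_mult real_norm_def by (intro AE_I2 mult_right_mono clamp_at_bounds) auto
  note dom1 = integrable_dominated_convergence2[OF m1 m1' integrable_abs[OF i1] lim1 bd1]
    integral_dominated_convergence[OF m1 m1' integrable_abs[OF i1] lim1 bd1]
  have "(LINT y|lebesgue. \<beta>m' m (y \<bullet> b) * k y * u y) + (LINT y|lebesgue. \<beta>m m (y \<bullet> b) * k y * u' y) = 0" for m
    using w_zero(2)[of m] dom1(1)[of m] dom2(1)[of m] by (simp add: Bochner_Integration.integral_add)
  with tendsto_add[OF dom1(2) dom2(3)]
  show "(LINT y|lebesgue. \<beta>' (y \<bullet> b) * k y * u y) + (LINT y|lebesgue. \<beta> (y \<bullet> b) * k y * u' y) = 0"
    by (simp add: LIMSEQ_const_iff)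
qed

section \<open>The weak Jacobian of a Lipschitz map\<close>

text \<open>Along a coordinate line, the derivative of a component of \<open>\<mu>\<close> is the
  corresponding entry of the matrix; the Lipschitz bound passes from the difference quotients to the
  entries.\<close>

lemma lipschitz_partials:
  fixes \<mu> :: "real^'n \<Rightarrow> real^'m" and D :: "real^'n \<Rightarrow> real^'n^'m"
  assumes lip: "\<And>y z. norm (\<mu> y - \<mu> z) \<le> L * norm (y - z)"
    and deriv: "AE y in lebesgue. (\<mu> has_derivative (\<lambda>h. D y *v h)) (at y)"
  shows "\<bar>\<mu> y $ i - \<mu> z $ i\<bar> \<le> L * norm (y - z)"
    and "continuous_on UNIV (\<lambda>y. \<mu> y $ i)"
    and "\<bar>\<mu> (y + t *\<^sub>R axis j 1) $ i - \<mu> y $ i\<bar> \<le> L * \<bar>t\<bar>"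
    and "AE y in lebesgue. ((\<lambda>t. \<mu> (y + t *\<^sub>R axis j 1) $ i) has_real_derivative D y $ i $ j) (at 0)"
    and "(\<lambda>y. D y $ i $ j) \<in> borel_measurable lebesgue"
    and "AE y in lebesgue. \<bar>D y $ i $ j\<bar> \<le> L"
    and "weak_jacobian \<mu> D"
proof -
  have L: "0 \<le> L" using order_trans[OF norm_ge_zero lip[of "axis undefined 1" 0]] by (simp)
  show c: "\<bar>\<mu> y $ i - \<mu> z $ i\<bar> \<le> L * norm (y - z)" for y z i
    using component_le_norm_cart[of "\<mu> y - \<mu> z" i] lip[of y z] by simp
  show cont: "continuous_on UNIV (\<lambda>y. \<mu> y $ i)" for i
    by (rule lipschitz_on_continuous_on[of L]) (use c L in \<open>auto simp: lipschitz_on_def dist_norm\<close>)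
  show ll: "\<bar>\<mu> (y + t *\<^sub>R axis j 1) $ i - \<mu> y $ i\<bar> \<le> L * \<bar>t\<bar>" for y t i j
    using c[of "y + t *\<^sub>R axis j 1" i y] by (simp)
  show d: "AE y in lebesgue. ((\<lambda>t. \<mu> (y + t *\<^sub>R axis j 1) $ i) has_real_derivative D y $ i $ j) (at 0)" for i j
    using deriv
  proof eventually_elim
    case (elim y)
    then have "(\<mu> has_derivative (\<lambda>h. D y *v h)) (at (y + 0 *\<^sub>R axis j 1))" by simp
    moreover have "((\<lambda>t. y + t *\<^sub>R axis j 1) has_derivative (\<lambda>t. t *\<^sub>R axis j 1)) (at 0)"
      by (auto intro!: derivative_eq_intros)
    ultimately have "((\<lambda>t. \<mu> (y + t *\<^sub>R axis j 1)) has_derivative (\<lambda>t. D y *v (t *\<^sub>R axis j 1))) (at 0)"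
      by (rule has_derivative_compose[rotated])
    then have "((\<lambda>t. \<mu> (y + t *\<^sub>R axis j 1) $ i) has_derivative (\<lambda>t. (D y *v (t *\<^sub>R axis j 1)) $ i)) (at 0)"
      by (rule bounded_linear.has_derivative[OF bounded_linear_vec_nth])
    moreover have "(\<lambda>t. (D y *v (t *\<^sub>R axis j 1)) $ i) = (*) (D y $ i $ j)"
      by (auto simp: matrix_vector_mult_def axis_def if_distrib cong: if_cong)
    ultimately show ?case by (simp add: has_field_derivative_def)
  qed
  show "(\<lambda>y. D y $ i $ j) \<in> borel_measurable lebesgue"
    by (rule directional_derivative_measurable[OF cont d])
  show "AE y in lebesgue. \<bar>D y $ i $ j\<bar> \<le> L"
    using d[of j i]
  proof eventually_elim
    case (elim y)
    show ?case
      by (rule LIMSEQ_le_const2[OF tendsto_rabs[OF difference_quotient_tendsto[OF elim]]])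
        (use difference_quotient_bound[of "\<lambda>y. \<mu> y $ i" "axis j 1" L, OF ll] in blast)
  qed
  show "weak_jacobian \<mu> D"
    unfolding weak_jacobian_def by (intro allI lipschitz_weak_partial[OF c _ d]) simp
qed

lemma weak_jacobian_unique:
  assumes "weak_jacobian \<mu> D" "weak_jacobian \<mu> D'"
  shows "AE y in lebesgue. trace (D y) = trace (D' y)"
proof -
  have "AE y in lebesgue. D y $ i $ i = D' y $ i $ i" for i
    by (rule weak_partial_unique[OF assms(1)[unfolded weak_jacobian_def, THEN spec, THEN spec]
        assms(2)[unfolded weak_jacobian_def, THEN spec, THEN spec]])
  then have "AE y in lebesgue. \<forall>i. D y $ i $ i = D' y $ i $ i" by (subst AE_all_countable) blast
  then show ?thesis by eventually_elim (simp add: trace_def)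
qed

section \<open>The law of a random vector with a density\<close>

text \<open>A random vector with a density almost surely avoids Lebesgue-null sets and the zeros of the
  density.\<close>

lemma AE_law:
  assumes d: "distributed Pr lborel Y (\<lambda>y. ennreal (f y))" and P: "AE y in lebesgue. P y"
  shows "AE \<omega> in completion Pr. P (Y \<omega>)" "AE \<omega> in completion Pr. 0 < f (Y \<omega>)"
proof -
  note law = distributed_distr_eq_density[OF d]
  have "AE y in density lborel (\<lambda>y. ennreal (f y)). P y"
    using P unfolding AE_completion_iff AE_density[OF distributed_borel_measurable[OF d]] by eventually_elim simp
  then have "AE \<omega> in Pr. P (Y \<omega>)" using AE_distrD[OF distributed_measurable[OF d]] unfolding law by blast
  then show "AE \<omega> in completion Pr. P (Y \<omega>)" by (rule AE_completion)
  have "AE y in density lborel (\<lambda>y. ennreal (f y)). 0 < f y"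
    unfolding AE_density[OF distributed_borel_measurable[OF d]] by simp
  then have "AE \<omega> in Pr. 0 < f (Y \<omega>)" using AE_distrD[OF distributed_measurable[OF d]] unfolding law by blast
  then show "AE \<omega> in completion Pr. 0 < f (Y \<omega>)" by (rule AE_completion)
qed

lemma measurable_cong_AE_completion:
  fixes f g :: "'a \<Rightarrow> real"
  assumes f: "f \<in> completion M \<rightarrow>\<^sub>M borel" and ae: "AE x in completion M. f x = g x"
  shows "g \<in> completion M \<rightarrow>\<^sub>M borel"
proof (rule measurableI)
  fix A :: "real set" assume A: "A \<in> sets borel"
  show "g -` A \<inter> space (completion M) \<in> sets (completion M)"
  proof (rule completion.in_sets_AE)
    show "f -` A \<inter> space (completion M) \<in> sets (completion M)" by (rule measurable_sets[OF f A])
    show "AE x in completion M. x \<in> f -` A \<inter> space (completion M) \<longleftrightarrow> x \<in> g -` A \<inter> space (completion M)"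
      using ae by eventually_elim simp
  qed simp
qed simp

text \<open>A Lebesgue measurable \<open>g\<close> agrees with a Borel measurable one off a null set, which
  \<open>Y\<close> almost surely avoids; for a Borel measurable integrand the claims are known. This is why
  integrals are taken in the completion.\<close>

lemma law_transfer:
  fixes f g :: "real^'n \<Rightarrow> real"
  assumes d: "distributed Pr lborel Y (\<lambda>y. ennreal (f y))" and f: "\<And>y. 0 \<le> f y"
    and g: "g \<in> borel_measurable lebesgue"
  shows "(\<lambda>\<omega>. g (Y \<omega>)) \<in> borel_measurable (completion Pr)"
    and "integrable (completion Pr) (\<lambda>\<omega>. g (Y \<omega>)) \<longleftrightarrow> integrable lebesgue (\<lambda>y. f y * g y)"
    and "(LINT \<omega>|completion Pr. g (Y \<omega>)) = (LINT y|lebesgue. f y * g y)"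
proof -
  obtain g' where g': "g' \<in> borel_measurable lborel" "AE y in lborel. g y = g' y"
    using completion_ex_borel_measurable_real[OF g] by blast
  have ae: "AE y in lebesgue. g' y = g y" using AE_completion[OF g'(2)] by eventually_elim simp
  have aeY: "AE \<omega> in completion Pr. g' (Y \<omega>) = g (Y \<omega>)" by (rule AE_law(1)[OF d ae])
  have fm: "f \<in> borel_measurable lborel" by (rule distributed_real_measurable[OF _ d]) (rule f)
  have m': "(\<lambda>\<omega>. g' (Y \<omega>)) \<in> borel_measurable Pr"
    by (rule measurable_compose[OF distributed_measurable[OF d] g'(1)])
  show m: "(\<lambda>\<omega>. g (Y \<omega>)) \<in> borel_measurable (completion Pr)"
    by (rule measurable_cong_AE_completion[OF measurable_completion[OF m'] aeY])
  have fg': "(\<lambda>y. f y * g' y) \<in> borel_measurable lborel" by (rule borel_measurable_times[OF fm g'(1)])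
  have fg: "(\<lambda>y. f y * g y) \<in> borel_measurable lebesgue"
    by (rule borel_measurable_times[OF measurable_completion[OF fm] g])
  have aef: "AE y in lebesgue. f y * g' y = f y * g y" using ae by eventually_elim simp
  have "integrable (completion Pr) (\<lambda>\<omega>. g (Y \<omega>)) \<longleftrightarrow> integrable (completion Pr) (\<lambda>\<omega>. g' (Y \<omega>))"
    by (rule integrable_cong_AE[OF m measurable_completion[OF m']]) (use aeY in eventually_elim, simp)
  also have "\<dots> \<longleftrightarrow> integrable lborel (\<lambda>y. f y * g' y)"
    unfolding integrable_completion[OF m'] by (rule distributed_integrable[symmetric, OF d g'(1) f])
  also have "\<dots> \<longleftrightarrow> integrable lebesgue (\<lambda>y. f y * g' y)" by (rule integrable_completion[symmetric, OF fg'])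
  also have "\<dots> \<longleftrightarrow> integrable lebesgue (\<lambda>y. f y * g y)"
    by (rule integrable_cong_AE[OF measurable_completion[OF fg'] fg aef])
  finally show "integrable (completion Pr) (\<lambda>\<omega>. g (Y \<omega>)) \<longleftrightarrow> integrable lebesgue (\<lambda>y. f y * g y)" .
  have "(LINT \<omega>|completion Pr. g (Y \<omega>)) = (LINT \<omega>|completion Pr. g' (Y \<omega>))"
    by (rule integral_cong_AE[OF m measurable_completion[OF m']]) (use aeY in eventually_elim, simp)
  also have "\<dots> = (LINT y|lborel. f y * g' y)"
    unfolding integral_completion[OF m'] by (rule distributed_integral[symmetric, OF d g'(1) f])
  also have "\<dots> = (LINT y|lebesgue. f y * g' y)" by (rule integral_completion[symmetric, OF fg'])
  also have "\<dots> = (LINT y|lebesgue. f y * g y)"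
    by (rule integral_cong_AE[OF measurable_completion[OF fg'] fg aef])
  finally show "(LINT \<omega>|completion Pr. g (Y \<omega>)) = (LINT y|lebesgue. f y * g y)" .
qed

lemma bounded_law_integrable:
  fixes f g :: "real^'n \<Rightarrow> real"
  assumes "prob_space Pr" and d: "distributed Pr lborel Y (\<lambda>y. ennreal (f y))" and f: "\<And>y. 0 \<le> f y"
    and g: "g \<in> borel_measurable lebesgue" "AE y in lebesgue. \<bar>g y\<bar> \<le> C"
  shows "integrable (completion Pr) (\<lambda>\<omega>. g (Y \<omega>))"
proof -
  interpret prob_space Pr by fact
  interpret C: prob_space "completion Pr" by (rule prob_space_completion)
  show ?thesis
    by (rule C.integrable_const_bound[of _ C]) (use AE_law(1)[OF d g(2)] law_transfer(1)[OF d f g(1)] in auto)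
qed

section \<open>The logarithmic derivative of the base density\<close>

text \<open>Almost every zero of a nonnegative weakly differentiable \<open>\<beta>\<close> is a minimum at which \<open>\<beta>\<close> is
  differentiable, so that \<open>\<beta>'\<close> vanishes there.\<close>

lemma log_derivative:
  fixes \<beta> \<beta>' :: "real \<Rightarrow> real"
  assumes nn: "\<And>t. 0 \<le> \<beta> t" and \<beta>: "continuous_on UNIV \<beta>" "weak_partial \<beta> 1 \<beta>'"
  shows "AE t in lebesgue. \<beta> t * deriv (\<lambda>s. ln (\<beta> s)) t = \<beta>' t \<and> \<beta> t * (\<beta>' t / \<beta> t) = \<beta>' t"
proof -
  have "locally_integrable \<beta>'" using \<beta>(2) unfolding weak_partial_def by blast
  then have "AE t in lebesgue. (\<beta> has_real_derivative \<beta>' t) (at t)"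
    by (rule lebesgue_differentiation) (rule weak_derivative_integral[OF \<beta>])
  then show ?thesis
  proof eventually_elim
    case (elim t)
    show ?case
    proof (cases "\<beta> t = 0")
      case True
      have "\<beta>' t = 0" by (rule DERIV_local_min[OF elim zero_less_one]) (use True nn in simp)
      then show ?thesis using True by simp
    next
      case False
      then have pos: "0 < \<beta> t" using nn[of t] by simp
      have "((\<lambda>s. ln (\<beta> s)) has_real_derivative 1 / \<beta> t * \<beta>' t) (at t)"
        by (rule DERIV_chain2[OF DERIV_ln_divide[OF pos] elim])
      then have "deriv (\<lambda>s. ln (\<beta> s)) t = \<beta>' t / \<beta> t" by (simp add: DERIV_imp_deriv)
      then show ?thesis using pos by simp
    qed
  qed
qed

section \<open>Stein's identity for a continuous exponential family\<close>

lemma exp_lipschitz_below: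
  fixes a b M :: real
  assumes "a \<le> M" "b \<le> M"
  shows "\<bar>exp a - exp b\<bar> \<le> exp M * \<bar>a - b\<bar>"
  using field_differentiable_bound[of "{..M}" exp exp "exp M" a b] assms
  by (auto intro: DERIV_exp DERIV_subset)

text \<open>With \<open>f\<close> the density, \<open>G\<close> is the product of \<open>\<mu>\<close> with
  the part of the gradient of \<open>f\<close> that comes from the base densities, and the remaining part of
  the gradient is \<open>f\<close> times \<open>\<theta>\<close>; so the identity says that the divergence
  of \<open>f \<cdot> \<mu>\<close> has integral zero. It is first proved for \<open>\<mu>\<close> times a
  cutoff, coordinate by coordinate. As \<open>\<mu>\<close> grows at most linearly, the terms with the
  derivative of the cutoff are bounded by a multiple of \<open>f\<close>, and dominated convergence removes
  the cutoff.\<close>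

theorem stein_identity:
  fixes \<mu> :: "real^'n \<Rightarrow> real^'n" and D :: "real^'n \<Rightarrow> real^'n^'n" and B B' :: "'n \<Rightarrow> real \<Rightarrow> real"
    and \<theta> :: "real^'n" and c :: real
  defines "E \<equiv> \<lambda>y. exp (y \<bullet> \<theta> - c)"
    and "k \<equiv> \<lambda>i y. \<Prod>j\<in>UNIV - {i}. B j (y $ j)"
  defines "f \<equiv> \<lambda>y. (\<Prod>i\<in>UNIV. B i (y $ i)) * E y"
    and "G \<equiv> \<lambda>y. \<Sum>i\<in>UNIV. B' i (y $ i) * k i y * E y * \<mu> y $ i"
  assumes B: "\<And>i. continuous_on UNIV (B i)" "\<And>i. weak_partial (B i) 1 (B' i)"
    and lip: "\<And>y z. norm (\<mu> y - \<mu> z) \<le> L * norm (y - z)"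
    and cont: "\<And>i. continuous_on UNIV (\<lambda>y. \<mu> y $ i)"
    and clip: "\<And>i j y t. \<bar>\<mu> (y + t *\<^sub>R axis j 1) $ i - \<mu> y $ i\<bar> \<le> L * \<bar>t\<bar>"
    and deriv: "\<And>i j. AE y in lebesgue. ((\<lambda>t. \<mu> (y + t *\<^sub>R axis j 1) $ i) has_real_derivative D y $ i $ j) (at 0)"
    and f: "integrable lebesgue f"
    and G: "integrable lebesgue G"
    and T: "integrable lebesgue (\<lambda>y. f y * (\<theta> \<bullet> \<mu> y))" "integrable lebesgue (\<lambda>y. f y * trace (D y))"
  shows "(LINT y|lebesgue. G y) + (LINT y|lebesgue. f y * (\<theta> \<bullet> \<mu> y)) + (LINT y|lebesgue. f y * trace (D y)) = 0"
proof -
  have L: "0 \<le> L" using order_trans[OF norm_ge_zero lip[of "axis undefined 1" 0]] by simp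
  define m where "m = norm (\<mu> 0)"
  have m0: "0 \<le> m" by (simp add: m_def)
  have \<mu>_bound: "\<bar>\<mu> y $ i\<bar> \<le> m + L * norm y" for y i
  proof -
    have "norm (\<mu> y) \<le> m + L * norm y"
      using lip[of y 0] norm_triangle_sub[of "\<mu> y" "\<mu> 0"] by (simp add: m_def)
    then show ?thesis using component_le_norm_cart[of "\<mu> y" i] by linarith
  qed
  have f_split: "f y = B i (y $ i) * k i y * E y" for i y
    unfolding f_def k_def by (simp add: prod.remove[of UNIV i])
  have k_cont: "continuous_on UNIV (k i)" for i
    unfolding k_def by (intro continuous_on_prod continuous_on_compose2[OF B(1)] continuous_intros) auto
  have k_dir: "k i (y + t *\<^sub>R axis i 1) = k i y" for i y t
    unfolding k_def by (intro prod.cong) (auto simp: axis_def)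
  have E_cont: "continuous_on UNIV E" unfolding E_def by (intro continuous_intros)
  let ?u = "\<lambda>R i y. E y * \<mu> y $ i * cutoff R y"
  let ?u' = "\<lambda>R i y. E y * (\<theta> $ i * \<mu> y $ i * cutoff R y + D y $ i $ i * cutoff R y + \<mu> y $ i * cutoff' R (axis i 1) y)"
  let ?h = "\<lambda>R y. \<Sum>i\<in>UNIV. B' i (y $ i) * k i y * ?u R i y + B i (y $ i) * k i y * ?u' R i y"
  have step: "integrable lebesgue (\<lambda>y. B' i (y $ i) * k i y * ?u R i y)" (is ?I1)
    "integrable lebesgue (\<lambda>y. B i (y $ i) * k i y * ?u' R i y)" (is ?I2)
    "(LINT y|lebesgue. B' i (y $ i) * k i y * ?u R i y) + (LINT y|lebesgue. B i (y $ i) * k i y * ?u' R i y) = 0" (is ?I3)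
    if R: "0 < R" for R i
  proof -
    let ?b = "axis i (1::real)" let ?v = "\<lambda>y. E y * \<mu> y $ i"
    define M where "M = R * norm \<theta> - c"
    have arg: "y \<bullet> \<theta> - c \<le> M" if "norm y \<le> R" for y
      using order_trans[OF norm_cauchy_schwarz mult_right_mono[OF that norm_ge_zero], of \<theta>] by (simp add: M_def)
    have E_bd: "\<bar>E y\<bar> \<le> exp M" if "norm y \<le> R" for y using arg[OF that] by (simp add: E_def)
    have \<mu>_bd: "\<bar>\<mu> y $ i\<bar> \<le> m + L * R" if "norm y \<le> R" for y
      using \<mu>_bound[of y i] mult_left_mono[OF that L] by linarith
    have mLR: "0 \<le> m + L * R" using m0 L R by simp
    have v1: "\<bar>?v y\<bar> \<le> exp M * (m + L * R)" if "norm y \<le> R" for y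
      unfolding abs_mult using E_bd[OF that] \<mu>_bd[OF that] by (intro mult_mono) auto
    have v2: "\<bar>?v (y + t *\<^sub>R ?b) - ?v y\<bar> \<le> (exp M * norm \<theta> * (m + L * R) + exp M * L) * \<bar>t\<bar>"
      if y: "norm y \<le> R" "norm (y + t *\<^sub>R ?b) \<le> R" for y t
    proof -
      have "\<bar>E (y + t *\<^sub>R ?b) - E y\<bar> \<le> exp M * \<bar>(y + t *\<^sub>R ?b) \<bullet> \<theta> - c - (y \<bullet> \<theta> - c)\<bar>"
        unfolding E_def by (rule exp_lipschitz_below[OF arg[OF y(2)] arg[OF y(1)]])
      also have "(y + t *\<^sub>R ?b) \<bullet> \<theta> - c - (y \<bullet> \<theta> - c) = t * \<theta> $ i"
        by (simp add: inner_add_left inner_axis')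
      also have "exp M * \<bar>t * \<theta> $ i\<bar> \<le> exp M * (norm \<theta> * \<bar>t\<bar>)"
        using mult_right_mono[OF component_le_norm_cart[of \<theta> i] abs_ge_zero[of t]]
        by (intro mult_left_mono) (simp_all add: abs_mult mult.commute)
      finally have e: "\<bar>E (y + t *\<^sub>R ?b) - E y\<bar> \<le> exp M * (norm \<theta> * \<bar>t\<bar>)" .
      have "\<bar>?v (y + t *\<^sub>R ?b) - ?v y\<bar> = \<bar>(E (y + t *\<^sub>R ?b) - E y) * \<mu> (y + t *\<^sub>R ?b) $ i
          + E y * (\<mu> (y + t *\<^sub>R ?b) $ i - \<mu> y $ i)\<bar>" by (simp add: algebra_simps)
      also have "\<dots> \<le> \<bar>E (y + t *\<^sub>R ?b) - E y\<bar> * \<bar>\<mu> (y + t *\<^sub>R ?b) $ i\<bar>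
          + \<bar>E y\<bar> * \<bar>\<mu> (y + t *\<^sub>R ?b) $ i - \<mu> y $ i\<bar>"
        unfolding abs_mult[symmetric] by (rule abs_triangle_ineq)
      also have "\<dots> \<le> exp M * (norm \<theta> * \<bar>t\<bar>) * (m + L * R) + exp M * (L * \<bar>t\<bar>)"
        using e E_bd[OF y(1)] \<mu>_bd[OF y(2)] clip[of y t i i] by (intro add_mono mult_mono) auto
      finally show ?thesis by (simp add: algebra_simps)
    qed
    note nnv = mult_nonneg_nonneg[OF exp_ge_zero mLR, of M]
    have nnl: "0 \<le> exp M * norm \<theta> * (m + L * R) + exp M * L" using mLR L by simp
    have chi: "\<bar>cutoff R y\<bar> \<le> 1" for y :: "real^'n" using cutoff_bounds[of R y] by simp
    have R4: "0 \<le> 4 / R" using R by simp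
    note pr = line_lipschitz_product[where u = "cutoff R" and v = ?v and b = ?b and R = R, OF chi
        cutoff_line_lipschitz[OF R norm_axis_1] cutoff_zero[OF R] v1 v2 nnv nnl R4]
    have d: "AE y in lebesgue. ((\<lambda>t. ?u R i (y + t *\<^sub>R ?b)) has_real_derivative ?u' R i y) (at 0)"
      using deriv[of i i]
    proof eventually_elim
      case (elim y)
      have dE: "((\<lambda>t. E (y + t *\<^sub>R ?b)) has_real_derivative E y * \<theta> $ i) (at 0)"
        unfolding E_def by (auto intro!: derivative_eq_intros simp: inner_add_left inner_axis')
      have dc: "((\<lambda>t. cutoff R (y + t *\<^sub>R ?b)) has_real_derivative cutoff' R ?b y) (at 0)"
        using cutoff_derivative[OF R, of y ?b 0] by simp
      from DERIV_mult[OF DERIV_mult[OF dE elim] dc] show ?case by (simp add: algebra_simps)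
    qed
    have uc: "continuous_on UNIV (?u R i)"
      by (intro continuous_intros E_cont cont continuous_cutoff[OF R])
    have supp: "?u R i y = 0" if "R < norm y" for y using cutoff_zero[OF R that] by simp
    have coord: "y \<bullet> ?b = y $ i" for y by (simp add: inner_axis)
    have bB: "?b \<in> Basis" by simp
    note ibp = integration_by_parts_coordinate[where R = R and u = "?u R i" and u' = "?u' R i" and k = "k i" and b = ?b, OF bB B(1)[of i] B(2)[of i] k_cont[of i] k_dir uc pr(1) pr(2) supp d, unfolded coord]
    show ?I1 by (rule ibp(1))
    show ?I2 by (rule ibp(2))
    show ?I3 by (rule ibp(3))
  qed
  have h_zero: "integrable lebesgue (?h R)" "(LINT y|lebesgue. ?h R y) = 0" if R: "0 < R" for R
  proof -
    show "integrable lebesgue (?h R)"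
      by (intro Bochner_Integration.integrable_sum Bochner_Integration.integrable_add step R)
    have "(LINT y|lebesgue. ?h R y) = (\<Sum>i\<in>UNIV. LINT y|lebesgue. B' i (y $ i) * k i y * ?u R i y + B i (y $ i) * k i y * ?u' R i y)"
      by (intro Bochner_Integration.integral_sum Bochner_Integration.integrable_add step R)
    also have "\<dots> = 0"
      by (intro sum.neutral ballI) (simp only: Bochner_Integration.integral_add[OF step(1,2)[OF R]] step(3)[OF R])
    finally show "(LINT y|lebesgue. ?h R y) = 0" .
  qed
  \<comment> \<open>sorted by the terms in which the cutoff occurs itself and those with its
    derivative\<close>
  have h_eq: "?h R y = cutoff R y * (G y + f y * (\<theta> \<bullet> \<mu> y) + f y * trace (D y))
      + f y * (\<Sum>i\<in>UNIV. \<mu> y $ i * cutoff' R (axis i 1) y)" for R y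
  proof -
    have "?h R y = (\<Sum>i\<in>UNIV. cutoff R y * (B' i (y $ i) * k i y * E y * \<mu> y $ i)
        + cutoff R y * (f y * (\<theta> $ i * \<mu> y $ i)) + cutoff R y * (f y * D y $ i $ i)
        + f y * (\<mu> y $ i * cutoff' R (axis i 1) y))"
    proof (rule sum.cong[OF refl])
      fix i
      show "B' i (y $ i) * k i y * ?u R i y + B i (y $ i) * k i y * ?u' R i y
        = cutoff R y * (B' i (y $ i) * k i y * E y * \<mu> y $ i)
        + cutoff R y * (f y * (\<theta> $ i * \<mu> y $ i)) + cutoff R y * (f y * D y $ i $ i)
        + f y * (\<mu> y $ i * cutoff' R (axis i 1) y)"
        unfolding f_split[of y i] by (simp add: algebra_simps)
    qed
    then show ?thesis
      unfolding G_def inner_vec_def trace_def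
      by (simp add: sum.distrib sum_distrib_left algebra_simps)
  qed
  let ?g = "\<lambda>y. G y + f y * (\<theta> \<bullet> \<mu> y) + f y * trace (D y)"
  \<comment> \<open>a bound for the terms with the derivative of the cutoff, by \<open>cutoff'_bound\<close>
    and linear growth, uniform over radii at least 1\<close>
  let ?C = "real CARD('n) * (4 * m + 4 * L)"
  have gi: "integrable lebesgue ?g" by (intro Bochner_Integration.integrable_add G T)
  have "(\<lambda>n. LINT y|lebesgue. ?h (real (Suc n)) y) \<longlonglongrightarrow> (LINT y|lebesgue. ?g y)"
  proof (rule integral_dominated_convergence[where w = "\<lambda>y. \<bar>?g y\<bar> + \<bar>f y\<bar> * ?C"])
    show "?g \<in> borel_measurable lebesgue" by (rule borel_measurable_integrable[OF gi])
    show "?h (real (Suc n)) \<in> borel_measurable lebesgue" for n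
      by (rule borel_measurable_integrable[OF h_zero(1)]) simp
    show "integrable lebesgue (\<lambda>y. \<bar>?g y\<bar> + \<bar>f y\<bar> * ?C)"
      by (intro Bochner_Integration.integrable_add integrable_abs gi integrable_mult_left f)
    show "AE y in lebesgue. (\<lambda>n. ?h (real (Suc n)) y) \<longlonglongrightarrow> ?g y"
    proof (rule AE_I2)
      fix y
      have "(\<lambda>n. cutoff (real (Suc n)) y * ?g y + f y * (\<Sum>i\<in>UNIV. \<mu> y $ i * cutoff' (real (Suc n)) (axis i 1) y))
          \<longlonglongrightarrow> 1 * ?g y + f y * (\<Sum>i\<in>UNIV. \<mu> y $ i * 0)"
        by (intro tendsto_intros cutoff_limit)
      then show "(\<lambda>n. ?h (real (Suc n)) y) \<longlonglongrightarrow> ?g y" unfolding h_eq by simp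
    qed
    fix n
    let ?R = "real (Suc n)"
    show "AE y in lebesgue. norm (?h ?R y) \<le> \<bar>?g y\<bar> + \<bar>f y\<bar> * ?C"
    proof (rule AE_I2)
      fix y
      have "\<bar>\<mu> y $ i * cutoff' ?R (axis i 1) y\<bar> \<le> 4 * m + 4 * L" for i
      proof -
        have R: "0 < ?R" "1 \<le> ?R" by auto
        note cb = cutoff'_bound[where b = "axis i 1" and x = y, OF R(1) norm_axis_1]
        have "\<bar>\<mu> y $ i * cutoff' ?R (axis i 1) y\<bar> \<le> (m + L * norm y) * \<bar>cutoff' ?R (axis i 1) y\<bar>"
          unfolding abs_mult by (intro mult_right_mono \<mu>_bound) simp
        also have "\<dots> = m * \<bar>cutoff' ?R (axis i 1) y\<bar> + L * (\<bar>cutoff' ?R (axis i 1) y\<bar> * norm y)"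
          by (simp add: algebra_simps)
        also have "\<dots> \<le> m * 4 + L * 4"
        proof (intro add_mono mult_left_mono m0 L cb(1))
          have "4 / ?R \<le> 4" using R by (simp add: field_simps)
          then show "\<bar>cutoff' ?R (axis i 1) y\<bar> \<le> 4" using cb(2) by linarith
        qed
        finally show ?thesis by simp
      qed
      then have "\<bar>\<Sum>i\<in>UNIV. \<mu> y $ i * cutoff' ?R (axis i 1) y\<bar> \<le> ?C"
        using sum_norm_bound[of UNIV "\<lambda>i. \<mu> y $ i * cutoff' ?R (axis i 1) y" "4 * m + 4 * L"] by simp
      then have "\<bar>f y * (\<Sum>i\<in>UNIV. \<mu> y $ i * cutoff' ?R (axis i 1) y)\<bar> \<le> \<bar>f y\<bar> * ?C"
        unfolding abs_mult by (rule mult_left_mono) simp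
      moreover have "\<bar>cutoff ?R y * ?g y\<bar> \<le> \<bar>?g y\<bar>"
        unfolding abs_mult using cutoff_bounds[of ?R y] by (intro mult_left_le_one_le) auto
      ultimately show "norm (?h ?R y) \<le> \<bar>?g y\<bar> + \<bar>f y\<bar> * ?C" unfolding h_eq real_norm_def by linarith
    qed
  qed
  moreover have "(LINT y|lebesgue. ?h (real (Suc n)) y) = 0" for n by (rule h_zero(2)) simp
  ultimately have "(LINT y|lebesgue. ?g y) = 0" by (simp add: LIMSEQ_const_iff)
  moreover have "(LINT y|lebesgue. ?g y) = (LINT y|lebesgue. G y) + (LINT y|lebesgue. f y * (\<theta> \<bullet> \<mu> y)) + (LINT y|lebesgue. f y * trace (D y))"
    by (simp only: Bochner_Integration.integral_add[OF Bochner_Integration.integrable_add[OF G T(1)] T(2)] Bochner_Integration.integral_add[OF G T(1)])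
  ultimately show ?thesis by simp
qed

theorem theorem4:
  fixes X :: "real^'p^'n" and \<beta>0 :: "real^'p" and \<mu>0 :: "real^'n"
    and B \<phi> :: "'n \<Rightarrow> real \<Rightarrow> real"
    and Pr :: "'w measure" and Y :: "'w \<Rightarrow> real^'n"
    and J :: "real^'p \<Rightarrow> ereal" and \<M> :: "real^'p \<Rightarrow> (real^'p) set"
    and F0 :: "real^'n \<Rightarrow> real^'n \<Rightarrow> real" and F :: "real^'p \<Rightarrow> real^'n \<Rightarrow> real"
    and \<beta>hat :: "real^'n \<Rightarrow> real^'p" and \<mu>hat :: "real^'n \<Rightarrow> real^'n"
    and \<Delta> :: "real^'n \<Rightarrow> real^'n^'n"
  assumes mu0: "\<mu>0 = X *v \<beta>0"
    and prob: "prob_space Pr"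
    and B_nonneg: "\<And>i t. B i t \<ge> 0"
    and natural: "\<And>i. \<mu>0 $ i \<in> natural_parameter_space (B i)"
    and glm: "distributed Pr lborel Y (\<lambda>y. ennreal (exp_family_density B \<phi> \<mu>0 y))"
    and J: "proper_fun J" "lsc_fun J" "convex_fun J"
    and partly_smooth: "partial_smoothness_manifolds J \<M>" "finite (manifold_family J \<M>)"
    and F: "\<And>\<beta> y. F \<beta> y = F0 (X *v \<beta>) y"
    and solution: "\<And>y. is_solution F J y (\<beta>hat y)"
    and muhat: "\<And>y. \<mu>hat y = X *v \<beta>hat y"
    and C_O: "cond_O F J \<M>"
    and C_sconv: "cond_sconv F0"
    and C_F: "cond_F F" "twice_differentiable_fst F0"
    and C_L: "cond_L F0"
    and G_null: "non_injectivity_set F J \<M> \<in> null_sets lebesgue"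
    and Delta: "is_Delta X F0 F J \<M> \<Delta>"
  shows
    "(\<exists>D. weak_jacobian \<mu>hat D) \<and>
     (\<forall>D. weak_jacobian \<mu>hat D \<longrightarrow>
        has_expectation Pr (\<lambda>\<omega>. trace (D (Y \<omega>))) \<and>
        unbiased_estimator Pr (\<lambda>\<omega>. trace (\<Delta> (Y \<omega>))) (expect Pr (\<lambda>\<omega>. trace (D (Y \<omega>))))) \<and>
     ((\<forall>i. weakly_differentiable_base (B i)) \<and>
      has_expectation Pr (\<lambda>\<omega>. grad_log B (Y \<omega>) \<bullet> \<mu>hat (Y \<omega>)) \<and>
      has_expectation Pr (\<lambda>\<omega>. (norm (\<mu>hat (Y \<omega>) - \<mu>0))\<^sup>2) \<longrightarrow>
        unbiased_estimator Pr (\<lambda>\<omega>. SURE B \<mu>0 \<mu>hat \<Delta> (Y \<omega>))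
          (expect Pr (\<lambda>\<omega>. (norm (\<mu>hat (Y \<omega>) - \<mu>0))\<^sup>2)))"
proof -
  obtain L where L: "L > 0" "\<And>y z b c. is_solution F J y b \<Longrightarrow> is_solution F J z c \<Longrightarrow>
    norm (X *v b - X *v c) \<le> L * norm (y - z)"
    by (rule prediction_lipschitz[OF J(1,3) F C_sconv C_F(2) C_L]) (rule that)
  have lip: "norm (\<mu>hat y - \<mu>hat z) \<le> L * norm (y - z)" for y z
    unfolding muhat by (rule L(2)[OF solution solution])
  obtain N where N: "N \<in> null_sets lebesgue" "\<And>y. y \<notin> N \<Longrightarrow> (\<mu>hat has_derivative (\<lambda>h. \<Delta> y *v h)) (at y)"
    by (rule prediction_has_derivative[OF J(1,3) partly_smooth F solution muhat C_O C_sconv C_F C_L G_null Delta])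
      (rule that)
  have "AE y in lebesgue. (\<mu>hat has_derivative (\<lambda>h. \<Delta> y *v h)) (at y)"
    by (rule AE_I'[OF N(1)]) (use N(2) in blast)
  note part = lipschitz_partials[OF lip this]
  interpret prob_space Pr by (rule prob)
  interpret C: prob_space "completion Pr" by (rule prob_space_completion)
  define f where "f = exp_family_density B \<phi> \<mu>0"
  have f0: "0 \<le> f y" for y
    unfolding f_def exp_family_density_def by (intro mult_nonneg_nonneg prod_nonneg) (auto simp: B_nonneg)
  have law: "distributed Pr lborel Y (\<lambda>y. ennreal (f y))" using glm unfolding f_def .
  have tr_m: "(\<lambda>y. trace (\<Delta> y)) \<in> borel_measurable lebesgue"
    unfolding trace_def by (intro borel_measurable_sum part(5))
  have "AE y in lebesgue. \<forall>i. \<bar>\<Delta> y $ i $ i\<bar> \<le> L" using part(6) by (subst AE_all_countable) blast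
  then have tr_bd: "AE y in lebesgue. \<bar>trace (\<Delta> y)\<bar> \<le> real CARD('n) * L"
  proof eventually_elim
    case (elim y)
    then show ?case unfolding trace_def using sum_norm_bound[of UNIV "\<lambda>i. \<Delta> y $ i $ i" L] by simp
  qed
  have tr_i: "integrable (completion Pr) (\<lambda>\<omega>. trace (\<Delta> (Y \<omega>)))"
    by (rule bounded_law_integrable[OF prob law f0 tr_m tr_bd])
  have divergence: "has_expectation Pr (\<lambda>\<omega>. trace (D (Y \<omega>))) \<and>
      unbiased_estimator Pr (\<lambda>\<omega>. trace (\<Delta> (Y \<omega>))) (expect Pr (\<lambda>\<omega>. trace (D (Y \<omega>))))"
    if D: "weak_jacobian \<mu>hat D" for D
  proof -
    have ae: "AE \<omega> in completion Pr. trace (\<Delta> (Y \<omega>)) = trace (D (Y \<omega>))"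
      by (rule AE_law(1)[OF law weak_jacobian_unique[OF part(7) D]])
    have m: "(\<lambda>\<omega>. trace (D (Y \<omega>))) \<in> borel_measurable (completion Pr)"
      by (rule measurable_cong_AE_completion[OF borel_measurable_integrable[OF tr_i] ae])
    have "integrable (completion Pr) (\<lambda>\<omega>. trace (D (Y \<omega>)))"
      by (rule integrable_cong_AE_imp[OF tr_i m]) (use ae in eventually_elim, simp)
    moreover have "(LINT \<omega>|completion Pr. trace (\<Delta> (Y \<omega>))) = (LINT \<omega>|completion Pr. trace (D (Y \<omega>)))"
      by (rule integral_cong_AE[OF borel_measurable_integrable[OF tr_i] m ae])
    ultimately show ?thesis
      using tr_i unfolding has_expectation_def unbiased_estimator_def expect_def by simp
  qed
  have risk: "unbiased_estimator Pr (\<lambda>\<omega>. SURE B \<mu>0 \<mu>hat \<Delta> (Y \<omega>)) (expect Pr (\<lambda>\<omega>. (norm (\<mu>hat (Y \<omega>) - \<mu>0))\<^sup>2))"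
    if base: "\<forall>i. weakly_differentiable_base (B i)"
      and gi: "has_expectation Pr (\<lambda>\<omega>. grad_log B (Y \<omega>) \<bullet> \<mu>hat (Y \<omega>))"
      and ri: "has_expectation Pr (\<lambda>\<omega>. (norm (\<mu>hat (Y \<omega>) - \<mu>0))\<^sup>2)"
  proof -
    have "\<forall>i. \<exists>b'. weak_partial (B i) 1 b'" using base unfolding weakly_differentiable_base_def by blast
    then obtain B' where B': "\<And>i. weak_partial (B i) 1 (B' i)" by metis
    have Bc: "continuous_on UNIV (B i)" for i using base unfolding weakly_differentiable_base_def by blast
    define E where "E y = exp (y \<bullet> \<mu>0 - (\<Sum>i\<in>UNIV. \<phi> i (\<mu>0 $ i)))" for y
    define k where "k i y = (\<Prod>j\<in>UNIV - {i}. B j (y $ j))" for i and y :: "real^'n"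
    define G where "G y = (\<Sum>i\<in>UNIV. B' i (y $ i) * k i y * E y * \<mu>hat y $ i)" for y
    \<comment> \<open>a version of \<open>grad_log B\<close> that is a quotient of measurable functions; at
      the zeros of the base densities it is zero, by the convention on division\<close>
    define gl where "gl y = (\<chi> i. B' i (y $ i) / B i (y $ i))" for y :: "real^'n"
    have f_eq: "f y = (\<Prod>i\<in>UNIV. B i (y $ i)) * E y" for y
      unfolding f_def exp_family_density_def E_def by simp
    have f_split: "f y = B i (y $ i) * k i y * E y" for i y
      unfolding f_eq k_def by (simp add: prod.remove[of UNIV i])
    have continuous_measurable: "g \<in> borel_measurable lebesgue" if "continuous_on UNIV g" for g :: "real^'n \<Rightarrow> real"
      using borel_measurable_continuous_onI[OF that] by (intro measurable_completion) simp
    have \<mu>_m: "(\<lambda>y. \<mu>hat y $ i) \<in> borel_measurable lebesgue" for i by (rule continuous_measurable[OF part(2)])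
    have gl_m: "(\<lambda>y. gl y \<bullet> \<mu>hat y) \<in> borel_measurable lebesgue"
    proof -
      have "locally_integrable (B' i)" for i using B'[of i] unfolding weak_partial_def by blast
      then have "(\<lambda>y. B' i (y \<bullet> axis i (1::real))) \<in> borel_measurable lebesgue" for i
        by (intro locally_integrable_coordinate(2) lebesgue_measurable_of_locally_integrable) auto
      then have "(\<lambda>y. B' i (y $ i)) \<in> borel_measurable lebesgue" for i by (simp add: inner_axis)
      moreover have "(\<lambda>y. B i (y $ i)) \<in> borel_measurable lebesgue" for i
        by (intro continuous_measurable continuous_on_compose2[OF Bc] continuous_intros) auto
      ultimately show ?thesis
        unfolding inner_vec_def gl_def vec_lambda_beta inner_real_def
        by (intro borel_measurable_sum borel_measurable_times borel_measurable_divide \<mu>_m) blast+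
    qed
    have "AE y in lebesgue. B i (y $ i) * deriv (\<lambda>s. ln (B i s)) (y $ i) = B' i (y $ i) \<and>
        B i (y $ i) * (B' i (y $ i) / B i (y $ i)) = B' i (y $ i)" for i
      using AE_coordinate[OF _ log_derivative[OF B_nonneg Bc B'], of "axis i (1::real)" i] by (simp add: inner_axis)
    then have ae0: "AE y in lebesgue. \<forall>i. B i (y $ i) * deriv (\<lambda>s. ln (B i s)) (y $ i) = B' i (y $ i) \<and>
        B i (y $ i) * (B' i (y $ i) / B i (y $ i)) = B' i (y $ i)"
      by (subst AE_all_countable) blast
    have aeG: "AE y in lebesgue. f y * (gl y \<bullet> \<mu>hat y) = G y"
      using ae0
    proof eventually_elim
      case (elim y)
      have "f y * (B' i (y $ i) / B i (y $ i) * \<mu>hat y $ i) = B' i (y $ i) * k i y * E y * \<mu>hat y $ i" for i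
      proof -
        have "f y * (B' i (y $ i) / B i (y $ i) * \<mu>hat y $ i)
            = (B i (y $ i) * (B' i (y $ i) / B i (y $ i))) * k i y * E y * \<mu>hat y $ i"
          unfolding f_split[of y i] by (simp add: mult_ac)
        then show ?thesis using elim by simp
      qed
      then show ?case unfolding G_def gl_def inner_vec_def by (simp add: sum_distrib_left)
    qed
    \<comment> \<open>where the density vanishes, \<open>grad_log\<close> has no meaning, but there the law
      puts no mass\<close>
    have aegl: "AE y in lebesgue. 0 < f y \<longrightarrow> grad_log B y = gl y"
      using ae0
    proof (eventually_elim, intro impI)
      fix y assume e: "\<forall>i. B i (y $ i) * deriv (\<lambda>s. ln (B i s)) (y $ i) = B' i (y $ i) \<and>
        B i (y $ i) * (B' i (y $ i) / B i (y $ i)) = B' i (y $ i)" and "0 < f y"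
      then have nz: "B i (y $ i) \<noteq> 0" for i using f_split[of y i] by auto
      show "grad_log B y = gl y"
        unfolding vec_eq_iff grad_log_def gl_def vec_lambda_beta
      proof
        fix i
        show "deriv (\<lambda>t. ln (B i t)) (y $ i) = B' i (y $ i) / B i (y $ i)"
          using e[rule_format, of i] nz[of i] by (metis nonzero_mult_div_cancel_left)
      qed
    qed
    have aeY: "AE \<omega> in completion Pr. grad_log B (Y \<omega>) \<bullet> \<mu>hat (Y \<omega>) = gl (Y \<omega>) \<bullet> \<mu>hat (Y \<omega>)"
      using AE_law(1)[OF law aegl] AE_law(2)[OF law aegl] by eventually_elim simp
    note gi' = gi[unfolded has_expectation_def]
    note ri' = ri[unfolded has_expectation_def]
    note glY_m = law_transfer(1)[OF law f0 gl_m]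
    have gl_i: "integrable (completion Pr) (\<lambda>\<omega>. gl (Y \<omega>) \<bullet> \<mu>hat (Y \<omega>))"
      by (rule integrable_cong_AE_imp[OF gi' glY_m]) (use aeY in eventually_elim, simp)
    have fgl: "integrable lebesgue (\<lambda>y. f y * (gl y \<bullet> \<mu>hat y))"
      using gl_i unfolding law_transfer(2)[OF law f0 gl_m] .
    have G_m: "G \<in> borel_measurable lebesgue" by (rule borel_measurable_AE[OF borel_measurable_integrable[OF fgl] aeG])
    have G_i: "integrable lebesgue G"
      by (rule integrable_cong_AE_imp[OF fgl G_m]) (use aeG in eventually_elim, simp)
    have f_i: "integrable lebesgue f"
      using law_transfer(2)[OF law f0 borel_measurable_const[of 1]] by simp
    have \<mu>0_m: "(\<lambda>y. \<mu>0 \<bullet> \<mu>hat y) \<in> borel_measurable lebesgue"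
      unfolding inner_vec_def inner_real_def by (intro borel_measurable_sum borel_measurable_times \<mu>_m borel_measurable_const)
    have \<mu>0_i: "integrable (completion Pr) (\<lambda>\<omega>. \<mu>0 \<bullet> \<mu>hat (Y \<omega>))"
    proof (rule Bochner_Integration.integrable_bound)
      \<comment> \<open>\<open>\<mu>hat (Y \<omega>)\<close> is integrable because the loss is\<close>
      show "integrable (completion Pr) (\<lambda>\<omega>. norm \<mu>0 * (1 + (norm (\<mu>hat (Y \<omega>) - \<mu>0))\<^sup>2 + norm \<mu>0))"
        by (intro integrable_mult_right Bochner_Integration.integrable_add ri' C.integrable_const)
      show "(\<lambda>\<omega>. \<mu>0 \<bullet> \<mu>hat (Y \<omega>)) \<in> borel_measurable (completion Pr)" by (rule law_transfer(1)[OF law f0 \<mu>0_m])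
      show "AE \<omega> in completion Pr. norm (\<mu>0 \<bullet> \<mu>hat (Y \<omega>))
          \<le> norm (norm \<mu>0 * (1 + (norm (\<mu>hat (Y \<omega>) - \<mu>0))\<^sup>2 + norm \<mu>0))"
      proof (rule AE_I2)
        fix \<omega>
        let ?r = "norm (\<mu>hat (Y \<omega>) - \<mu>0)"
        have "2 * ?r \<le> 1 + ?r\<^sup>2" using sum_squares_bound[of ?r 1] by simp
        then have "?r \<le> 1 + ?r\<^sup>2" using norm_ge_zero[of "\<mu>hat (Y \<omega>) - \<mu>0"] by linarith
        then have "norm (\<mu>hat (Y \<omega>)) \<le> 1 + ?r\<^sup>2 + norm \<mu>0" using norm_triangle_sub[of "\<mu>hat (Y \<omega>)" \<mu>0] by linarith
        then have "norm \<mu>0 * norm (\<mu>hat (Y \<omega>)) \<le> norm \<mu>0 * (1 + ?r\<^sup>2 + norm \<mu>0)" by (rule mult_left_mono) simp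
        then show "norm (\<mu>0 \<bullet> \<mu>hat (Y \<omega>)) \<le> norm (norm \<mu>0 * (1 + ?r\<^sup>2 + norm \<mu>0))"
          using Cauchy_Schwarz_ineq2[of \<mu>0 "\<mu>hat (Y \<omega>)"] by (simp add: abs_of_nonneg)
      qed
    qed
    have T: "integrable lebesgue (\<lambda>y. f y * (\<mu>0 \<bullet> \<mu>hat y))" "integrable lebesgue (\<lambda>y. f y * trace (\<Delta> y))"
      using \<mu>0_i tr_i unfolding law_transfer(2)[OF law f0 \<mu>0_m] law_transfer(2)[OF law f0 tr_m] .
    have "(LINT y|lebesgue. G y) + (LINT y|lebesgue. f y * (\<mu>0 \<bullet> \<mu>hat y)) + (LINT y|lebesgue. f y * trace (\<Delta> y)) = 0"
    proof -
      note stein_identity[where B = B and B' = B' and \<mu> = \<mu>hat and D = \<Delta> and L = L and \<theta> = \<mu>0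
          and c = "\<Sum>i\<in>UNIV. \<phi> i (\<mu>0 $ i)", OF Bc B' lip part(2,3,4), folded E_def k_def, folded f_eq G_def]
      from this[OF f_i G_i T] show ?thesis .
    qed
    moreover have "(LINT \<omega>|completion Pr. grad_log B (Y \<omega>) \<bullet> \<mu>hat (Y \<omega>)) = (LINT y|lebesgue. G y)"
    proof -
      have "(LINT \<omega>|completion Pr. grad_log B (Y \<omega>) \<bullet> \<mu>hat (Y \<omega>)) = (LINT \<omega>|completion Pr. gl (Y \<omega>) \<bullet> \<mu>hat (Y \<omega>))"
        by (rule integral_cong_AE[OF borel_measurable_integrable[OF gi'] glY_m aeY])
      also have "\<dots> = (LINT y|lebesgue. f y * (gl y \<bullet> \<mu>hat y))" by (rule law_transfer(3)[OF law f0 gl_m])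
      also have "\<dots> = (LINT y|lebesgue. G y)"
        by (rule integral_cong_AE[OF borel_measurable_integrable[OF fgl] G_m aeG])
      finally show ?thesis .
    qed
    ultimately have zero: "(LINT \<omega>|completion Pr. grad_log B (Y \<omega>) \<bullet> \<mu>hat (Y \<omega>))
        + (LINT \<omega>|completion Pr. \<mu>0 \<bullet> \<mu>hat (Y \<omega>)) + (LINT \<omega>|completion Pr. trace (\<Delta> (Y \<omega>))) = 0"
      unfolding law_transfer(3)[OF law f0 \<mu>0_m] law_transfer(3)[OF law f0 tr_m] by simp
    let ?S = "\<lambda>\<omega>. grad_log B (Y \<omega>) \<bullet> \<mu>hat (Y \<omega>) + \<mu>0 \<bullet> \<mu>hat (Y \<omega>) + trace (\<Delta> (Y \<omega>))"
    have S_i: "integrable (completion Pr) ?S"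
      by (intro Bochner_Integration.integrable_add gi' \<mu>0_i tr_i)
    have S_0: "(LINT \<omega>|completion Pr. ?S \<omega>) = 0"
      using zero Bochner_Integration.integral_add[OF Bochner_Integration.integrable_add[OF gi' \<mu>0_i] tr_i]
        Bochner_Integration.integral_add[OF gi' \<mu>0_i] by simp
    \<comment> \<open>the loss plus twice a term of mean zero\<close>
    have SURE_eq: "SURE B \<mu>0 \<mu>hat \<Delta> y = (norm (\<mu>hat y - \<mu>0))\<^sup>2
        + 2 * (grad_log B y \<bullet> \<mu>hat y + \<mu>0 \<bullet> \<mu>hat y + trace (\<Delta> y))" for y
      unfolding SURE_def power2_norm_eq_inner
      by (simp add: inner_add_left inner_add_right inner_diff_left inner_diff_right inner_commute algebra_simps)
    have SURE: "SURE B \<mu>0 \<mu>hat \<Delta> (Y \<omega>) = (norm (\<mu>hat (Y \<omega>) - \<mu>0))\<^sup>2 + 2 * ?S \<omega>" for \<omega> by (rule SURE_eq)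
    show ?thesis
      unfolding unbiased_estimator_def has_expectation_def expect_def SURE
      using Bochner_Integration.integrable_add[OF ri' integrable_mult_right[OF S_i, of 2]]
        Bochner_Integration.integral_add[OF ri' integrable_mult_right[OF S_i, of 2]] S_0
      by (simp only: integral_mult_right_zero) simp
  qed
  show ?thesis using part(7) divergence risk by blast
qed

end
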